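(* Let $r\ge 3$ and let $\mathcal{G}$ be the set of all $\eta\in\mathfrak{X}_{\mathfrak{R}}^r(\mathbb{E}^3)$ such that all $\eta$-principal cycles of $\mathcal{F}_1(\eta)$ and of $\mathcal{F}_2(\eta)$ are hyperbolic. Then $\mathcal{G}$ is dense in $\mathfrak{X}_{\mathfrak{R}}^r(\mathbb{E}^3)$.
   Context: $\mathbb{E}^3$ is Euclidean 3-space with inner product $\langle\cdot,\cdot\rangle$. $\mathfrak{X}_{\mathfrak{R}}^r(\mathbb{E}^3)$ is the set of unit vector fields of class $C^r$ on $\mathbb{E}^3$, with the following $C^r$ Whitney topology (induced from the space of all $C^r$ vector fields). Fix an exhaustion $K_1\subset K_2\subset\cdots$ of $\mathbb{E}^3$ by compact sets with nonempty interiors and $K_i$ contained in the interior of $K_{i+1}$, $K_0=\emptyset$. For a vector field $X$ and a positive function $\delta$ on $\mathbb{E}^3$ put $\delta_i=\inf\{\delta(x): x\in K_i\setminus \mathrm{int}\,K_{i-1}\}$; the sets of all $Y$ with $d(X,Y,K_i\setminus\mathrm{int}\,K_{i-1})<\delta_i$ for all $i$, where $d(\cdot,\cdot,K)$ is the usual $C^r$ distance on a compact set $K$ (supremum over $K$ of the differences of all derivatives of order $\le r$), form a base of neighbourhoods of $X$. For a unit vector field $\eta$, let $\Delta_\eta$ be the plane field orthogonal to $\eta$. Its normal curvature in a nonzero direction $X\in\Delta_\eta(p)$ is $$k_\eta(X)=-\frac{\langle D\eta\cdot X,X\rangle}{\langle X,X\rangle}.$$ The minimum and maximum $k_1(p)\le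 k_2(p)$ of $k_\eta$ restricted to $\Delta_\eta(p)$ are the $\eta$-principal curvatures; the set $\mathcal{P}(\eta)=\{p: k_1(p)=k_2(p)\}$ is the partially umbilic set. Outside $\mathcal{P}(\eta)$ the directions in $\Delta_\eta$ realizing $k_1$ and $k_2$ (the $\eta$-principal directions) define two mutually orthogonal line fields; their integral curves, the $\eta$-principal lines, form the one-dimensional $\eta$-principal foliations $\mathcal{F}_1(\eta)$ and $\mathcal{F}_2(\eta)$ of $\mathbb{E}^3\setminus\mathcal{P}(\eta)$, corresponding to $k_1$ and $k_2$ respectively. An $\eta$-principal cycle is a closed (periodic) integral curve, i.e. a compact leaf, of $\mathcal{F}_1(\eta)$ or $\mathcal{F}_2(\eta)$. It is hyperbolic if the derivative at the base point of its Poincaré first return map, defined by following leaves of the foliation along the cycle on a two-dimensional section transversal to it, has no eigenvalue on the unit circle $\mathbb{S}^1\subset\mathbb{C}$. *)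

theory Defs
  imports "HOL-Analysis.Analysis"
begin

primrec partial_deriv ::
  "'a::euclidean_space list \<Rightarrow> ('a \<Rightarrow> 'b::real_normed_vector) \<Rightarrow> 'a \<Rightarrow> 'b" where
  "partial_deriv [] f = f"
| "partial_deriv (v # vs) f = (\<lambda>x. frechet_derivative (partial_deriv vs f) (at x) v)"

text \<open>Lists of basis vectors play the role of multi-indices. The set \<open>S\<close> is meant to be open.\<close>

definition multi_indices :: "nat \<Rightarrow> 'a::euclidean_space list set" where
  "multi_indices r = {vs. set vs \<subseteq> Basis \<and> length vs \<le> r}"

definition Cr_on :: "nat \<Rightarrow> ('a::euclidean_space \<Rightarrow> 'b::real_normed_vector) \<Rightarrow> 'a set \<Rightarrow> bool" where
  "Cr_on r f S \<longleftrightarrow>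
     (\<forall>vs\<in>multi_indices r.
        continuous_on S (partial_deriv vs f) \<and>
        (length vs < r \<longrightarrow> (\<forall>x\<in>S. partial_deriv vs f differentiable at x)))"

definition vector_fields :: "nat \<Rightarrow> (real^3 \<Rightarrow> real^3) set" where
  "vector_fields r = {X. Cr_on r X UNIV}"

definition unit_vector_fields :: "nat \<Rightarrow> (real^3 \<Rightarrow> real^3) set" where
  "unit_vector_fields r = {\<eta> \<in> vector_fields r. \<forall>p. norm (\<eta> p) = 1}"

definition compact_exhaustion :: "(nat \<Rightarrow> (real^3) set) \<Rightarrow> bool" where
  "compact_exhaustion K \<longleftrightarrow>
     K 0 = {} \<and>
     (\<forall>i\<ge>1. compact (K i) \<and> interior (K i) \<noteq> {}) \<and>
     (\<forall>i. K i \<subseteq> interior (K (Suc i))) \<and>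
     (\<Union>i. K i) = UNIV"

text \<open>The index is shifted: \<open>shell K i\<close> is \<open>K\<^sub>j - int K\<^sub>j\<^sub>-\<^sub>1\<close> for \<open>j = i + 1\<close>.\<close>

definition shell :: "(nat \<Rightarrow> (real^3) set) \<Rightarrow> nat \<Rightarrow> (real^3) set" where
  "shell K i = K (Suc i) - interior (K i)"

definition Cr_dist :: "nat \<Rightarrow> (real^3 \<Rightarrow> real^3) \<Rightarrow> (real^3 \<Rightarrow> real^3) \<Rightarrow> (real^3) set \<Rightarrow> real" where
  "Cr_dist r X Y A =
     (SUP (vs, x) \<in> multi_indices r \<times> A. norm (partial_deriv vs X x - partial_deriv vs Y x))"

definition whitney_nbhd ::
  "nat \<Rightarrow> (nat \<Rightarrow> (real^3) set) \<Rightarrow> (real^3 \<Rightarrow> real^3) \<Rightarrow> (real^3 \<Rightarrow> real) \<Rightarrow> (real^3 \<Rightarrow> real^3) set" where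
  "whitney_nbhd r K X \<delta> =
     {Y \<in> vector_fields r. \<forall>i. Cr_dist r X Y (shell K i) < (INF x\<in>shell K i. \<delta> x)}"

text \<open>The functions \<open>\<delta>\<close> are taken continuous, so that their infima over the (compact) shells
  are positive.\<close>

definition whitney_open :: "nat \<Rightarrow> (nat \<Rightarrow> (real^3) set) \<Rightarrow> (real^3 \<Rightarrow> real^3) set \<Rightarrow> bool" where
  "whitney_open r K U \<longleftrightarrow>
     U \<subseteq> vector_fields r \<and>
     (\<forall>X\<in>U. \<exists>\<delta>. continuous_on UNIV \<delta> \<and> (\<forall>x. \<delta> x > 0) \<and> whitney_nbhd r K X \<delta> \<subseteq> U)"

definition whitney_topology :: "nat \<Rightarrow> (nat \<Rightarrow> (real^3) set) \<Rightarrow> (real^3 \<Rightarrow> real^3) topology" where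
  "whitney_topology r K = topology (whitney_open r K)"

lemma whitney_nbhd_mono:
  assumes "\<And>x. 0 < \<delta> x" "\<And>x. \<delta> x \<le> \<delta>' x"
  shows "whitney_nbhd r K X \<delta> \<subseteq> whitney_nbhd r K X \<delta>'"
proof -
  have "(INF x\<in>shell K i. \<delta> x) \<le> (INF x\<in>shell K i. \<delta>' x)" for i
  proof (cases "shell K i = {}")
    case False
    moreover have "bdd_below (\<delta> ` shell K i)"
      using assms(1) by (meson bdd_belowI2 less_imp_le)
    ultimately show ?thesis
      using assms(2) by (intro cINF_mono) auto
  qed simp
  then show ?thesis
    unfolding whitney_nbhd_def by (smt (verit) Collect_mono)
qed

lemma istopology_whitney_open: "istopology (whitney_open r K)"
  unfolding istopology_def
proof (intro conjI allI impI)
  fix S T assume S: "whitney_open r K S" and T: "whitney_open r K T"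
  show "whitney_open r K (S \<inter> T)"
    unfolding whitney_open_def
  proof (intro conjI ballI)
    show "S \<inter> T \<subseteq> vector_fields r"
      using S by (auto simp: whitney_open_def)
    fix X assume "X \<in> S \<inter> T"
    then obtain \<delta> \<delta>' where d: "continuous_on UNIV \<delta>" "\<And>x. \<delta> x > 0" "whitney_nbhd r K X \<delta> \<subseteq> S"
      and d': "continuous_on UNIV \<delta>'" "\<And>x. \<delta>' x > 0" "whitney_nbhd r K X \<delta>' \<subseteq> T"
      using S T unfolding whitney_open_def by (metis IntD1 IntD2)
    define m where "m = (\<lambda>x. min (\<delta> x) (\<delta>' x))"
    have "whitney_nbhd r K X m \<subseteq> whitney_nbhd r K X \<delta>"
      "whitney_nbhd r K X m \<subseteq> whitney_nbhd r K X \<delta>'"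
      using d(2) d'(2) by (intro whitney_nbhd_mono; simp add: m_def)+
    moreover have "continuous_on UNIV m" "\<forall>x. m x > 0"
      using d d' by (auto simp: m_def intro!: continuous_intros)
    ultimately show "\<exists>\<delta>. continuous_on UNIV \<delta> \<and> (\<forall>x. \<delta> x > 0) \<and> whitney_nbhd r K X \<delta> \<subseteq> S \<inter> T"
      using d(3) d'(3) by blast
  qed
next
  fix \<U> assume U: "\<forall>S\<in>\<U>. whitney_open r K S"
  show "whitney_open r K (\<Union>\<U>)"
    unfolding whitney_open_def
  proof (intro conjI ballI)
    show "\<Union>\<U> \<subseteq> vector_fields r"
      using U by (auto simp: whitney_open_def)
    fix X assume "X \<in> \<Union>\<U>"
    then obtain S where "S \<in> \<U>" "X \<in> S" by blast
    with U obtain \<delta> where "continuous_on UNIV \<delta>" "\<forall>x. \<delta> x > 0" "whitney_nbhd r K X \<delta> \<subseteq> S"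
      unfolding whitney_open_def by metis
    with \<open>S \<in> \<U>\<close> show "\<exists>\<delta>. continuous_on UNIV \<delta> \<and> (\<forall>x. \<delta> x > 0) \<and> whitney_nbhd r K X \<delta> \<subseteq> \<Union>\<U>"
      by blast
  qed
qed

lemma openin_whitney_topology: "openin (whitney_topology r K) U \<longleftrightarrow> whitney_open r K U"
  by (simp add: whitney_topology_def topology_inverse' istopology_whitney_open)

lemma topspace_whitney_topology: "topspace (whitney_topology r K) = vector_fields r"
proof
  have "whitney_open r K (vector_fields r)"
    unfolding whitney_open_def whitney_nbhd_def
    by (auto intro!: exI[of _ "\<lambda>_. 1"])
  then show "vector_fields r \<subseteq> topspace (whitney_topology r K)"
    by (simp add: openin_subset openin_whitney_topology)
  show "topspace (whitney_topology r K) \<subseteq> vector_fields r"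
    using openin_topspace[of "whitney_topology r K"]
    unfolding openin_whitney_topology whitney_open_def by blast
qed

lemma compact_shell: "compact_exhaustion K \<Longrightarrow> compact (shell K i)"
  unfolding shell_def compact_exhaustion_def by (intro compact_diff) auto

lemma shell_nonempty:
  assumes "compact_exhaustion K"
  shows "shell K i \<noteq> {}"
proof
  assume "shell K i = {}"
  then have "K (Suc i) \<subseteq> interior (K i)" by (auto simp: shell_def)
  moreover have "K i \<subseteq> interior (K (Suc i))" "compact (K (Suc i))" "interior (K (Suc i)) \<noteq> {}"
    using assms by (auto simp: compact_exhaustion_def)
  ultimately have "open (K (Suc i))" "closed (K (Suc i))" "bounded (K (Suc i))" "K (Suc i) \<noteq> {}"
    using interior_subset[of "K i"] interior_subset[of "K (Suc i)"] open_interior[of "K i"]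
    by (auto simp: compact_eq_bounded_closed) (metis subset_antisym open_interior order_trans)
  then show False
    using clopen[of "K (Suc i)"] not_bounded_UNIV by metis
qed

lemma finite_multi_indices: "finite (multi_indices r :: 'a::euclidean_space list set)"
  unfolding multi_indices_def by (rule finite_lists_length_le) simp

lemma bdd_above_Cr_dist:
  assumes "X \<in> vector_fields r" "Y \<in> vector_fields r" "compact A"
  shows "bdd_above ((\<lambda>(vs, x). norm (partial_deriv vs X x - partial_deriv vs Y x)) `
           (multi_indices r \<times> A))"
proof -
  have "bdd_above ((\<lambda>x. norm (partial_deriv vs X x - partial_deriv vs Y x)) ` A)"
    if "vs \<in> multi_indices r" for vs
  proof -
    have "continuous_on A (\<lambda>x. norm (partial_deriv vs X x - partial_deriv vs Y x))"
      using assms(1,2) that unfolding vector_fields_def Cr_on_def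
      by (intro continuous_intros) (auto intro: continuous_on_subset)
    then show ?thesis
      using assms(3)
      by (intro bounded_imp_bdd_above compact_imp_bounded compact_continuous_image)
  qed
  then have "bdd_above (\<Union>vs\<in>multi_indices r.
      (\<lambda>x. norm (partial_deriv vs X x - partial_deriv vs Y x)) ` A)"
    by (subst bdd_above_UN[OF finite_multi_indices]) (intro ballI)
  then show ?thesis
    by (rule bdd_above_mono) auto
qed

lemma Cr_dist_triangle:
  assumes "X \<in> vector_fields r" "Y \<in> vector_fields r" "Z \<in> vector_fields r"
    and "compact A" "A \<noteq> {}"
  shows "Cr_dist r X Z A \<le> Cr_dist r X Y A + Cr_dist r Y Z A"
  unfolding Cr_dist_def[of r X Z]
proof (rule cSUP_least)
  have "[] \<in> multi_indices r" by (simp add: multi_indices_def)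
  then show "multi_indices r \<times> A \<noteq> {}" using assms(5) by blast
  fix w :: "(real^3) list \<times> (real^3)" assume w: "w \<in> multi_indices r \<times> A"
  obtain vs x where [simp]: "w = (vs, x)" by (cases w)
  have "norm (partial_deriv vs X x - partial_deriv vs Y x) \<le> Cr_dist r X Y A"
    unfolding Cr_dist_def
    using cSUP_upper[OF w bdd_above_Cr_dist[OF assms(1,2,4)]] by simp
  moreover have "norm (partial_deriv vs Y x - partial_deriv vs Z x) \<le> Cr_dist r Y Z A"
    unfolding Cr_dist_def
    using cSUP_upper[OF w bdd_above_Cr_dist[OF assms(2,3,4)]] by simp
  ultimately show "(case w of (vs, x) \<Rightarrow> norm (partial_deriv vs X x - partial_deriv vs Z x))
      \<le> Cr_dist r X Y A + Cr_dist r Y Z A"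
    using norm_diff_triangle_le by auto
qed

lemma whitney_nbhd_self:
  assumes "compact_exhaustion K" "X \<in> vector_fields r" "continuous_on UNIV \<delta>" "\<And>x. \<delta> x > 0"
  shows "X \<in> whitney_nbhd r K X \<delta>"
proof -
  have "Cr_dist r X X (shell K i) < (INF x\<in>shell K i. \<delta> x)" for i
  proof -
    have ne: "shell K i \<noteq> {}" and comp: "compact (shell K i)"
      using assms(1) by (simp_all add: shell_nonempty compact_shell)
    have "[] \<in> multi_indices r" by (simp add: multi_indices_def)
    then have "multi_indices r \<times> shell K i \<noteq> {}" using ne by blast
    then have "Cr_dist r X X (shell K i) = 0"
      using cSUP_const[of "multi_indices r \<times> shell K i" "0::real"]
      by (simp add: Cr_dist_def case_prod_unfold del: Times_empty)
    moreover obtain a where "a \<in> shell K i" "\<And>x. x \<in> shell K i \<Longrightarrow> \<delta> a \<le> \<delta> x"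
      using continuous_attains_inf[OF comp ne continuous_on_subset[OF assms(3)]] by blast
    then have "\<delta> a \<le> (INF x\<in>shell K i. \<delta> x)"
      using ne by (intro cINF_greatest)
    ultimately show ?thesis using assms(4)[of a] by simp
  qed
  then show ?thesis using assms(2) by (simp add: whitney_nbhd_def)
qed

lemma compact_subset_exhaustion:
  assumes K: "compact_exhaustion K" and "compact C"
  obtains n where "\<And>i. i \<ge> n \<Longrightarrow> C \<inter> shell K i = {}"
proof -
  have step: "K i \<subseteq> interior (K (Suc i))" for i
    using K by (simp add: compact_exhaustion_def)
  have mono: "interior (K i) \<subseteq> interior (K j)" if "i \<le> j" for i j
    using that by (rule lift_Suc_mono_le[rotated]) (meson step interior_subset order_trans)
  have "(\<Union>i. K i) = UNIV"
    using K by (simp add: compact_exhaustion_def)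
  then have cov: "C \<subseteq> (\<Union>i. interior (K i))"
    using step by blast
  obtain I where I: "finite I" "C \<subseteq> (\<Union>i\<in>I. interior (K i))"
    using compactE_image[OF assms(2), of UNIV "\<lambda>i. interior (K i)"] cov by auto
  have "C \<inter> shell K i = {}" if "i \<ge> Max (insert 0 I)" for i
  proof -
    have "interior (K j) \<subseteq> interior (K i)" if "j \<in> I" for j
      using mono I(1) that \<open>i \<ge> Max (insert 0 I)\<close> by auto
    with I(2) show ?thesis by (auto simp: shell_def)
  qed
  then show ?thesis using that by blast
qed

text \<open>The sets \<open>whitney_nbhd r K X \<delta>\<close> are open, so with \<open>whitney_nbhd_self\<close> they do form a base
  of neighbourhoods of \<open>X\<close>.\<close>

lemma openin_whitney_nbhd:
  assumes K: "compact_exhaustion K" and X: "X \<in> vector_fields r"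
  shows "openin (whitney_topology r K) (whitney_nbhd r K X \<delta>)"
  unfolding openin_whitney_topology whitney_open_def
proof (intro conjI ballI)
  show "whitney_nbhd r K X \<delta> \<subseteq> vector_fields r" by (auto simp: whitney_nbhd_def)
  fix Y assume "Y \<in> whitney_nbhd r K X \<delta>"
  define e where "e i = (INF x\<in>shell K i. \<delta> x) - Cr_dist r X Y (shell K i)" for i
  have Y: "Y \<in> vector_fields r" and e: "e i > 0" for i
    using \<open>Y \<in> whitney_nbhd r K X \<delta>\<close> by (auto simp: whitney_nbhd_def e_def)
  define d where "d x = (INF i. e i + infdist x (shell K i))" for x
  have bdd: "bdd_below (range (\<lambda>i. e i + infdist x (shell K i)))" for x
    using e by (intro bdd_belowI2[of _ 0]) (simp add: less_imp_le infdist_nonneg add_nonneg_nonneg)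
  have d_le: "d x \<le> e i + infdist x (shell K i)" for x i
    unfolding d_def using bdd by (intro cINF_lower) auto
  have lip: "d x \<le> d y + dist x y" for x y
  proof -
    have "d x - dist x y \<le> d y"
      unfolding d_def[of y]
    proof (rule cINF_greatest)
      fix i
      show "d x - dist x y \<le> e i + infdist y (shell K i)"
        using d_le[of x i] infdist_triangle[of x "shell K i" y] by linarith
    qed simp
    then show ?thesis by simp
  qed
  have "continuous_on UNIV d"
  proof (rule continuous_onI)
    fix x and \<epsilon> :: real assume "\<epsilon> > 0"
    have "dist (d x') (d x) \<le> dist x' x" for x'
      using lip[of x x'] lip[of x' x] by (simp add: dist_real_def abs_le_iff dist_commute)
    with \<open>\<epsilon> > 0\<close> show "\<exists>da>0. \<forall>x'\<in>UNIV. dist x' x < da \<longrightarrow> dist (d x') (d x) \<le> \<epsilon>"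
      by (meson less_imp_le order_trans)
  qed
  moreover have "d x > 0" for x
  proof -
    obtain n where n: "\<And>i. i \<ge> n \<Longrightarrow> cball x 1 \<inter> shell K i = {}"
      using compact_subset_exhaustion[OF K compact_cball] by metis
    define m where "m = Min (insert 1 (e ` {..<n}))"
    have "m > 0" using e by (simp add: m_def)
    moreover have "m \<le> d x"
      unfolding d_def
    proof (rule cINF_greatest)
      fix i
      show "m \<le> e i + infdist x (shell K i)"
      proof (cases "i < n")
        case True
        then have "m \<le> e i" by (simp add: m_def)
        then show ?thesis using infdist_nonneg[of x "shell K i"] by linarith
      next
        case False
        have "1 \<le> infdist x (shell K i)"
        proof -
          have "1 \<le> dist x a" if "a \<in> shell K i" for a
            using n[of i] False that by (force simp: not_less)
          then show ?thesis
            using shell_nonempty[OF K, of i] by (simp add: infdist_def cINF_greatest)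
        qed
        moreover have "m \<le> 1" by (simp add: m_def)
        ultimately show ?thesis using e[of i] by linarith
      qed
    qed simp
    ultimately show ?thesis by linarith
  qed
  moreover have "whitney_nbhd r K Y d \<subseteq> whitney_nbhd r K X \<delta>"
  proof
    fix Z assume Z: "Z \<in> whitney_nbhd r K Y d"
    have "Cr_dist r X Z (shell K i) < (INF x\<in>shell K i. \<delta> x)" for i
    proof -
      obtain a where a: "a \<in> shell K i" using shell_nonempty[OF K] by blast
      have "bdd_below (d ` shell K i)"
        using \<open>\<And>x. d x > 0\<close> by (meson bdd_belowI2 less_imp_le)
      then have "(INF x\<in>shell K i. d x) \<le> d a" using a by (rule cINF_lower)
      also have "d a \<le> e i" using d_le[of a i] a by simp
      finally have "Cr_dist r Y Z (shell K i) < e i"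
        using Z by (auto simp: whitney_nbhd_def intro: less_le_trans)
      moreover have "Cr_dist r X Z (shell K i) \<le> Cr_dist r X Y (shell K i) + Cr_dist r Y Z (shell K i)"
        using Z Y X K by (intro Cr_dist_triangle)
          (auto simp: whitney_nbhd_def compact_shell shell_nonempty)
      ultimately show ?thesis by (simp add: e_def)
    qed
    then show "Z \<in> whitney_nbhd r K X \<delta>" using Z by (simp add: whitney_nbhd_def)
  qed
  ultimately show "\<exists>\<delta>'. continuous_on UNIV \<delta>' \<and> (\<forall>x. \<delta>' x > 0) \<and>
      whitney_nbhd r K Y \<delta>' \<subseteq> whitney_nbhd r K X \<delta>" by blast
qed

definition unit_field_topology :: "nat \<Rightarrow> (nat \<Rightarrow> (real^3) set) \<Rightarrow> (real^3 \<Rightarrow> real^3) topology" where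
  "unit_field_topology r K = subtopology (whitney_topology r K) (unit_vector_fields r)"

lemma topspace_unit_field_topology: "topspace (unit_field_topology r K) = unit_vector_fields r"
  by (auto simp: unit_field_topology_def topspace_whitney_topology unit_vector_fields_def)

definition normal_plane :: "(real^3 \<Rightarrow> real^3) \<Rightarrow> real^3 \<Rightarrow> (real^3) set" where
  "normal_plane \<eta> p = {X. \<eta> p \<bullet> X = 0}"

definition normal_curvature :: "(real^3 \<Rightarrow> real^3) \<Rightarrow> real^3 \<Rightarrow> real^3 \<Rightarrow> real" where
  "normal_curvature \<eta> p X = - (frechet_derivative \<eta> (at p) X \<bullet> X) / (X \<bullet> X)"

text \<open>For differentiable \<open>\<eta>\<close> the infimum and supremum are attained; see
  \<open>principal_curvatures_attained\<close> below.\<close>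

definition k1 :: "(real^3 \<Rightarrow> real^3) \<Rightarrow> real^3 \<Rightarrow> real" where
  "k1 \<eta> p = (INF X \<in> normal_plane \<eta> p - {0}. normal_curvature \<eta> p X)"

definition k2 :: "(real^3 \<Rightarrow> real^3) \<Rightarrow> real^3 \<Rightarrow> real" where
  "k2 \<eta> p = (SUP X \<in> normal_plane \<eta> p - {0}. normal_curvature \<eta> p X)"

lemma principal_curvatures_attained:
  assumes "\<eta> differentiable at p"
  shows "\<exists>X \<in> normal_plane \<eta> p - {0}. normal_curvature \<eta> p X = k1 \<eta> p \<and>
           (\<forall>Y \<in> normal_plane \<eta> p - {0}. k1 \<eta> p \<le> normal_curvature \<eta> p Y)"
    and "\<exists>X \<in> normal_plane \<eta> p - {0}. normal_curvature \<eta> p X = k2 \<eta> p \<and>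
           (\<forall>Y \<in> normal_plane \<eta> p - {0}. normal_curvature \<eta> p Y \<le> k2 \<eta> p)"
proof -
  let ?P = "normal_plane \<eta> p - {0}" and ?k = "normal_curvature \<eta> p"
  let ?S = "normal_plane \<eta> p \<inter> sphere 0 1"
  have lin: "linear (frechet_derivative \<eta> (at p))"
    using assms linear_frechet_derivative by blast
  have unit: "\<exists>Y\<in>?S. ?k Y = ?k X" if "X \<in> ?P" for X
  proof
    show "X /\<^sub>R norm X \<in> ?S"
      using that by (simp add: normal_plane_def)
    show "?k (X /\<^sub>R norm X) = ?k X"
      using that by (simp add: normal_curvature_def linear_scale[OF lin])
  qed
  have SP: "?S \<subseteq> ?P" by auto
  obtain X0 :: "real^3" where "X0 \<noteq> 0" "orthogonal (\<eta> p) X0"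
    using orthogonal_to_vector_exists[of "\<eta> p"] by auto
  then have "X0 \<in> ?P" by (simp add: normal_plane_def orthogonal_def)
  with unit have ne: "?S \<noteq> {}" by blast
  have "closed (normal_plane \<eta> p)"
    unfolding normal_plane_def by (rule closed_hyperplane)
  then have comp: "compact ?S"
    using compact_sphere closed_Int_compact by blast
  have cont: "continuous_on ?S ?k"
    unfolding normal_curvature_def
    by (intro continuous_intros linear_continuous_on linear_conv_bounded_linear[THEN iffD1] lin) auto
  obtain m where m: "m \<in> ?S" "\<And>Y. Y \<in> ?S \<Longrightarrow> ?k m \<le> ?k Y"
    using continuous_attains_inf[OF comp ne cont] by blast
  have m': "?k m \<le> ?k Y" if "Y \<in> ?P" for Y
    using unit[OF that] m(2) by force
  have "k1 \<eta> p = ?k m"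
    unfolding k1_def using m(1) SP m' by (intro cInf_eq_minimum) blast+
  then show "\<exists>X \<in> ?P. ?k X = k1 \<eta> p \<and> (\<forall>Y \<in> ?P. k1 \<eta> p \<le> ?k Y)"
    using m(1) SP m' by (intro bexI[of _ m]) auto
  obtain M where M: "M \<in> ?S" "\<And>Y. Y \<in> ?S \<Longrightarrow> ?k Y \<le> ?k M"
    using continuous_attains_sup[OF comp ne cont] by blast
  have M': "?k Y \<le> ?k M" if "Y \<in> ?P" for Y
    using unit[OF that] M(2) by force
  have "k2 \<eta> p = ?k M"
    unfolding k2_def using M(1) SP M' by (intro cSup_eq_maximum) blast+
  then show "\<exists>X \<in> ?P. ?k X = k2 \<eta> p \<and> (\<forall>Y \<in> ?P. ?k Y \<le> k2 \<eta> p)"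
    using M(1) SP M' by (intro bexI[of _ M]) auto
qed

definition partially_umbilic_set :: "(real^3 \<Rightarrow> real^3) \<Rightarrow> (real^3) set" where
  "partially_umbilic_set \<eta> = {p. k1 \<eta> p = k2 \<eta> p}"

text \<open>From here on \<open>\<kappa>\<close> stands for either \<open>k1 \<eta>\<close> or \<open>k2 \<eta>\<close>, and thereby selects one of the
  two principal foliations.\<close>

definition principal_directions ::
  "(real^3 \<Rightarrow> real^3) \<Rightarrow> (real^3 \<Rightarrow> real) \<Rightarrow> real^3 \<Rightarrow> (real^3) set" where
  "principal_directions \<eta> \<kappa> p = {X \<in> normal_plane \<eta> p - {0}. normal_curvature \<eta> p X = \<kappa> p}"

definition principal_line ::
  "(real^3 \<Rightarrow> real^3) \<Rightarrow> (real^3 \<Rightarrow> real) \<Rightarrow> (real \<Rightarrow> real^3) \<Rightarrow> real set \<Rightarrow> bool" where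
  "principal_line \<eta> \<kappa> c I \<longleftrightarrow>
     c C1_differentiable_on I \<and>
     (\<forall>t\<in>I. c t \<notin> partially_umbilic_set \<eta> \<and>
            vector_derivative c (at t) \<in> principal_directions \<eta> \<kappa> (c t))"

text \<open>A compact leaf is given by a regular periodic parametrization; \<open>T\<close> is its least period.\<close>

definition principal_cycle ::
  "(real^3 \<Rightarrow> real^3) \<Rightarrow> (real^3 \<Rightarrow> real) \<Rightarrow> (real \<Rightarrow> real^3) \<Rightarrow> real \<Rightarrow> bool" where
  "principal_cycle \<eta> \<kappa> \<gamma> T \<longleftrightarrow>
     T > 0 \<and> principal_line \<eta> \<kappa> \<gamma> UNIV \<and> (\<forall>t. \<gamma> (t + T) = \<gamma> t) \<and> inj_on \<gamma> {0..<T}"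

text \<open>A section is an embedded \<open>C\<^sup>1\<close> surface, parametrized by \<open>\<sigma>\<close> on a neighbourhood \<open>U\<close> of the
  origin of the plane, that meets the cycle only in the base point \<open>\<gamma> 0 = \<sigma> 0\<close>, transversally.\<close>

definition transversal_section ::
  "(real \<Rightarrow> real^3) \<Rightarrow> (real^2) set \<Rightarrow> (real^2 \<Rightarrow> real^3) \<Rightarrow> bool" where
  "transversal_section \<gamma> U \<sigma> \<longleftrightarrow>
     open U \<and> 0 \<in> U \<and> \<sigma> 0 = \<gamma> 0 \<and>
     Cr_on 1 \<sigma> U \<and> (\<forall>u\<in>U. inj (frechet_derivative \<sigma> (at u))) \<and>
     (\<exists>\<tau>. homeomorphism U (\<sigma> ` U) \<sigma> \<tau>) \<and>
     \<sigma> ` U \<inter> range \<gamma> = {\<gamma> 0} \<and>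
     vector_derivative \<gamma> (at 0) \<notin> range (frechet_derivative \<sigma> (at 0))"

text \<open>\<open>\<pi>\<close> is the first return map in the coordinates given by \<open>\<sigma>\<close>. Only its germ at the origin
  matters. Leaves carry no orientation of their own; the sign condition makes the leaf through
  \<open>\<sigma> u\<close> be followed in the direction of the cycle.\<close>

definition first_return_map ::
  "(real^3 \<Rightarrow> real^3) \<Rightarrow> (real^3 \<Rightarrow> real) \<Rightarrow> (real \<Rightarrow> real^3) \<Rightarrow>
   (real^2) set \<Rightarrow> (real^2 \<Rightarrow> real^3) \<Rightarrow> (real^2 \<Rightarrow> real^2) \<Rightarrow> bool" where
  "first_return_map \<eta> \<kappa> \<gamma> U \<sigma> \<pi> \<longleftrightarrow>
     (\<forall>\<^sub>F u in nhds 0. u \<in> U \<and> \<pi> u \<in> U \<and>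
        (\<exists>c \<tau>. \<tau> > 0 \<and> principal_line \<eta> \<kappa> c {0..\<tau>} \<and>
               c 0 = \<sigma> u \<and> c \<tau> = \<sigma> (\<pi> u) \<and> (\<forall>t\<in>{0<..<\<tau>}. c t \<notin> \<sigma> ` U) \<and>
               vector_derivative c (at 0) \<bullet> vector_derivative \<gamma> (at 0) > 0))"

definition complex_eigenvalue :: "real^'n^'n \<Rightarrow> complex \<Rightarrow> bool" where
  "complex_eigenvalue A z \<longleftrightarrow>
     (\<exists>v :: complex^'n. v \<noteq> 0 \<and> (\<chi> i j. complex_of_real (A $ i $ j)) *v v = z *s v)"

text \<open>Any two sections at the base point have conjugate return maps, so asking for one section is
  the same as asking for all of them; it also makes the existence and differentiability of the
  return map part of the condition, so that it never holds vacuously.\<close>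

definition hyperbolic_cycle ::
  "(real^3 \<Rightarrow> real^3) \<Rightarrow> (real^3 \<Rightarrow> real) \<Rightarrow> (real \<Rightarrow> real^3) \<Rightarrow> bool" where
  "hyperbolic_cycle \<eta> \<kappa> \<gamma> \<longleftrightarrow>
     (\<exists>U \<sigma> \<pi>. transversal_section \<gamma> U \<sigma> \<and> first_return_map \<eta> \<kappa> \<gamma> U \<sigma> \<pi> \<and>
        \<pi> differentiable (at 0) \<and>
        (\<forall>z. complex_eigenvalue (matrix (frechet_derivative \<pi> (at 0))) z \<longrightarrow> cmod z \<noteq> 1))"

definition hyperbolic_cycle_fields :: "nat \<Rightarrow> (real^3 \<Rightarrow> real^3) set" where
  "hyperbolic_cycle_fields r =
     {\<eta> \<in> unit_vector_fields r.
        \<forall>\<kappa>\<in>{k1 \<eta>, k2 \<eta>}. \<forall>\<gamma> T. principal_cycle \<eta> \<kappa> \<gamma> T \<longrightarrow> hyperbolic_cycle \<eta> \<kappa> \<gamma>}"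

end

theory Submission
 imports Defs
begin

text \<open>A Kupka--Smale argument. Given a direction field \<open>w\<close>, a smooth cut-off of the eigenvector formula
 turns the 2-jet of a field into a \<open>C\<^sup>2\<close> vector field \<open>Y\<close> whose nonzero values are the principal
 directions on the side of \<open>w\<close>; every principal cycle is a periodic orbit of \<open>Y\<close> for one of countably
 many \<open>w\<close>. The given field is perturbed by a series of localized polynomial fields, with parameters in the
 Polish space \<open>nat => real\<close> and coefficients small enough to stay in the Whitney neighbourhood. The return
 map has no eigenvalue on the unit circle unless its trace or determinant satisfies one of three equations.
 Together with the closing condition such an equation cuts out a transversal zero set: a covector killing all
 variations solves the adjoint variational equation, and testing it on fields concentrated at a point of the
 orbit forces it to vanish. So it fails for most parameters, and Baire's theorem finds one parameter that
 avoids all equations.\<close>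

section \<open>Maps of class \<open>C\<^sup>n\<close> with a parameter\<close>

text \<open>Four equations, three for closing up and one for the spectrum, face the period
  \<open>tau\<close> and three coefficients \<open>alp\<close> of perturbing fields. The initial
  point adds three unknowns, but fixing one coordinate to a rational number removes the phase of the
  orbit and leaves two. Where the derivative in (\<open>tau\<close>, \<open>alp\<close>) is
  invertible, the exceptional \<open>alp\<close> lie in a Lipschitz image of a piece of a plane in
  3-space, a null set. For \<open>r = 3\<close> the jet is C^2 and the linearised flow C^1, with no
  smoothness to spare. The obstacle is the spectral equation. A field acts on the linearised flow
  through second derivatives, and these are symmetric, so the tests give only symmetrised
  information on the covector. It suffices where \<open>ha\<close> is nonzero, that is, where the
  plane field is not integrable. So \<open>ha = 0\<close> at a point of a closed orbit is excluded
  first. Determinant 1 comes next, because the equations for the eigenvalues 1 and -1 are shown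
  transversal only when the determinant differs from 1. Principal directions carry no orientation;
  the auxiliary \<open>w\<close> supplies one locally, and its compact support makes all flows
  global.\<close>

abbreviation FD :: "('a::real_normed_vector => 'b::real_normed_vector) => 'a => 'a => 'b"
 where "FD f x == frechet_derivative f (at x)"

type_synonym R3 = "real^3"

lemmas num23 = numeral_3_eq_3 numeral_2_eq_2

text \<open>The parameter \<open>s\<close> ranges over a mere topological space, in the end over
  \<open>nat => real\<close> with the product topology, so derivatives are taken in \<open>x\<close>
  only. Continuity is joint in \<open>(s, x)\<close>; this is what makes estimates along a flow
  locally uniform in the parameter.\<close>

primrec Ck :: "nat => ('s::topological_space => 'a::euclidean_space => 'b::real_normed_vector) => bool" where
 "Ck 0 F \<longleftrightarrow> continuous_on UNIV (%p. F (fst p) (snd p))"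
| "Ck (Suc n) F \<longleftrightarrow> continuous_on UNIV (%p. F (fst p) (snd p)) &
  (\<forall>s x. F s differentiable (at x)) &
  (\<forall>i\<in>Basis. Ck n (%s x. FD (F s) x i))"

lemma Ck_continuous: "Ck n F ==> continuous_on UNIV (%p. F (fst p) (snd p))"
 by (cases n) auto

lemma Ck_differentiable: "Ck (Suc n) F ==> F s differentiable (at x)"
 by auto

lemma Ck_has_derivative:
 "Ck (Suc n) F ==> (F s has_derivative FD (F s) x) (at x)"
 using Ck_differentiable frechet_derivative_works by blast

lemma Ck_Suc_D: "Ck (Suc n) F ==> Ck n F"
proof (induction n arbitrary: F)
 case (Suc n)
 hence "Ck n (%s x. FD (F s) x i)" if "i \<in> Basis" for i
  using that by (simp only: Ck.simps(2)[of "Suc n"])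
 thus ?case using Suc.prems Ck.simps(2)[of n F] Ck.simps(2)[of "Suc n" F] by blast
qed simp

lemma Ck_mono: "Ck n F ==> m <= n ==> Ck m F"
 by (induction n) (auto dest: Ck_Suc_D simp: le_Suc_eq simp del: Ck.simps(2))

lemma Ck_SucI:
 assumes "continuous_on UNIV (%p. F (fst p) (snd p))"
  and "!!s x. (F s has_derivative F' s x) (at x)"
  and "!!i. i \<in> Basis ==> Ck n (%s x. F' s x i)"
 shows "Ck (Suc n) F"
proof -
 have "FD (F s) x = F' s x" for s x
  using assms(2) frechet_derivative_at by metis
 moreover have "F s differentiable (at x)" for s x
  using assms(2) unfolding differentiable_def by blast
 ultimately show ?thesis using assms by simp
qed

lemma Ck_const [simp]: "Ck n (%s x. c)"
 by (induction n arbitrary: c) (auto intro!: continuous_intros)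

lemma Ck_bounded_linear:
 assumes L: "bounded_linear L" shows "Ck n F ==> Ck n (%s x. L (F s x))"
proof (induction n arbitrary: F)
 case 0
 thus ?case
  by (auto intro!: continuous_intros bounded_linear.continuous_on[OF L])
next
 case (Suc n)
 show ?case
 proof (rule Ck_SucI)
  show "continuous_on UNIV (%p. L (F (fst p) (snd p)))"
   using Ck_continuous[OF Suc.prems] by (rule bounded_linear.continuous_on[OF L])
  show "((%x. L (F s x)) has_derivative (%h. L (FD (F s) x h))) (at x)" for s x
   by (intro bounded_linear.has_derivative[OF L] Ck_has_derivative[OF Suc.prems])
  show "Ck n (%s x. L (FD (F s) x i))" if "i \<in> Basis" for i
   using Suc that by auto
 qed
qed

lemma Ck_add: "Ck n F ==> Ck n G ==> Ck n (%s x. F s x + G s x)"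
proof (induction n arbitrary: F G)
 case 0
 thus ?case by (auto intro!: continuous_intros)
next
 case (Suc n)
 show ?case
 proof (rule Ck_SucI)
  show "continuous_on UNIV (%p. F (fst p) (snd p) + G (fst p) (snd p))"
   using Ck_continuous[OF Suc.prems(1)] Ck_continuous[OF Suc.prems(2)] by (intro continuous_intros)
  show "((%x. F s x + G s x) has_derivative
    (%h. FD (F s) x h + FD (G s) x h)) (at x)" for s x
   by (intro has_derivative_add Ck_has_derivative[OF Suc.prems(1)] Ck_has_derivative[OF Suc.prems(2)])
  show "Ck n (%s x. FD (F s) x i + FD (G s) x i)"
   if "i \<in> Basis" for i
   using Suc.prems that by (intro Suc.IH) auto
 qed
qed

lemma Ck_sum: "(!!i. i \<in> I ==> Ck n (F i)) ==> Ck n (%s x. \<Sum>i\<in>I. F i s x)"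
 by (induction I rule: infinite_finite_induct) (auto intro!: Ck_add)

lemma Ck_bounded_bilinear:
 assumes B: "bounded_bilinear B" shows "Ck n F ==> Ck n G ==> Ck n (%s x. B (F s x) (G s x))"
proof (induction n arbitrary: F G)
 case 0
 thus ?case by (auto intro!: bounded_bilinear.continuous_on[OF B])
next
 case (Suc n)
 show ?case
 proof (rule Ck_SucI)
  show "continuous_on UNIV (%p. B (F (fst p) (snd p)) (G (fst p) (snd p)))"
   using Ck_continuous[OF Suc.prems(1)] Ck_continuous[OF Suc.prems(2)]
   by (intro bounded_bilinear.continuous_on[OF B])
  show "((%x. B (F s x) (G s x)) has_derivative
    (%h. B (F s x) (FD (G s) x h) + B (FD (F s) x h) (G s x))) (at x)" for s x
   by (intro bounded_bilinear.FDERIV[OF B] Ck_has_derivative[OF Suc.prems(1)] Ck_has_derivative[OF Suc.prems(2)])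
  show "Ck n (%s x. B (F s x) (FD (G s) x i) + B (FD (F s) x i) (G s x))"
   if "i \<in> Basis" for i
   using Suc.prems that Ck_Suc_D[OF Suc.prems(1)] Ck_Suc_D[OF Suc.prems(2)]
   by (intro Ck_add Suc.IH) auto
 qed
qed

lemmas Ck_scaleR = Ck_bounded_bilinear[OF bounded_bilinear_scaleR]
 and Ck_inner = Ck_bounded_bilinear[OF bounded_bilinear_inner]
 and Ck_mult = Ck_bounded_bilinear[OF bounded_bilinear_mult]

lemma Ck_minus: "Ck n F ==> Ck n (%s x. - F s x)"
 by (rule Ck_bounded_linear[OF bounded_linear_minus[OF bounded_linear_ident]])

lemma Ck_diff: "Ck n F ==> Ck n G ==> Ck n (%s x. F s x - G s x)"
 using Ck_add[of n F "%s x. - G s x"] Ck_minus[of n G] by simp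

lemma Ck_power: "Ck n F ==> Ck n (%s x. F s x ^ k :: real)"
 by (induction k) (auto intro: Ck_mult)

lemma frechet_derivative_expand:
 fixes f :: "'a::euclidean_space => 'b::real_normed_vector"
 assumes "f differentiable (at x)"
 shows "FD f x h = (\<Sum>i\<in>Basis. (h \<bullet> i) *\<^sub>R FD f x i)"
proof -
 have "linear (FD f x)"
  by (rule linear_frechet_derivative[OF assms])
 thus ?thesis
  by (subst euclidean_representation[of h, symmetric], simp add: linear_sum linear_scale)
qed

lemma Ck_bounded_linear_arg:
 assumes L: "bounded_linear (L :: 'a::euclidean_space => 'b::real_normed_vector)"
 shows "Ck n (%s x. L x)"
proof (cases n)
 case 0
 thus ?thesis by (auto intro!: bounded_linear.continuous_on[OF L] continuous_intros)
next
 case (Suc m)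
 show ?thesis unfolding Suc
  by (rule Ck_SucI[where F' = "%s x. L"])
   (auto intro!: bounded_linear.continuous_on[OF L] continuous_intros bounded_linear_imp_has_derivative L)
qed

lemmas Ck_id [simp] = Ck_bounded_linear_arg[OF bounded_linear_ident]

lemma Ck_compose:
 fixes G :: "'s::topological_space => 'b::euclidean_space => 'c::real_normed_vector"
  and J :: "'s => 'a::euclidean_space => 'b"
 assumes "Ck n G" "Ck n J"
 shows "Ck n (%s x. G s (J s x))"
 using assms
proof (induction n arbitrary: G)
 case 0
 have "continuous_on UNIV (%p. (%p. G (fst p) (snd p)) (fst p, J (fst p) (snd p)))"
  using 0 by (intro continuous_on_compose2[OF 0(1)[unfolded Ck.simps]]) (auto intro!: continuous_intros)
 thus ?case by simp
next
 case (Suc n)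
 have dG: "(G s has_derivative FD (G s) y) (at y)" for s y
  using Ck_has_derivative[OF Suc.prems(1)] .
 have dG2: "G s differentiable (at y)" for s y using dG by (auto simp: differentiable_def)
 have dJ: "(J s has_derivative FD (J s) x) (at x)" for s x
  by (rule Ck_has_derivative[OF Suc.prems(2)])
 show ?case
 proof (rule Ck_SucI)
  have "continuous_on UNIV (%p. (%p. G (fst p) (snd p)) (fst p, J (fst p) (snd p)))"
   using Ck_continuous[OF Suc.prems(2)]
   by (intro continuous_on_compose2[OF Ck_continuous[OF Suc.prems(1)]]) (auto intro!: continuous_intros)
  thus "continuous_on UNIV (%p. G (fst p) (J (fst p) (snd p)))" by simp
  show "((%x. G s (J s x)) has_derivative
   (%h. FD (G s) (J s x) (FD (J s) x h))) (at x)" for s x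
   using diff_chain_at[OF dJ dG] by (simp add: o_def)
  fix i :: 'a assume "i \<in> Basis"
  hence "Ck n (%s x. FD (J s) x i)" using Suc.prems(2) by auto
  moreover have "Ck n (%s x. FD (G s) (J s x) k)" if "k \<in> Basis" for k
   by (rule Suc.IH) (use Suc.prems Ck_Suc_D that in auto)
  ultimately show "Ck n (%s x. FD (G s) (J s x) (FD (J s) x i))"
   by (subst frechet_derivative_expand[OF dG2])
    (intro Ck_sum Ck_scaleR Ck_inner Ck_const)
 qed
qed

lemma Ck_directional:
 assumes "Ck (Suc n) F" "Ck n P" "Ck n Q"
 shows "Ck n (%s z. FD (F s) (P s z) (Q s z))"
proof -
 have "Ck n (%s z. FD (F s) (P s z) k)" if "k \<in> Basis" for k
  using assms(1) that by (intro Ck_compose[OF _ assms(2), of "%s x. FD (F s) x k"]) auto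
 thus ?thesis
  using assms by (subst frechet_derivative_expand[OF Ck_differentiable[OF assms(1)]])
   (intro Ck_sum Ck_scaleR Ck_inner Ck_const)
qed

lemma continuous_on_reparam:
 assumes "continuous_on UNIV r" "continuous_on UNIV (%p. F (fst p) (snd p))"
 shows "continuous_on UNIV (%p. F (r (fst p)) (snd p))"
proof -
 have r: "continuous_on UNIV (%p. r (fst p))"
  by (rule continuous_on_compose2[OF assms(1)]) (auto intro!: continuous_intros)
 have "continuous_on UNIV (%p. (r (fst p), snd p))"
  by (rule continuous_on_Pair[OF r]) (auto intro!: continuous_intros)
 from continuous_on_compose2[OF assms(2) this] show ?thesis by simp
qed

lemma Ck_reparam:
 assumes "continuous_on UNIV r" "Ck n F"
 shows "Ck n (%s x. F (r s) x)"
 using assms(2)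
proof (induction n arbitrary: F)
 case 0
 thus ?case using continuous_on_reparam[OF assms(1), of F] by simp
next
 case (Suc n)
 show ?case unfolding Ck.simps
  using continuous_on_reparam[OF assms(1) Ck_continuous[OF Suc.prems]] Suc by auto
qed

lemma Ck_fixed_param: "Ck n F ==> Ck n (%_. F s)"
 by (rule Ck_reparam[where r = "%_. s"]) auto

lemma Ck_continuous_arg:
 fixes F :: "'s::topological_space => 'a::euclidean_space => 'b::real_normed_vector"
 shows "Ck n F ==> continuous_on S (F s)"
proof -
 assume "Ck n F"
 have "continuous_on S (%y. (%p. F (fst p) (snd p)) (s, y))"
  using Ck_continuous[OF \<open>Ck n F\<close>]
  by (rule continuous_on_compose2) (auto intro!: continuous_intros)
 thus ?thesis by simp
qed

lemma Ck_componentwise: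
 fixes F :: "'s::topological_space => 'a::euclidean_space => 'b::euclidean_space"
 assumes "!!i. i \<in> Basis ==> Ck n (%s x. F s x \<bullet> i)"
 shows "Ck n F"
proof -
 have "Ck n (%s x. \<Sum>i\<in>Basis. (F s x \<bullet> i) *\<^sub>R i)"
  by (intro Ck_sum Ck_scaleR Ck_const assms)
 thus ?thesis by (simp add: euclidean_representation)
qed

lemma Ck_vec:
 fixes F :: "'s::topological_space => 'a::euclidean_space => 'b::euclidean_space^'n"
 assumes "!!i. Ck n (%s x. F s x $ i)"
 shows "Ck n F"
proof (rule Ck_componentwise)
 fix b :: "'b^'n" assume "b \<in> Basis"
 then obtain i u where b: "b = axis i u" "u \<in> Basis" by (auto simp: Basis_vec_def)
 have "Ck n (%s x. F s x $ i \<bullet> u)" by (intro Ck_inner assms Ck_const)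
 thus "Ck n (%s x. F s x \<bullet> b)" by (simp add: b inner_axis)
qed

lemma Ck_nth: "Ck n F ==> Ck n (%s x. F s x $ i)"
 by (rule Ck_bounded_linear[OF bounded_linear_vec_nth])

lemma Ck_Pair: "Ck n F ==> Ck n G ==> Ck n (%s x. (F s x, G s x))"
proof -
 assume FG: "Ck n F" "Ck n G"
 have "bounded_linear (%a::'c. (a, 0::'d))" "bounded_linear (%b::'d. (0::'c, b))"
  by (auto intro!: bounded_linear_Pair bounded_linear_ident bounded_linear_zero)
 hence "Ck n (%s x. (F s x, 0) + (0, G s x))"
  using FG by (intro Ck_add) (auto intro: Ck_bounded_linear)
 thus ?thesis by simp
qed

lemma Ck_fst: "Ck n F ==> Ck n (%s x. fst (F s x))"
 and Ck_snd: "Ck n F ==> Ck n (%s x. snd (F s x))"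
 by (auto intro: Ck_bounded_linear bounded_linear_fst bounded_linear_snd)

lemmas Ck_intros = Ck_const Ck_id Ck_add Ck_diff Ck_minus Ck_sum Ck_scaleR Ck_inner Ck_mult
 Ck_power Ck_nth Ck_Pair Ck_fst Ck_snd

section \<open>Powers of the square root of the positive part\<close>

definition pq :: "nat => real => real" where
 "pq k t = sqrt (max 0 t) ^ k"

lemma pq_nonneg [simp]: "0 <= pq k t" by (simp add: pq_def)

lemma pq_pos_iff: "k > 0 ==> 0 < pq k t \<longleftrightarrow> 0 < t"
 by (cases "0 < t") (auto simp: pq_def max_def zero_power)

lemma pq_eq_0_iff: "k > 0 ==> pq k t = 0 \<longleftrightarrow> t <= 0"
 by (cases "0 < t") (auto simp: pq_def max_def zero_power)

lemma continuous_on_pq: "continuous_on S (pq k)"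
 unfolding pq_def by (intro continuous_intros)

text \<open>Each derivative costs two powers of the square root, hence the bound
  \<open>k >= 2 * n + 1\<close> in \<open>Ck_pq\<close>. At 0 the difference quotient is dominated
  by \<open>pq (k - 2)\<close>, which tends to 0 because \<open>k >= 3\<close>.\<close>

lemma pq_has_field_derivative:
 assumes "k >= 3"
 shows "(pq k has_field_derivative (real k / 2 * pq (k - 2) t)) (at t)"
proof -
 consider "t > 0" | "t < 0" | "t = 0" by linarith
 thus ?thesis
 proof cases
  case 1
  have "((%t. sqrt t ^ k) has_field_derivative (real k * (inverse (sqrt t) / 2 * sqrt t ^ (k - Suc 0)))) (at t)"
   by (rule DERIV_power[OF DERIV_real_sqrt[OF 1]])
  moreover have "real k * (inverse (sqrt t) / 2 * sqrt t ^ (k - Suc 0)) = real k / 2 * pq (k - 2) t"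
  proof -
   obtain m where "k = Suc (Suc m)" using assms that[of "k - 2"] by linarith
   thus ?thesis using 1 by (simp add: pq_def)
  qed
  ultimately have "((%t. sqrt t ^ k) has_field_derivative (real k / 2 * pq (k - 2) t)) (at t)"
   by (simp only:)
  thus ?thesis
   by (rule has_field_derivative_transform_within_open[where S="{0<..}"]) (use 1 in \<open>auto simp: pq_def\<close>)
 next
  case 2
  have "((%t. 0) has_field_derivative 0) (at t)" by simp
  hence "(pq k has_field_derivative 0) (at t)"
   by (rule has_field_derivative_transform_within_open[where S="{..<0}"])
    (use 2 assms in \<open>auto simp: pq_def power_0_left\<close>)
  thus ?thesis using 2 assms by (simp add: pq_def power_0_left)
 next
  case 3
  have "((%h. pq (k - 2) h) \<longlongrightarrow> pq (k - 2) 0) (at 0)"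
   using continuous_on_pq[of UNIV "k-2"] by (simp add: continuous_on_def)
  moreover have pq0: "pq (k - 2) 0 = 0" using assms by (simp add: pq_eq_0_iff)
  ultimately have "((%h. pq (k - 2) h) \<longlongrightarrow> 0) (at 0)" by simp
  moreover have "norm ((pq k (0 + h) - pq k 0) / h) <= pq (k - 2) h" for h
  proof (cases "h > 0")
   case True
   obtain m where "k = Suc (Suc m)" using assms that[of "k - 2"] by linarith
   thus ?thesis using True assms
    by (simp add: pq_def flip: mult.assoc)
  qed (use assms in \<open>auto simp: pq_def\<close>)
  ultimately have "((%h. (pq k (0 + h) - pq k 0) / h) \<longlongrightarrow> 0) (at 0)"
   by (metis (no_types, lifting) Lim_null_comparison always_eventually)
  thus ?thesis unfolding 3 pq0 by (simp add: DERIV_def)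
 qed
qed

lemma Ck_pq: "k >= 2 * n + 1 ==> Ck n (%_::'s::topological_space. pq k)"
proof (induction n arbitrary: k)
 case 0
 have "continuous_on UNIV (%p::'s\<times>real. pq k (snd p))"
  by (rule continuous_on_compose2[OF continuous_on_pq[of UNIV]]) (auto intro!: continuous_intros)
 thus ?case by simp
next
 case (Suc n)
 show ?case
 proof (rule Ck_SucI)
  show "continuous_on UNIV (%p::'s\<times>real. pq k (snd p))"
   by (rule continuous_on_compose2[OF continuous_on_pq[of UNIV]]) (auto intro!: continuous_intros)
  show "(pq k has_derivative (%h. (real k / 2 * pq (k - 2) t) * h)) (at t)" for t
   by (rule has_field_derivative_imp_has_derivative[OF pq_has_field_derivative]) (use Suc.prems in simp)
  show "Ck n (%(_::'s) t. real k / 2 * pq (k - 2) t * i)" for i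
  proof -
   have "2 * n + 1 <= k - 2" using Suc.prems by arith
   thus ?thesis by (intro Ck_mult Ck_const Suc.IH)
  qed
 qed
qed

lemma Ck_pq_compose: "k >= 2 * n + 1 ==> Ck n F ==> Ck n (%s x. pq k (F s x))"
 by (rule Ck_compose[OF Ck_pq])

section \<open>Ordinary differential equations\<close>

lemma gronwall:
 fixes f :: "real => 'e::euclidean_space"
 assumes der: "!!t. t \<in> {0..T} ==> (f has_vector_derivative f' t) (at t within {0..T})"
  and bnd: "!!t. t \<in> {0..T} ==> norm (f' t) <= a * norm (f t) + b"
  and ab: "a >= 0" "b >= 0" and t: "t \<in> {0..T}"
 shows "norm (f t) <= (norm (f 0) + b * t) * exp (a * t)"
proof (cases "t = 0")
 case False
 hence t0: "0 < t" using t by auto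
 have sub: "{0..t} \<subseteq> {0..T}" using t by auto
 have cf: "continuous_on {0..T} f"
  using der by (intro continuous_on_vector_derivative)
 define g where "g s = a * norm (f s) + b" for s
 have cg: "continuous_on {0..T} g" unfolding g_def using cf by (intro continuous_intros)
 define I where "I s = norm (f 0) + integral {0..s} g" for s
 have dI: "(I has_real_derivative g s) (at s within {0..T})" if "s \<in> {0..T}" for s
  unfolding I_def using integral_has_real_derivative[OF cg that] by (auto intro!: derivative_eq_intros)
 have fI: "norm (f s) <= I s" if s: "s \<in> {0..T}" for s
 proof -
  have sub: "{0..s} \<subseteq> {0..T}" using s by auto
  have 1: "(f' has_integral (f s - f 0)) {0..s}"
   using s by (intro fundamental_theorem_of_calculus)
    (auto intro!: has_vector_derivative_within_subset[OF der sub])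
  have "norm (integral {0..s} f') <= integral {0..s} g"
  proof (rule integral_norm_bound_integral)
   show "f' integrable_on {0..s}" using 1 by blast
   show "g integrable_on {0..s}"
    by (intro integrable_continuous_interval continuous_on_subset[OF cg sub])
  qed (use bnd sub in \<open>auto simp: g_def\<close>)
  hence "norm (f s - f 0) <= integral {0..s} g" using 1 by (simp add: integral_unique)
  thus ?thesis unfolding I_def using norm_triangle_sub[of "f s" "f 0"] by linarith
 qed
 \<comment> \<open>\<open>K\<close> is non-increasing: \<open>I\<close> has derivative
   \<open>g\<close>, which is at most \<open>a * I + b\<close>, and
   \<open>exp (- a * s) <= 1\<close>.\<close>
 define K where "K s = I s * exp (- a * s) - b * s" for s
 have dK: "(K has_real_derivative (g s * exp (- a * s) + I s * (exp (- a * s) * (- a)) - b)) (at s within {0..t})"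
  if "s \<in> {0..t}" for s
  unfolding K_def using that sub
  by (auto intro!: derivative_eq_intros DERIV_subset[OF dI, of s "{0..t}"])
 have neg: "g s * exp (- a * s) + I s * (exp (- a * s) * (- a)) - b <= 0" if "s \<in> {0..t}" for s
 proof -
  have "g s - a * I s <= b"
   using fI[of s] that sub ab mult_left_mono[of "norm (f s)" "I s" a] by (auto simp: g_def)
  hence "(g s - a * I s) * exp (- a * s) <= b * exp (- a * s)" by (intro mult_right_mono) auto
  also have "... <= b * 1" using that ab by (intro mult_left_mono) auto
  finally show ?thesis by (simp add: algebra_simps)
 qed
 obtain \<xi> where "\<xi> \<in> {0<..<t}" and
  e: "K t - K 0 = (g \<xi> * exp (- a * \<xi>) + I \<xi> * (exp (- a * \<xi>) * (- a)) - b) * (t - 0)"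
 proof -
  have "\<exists>\<xi>\<in>{0<..<t}. K t - K 0 = (%s h. (g s * exp (- a * s) + I s * (exp (- a * s) * (- a)) - b) * h) \<xi> (t - 0)"
   by (rule mvt_simple[OF t0]) (use dK in \<open>auto simp: has_field_derivative_def\<close>)
  thus ?thesis using that by blast
 qed
 have "K t - K 0 <= 0" unfolding e using neg[of \<xi>] \<open>\<xi> \<in> _\<close> t0 by (intro mult_nonpos_nonneg) auto
 hence "K t <= K 0" by simp
 also have "K 0 = norm (f 0)" by (simp add: K_def I_def)
 finally have "I t * exp (- a * t) <= norm (f 0) + b * t" by (simp add: K_def)
 hence "I t * exp (- a * t) * exp (a * t) <= (norm (f 0) + b * t) * exp (a * t)"
  by (intro mult_right_mono) auto
 thus ?thesis using fI[OF t] by (simp add: mult.assoc flip: exp_add)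
qed simp

text \<open>One contraction covers the whole half line. Dividing by the weight \<open>W\<close>
  turns functions of exponential growth into bounded continuous ones, and the rate
  \<open>2 * M\<close> in the exponent makes the Picard operator contract by the factor 1/2, because
  the integral of \<open>M * W\<close> is \<open>(W - 1) / 2\<close>.\<close>

lemma ode_exists:
 fixes F :: "real => 'e::euclidean_space => 'e"
 assumes cont: "continuous_on UNIV (%p. F (fst p) (snd p))"
  and lip: "!!t u v. norm (F t u - F t v) <= L * norm (u - v)"
  and bnd: "!!t. norm (F t 0) <= C"
 obtains u where "u 0 = x0" "continuous_on UNIV u"
  "!!T t. t \<in> {0..T} ==> (u has_vector_derivative F t (u t)) (at t within {0..T})"
proof -
 define M where "M = max L 1"
 have M: "M >= 1" "L <= M" by (auto simp: M_def)
 have lipM: "norm (F t u - F t v) <= M * norm (u - v)" for t u v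
  using lip[of t u v] M mult_right_mono[of L M "norm (u - v)"] by auto
 have C0: "C >= 0" using bnd[of 0] norm_ge_zero order_trans by blast
 define W where "W t = exp (2 * M * max 0 t)" for t :: real
 have W1: "W t >= 1" for t using M by (simp add: W_def)
 have Wpos: "W t > 0" for t by (simp add: W_def)
 have cW: "continuous_on S W" for S unfolding W_def by (intro continuous_intros)
 have contF: "continuous_on S (%s. F s (W s *\<^sub>R g s))" if "continuous_on UNIV g" for g S
 proof -
  have "continuous_on S (%s. (s, W s *\<^sub>R g s))"
   by (intro continuous_intros continuous_on_subset[OF that] cW) auto
  from continuous_on_compose2[OF cont this] show ?thesis by simp
 qed
 have intW: "((%s. M * W s) has_integral ((W t - 1) / 2)) {0..t}" if "t >= 0" for t
 proof -
  have "((%s. exp (2 * M * s) / 2) has_vector_derivative M * W s) (at s within {0..t})" if "s \<in> {0..t}" for s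
   using that unfolding has_real_derivative_iff_has_vector_derivative[symmetric] W_def
   by (auto intro!: derivative_eq_intros)
  from fundamental_theorem_of_calculus[OF \<open>t >= 0\<close> this] show ?thesis
   using that by (simp add: W_def diff_divide_distrib)
 qed
 \<comment> \<open>The Picard operator written for \<open>g = u / W\<close>. For negative times the
   interval of integration is empty and \<open>W\<close> is 1, so \<open>K g\<close> is constantly
   \<open>x0\<close> there and stays continuous on the whole line.\<close>
 define K where "K g t = (1 / W t) *\<^sub>R (x0 + integral {0..t} (%s. F s (W s *\<^sub>R g s)))"
  for g :: "real => 'e" and t
 have cint: "continuous_on UNIV (%t. integral {0..t} f)" if "continuous_on UNIV f" for f :: "real => 'e"
 proof -
  have "isCont (%t. integral {0..t} f) t" for t
  proof -
   define N where "N = \<bar>t\<bar> + 1"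
   have "continuous_on {-N..0} (%t. integral {0..t} f)"
    by (rule continuous_on_eq[of _ "%_. 0"]) (auto, metis atLeastatMost_empty atLeastatMost_empty_iff integral_refl less_eq_real_def box_real(2) integral_empty)
   moreover have "continuous_on {0..N} (%t. integral {0..t} f)"
    by (intro indefinite_integral_continuous_1 integrable_continuous_interval continuous_on_subset[OF that]) auto
   ultimately have "continuous_on ({-N..0} \<union> {0..N}) (%t. integral {0..t} f)"
    by (intro continuous_on_closed_Un) auto
   hence "continuous_on {-N<..<N} (%t. integral {0..t} f)"
    by (rule continuous_on_subset) auto
   moreover have "t \<in> {-N<..<N}" by (auto simp: N_def)
   ultimately show ?thesis by (simp add: continuous_on_eq_continuous_at)
  qed
  thus ?thesis by (simp add: continuous_at_imp_continuous_on)
 qed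
 have cK: "continuous_on UNIV (K g)" if "continuous_on UNIV g" for g
  unfolding K_def using Wpos
  by (intro continuous_intros cW cint contF that) (auto simp: less_imp_neq[symmetric])
 have bK: "norm (K g t) <= norm x0 + C + B" if g: "continuous_on UNIV g" and B: "!!s. norm (g s) <= B" for g t B
 proof -
  have B0: "B >= 0" using B[of 0] norm_ge_zero order_trans by blast
  have *: "norm (integral {0..t} (%s. F s (W s *\<^sub>R g s))) <= (C + B) * W t"
  proof (cases "t >= 0")
   case True
   have "((%s. B * (M * W s)) has_integral (B * ((W t - 1) / 2))) {0..t}"
    by (rule has_integral_mult_right[OF intW[OF True]])
   from has_integral_add[OF has_integral_const_real[of C 0 t] this]
   have i: "((%s. C + B * (M * W s)) has_integral (C * t + B * ((W t - 1) / 2))) {0..t}"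
    using True by (simp add: mult.commute)
   have "norm (integral {0..t} (%s. F s (W s *\<^sub>R g s))) <= integral {0..t} (%s. C + B * (M * W s))"
   proof (rule integral_norm_bound_integral)
    show "(%s. F s (W s *\<^sub>R g s)) integrable_on {0..t}"
     by (intro integrable_continuous_interval contF g)
    show "(%s. C + B * (M * W s)) integrable_on {0..t}" using i by blast
    fix s assume "s \<in> {0..t}"
    have "norm (F s (W s *\<^sub>R g s)) <= norm (F s 0) + M * norm (W s *\<^sub>R g s - 0)"
     using lipM[of s "W s *\<^sub>R g s" 0] norm_triangle_sub[of "F s (W s *\<^sub>R g s)" "F s 0"] by linarith
    also have "... <= C + M * (W s * B)"
     using bnd[of s] B[of s] M Wpos[of s] by (intro add_mono mult_left_mono) auto
    finally show "norm (F s (W s *\<^sub>R g s)) <= C + B * (M * W s)" by (simp add: mult_ac)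
   qed
   also have "... = C * t + B * ((W t - 1) / 2)" using i by (simp add: integral_unique)
   also have "... <= C * W t + B * W t"
   proof (intro add_mono mult_left_mono)
    have "t <= 1 + 2 * M * t" using True M mult_right_mono[of 1 "2 * M" t] by auto
    also have "... <= W t" using True M exp_ge_add_one_self[of "2 * M * t"] by (simp add: W_def)
    finally show "t <= W t" .
    show "(W t - 1) / 2 <= W t" using W1[of t] by simp
   qed (use C0 B0 in auto)
   finally show ?thesis by (simp add: algebra_simps)
  next
   case False
   thus ?thesis using C0 B0 Wpos[of t] by simp
  qed
  have "norm (K g t) <= (1 / W t) * (norm x0 * W t + (C + B) * W t)"
   unfolding K_def norm_scaleR using * Wpos[of t] W1[of t]
   by (intro mult_mono order_trans[OF norm_triangle_ineq] add_mono)
    (auto intro: mult_left_mono[of 1 "W t" "norm x0", simplified])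
  also have "... = norm x0 + C + B" using Wpos[of t] by (simp add: field_simps)
  finally show ?thesis .
 qed
 define KB where "KB g = Bcontfun (K (apply_bcontfun g))" for g :: "real \<Rightarrow>\<^sub>C 'e"
 have KB: "apply_bcontfun (KB g) = K (apply_bcontfun g)" for g
  unfolding KB_def
 proof (rule Bcontfun_inverse, rule bcontfun_normI)
  show "continuous_on UNIV (K (apply_bcontfun g))" by (rule cK) auto
  show "norm (K (apply_bcontfun g) t) <= norm x0 + C + norm g" for t
   by (rule bK) (auto intro: norm_bounded)
 qed
 have contr: "dist (KB g) (KB h) <= 1 / 2 * dist g h" for g h
 proof (rule dist_bound)
  fix t
  show "dist (KB g t) (KB h t) <= 1 / 2 * dist g h"
  proof (cases "t >= 0")
   case True
   let ?f = "%g s. F s (W s *\<^sub>R apply_bcontfun g s)"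
   have int: "?f g integrable_on {0..t}" for g
    by (intro integrable_continuous_interval contF) auto
   have i: "((%s. dist g h * (M * W s)) has_integral (dist g h * ((W t - 1) / 2))) {0..t}"
    by (rule has_integral_mult_right[OF intW[OF True]])
   have "norm (integral {0..t} (%s. ?f g s - ?f h s)) <= integral {0..t} (%s. dist g h * (M * W s))"
   proof (rule integral_norm_bound_integral)
    show "(%s. ?f g s - ?f h s) integrable_on {0..t}" by (intro integrable_diff int)
    show "(%s. dist g h * (M * W s)) integrable_on {0..t}" using i by blast
    fix s assume "s \<in> {0..t}"
    have "norm (?f g s - ?f h s) <= M * norm (W s *\<^sub>R (g s - h s))"
     using lipM[of s "W s *\<^sub>R g s" "W s *\<^sub>R h s"] by (simp add: scaleR_diff_right)
    also have "... <= M * (W s * dist g h)"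
     using M Wpos[of s] dist_bounded[of g s h] by (auto intro!: mult_left_mono simp: dist_norm)
    finally show "norm (?f g s - ?f h s) <= dist g h * (M * W s)" by (simp add: mult_ac)
   qed
   also have "... = dist g h * ((W t - 1) / 2)" using i by (rule integral_unique)
   also have "... <= dist g h * (W t / 2)" by (intro mult_left_mono) auto
   finally have *: "norm (integral {0..t} (%s. ?f g s - ?f h s)) <= dist g h * (W t / 2)" .
   have "dist (KB g t) (KB h t) = (1 / W t) * norm (integral {0..t} (%s. ?f g s - ?f h s))"
    using Wpos[of t] by (simp add: KB K_def dist_norm integral_diff[OF int int] flip: scaleR_diff_right)
   also have "... <= (1 / W t) * (dist g h * (W t / 2))"
    using * Wpos[of t] by (intro mult_left_mono) auto
   finally show ?thesis using Wpos[of t] by simp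
  qed (simp add: KB K_def)
 qed
 obtain g where g: "KB g = g" using banach_fix_type[of "1/2" KB] contr by auto
 define u where "u t = W t *\<^sub>R g t" for t
 have cu: "continuous_on UNIV u" unfolding u_def by (intro continuous_intros cW) auto
 have u: "u t = x0 + integral {0..t} (%s. F s (u s))" for t
 proof -
  have "g t = K (apply_bcontfun g) t" using KB[of g] by (simp add: g)
  thus ?thesis using Wpos[of t] unfolding u_def by (simp add: K_def)
 qed
 have cFu: "continuous_on S (%s. F s (u s))" for S
  unfolding u_def by (intro contF) auto
 show ?thesis
 proof
  show "u 0 = x0" using u[of 0] by simp
  show "continuous_on UNIV u" by (rule cu)
  fix T t :: real assume t: "t \<in> {0..T}"
  have "((%t. x0 + integral {0..t} (%s. F s (u s))) has_vector_derivative F t (u t)) (at t within {0..T})"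
   using integral_has_vector_derivative[OF cFu t] by (auto intro!: derivative_eq_intros)
  thus "(u has_vector_derivative F t (u t)) (at t within {0..T})"
   using u by (metis (no_types, lifting) ext)
 qed
qed


text \<open>All flows run up to time 1; the actual period enters as a factor of the vector field, so
  that varying it is varying the equation.\<close>

definition sol1 :: "('e::real_normed_vector => 'e) => (real => 'e) => bool" where
 "sol1 f u \<longleftrightarrow> (\<forall>t\<in>{0..1}. (u has_vector_derivative f (u t)) (at t within {0..1}))"

lemma sol1_continuous: "sol1 f u ==> continuous_on {0..1} u"
 unfolding sol1_def by (intro continuous_on_vector_derivative) auto

definition varsol :: "('e::real_normed_vector => 'e) => (real => 'e) => (real => 'e) => bool" where
 "varsol f u y \<longleftrightarrow>
  (\<forall>t\<in>{0..1}. (y has_vector_derivative FD f (u t) (y t)) (at t within {0..1}))"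

lemma frechet_derivative_bound:
 fixes f :: "'a::euclidean_space => 'b::real_normed_vector"
 assumes "f differentiable (at x)"
 shows "norm (FD f x h) <= (\<Sum>i\<in>Basis. norm (FD f x i)) * norm h"
proof -
 have "norm (FD f x h) <= (\<Sum>i\<in>Basis. norm ((h \<bullet> i) *\<^sub>R FD f x i))"
  by (subst frechet_derivative_expand[OF assms]) (rule norm_sum)
 also have "... <= (\<Sum>i\<in>Basis. norm (FD f x i) * norm h)"
  by (intro sum_mono) (auto simp: mult.commute[of _ "norm h"] intro!: mult_right_mono Basis_le_norm)
 finally show ?thesis by (simp add: sum_distrib_right)
qed

lemma Ck_derivative_bounded_on_compact:
 fixes f :: "'a::euclidean_space => 'b::real_normed_vector"
 assumes f: "Ck 1 (%_::real. f)" and K: "compact K"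
 obtains L where "L >= 0" "!!x h. x \<in> K ==> norm (FD f x h) <= L * norm h"
proof -
 have c: "continuous_on K (%x. FD f x i)" if "i \<in> Basis" for i
  using Ck_continuous_arg[of 0 "%(_::real) x. FD f x i" K 0] f that by simp
 have "compact ((%x. \<Sum>i\<in>Basis. norm (FD f x i)) ` K)"
  by (intro compact_continuous_image K continuous_intros c)
 then obtain L where L: "\<forall>y\<in>(%x. \<Sum>i\<in>Basis. norm (FD f x i)) ` K. norm y <= L"
  using compact_imp_bounded bounded_iff by blast
 have d: "f differentiable (at x)" for x using f by auto
 show ?thesis
 proof (rule that[of "max L 0"])
  fix x h assume "x \<in> K"
  hence "(\<Sum>i\<in>Basis. norm (FD f x i)) <= L" using L by force
  thus "norm (FD f x h) <= max L 0 * norm h"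
   by (intro order_trans[OF frechet_derivative_bound[OF d]] mult_right_mono) auto
 qed simp
qed

text \<open>Tube lemma: both estimates define an open condition on parameter, displacement and time,
  which holds on the compact set of times at parameter \<open>s0\<close> and displacement 0.\<close>

lemma uniform_near:
 fixes G :: "'s::topological_space => 'e::euclidean_space => 'b::euclidean_space"
 assumes G: "Ck 1 G" and u0: "continuous_on {0..1::real} u0" and e: "e > 0"
 obtains S rho where "open S" "s0 \<in> S" "rho > 0"
  "!!s t d h. s \<in> S ==> t \<in> {0..1} ==> norm d < rho ==>
   norm (FD (G s) (u0 t + d) h - FD (G s0) (u0 t) h) <= e * norm h"
  "!!s t. s \<in> S ==> t \<in> {0..1} ==> norm (G s (u0 t) - G s0 (u0 t)) <= e"
proof -
 define c where "c t = max 0 (min 1 t)" for t :: real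
 have c: "continuous_on UNIV c" "c t \<in> {0..1}" for t unfolding c_def by (intro continuous_intros) auto
 have cu: "continuous_on UNIV (%t. u0 (c t))"
  by (rule continuous_on_compose2[OF u0 c(1)]) (use c in auto)
 have cu3: "continuous_on UNIV (%p::('s\<times>'e)\<times>real. u0 (c (snd p)))"
  by (rule continuous_on_compose2[OF cu]) (auto intro!: continuous_intros)
 have cD: "continuous_on UNIV (%p. FD (G (fst p)) (snd p) i)" if "i \<in> Basis" for i
  using G that by simp
 have cG: "continuous_on UNIV (%p. G (fst p) (snd p))" using G by simp
 define \<Phi> where "\<Phi> p = (\<Sum>i\<in>Basis. norm (FD (G (fst (fst p))) (u0 (c (snd p)) + snd (fst p)) i
   - FD (G s0) (u0 (c (snd p))) i))
  + norm (G (fst (fst p)) (u0 (c (snd p))) - G s0 (u0 (c (snd p))))" for p :: "('s\<times>'e)\<times>real"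
 have c1: "continuous_on UNIV (%p::('s\<times>'e)\<times>real. FD (G (fst (fst p))) (u0 (c (snd p)) + snd (fst p)) i)"
  if "i \<in> Basis" for i
  using continuous_on_compose2[OF cD[OF that], of UNIV "%p::('s\<times>'e)\<times>real. (fst (fst p), u0 (c (snd p)) + snd (fst p))"]
  by (simp add: continuous_on_Pair continuous_on_add cu3 continuous_on_fst continuous_on_snd)
 have c2: "continuous_on UNIV (%p::('s\<times>'e)\<times>real. FD (G s0) (u0 (c (snd p))) i)"
  if "i \<in> Basis" for i
  using continuous_on_compose2[OF cD[OF that], of UNIV "%p::('s\<times>'e)\<times>real. (s0, u0 (c (snd p)))"]
  by (simp add: continuous_on_Pair cu3)
 have c3: "continuous_on UNIV (%p::('s\<times>'e)\<times>real. G (fst (fst p)) (u0 (c (snd p))))"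
  using continuous_on_compose2[OF cG, of UNIV "%p::('s\<times>'e)\<times>real. (fst (fst p), u0 (c (snd p)))"]
  by (simp add: continuous_on_Pair cu3 continuous_on_fst)
 have c4: "continuous_on UNIV (%p::('s\<times>'e)\<times>real. G s0 (u0 (c (snd p))))"
  using continuous_on_compose2[OF cG, of UNIV "%p::('s\<times>'e)\<times>real. (s0, u0 (c (snd p)))"]
  by (simp add: continuous_on_Pair cu3)
 have "continuous_on UNIV \<Phi>"
  unfolding \<Phi>_def using c1 c2 c3 c4 by (intro continuous_intros) auto
 hence "open {p. \<Phi> p < e}" by (intro open_Collect_less continuous_on_const)
 moreover have "{(s0, 0)} \<times> {0..1} \<subseteq> {p. \<Phi> p < e}" using e by (auto simp: \<Phi>_def)
 ultimately obtain X where X: "(s0, 0) \<in> X" "open X" "X \<times> {0..1} \<subseteq> {p. \<Phi> p < e}"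
  using Elementary_Topology.tube_lemma[OF compact_Icc[of 0 1], of "{p. \<Phi> p < e}" "(s0, 0)"] by blast
 obtain S B where SB: "open S" "open B" "s0 \<in> S" "0 \<in> B" "S \<times> B \<subseteq> X"
  using open_prod_elim[OF X(2,1)] by (metis SigmaE2)
 obtain rho where rho: "rho > 0" "ball 0 rho \<subseteq> B" using SB(2,4) open_contains_ball by blast
 have c_id: "c t = t" if "t \<in> {0..1}" for t using that by (auto simp: c_def)
 have \<Phi>e: "\<Phi> ((s, d), t) < e" if "s \<in> S" "norm d < rho" "t \<in> {0..1}" for s d t
 proof -
  have "((s, d), t) \<in> X \<times> {0..1}" using that rho SB by auto
  thus ?thesis using X(3) by blast
 qed
 have dG: "G s differentiable (at x)" for s x using G by simp
 show ?thesis
 proof (rule that[OF SB(1,3) rho(1)])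
  fix s t and d h :: 'e assume *: "s \<in> S" "t \<in> {0..1::real}" "norm d < rho"
  let ?D = "%i. FD (G s) (u0 t + d) i - FD (G s0) (u0 t) i"
  have "norm (?D h) <= (\<Sum>i\<in>Basis. norm ((h \<bullet> i) *\<^sub>R ?D i))"
   by (subst (1 2) frechet_derivative_expand[OF dG])
    (simp add: sum_subtractf[symmetric] scaleR_diff_right[symmetric] norm_sum del: norm_scaleR)
  also have "... <= (\<Sum>i\<in>Basis. norm (?D i) * norm h)"
   by (intro sum_mono) (auto simp: mult.commute[of _ "norm h"] intro!: mult_right_mono Basis_le_norm)
  also have "... <= e * norm h"
   using \<Phi>e[OF *(1,3,2)] c_id[OF *(2)] unfolding sum_distrib_right[symmetric] \<Phi>_def
   by (intro mult_right_mono) (auto intro: order_trans[rotated] less_imp_le)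
  finally show "norm (?D h) <= e * norm h" .
 next
  fix s t assume *: "s \<in> S" "t \<in> {0..1::real}"
  have "(\<Sum>i\<in>Basis. norm (FD (G s) (u0 t) i - FD (G s0) (u0 t) i)) >= 0"
   by (intro sum_nonneg) auto
  thus "norm (G s (u0 t) - G s0 (u0 t)) <= e"
   using \<Phi>e[of s 0 t] c_id[OF *(2)] * rho(1) unfolding \<Phi>_def by auto
 qed
qed

lemma near_mvt:
 fixes f :: "'e::euclidean_space => 'b::euclidean_space"
 assumes d: "!!x. f differentiable (at x)" and A: "bounded_linear A"
  and near: "!!d h. norm d < rho ==> norm (FD f (z + d) h - A h) <= e * norm h"
  and xy: "norm (x - z) < rho" "norm (y - z) < rho"
 shows "norm (f x - f y - A (x - y)) <= e * norm (x - y)"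
proof -
 have "norm ((f x - A x) - (f y - A y)) <= e * norm (x - y)"
 proof (rule differentiable_bound[where S = "ball z rho"])
  fix w assume w: "w \<in> ball z rho"
  show "((%x. f x - A x) has_derivative (%h. FD f w h - A h)) (at w within ball z rho)"
   using has_derivative_at_withinI[OF d[of w, unfolded frechet_derivative_works]]
    has_derivative_at_withinI[OF bounded_linear_imp_has_derivative[OF A]]
   by (rule has_derivative_diff)
  show "onorm (%h. FD f w h - A h) <= e"
   using near[of "w - z"] w by (intro onorm_le) (auto simp: dist_norm norm_minus_commute)
 qed (use xy in \<open>auto simp: dist_norm norm_minus_commute\<close>)
 thus ?thesis by (simp add: algebra_simps linear_diff[OF bounded_linear.linear[OF A]])
qed

text \<open>The field is controlled only in a tube around \<open>u0\<close>, so Gronwall applies up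
  to the first time \<open>T\<close> at which the distance reaches \<open>r\<close>. The constants
  make the distance at that time at most \<open>r / 2\<close>, a contradiction.\<close>

lemma flow_continuous:
 fixes G :: "'s::topological_space => 'e::euclidean_space => 'e"
 assumes G: "Ck 1 G" and u0: "sol1 (G s0) u0" and e: "e > 0"
 obtains S d where "open S" "s0 \<in> S" "d > 0"
  "!!s u t. s \<in> S ==> sol1 (G s) u ==> norm (u 0 - u0 0) < d ==> t \<in> {0..1} ==> norm (u t - u0 t) < e"
proof -
 have cu0: "continuous_on {0..1} u0" using u0 by (rule sol1_continuous)
 obtain L where L: "L >= 0" "!!x h. x \<in> u0 ` {0..1} ==> norm (FD (G s0) x h) <= L * norm h"
  using Ck_derivative_bounded_on_compact[OF Ck_fixed_param[OF G, of s0] compact_continuous_image[OF cu0 compact_Icc]] by metis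
 obtain S1 rho where S1: "open S1" "s0 \<in> S1" "rho > 0"
  and near: "!!s t d h. s \<in> S1 ==> t \<in> {0..1} ==> norm d < rho ==>
   norm (FD (G s) (u0 t + d) h - FD (G s0) (u0 t) h) <= 1 * norm h"
  using uniform_near[OF G cu0 zero_less_one] by metis
 define r where "r = min e (rho / 2)"
 have r: "r > 0" "r < rho" "r <= e" using e S1 by (auto simp: r_def)
 \<comment> \<open>In the Gronwall estimate this gives \<open>(d + d) * exp (L + 1) = r / 2\<close>:
   one \<open>d\<close> for the initial distance, one for the change of the field with the
   parameter.\<close>
 define d where "d = r / (4 * exp (L + 1))"
 have d: "d > 0" using r by (simp add: d_def)
 obtain S2 rho' where S2: "open S2" "s0 \<in> S2"
  and near2: "!!s t. s \<in> S2 ==> t \<in> {0..1} ==> norm (G s (u0 t) - G s0 (u0 t)) <= d"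
  using uniform_near[OF G cu0 d] by metis
 have dG: "G s differentiable (at x)" for s x using G by simp
 show ?thesis
 proof (rule that[of "S1 \<inter> S2" d])
  fix s u t assume s: "s \<in> S1 \<inter> S2" and u: "sol1 (G s) u" and d0: "norm (u 0 - u0 0) < d" and t: "t \<in> {0..1::real}"
  define w where "w t = u t - u0 t" for t
  have cw: "continuous_on {0..1} w"
   unfolding w_def by (intro continuous_intros sol1_continuous[OF u] cu0)
  have "d < r"
  proof -
   have "1 < 4 * exp (L + 1)" using L(1) exp_ge_add_one_self[of "L + 1"] by linarith
   thus ?thesis unfolding d_def using r by (simp add: divide_less_eq)
  qed
  have "norm (w t) < r" if t: "t \<in> {0..1}" for t
  proof (rule ccontr)
   assume nt: "\<not> norm (w t) < r"
   define Z where "Z = {t \<in> {0..1}. r <= norm (w t)}"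
   have "closed Z"
   proof -
    have "closed ({0..1} \<inter> (%t. norm (w t)) -` {r..})"
     by (intro continuous_closed_preimage continuous_on_norm cw) auto
    moreover have "{0..1} \<inter> (%t. norm (w t)) -` {r..} = Z" by (auto simp: Z_def)
    ultimately show ?thesis by simp
   qed
   have Zne: "Z ~= {}" "bdd_below Z" using nt t by (auto simp: Z_def)
   define T where "T = Inf Z"
   have TZ: "T \<in> Z" unfolding T_def using closed_contains_Inf[OF Zne \<open>closed Z\<close>] .
   have T: "T \<in> {0..1}" using TZ by (auto simp: Z_def)
   have le: "norm (w t) <= r" if "t \<in> {0..T}" for t
   proof (rule ccontr)
    assume "\<not> norm (w t) <= r"
    hence tZ: "t \<in> Z" using that T by (auto simp: Z_def)
    hence "T <= t" unfolding T_def using Zne by (intro cInf_lower)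
    with that have "t = T" by auto
    have "\<exists>x\<ge>0. x <= T & norm (w x) = r"
     using \<open>\<not> norm (w t) <= r\<close> \<open>t = T\<close> d0 \<open>d < r\<close> T
     by (intro IVT') (auto simp: w_def[of 0] intro!: continuous_on_norm continuous_on_subset[OF cw])
    then obtain x where x: "0 <= x" "x <= T" "norm (w x) = r" by blast
    hence "x \<in> Z" using T by (auto simp: Z_def)
    hence "T <= x" unfolding T_def using Zne by (intro cInf_lower)
    with x \<open>\<not> norm (w t) <= r\<close> \<open>t = T\<close> show False by auto
   qed
   have "norm (w T) <= (norm (w 0) + d * T) * exp ((L + 1) * T)"
   proof (rule gronwall[where T = T and f' = "%t. G s (u t) - G s0 (u0 t)"])
    fix t assume tT: "t \<in> {0..T}"
    hence t: "t \<in> {0..1}" using T by auto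
    have sub: "{0..T} \<subseteq> {0..1}" using T by auto
    show "(w has_vector_derivative G s (u t) - G s0 (u0 t)) (at t within {0..T})"
     unfolding w_def using u u0 t unfolding sol1_def
     by (intro has_vector_derivative_diff) (auto intro: has_vector_derivative_within_subset[OF _ sub])
    have bl: "bounded_linear (FD (G s0) (u0 t))"
     using dG frechet_derivative_works has_derivative_bounded_linear by blast
    have "norm (G s (u t) - G s (u0 t) - FD (G s0) (u0 t) (u t - u0 t)) <= 1 * norm (u t - u0 t)"
    proof (rule near_mvt[OF dG bl])
     show "norm (FD (G s) (u0 t + d) h - FD (G s0) (u0 t) h) <= 1 * norm h"
      if "norm d < rho" for d h using near[OF _ t that] s by auto
     show "norm (u t - u0 t) < rho" "norm (u0 t - u0 t) < rho"
      using le[OF tT] r S1 by (auto simp: w_def)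
    qed
    moreover have "norm (FD (G s0) (u0 t) (u t - u0 t)) <= L * norm (u t - u0 t)"
     using L(2) t by blast
    moreover have "norm (G s (u0 t) - G s0 (u0 t)) <= d" using near2 s t by auto
    moreover have "G s (u t) - G s0 (u0 t) = (G s (u t) - G s (u0 t) - FD (G s0) (u0 t) (u t - u0 t))
     + FD (G s0) (u0 t) (u t - u0 t) + (G s (u0 t) - G s0 (u0 t))" by simp
    ultimately have "norm (G s (u t) - G s0 (u0 t)) <= 1 * norm (u t - u0 t) + L * norm (u t - u0 t) + d"
     by (simp only: \<open>G s (u t) - G s0 (u0 t) = _\<close>) (intro norm_triangle_mono)
    thus "norm (G s (u t) - G s0 (u0 t)) <= (L + 1) * norm (w t) + d"
     by (simp add: w_def distrib_right)
   qed (use L d T in auto)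
   also have "... <= (d + d * 1) * exp ((L + 1) * 1)"
    using d0 d T L by (intro mult_mono add_mono mult_left_mono) (auto simp: w_def)
   also have "... = r / 2" by (simp add: d_def)
   finally show False using TZ r by (auto simp: Z_def)
  qed
  thus "norm (u t - u0 t) < e" using t r by (force simp: w_def)
 qed (use S1 S2 d in auto)
qed

text \<open>Strict differentiability in the initial value, uniform for parameters near
  \<open>s0\<close>: two neighbouring solutions of a neighbouring equation are compared with the
  variational equation along the single solution \<open>u0\<close>.\<close>

lemma flow_strict:
 fixes G :: "'s::topological_space => 'e::euclidean_space => 'e"
 assumes G: "Ck 1 G" and u0: "sol1 (G s0) u0" and e: "e > 0"
 obtains S d where "open S" "s0 \<in> S" "d > 0"
  "!!s u v y t. s \<in> S ==> sol1 (G s) u ==> sol1 (G s) v ==> varsol (G s0) u0 y ==> y 0 = u 0 - v 0 ==>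
   norm (u 0 - u0 0) < d ==> norm (v 0 - u0 0) < d ==> t \<in> {0..1} ==>
   norm (u t - v t - y t) <= e * norm (u 0 - v 0)"
proof -
 have cu0: "continuous_on {0..1} u0" using u0 by (rule sol1_continuous)
 obtain L where L: "L >= 0" "!!x h. x \<in> u0 ` {0..1} ==> norm (FD (G s0) x h) <= L * norm h"
  using Ck_derivative_bounded_on_compact[OF Ck_fixed_param[OF G, of s0] compact_continuous_image[OF cu0 compact_Icc]] by metis
 \<comment> \<open>Two Gronwall estimates are chained, one for \<open>u - v\<close> with rate
   \<open>L + 1\<close> and one for its distance from \<open>y\<close> with rate \<open>L\<close>;
   hence the product of two exponentials.\<close>
 define e1 where "e1 = min 1 (e / (exp (L + 1) * exp L))"
 have e1: "e1 > 0" "e1 <= 1" using e by (auto simp: e1_def)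
 have e1e: "e1 * (exp (L + 1) * exp L) <= e"
  by (simp add: e1_def min_le_iff_disj flip: pos_le_divide_eq)
 obtain S1 rho where S1: "open S1" "s0 \<in> S1" "rho > 0"
  and near: "!!s t d h. s \<in> S1 ==> t \<in> {0..1} ==> norm d < rho ==>
   norm (FD (G s) (u0 t + d) h - FD (G s0) (u0 t) h) <= e1 * norm h"
  using uniform_near[OF G cu0 e1(1)] by metis
 obtain S2 d where S2: "open S2" "s0 \<in> S2" "d > 0"
  and close: "!!s u t. s \<in> S2 ==> sol1 (G s) u ==> norm (u 0 - u0 0) < d ==> t \<in> {0..1} ==> norm (u t - u0 t) < rho"
  using flow_continuous[OF G u0 S1(3)] by metis
 have dG: "G s differentiable (at x)" for s x using G by simp
 show ?thesis
 proof (rule that[of "S1 \<inter> S2" d])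
  fix s u v y t assume s: "s \<in> S1 \<inter> S2" and u: "sol1 (G s) u" and v: "sol1 (G s) v"
   and y: "varsol (G s0) u0 y" "y 0 = u 0 - v 0"
   and d0: "norm (u 0 - u0 0) < d" "norm (v 0 - u0 0) < d" and t: "t \<in> {0..1::real}"
  let ?A = "%t. FD (G s0) (u0 t)"
  have bl: "bounded_linear (?A t)" for t
   using dG frechet_derivative_works has_derivative_bounded_linear by blast
  define w where "w t = u t - v t" for t
  have *: "norm (G s (u t) - G s (v t) - ?A t (w t)) <= e1 * norm (w t)" if t: "t \<in> {0..1}" for t
   unfolding w_def
  proof (rule near_mvt[OF dG bl])
   show "norm (FD (G s) (u0 t + d) h - ?A t h) <= e1 * norm h"
    if "norm d < rho" for d h using near[OF _ t that] s by auto
   show "norm (u t - u0 t) < rho" "norm (v t - u0 t) < rho"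
    using close[OF _ u d0(1) t] close[OF _ v d0(2) t] s by auto
  qed
  have wd: "(w has_vector_derivative G s (u t) - G s (v t)) (at t within {0..1})" if "t \<in> {0..1}" for t
   unfolding w_def using u v that unfolding sol1_def by (intro has_vector_derivative_diff) auto
  have w: "norm (w t) <= norm (w 0) * exp (L + 1)" if t: "t \<in> {0..1}" for t
  proof -
   have "norm (w t) <= (norm (w 0) + 0 * t) * exp ((L + 1) * t)"
   proof (rule gronwall[where T = 1 and f' = "%t. G s (u t) - G s (v t)"])
    fix t assume t: "t \<in> {0..1::real}"
    show "(w has_vector_derivative G s (u t) - G s (v t)) (at t within {0..1})" using wd t by blast
    have "norm (?A t (w t)) <= L * norm (w t)" using L(2) t by blast
    moreover have "e1 * norm (w t) <= 1 * norm (w t)" by (intro mult_right_mono e1) auto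
    ultimately show "norm (G s (u t) - G s (v t)) <= (L + 1) * norm (w t) + 0"
     using *[OF t] norm_triangle_sub[of "G s (u t) - G s (v t)" "?A t (w t)"]
     by (simp add: distrib_right)
   qed (use L t in auto)
   also have "... <= norm (w 0) * exp ((L + 1) * 1)"
    using t L by (auto intro!: mult_left_mono)
   finally show ?thesis by simp
  qed
  define z where "z t = w t - y t" for t
  have "norm (z t) <= (norm (z 0) + (e1 * (norm (w 0) * exp (L + 1))) * t) * exp (L * t)"
  proof (rule gronwall[where T = 1 and f' = "%t. G s (u t) - G s (v t) - ?A t (y t)"])
   fix t assume t: "t \<in> {0..1::real}"
   show "(z has_vector_derivative G s (u t) - G s (v t) - ?A t (y t)) (at t within {0..1})"
    unfolding z_def using wd[OF t] y(1) t unfolding varsol_def by (intro has_vector_derivative_diff) auto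
   have eq: "G s (u t) - G s (v t) - ?A t (y t) = (G s (u t) - G s (v t) - ?A t (w t)) + ?A t (z t)"
    unfolding z_def by (simp add: linear_diff[OF bounded_linear.linear[OF bl]])
   have "norm (?A t (z t)) <= L * norm (z t)" using L(2) t by blast
   moreover have "e1 * norm (w t) <= e1 * (norm (w 0) * exp (L + 1))"
    using w[OF t] e1 by (intro mult_left_mono) auto
   ultimately show "norm (G s (u t) - G s (v t) - ?A t (y t)) <= L * norm (z t) + e1 * (norm (w 0) * exp (L + 1))"
    using *[OF t] norm_triangle_ineq[of "G s (u t) - G s (v t) - ?A t (w t)" "?A t (z t)"]
    unfolding eq by linarith
  qed (use L t e1 in auto)
  also have "z 0 = 0" using y(2) by (simp add: z_def w_def)
  also have "(norm (0::'e) + (e1 * (norm (w 0) * exp (L + 1))) * t) * exp (L * t)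
   <= ((e1 * (norm (w 0) * exp (L + 1))) * 1) * exp (L * 1)"
   using t L(1) e1 unfolding norm_zero add_0_left
   by (intro mult_mono mult_left_mono iffD2[OF exp_le_cancel_iff]) auto
  also have "... = (e1 * (exp (L + 1) * exp L)) * norm (w 0)" by simp
  also have "... <= e * norm (w 0)" using e1e by (intro mult_right_mono) auto
  finally show "norm (u t - v t - y t) <= e * norm (u 0 - v 0)" by (simp add: z_def w_def)
 qed (use S1 S2 in auto)
qed

section \<open>Principal directions as functions of the 2-jet\<close>

text \<open>\<open>A $ i\<close> is the image of the \<open>i\<close>-th axis vector, so this is the
  action of the transpose. The convention matches \<open>jac\<close>, whose entry \<open>i\<close>
  is the derivative in direction \<open>axis i 1\<close>.\<close>

definition mv :: "real^3^3 => R3 => R3" where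
 "mv A X = (\<Sum>i\<in>UNIV. X $ i *\<^sub>R A $ i)"

lemma bounded_bilinear_mv: "bounded_bilinear mv"
proof -
 have "bilinear mv"
  unfolding bilinear_def mv_def
  by (auto intro!: linearI simp: algebra_simps sum.distrib scaleR_sum_right)
 thus ?thesis by (simp add: bilinear_conv_bounded_bilinear)
qed

lemma bounded_bilinear_cross3: "bounded_bilinear cross3"
 using bilinear_cross by (simp add: bilinear_conv_bounded_bilinear)

lemmas mv_simps = bounded_bilinear.add_left[OF bounded_bilinear_mv]
 bounded_bilinear.add_right[OF bounded_bilinear_mv]
 bounded_bilinear.diff_left[OF bounded_bilinear_mv]
 bounded_bilinear.diff_right[OF bounded_bilinear_mv]
 bounded_bilinear.scaleR_left[OF bounded_bilinear_mv]
 bounded_bilinear.scaleR_right[OF bounded_bilinear_mv]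

definition qf :: "real^3^3 => R3 => real" where
 "qf A X = mv A X \<bullet> X"

definition offd :: "real^3^3 => R3 => R3 => real" where
 "offd A V X = mv A X \<bullet> (cross3 V X) + mv A (cross3 V X) \<bullet> X"

text \<open>For \<open>X\<close> orthogonal to \<open>V\<close>, both nonzero, a positive multiple
  of the difference of the Rayleigh quotients of \<open>X\<close> and \<open>cross3 V X\<close>,
  cleared of denominators so that it stays polynomial in the jet.\<close>

definition dlt :: "real^3^3 => R3 => R3 => real" where
 "dlt A V X = 2 * (V \<bullet> V) * qf A X - 2 * qf A (cross3 V X)"

definition DD :: "real^3^3 => R3 => R3 => real" where
 "DD A V X = (dlt A V X)\<^sup>2 + 4 * (V \<bullet> V) * (offd A V X)\<^sup>2"

text \<open>The orthogonal projection of \<open>w\<close> to the normal plane times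
  \<open>V \<bullet> V\<close>; the factor avoids a division.\<close>

definition prX :: "R3 => R3 => R3" where
 "prX w V = (V \<bullet> V) *\<^sub>R w - (V \<bullet> w) *\<^sub>R V"

text \<open>In the orthogonal frame \<open>X\<close>, \<open>Z = cross3 V X\<close> of the normal plane the curvature form has discriminant
 \<open>DD\<close> and eigenvector \<open>(sqrt DD + sg * dlt) *\<^sub>R X + (2 * sg * offd) *\<^sub>R Z\<close>. The factor \<open>sqrt DD ^ 6\<close> makes it
 \<open>C\<^sup>2\<close> and zero at partially umbilic points.\<close>

definition YX :: "real => R3 => R3 => real^3^3 => R3" where
 "YX sg X V A = pq 7 (DD A V X) *\<^sub>R X +
  (sg * pq 6 (DD A V X)) *\<^sub>R (dlt A V X *\<^sub>R X + (2 * offd A V X) *\<^sub>R cross3 V X)"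

definition YY :: "real => R3 => R3 => real^3^3 => R3" where
 "YY sg w V A = YX sg (prX w V) V A"

lemma DD_nonneg: "DD A V X >= 0"
 by (simp add: DD_def)

lemma prX_perp: "V \<bullet> prX w V = 0"
 by (simp add: prX_def inner_diff_right)

lemma cross3_cross3_perp: "V \<bullet> X = 0 ==> cross3 V (cross3 V X) = - (V \<bullet> V) *\<^sub>R X"
 by (simp add: Lagrange)

lemma cross3_inner_self: "V \<bullet> X = 0 ==> cross3 V X \<bullet> cross3 V X = (V \<bullet> V) * (X \<bullet> X)"
 by (simp add: dot_cross inner_commute)

lemma perp_decomp:
 assumes V: "V ~= 0" and Y: "Y ~= 0" "V \<bullet> Y = 0" and X: "V \<bullet> X = 0"
 shows "X = (X \<bullet> Y / (Y \<bullet> Y)) *\<^sub>R Y + (X \<bullet> cross3 V Y / ((V \<bullet> V) * (Y \<bullet> Y))) *\<^sub>R cross3 V Y"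
proof -
 let ?Z = "cross3 V Y"
 have ZZ: "?Z \<bullet> ?Z = (V \<bullet> V) * (Y \<bullet> Y)" by (rule cross3_inner_self[OF Y(2)])
 hence Z0: "?Z ~= 0" using V Y by auto
 define R where "R = X - (X \<bullet> Y / (Y \<bullet> Y)) *\<^sub>R Y - (X \<bullet> ?Z / ((V \<bullet> V) * (Y \<bullet> Y))) *\<^sub>R ?Z"
 have R: "R \<bullet> Y = 0" "R \<bullet> V = 0" "R \<bullet> ?Z = 0"
  using V Y X ZZ inner_commute[of Y V] inner_commute[of X V]
  by (simp_all add: R_def inner_diff_left dot_cross_self)
 \<comment> \<open>Being orthogonal to \<open>V\<close> and \<open>Y\<close>, the remainder
   \<open>R\<close> is parallel to \<open>cross3 V Y\<close>; it is orthogonal to that vector too,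
   so it vanishes.\<close>
 have "cross3 R ?Z = 0" using R by (simp add: Lagrange)
 hence "(norm R * norm ?Z)\<^sup>2 = 0" using norm_cross_dot[of R ?Z] R(3) by simp
 hence "R = 0" using Z0 by simp
 thus ?thesis by (simp add: R_def algebra_simps)
qed

text \<open>With \<open>u\<close> and \<open>v\<close> in the role of cosine and sine, this and
  \<open>dlt_combo\<close> are the double-angle formulas for the entries of a symmetric form under a
  change of frame.\<close>

lemma offd_combo:
 assumes "V \<bullet> X = 0"
 shows "offd A V (u *\<^sub>R X + v *\<^sub>R cross3 V X) =
  (u\<^sup>2 - v\<^sup>2 * (V \<bullet> V)) * offd A V X - u * v * dlt A V X"
 using assms
 by (simp add: offd_def dlt_def qf_def bounded_bilinear.add_right[OF bounded_bilinear_cross3]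
  bounded_bilinear.scaleR_right[OF bounded_bilinear_cross3] cross3_cross3_perp mv_simps
  inner_add_left inner_add_right inner_diff_left inner_diff_right power2_eq_square algebra_simps
  bounded_bilinear.minus_right[OF bounded_bilinear_mv])

lemma dlt_combo:
 assumes "V \<bullet> X = 0"
 shows "dlt A V (u *\<^sub>R X + v *\<^sub>R cross3 V X) =
  (u\<^sup>2 - v\<^sup>2 * (V \<bullet> V)) * dlt A V X + 4 * (V \<bullet> V) * u * v * offd A V X"
 using assms
 by (simp add: offd_def dlt_def qf_def bounded_bilinear.add_right[OF bounded_bilinear_cross3]
  bounded_bilinear.scaleR_right[OF bounded_bilinear_cross3] cross3_cross3_perp mv_simps
  inner_add_left inner_add_right inner_diff_left inner_diff_right power2_eq_square algebra_simps
  bounded_bilinear.minus_right[OF bounded_bilinear_mv])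

lemma pq_succ: "t >= 0 ==> pq (Suc k) t = sqrt t * pq k t"
 by (simp add: pq_def max_def)

lemma YX_combo:
 "YX sg X V A = (pq 6 (DD A V X) * (sqrt (DD A V X) + sg * dlt A V X)) *\<^sub>R X
  + (2 * sg * pq 6 (DD A V X) * offd A V X) *\<^sub>R cross3 V X"
proof -
 have "pq 7 (DD A V X) = sqrt (DD A V X) * pq 6 (DD A V X)"
  using pq_succ[OF DD_nonneg, of 6 A V X] by simp
 thus ?thesis by (simp add: YX_def algebra_simps)
qed

context
 fixes sg :: real and A :: "real^3^3" and V X :: "R3"
 assumes sg: "sg = 1 \<or> sg = -1" and perp: "V \<bullet> X = 0"
begin

private lemma sg2: "sg * sg = 1" using sg by auto

private lemma sq: "sqrt (DD A V X) * sqrt (DD A V X) = (dlt A V X)\<^sup>2 + 4 * (V \<bullet> V) * (offd A V X)\<^sup>2"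
 using DD_nonneg[of A V X] by (simp add: DD_def)

lemma YX_perp: "V \<bullet> YX sg X V A = 0"
 by (simp add: YX_combo inner_add_right perp dot_cross_self)

text \<open>Vanishing \<open>offd\<close> is the eigenvector equation. By \<open>offd_combo\<close>
  it is quadratic in the coefficients, and those of \<open>YX_combo\<close> solve it because
  \<open>sqrt DD\<close> squares to the discriminant.\<close>

lemma YX_offd: "offd A V (YX sg X V A) = 0"
 unfolding YX_combo offd_combo[OF perp]
 using sq sg2 by algebra

lemma YX_dlt: "dlt A V (YX sg X V A) * (X \<bullet> X) = sg * sqrt (DD A V X) * (YX sg X V A \<bullet> YX sg X V A)"
proof -
 have n: "YX sg X V A \<bullet> YX sg X V A = (pq 6 (DD A V X) * (sqrt (DD A V X) + sg * dlt A V X))\<^sup>2 * (X \<bullet> X)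
  + (2 * sg * pq 6 (DD A V X) * offd A V X)\<^sup>2 * ((V \<bullet> V) * (X \<bullet> X))"
  by (simp add: YX_combo inner_add_right inner_add_left dot_cross_self
    cross3_inner_self[OF perp] power2_eq_square algebra_simps)
 show ?thesis unfolding n unfolding YX_combo dlt_combo[OF perp]
  using sq sg2 by algebra
qed

lemma YX_inner_nonneg: "YX sg X V A \<bullet> X >= 0"
proof -
 have "\<bar>dlt A V X\<bar> <= sqrt (DD A V X)"
  by (rule real_le_rsqrt) (simp add: DD_def)
 hence "sqrt (DD A V X) + sg * dlt A V X >= 0" using sg by auto
 thus ?thesis by (simp add: YX_combo inner_add_left dot_cross_self)
qed

lemma YX_nonzeroD:
 assumes "YX sg X V A ~= 0"
 shows "X ~= 0" "DD A V X > 0"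
proof -
 show "X ~= 0" using assms by (auto simp: YX_def)
 show "DD A V X > 0"
 proof (rule ccontr)
  assume "\<not> DD A V X > 0"
  hence "pq 7 (DD A V X) = 0" "pq 6 (DD A V X) = 0" by (auto simp: pq_eq_0_iff)
  thus False using assms by (simp add: YX_def)
 qed
qed

text \<open>Apart from a vanishing discriminant there is a second way to vanish: \<open>X\<close>
  itself is principal, but for the other eigenvalue. \<open>YY_of_principal\<close> excludes this by
  the sign of \<open>w \<bullet> e\<close>.\<close>

lemma YX_zeroD:
 assumes "YX sg X V A = 0" "X ~= 0" "V ~= 0"
 shows "offd A V X = 0 & sg * dlt A V X <= 0"
proof (cases "DD A V X > 0")
 case True
 have Z: "cross3 V X \<bullet> cross3 V X ~= 0" using cross3_inner_self[OF perp] assms by simp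
 have "YX sg X V A \<bullet> cross3 V X = 2 * sg * pq 6 (DD A V X) * offd A V X * (cross3 V X \<bullet> cross3 V X)"
  by (simp add: YX_combo inner_add_left dot_cross_self)
 hence "offd A V X = 0" using assms(1) Z sg pq_pos_iff[of 6 "DD A V X"] True by auto
 moreover have "YX sg X V A \<bullet> X = pq 6 (DD A V X) * (sqrt (DD A V X) + sg * dlt A V X) * (X \<bullet> X)"
  by (simp add: YX_combo inner_add_left dot_cross_self)
 hence "sqrt (DD A V X) + sg * dlt A V X = 0"
  using assms(1,2) pq_pos_iff[of 6 "DD A V X"] True by auto
 ultimately show ?thesis using True real_sqrt_ge_zero[of "DD A V X"] by linarith
next
 case False
 hence "DD A V X = 0" using DD_nonneg[of A V X] by linarith
 moreover have "4 * (V \<bullet> V) * (offd A V X)\<^sup>2 >= 0" by simp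
 ultimately have "(dlt A V X)\<^sup>2 = 0" "4 * (V \<bullet> V) * (offd A V X)\<^sup>2 = 0"
  unfolding DD_def by (smt (verit) zero_le_power2)+
 thus ?thesis using assms by auto
qed

end

lemma qf_combo:
 "offd A V Y = 0 ==> qf A (a *\<^sub>R Y + b *\<^sub>R cross3 V Y) = a\<^sup>2 * qf A Y + b\<^sup>2 * qf A (cross3 V Y)"
proof -
 assume "offd A V Y = 0"
 hence "mv A (cross3 V Y) \<bullet> Y = - (mv A Y \<bullet> cross3 V Y)" by (simp add: offd_def)
 thus ?thesis
  by (simp add: qf_def mv_simps inner_add_left inner_add_right power2_eq_square algebra_simps)
qed

text \<open>Exact differences rather than inequalities, so that one formula yields both the
  extremality of the two directions and, through \<open>b = 0\<close>, uniqueness of the principal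
  direction up to scaling.\<close>

lemma rayleigh_diff:
 assumes V: "V ~= 0" and Y: "Y ~= 0" "V \<bullet> Y = 0" "offd A V Y = 0"
  and ab: "a ~= 0 \<or> b ~= 0" and X: "X = a *\<^sub>R Y + b *\<^sub>R cross3 V Y"
 shows "qf A Y / (Y \<bullet> Y) - qf A X / (X \<bullet> X) = b\<^sup>2 * dlt A V Y / (2 * (X \<bullet> X))"
  and "qf A X / (X \<bullet> X) - qf A (cross3 V Y) / (cross3 V Y \<bullet> cross3 V Y)
   = a\<^sup>2 * dlt A V Y / (2 * (V \<bullet> V) * (X \<bullet> X))"
  and "X \<bullet> X > 0"
proof -
 let ?n = "V \<bullet> V" and ?y = "Y \<bullet> Y"
 have pos: "?n > 0" "?y > 0" using V Y by auto
 have XX: "X \<bullet> X = (a\<^sup>2 + b\<^sup>2 * ?n) * ?y"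
  by (simp add: X inner_add_left inner_add_right dot_cross_self cross3_inner_self[OF Y(2)]
    power2_eq_square algebra_simps)
 have s: "a\<^sup>2 + b\<^sup>2 * ?n > 0"
  using ab pos by (auto intro: add_pos_nonneg add_nonneg_pos)
 thus XXp: "X \<bullet> X > 0" using pos by (simp add: XX)
 have q: "qf A X = a\<^sup>2 * qf A Y + b\<^sup>2 * qf A (cross3 V Y)"
  unfolding X by (rule qf_combo[OF Y(3)])
 show "qf A Y / ?y - qf A X / (X \<bullet> X) = b\<^sup>2 * dlt A V Y / (2 * (X \<bullet> X))"
  using XXp pos unfolding q dlt_def
  by (simp add: divide_simps) (simp add: XX algebra_simps)
 show "qf A X / (X \<bullet> X) - qf A (cross3 V Y) / (cross3 V Y \<bullet> cross3 V Y)
   = a\<^sup>2 * dlt A V Y / (2 * ?n * (X \<bullet> X))"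
  using XXp pos unfolding q dlt_def cross3_inner_self[OF Y(2)]
  by (simp add: divide_simps) (simp add: XX algebra_simps)
qed


text \<open>Normal curvature is minus the form, so \<open>sg = 1\<close>, which selects the
  direction with the larger Rayleigh quotient, belongs to the smaller curvature
  \<open>k1\<close>.\<close>

abbreviation kap :: "real => (R3 => R3) => R3 => real" where
 "kap sg eta \<equiv> if sg = 1 then k1 eta else k2 eta"

context
 fixes eta :: "R3 => R3" and p V :: "R3" and A :: "real^3^3" and r :: real
 assumes V: "V ~= 0" and plane: "normal_plane eta p = {X. V \<bullet> X = 0}" and r: "r > 0"
  and form: "!!X. V \<bullet> X = 0 ==> FD eta p X \<bullet> X = r * qf A X"
begin

private lemma nc: "V \<bullet> X = 0 ==> normal_curvature eta p X = - r * (qf A X / (X \<bullet> X))"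
 by (simp add: normal_curvature_def form)

lemma curvature_extrema:
 assumes Y: "Y ~= 0" "V \<bullet> Y = 0" "offd A V Y = 0"
 shows "dlt A V Y >= 0 ==> k1 eta p = normal_curvature eta p Y & k2 eta p = normal_curvature eta p (cross3 V Y)"
  and "dlt A V Y <= 0 ==> k2 eta p = normal_curvature eta p Y & k1 eta p = normal_curvature eta p (cross3 V Y)"
  and "!!X. X \<in> normal_plane eta p - {0} ==> \<exists>a b. X = a *\<^sub>R Y + b *\<^sub>R cross3 V Y & X \<bullet> X > 0 &
    normal_curvature eta p X - normal_curvature eta p Y = r * (b\<^sup>2 * dlt A V Y / (2 * (X \<bullet> X))) &
    normal_curvature eta p (cross3 V Y) - normal_curvature eta p X = r * (a\<^sup>2 * dlt A V Y / (2 * (V \<bullet> V) * (X \<bullet> X)))"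
proof -
 let ?Z = "cross3 V Y" and ?P = "normal_plane eta p - {0}" and ?k = "normal_curvature eta p"
 show *: "\<exists>a b. X = a *\<^sub>R Y + b *\<^sub>R ?Z & X \<bullet> X > 0 &
    ?k X - ?k Y = r * (b\<^sup>2 * dlt A V Y / (2 * (X \<bullet> X))) &
    ?k ?Z - ?k X = r * (a\<^sup>2 * dlt A V Y / (2 * (V \<bullet> V) * (X \<bullet> X)))" if X: "X \<in> ?P" for X
 proof -
  have X': "V \<bullet> X = 0" "X ~= 0" using X plane by auto
  define a where "a = X \<bullet> Y / (Y \<bullet> Y)"
  define b where "b = X \<bullet> cross3 V Y / ((V \<bullet> V) * (Y \<bullet> Y))"
  have e: "X = a *\<^sub>R Y + b *\<^sub>R ?Z" unfolding a_def b_def by (rule perp_decomp[OF V Y(1,2) X'(1)])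
  have ab: "a ~= 0 \<or> b ~= 0" using e X'(2) by auto
  note R = rayleigh_diff[OF V Y ab e]
  have "?k X - ?k Y = r * (qf A Y / (Y \<bullet> Y) - qf A X / (X \<bullet> X))"
   using X' Y by (simp add: nc right_diff_distrib)
  moreover have "?k ?Z - ?k X = r * (qf A X / (X \<bullet> X) - qf A ?Z / (?Z \<bullet> ?Z))"
   using X' by (simp add: nc right_diff_distrib dot_cross_self)
  ultimately show ?thesis using e R by metis
 qed
 have Zn: "?Z ~= 0" using cross3_inner_self[OF Y(2)] V Y by auto
 have YP: "Y \<in> ?P" "?Z \<in> ?P" using Y Zn by (auto simp: plane dot_cross_self)
 have n0: "V \<bullet> V > 0" using V by auto
 show "k1 eta p = ?k Y & k2 eta p = ?k ?Z" if d: "dlt A V Y >= 0"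
 proof
  have le: "?k Y <= ?k X & ?k X <= ?k ?Z" if X: "X \<in> ?P" for X
  proof -
   obtain a b where X: "X \<bullet> X > 0" "?k X - ?k Y = r * (b\<^sup>2 * dlt A V Y / (2 * (X \<bullet> X)))"
    "?k ?Z - ?k X = r * (a\<^sup>2 * dlt A V Y / (2 * (V \<bullet> V) * (X \<bullet> X)))" using *[OF X] by blast
   have "?k X - ?k Y >= 0" "?k ?Z - ?k X >= 0" unfolding X(2,3) using d r X(1) n0 by auto
   thus ?thesis by auto
  qed
  show "k1 eta p = ?k Y" unfolding k1_def using YP le by (intro cInf_eq_minimum) auto
  show "k2 eta p = ?k ?Z" unfolding k2_def using YP le by (intro cSup_eq_maximum) auto
 qed
 show "k2 eta p = ?k Y & k1 eta p = ?k ?Z" if d: "dlt A V Y <= 0"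
 proof
  have le: "?k X <= ?k Y & ?k ?Z <= ?k X" if X: "X \<in> ?P" for X
  proof -
   obtain a b where X: "X \<bullet> X > 0" "?k X - ?k Y = r * (b\<^sup>2 * dlt A V Y / (2 * (X \<bullet> X)))"
    "?k ?Z - ?k X = r * (a\<^sup>2 * dlt A V Y / (2 * (V \<bullet> V) * (X \<bullet> X)))" using *[OF X] by blast
   have "?k X - ?k Y <= 0" "?k ?Z - ?k X <= 0" unfolding X(2,3) using d r X(1) n0
    by (auto intro!: mult_nonneg_nonpos divide_nonpos_pos)
   thus ?thesis by auto
  qed
  show "k2 eta p = ?k Y" unfolding k2_def using YP le by (intro cSup_eq_maximum) auto
  show "k1 eta p = ?k ?Z" unfolding k1_def using YP le by (intro cInf_eq_minimum) auto
 qed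
qed

lemma principal_of_form:
 assumes Y: "Y ~= 0" "V \<bullet> Y = 0" "offd A V Y = 0"
  and sg: "sg = 1 \<or> sg = -1" and pos: "sg * dlt A V Y > 0"
 shows "Y \<in> principal_directions eta (kap sg eta) p"
  and "p \<notin> partially_umbilic_set eta"
  and "X \<in> principal_directions eta (kap sg eta) p ==> \<exists>a. X = a *\<^sub>R Y"
proof -
 let ?Z = "cross3 V Y" and ?P = "normal_plane eta p - {0}" and ?k = "normal_curvature eta p"
 have YP: "Y \<in> ?P" using Y by (auto simp: plane)
 have kY: "kap sg eta p = ?k Y" using curvature_extrema(1,2)[OF Y] sg pos by auto
 thus "Y \<in> principal_directions eta (kap sg eta) p"
  using YP by (auto simp: principal_directions_def)
 have n0: "V \<bullet> V > 0" "Y \<bullet> Y > 0" using V Y by auto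
 obtain a b where ab: "Y = a *\<^sub>R Y + b *\<^sub>R ?Z"
  "?k ?Z - ?k Y = r * (a\<^sup>2 * dlt A V Y / (2 * (V \<bullet> V) * (Y \<bullet> Y)))"
  using curvature_extrema(3)[OF Y YP] by blast
 have "a ~= 0"
 proof
  assume "a = 0"
  hence "Y \<bullet> Y = b *\<^sub>R ?Z \<bullet> Y" using ab(1) by (metis add_0 scale_zero_left)
  thus False using n0 by (simp add: dot_cross_self)
 qed
 hence "?k ?Z ~= ?k Y" using ab(2) r n0 pos by auto
 thus "p \<notin> partially_umbilic_set eta"
  using curvature_extrema(1,2)[OF Y] linear[of 0 "dlt A V Y"] by (auto simp: partially_umbilic_set_def)
 assume "X \<in> principal_directions eta (kap sg eta) p"
 hence X: "X \<in> ?P" "?k X = ?k Y" using kY by (auto simp: principal_directions_def)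
 obtain a b where ab: "X = a *\<^sub>R Y + b *\<^sub>R ?Z" "X \<bullet> X > 0"
  "?k X - ?k Y = r * (b\<^sup>2 * dlt A V Y / (2 * (X \<bullet> X)))"
  using curvature_extrema(3)[OF Y X(1)] by blast
 hence "b = 0" using X(2) r pos by auto
 thus "\<exists>a. X = a *\<^sub>R Y" using ab(1) by auto
qed

lemma YY_principal:
 assumes sg: "sg = 1 \<or> sg = -1" and Y: "YY sg w V A ~= 0"
 shows "YY sg w V A \<in> principal_directions eta (kap sg eta) p"
  and "p \<notin> partially_umbilic_set eta"
  and "X \<in> principal_directions eta (kap sg eta) p ==> \<exists>a. X = a *\<^sub>R YY sg w V A"
  and "sg * dlt A V (YY sg w V A) > 0"
proof -
 let ?Y = "YY sg w V A"
 note Y' = Y[unfolded YY_def]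
 have 0: "V \<bullet> ?Y = 0" "offd A V ?Y = 0"
  unfolding YY_def by (rule YX_perp[OF sg prX_perp] YX_offd[OF sg prX_perp])+
 have X: "prX w V \<bullet> prX w V > 0" "sqrt (DD A V (prX w V)) > 0"
  using YX_nonzeroD[OF sg prX_perp Y'] by auto
 have "sg * dlt A V ?Y * (prX w V \<bullet> prX w V) = sqrt (DD A V (prX w V)) * (?Y \<bullet> ?Y)"
  using YX_dlt[OF sg prX_perp[of V w], where A = A] sg unfolding YY_def by auto
 also have "... > 0" using X Y by auto
 finally show 1: "sg * dlt A V ?Y > 0" using X(1) by (simp add: zero_less_mult_iff)
 show "?Y \<in> principal_directions eta (kap sg eta) p" "p \<notin> partially_umbilic_set eta"
  "X \<in> principal_directions eta (kap sg eta) p ==> \<exists>a. X = a *\<^sub>R ?Y"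
  using principal_of_form[OF Y 0 sg 1] by auto
qed

text \<open>If the formula vanished, \<open>prX w V\<close> would be principal for the other
  curvature, hence orthogonal to \<open>e\<close> at a point that is not partially umbilic. But its
  inner product with \<open>e\<close> is \<open>V \<bullet> V\<close> times
  \<open>w \<bullet> e\<close>, which is positive. The same sign makes the factor \<open>a\<close>
  positive.\<close>

lemma YY_of_principal:
 assumes sg: "sg = 1 \<or> sg = -1" and e: "e \<in> principal_directions eta (kap sg eta) p"
  and nu: "p \<notin> partially_umbilic_set eta" and we: "w \<bullet> e > 0"
 obtains a where "a > 0" "e = a *\<^sub>R YY sg w V A" "YY sg w V A ~= 0"
proof -
 let ?X = "prX w V" and ?P = "normal_plane eta p - {0}" and ?k = "normal_curvature eta p"
 have eP: "e \<in> ?P" "?k e = kap sg eta p" using e by (auto simp: principal_directions_def)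
 hence Ve: "V \<bullet> e = 0" by (simp add: plane)
 have n0: "V \<bullet> V > 0" using V by auto
 have Xe: "?X \<bullet> e > 0" using we n0 Ve by (simp add: prX_def inner_diff_left)
 hence X0: "?X ~= 0" by auto
 have Y0: "YY sg w V A ~= 0"
 proof
  assume "YY sg w V A = 0"
  hence o: "offd A V ?X = 0" and d: "sg * dlt A V ?X <= 0"
   using YX_zeroD[OF sg prX_perp _ X0 V] by (auto simp: YY_def)
  note ext = curvature_extrema[OF X0 prX_perp o]
  have kZ: "?k (cross3 V ?X) = kap sg eta p" using ext(1,2) sg d by auto
  obtain a b where ab: "e = a *\<^sub>R ?X + b *\<^sub>R cross3 V ?X" "e \<bullet> e > 0"
   "?k (cross3 V ?X) - ?k e = r * (a\<^sup>2 * dlt A V ?X / (2 * (V \<bullet> V) * (e \<bullet> e)))"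
   using ext(3)[OF eP(1)] by blast
  have "?X \<bullet> e = a * (?X \<bullet> ?X)" by (simp add: ab(1) inner_add_right dot_cross_self)
  hence "a ~= 0" using Xe by auto
  hence "dlt A V ?X = 0" using ab(2,3) kZ eP(2) n0 r by auto
  hence "k1 eta p = k2 eta p"
   using trans[OF conjunct1[OF ext(1)] sym[OF conjunct1[OF ext(2)]]] by simp
  thus False using nu by (simp add: partially_umbilic_set_def)
 qed
 obtain a where a: "e = a *\<^sub>R YY sg w V A" using YY_principal(3)[OF sg Y0 e] by blast
 have "YY sg w V A \<bullet> ?X >= 0" unfolding YY_def by (rule YX_inner_nonneg[OF sg prX_perp])
 moreover have "a * (YY sg w V A \<bullet> ?X) > 0" using Xe unfolding a by (simp add: inner_commute)
 ultimately have "a > 0" by (simp add: zero_less_mult_iff)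
 thus ?thesis using that a Y0 by blast
qed

end

lemma Ck_mv: "Ck n F ==> Ck n G ==> Ck n (%s x. mv (F s x) (G s x))"
 by (rule Ck_bounded_bilinear[OF bounded_bilinear_mv])

lemma Ck_cross3: "Ck n F ==> Ck n G ==> Ck n (%s x. cross3 (F s x) (G s x))"
 by (rule Ck_bounded_bilinear[OF bounded_bilinear_cross3])

lemma Ck_YY:
 assumes "Ck n w" "Ck n V" "Ck n A" "n <= 2"
 shows "Ck n (%s x. YY sg (w s x) (V s x) (A s x))"
proof -
 have X: "Ck n (%s x. prX (w s x) (V s x))"
  unfolding prX_def using assms by (intro Ck_diff Ck_scaleR Ck_inner)
 have Z: "Ck n (%s x. cross3 (V s x) (prX (w s x) (V s x)))" by (intro Ck_cross3 X assms)
 have O: "Ck n (%s x. offd (A s x) (V s x) (prX (w s x) (V s x)))"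
  unfolding offd_def by (intro Ck_add Ck_inner Ck_mv X Z assms)
 have d: "Ck n (%s x. dlt (A s x) (V s x) (prX (w s x) (V s x)))"
  unfolding dlt_def qf_def by (intro Ck_diff Ck_mult Ck_inner Ck_mv Ck_const X Z assms)
 have D: "Ck n (%s x. DD (A s x) (V s x) (prX (w s x) (V s x)))"
  unfolding DD_def by (intro Ck_add Ck_mult Ck_power Ck_inner Ck_const O d assms)
 have p: "Ck n (%s x. pq k (DD (A s x) (V s x) (prX (w s x) (V s x))))" if "k >= 6" for k
  by (rule Ck_pq_compose[OF _ D]) (use that assms(4) in arith)
 show ?thesis
  unfolding YY_def YX_def by (intro Ck_add Ck_scaleR Ck_mult Ck_const X Z O d p) auto
qed

section \<open>The principal field as a function of jets, and its first variation\<close>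

type_synonym jet = "R3 \<times> R3 \<times> (real^3^3)"

definition YJ :: "real => jet => R3" where
 "YJ sg j = YY sg (fst j) (fst (snd j)) (snd (snd j))"

lemma Ck_YJ: "n <= 2 ==> Ck n (%_. YJ sg)"
 unfolding YJ_def by (intro Ck_YY Ck_intros)

abbreviation DYJ :: "real => jet => jet => R3" where
 "DYJ sg j \<equiv> FD (YJ sg) j"

definition outer :: "R3 => R3 => real^3^3" where
 "outer e v = (\<chi> i. v $ i *\<^sub>R e)"

lemma mv_outer: "mv (outer e v) X = (v \<bullet> X) *\<^sub>R e"
 by (simp add: mv_def outer_def inner_vec_def scaleR_sum_left mult.commute)

lemma YJ_has_derivative: "(YJ sg has_derivative DYJ sg j) (at j)"
 using Ck_has_derivative[of 0 "%_::real. YJ sg"] Ck_YJ[of 1 sg] by (simp del: Ck.simps)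

lemma linear_DYJ: "linear (DYJ sg j)"
 using YJ_has_derivative has_derivative_linear by blast

lemma YJ_perp: "sg = 1 \<or> sg = -1 ==> fst (snd j) \<bullet> YJ sg j = 0"
 unfolding YJ_def YY_def by (rule YX_perp[OF _ prX_perp])

lemma YJ_offd: "sg = 1 \<or> sg = -1 ==> offd (snd (snd j)) (fst (snd j)) (YJ sg j) = 0"
 unfolding YJ_def YY_def by (rule YX_offd[OF _ prX_perp])

text \<open>Since \<open>offd\<close> vanishes at \<open>YJ\<close>, this is half of the
  antisymmetric part of the derivative on the normal plane, evaluated on the principal frame: the
  Frobenius obstruction to integrability of the plane field.\<close>

definition ha :: "real => jet => real" where
 "ha sg j = mv (snd (snd j)) (YJ sg j) \<bullet> cross3 (fst (snd j)) (YJ sg j)"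

lemma Ck_ha: "n <= 2 ==> Ck n (%_. ha sg)"
 unfolding ha_def by (intro Ck_inner Ck_mv Ck_cross3 Ck_YJ Ck_snd Ck_fst Ck_id)

lemma ha_has_derivative: "(ha sg has_derivative FD (ha sg) j) (at j)"
 using Ck_has_derivative[of 0 "%_::real. ha sg"] Ck_ha[of 1 sg] by (simp del: Ck.simps)

lemmas hd_mv = bounded_bilinear.FDERIV[OF bounded_bilinear_mv]
 and hd_cross3 = bounded_bilinear.FDERIV[OF bounded_bilinear_cross3]
 and hd_inner = bounded_bilinear.FDERIV[OF bounded_bilinear_inner]

lemma hd_fst_snd: "((%j. fst (snd j)) has_derivative (%h. fst (snd h))) F"
 and hd_snd_snd: "((%j. snd (snd j)) has_derivative (%h. snd (snd h))) F"
 by (auto intro!: derivative_eq_intros has_derivative_fst has_derivative_snd)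

context
 fixes sg :: real and w V :: "R3" and A :: "real^3^3" and j :: jet and Y Z :: "R3"
 assumes sg: "sg = 1 \<or> sg = -1" and V: "V ~= 0" and j: "j = (w, V, A)"
  and Y: "Y = YJ sg j" and Y0: "Y ~= 0" and Z: "Z = cross3 V Y"
begin

private lemma Yp: "V \<bullet> Y = 0" and Yo: "offd A V Y = 0"
 using YJ_perp[OF sg, of j] YJ_offd[OF sg, of j] by (auto simp: j Y)

private lemma dlt_nz: "dlt A V Y ~= 0"
proof -
 have Y': "YX sg (prX w V) V A = Y" by (simp add: Y j YJ_def YY_def)
 have X: "prX w V \<bullet> prX w V > 0" "sqrt (DD A V (prX w V)) > 0"
  using YX_nonzeroD[OF sg prX_perp] Y' Y0 by auto
 have "dlt A V Y * (prX w V \<bullet> prX w V) = sg * sqrt (DD A V (prX w V)) * (Y \<bullet> Y)"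
  using YX_dlt[OF sg prX_perp[of V w], where A = A] by (simp add: Y')
 thus ?thesis using X Y0 sg by auto
qed

private lemma ZZ: "Z \<bullet> Z = (V \<bullet> V) * (Y \<bullet> Y)"
 unfolding Z by (rule cross3_inner_self[OF Yp])

private lemma Zorth: "V \<bullet> Z = 0" "Y \<bullet> Z = 0" "Z \<bullet> V = 0" "Z \<bullet> Y = 0"
 by (auto simp: Z dot_cross_self)

text \<open>This and \<open>DYJ_offd\<close> come from differentiating identities valid for every
  jet, orthogonality to \<open>V\<close> and the eigenvector equation; the explicit formula with its
  square roots is never differentiated.\<close>

lemma DYJ_perp: "V \<bullet> DYJ sg j (a, e, T) = - (e \<bullet> Y)"
proof -
 have "((%j. fst (snd j) \<bullet> YJ sg j) has_derivative
  (%h. fst (snd j) \<bullet> DYJ sg j h + fst (snd h) \<bullet> YJ sg j)) (at j)"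
  by (rule hd_inner[OF hd_fst_snd YJ_has_derivative])
 moreover have "((%j. fst (snd j) \<bullet> YJ sg j) has_derivative (%h. 0)) (at j)"
  using YJ_perp[OF sg] by simp
 ultimately have "(%h. fst (snd j) \<bullet> DYJ sg j h + fst (snd h) \<bullet> YJ sg j) = (%h. 0)"
  by (rule has_derivative_unique)
 from fun_cong[OF this, of "(a, e, T)"] show ?thesis by (simp add: j Y)
qed

lemma DYJ_offd:
 assumes K: "K = DYJ sg j (0, 0, T)"
 shows "mv T Y \<bullet> Z + mv T Z \<bullet> Y + (mv A K \<bullet> Z + mv A Y \<bullet> cross3 V K + mv A (cross3 V K) \<bullet> Y + mv A Z \<bullet> K) = 0"
proof -
 let ?A = "%j::jet. snd (snd j)" and ?V = "%j::jet. fst (snd j)"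
 note dY = YJ_has_derivative[of sg j]
 note dc = hd_cross3[OF hd_fst_snd dY]
 have "((%j. offd (?A j) (?V j) (YJ sg j)) has_derivative
  (%h. mv (?A j) (YJ sg j) \<bullet> (cross3 (?V j) (DYJ sg j h) + cross3 (?V h) (YJ sg j))
    + (mv (?A j) (DYJ sg j h) + mv (?A h) (YJ sg j)) \<bullet> cross3 (?V j) (YJ sg j)
    + (mv (?A j) (cross3 (?V j) (YJ sg j)) \<bullet> DYJ sg j h
    + (mv (?A j) (cross3 (?V j) (DYJ sg j h) + cross3 (?V h) (YJ sg j)) + mv (?A h) (cross3 (?V j) (YJ sg j))) \<bullet> YJ sg j))) (at j)"
  unfolding offd_def
  by (intro has_derivative_add hd_inner hd_mv[OF hd_snd_snd dY] hd_mv[OF hd_snd_snd dc] dc dY)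
 moreover have "((%j. offd (?A j) (?V j) (YJ sg j)) has_derivative (%h. 0)) (at j)"
  using YJ_offd[OF sg] by simp
 ultimately have "(%h. mv (?A j) (YJ sg j) \<bullet> (cross3 (?V j) (DYJ sg j h) + cross3 (?V h) (YJ sg j))
    + (mv (?A j) (DYJ sg j h) + mv (?A h) (YJ sg j)) \<bullet> cross3 (?V j) (YJ sg j)
    + (mv (?A j) (cross3 (?V j) (YJ sg j)) \<bullet> DYJ sg j h
    + (mv (?A j) (cross3 (?V j) (DYJ sg j h) + cross3 (?V h) (YJ sg j)) + mv (?A h) (cross3 (?V j) (YJ sg j))) \<bullet> YJ sg j)) = (%h. 0)"
  by (rule has_derivative_unique)
 from fun_cong[OF this, of "(0, 0, T)"] show ?thesis
  unfolding K by (simp add: j Y Z inner_add_left algebra_simps)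
qed

text \<open>First-order perturbation theory: the eigenvector turns by the off-diagonal part of the
  perturbation divided by the eigenvalue gap. The component along \<open>Y\<close> only changes the
  length and is left open.\<close>

lemma DYJ_third:
 obtains g where "DYJ sg j (0, 0, T) = g *\<^sub>R Y + ((mv T Y \<bullet> Z + mv T Z \<bullet> Y) / dlt A V Y) *\<^sub>R Z"
proof -
 define K where "K = DYJ sg j (0, 0, T)"
 have "V \<bullet> K = 0" unfolding K_def DYJ_perp by simp
 from perp_decomp[OF V Y0 Yp this]
 obtain g k where K: "K = g *\<^sub>R Y + k *\<^sub>R Z" unfolding Z by blast
 have c: "cross3 V K = g *\<^sub>R Z - (k * (V \<bullet> V)) *\<^sub>R Y"
  using Yp by (simp add: K Z cross_add_right cross_mult_right cross3_cross3_perp)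
 have o: "mv A Y \<bullet> Z + mv A Z \<bullet> Y = 0" using Yo by (simp add: offd_def Z)
 have "mv A K \<bullet> Z + mv A Y \<bullet> cross3 V K + mv A (cross3 V K) \<bullet> Y + mv A Z \<bullet> K
  = 2 * g * (mv A Y \<bullet> Z + mv A Z \<bullet> Y) + k * (2 * (mv A Z \<bullet> Z) - 2 * (V \<bullet> V) * (mv A Y \<bullet> Y))"
  unfolding c by (simp add: K mv_simps inner_add_left inner_add_right inner_diff_left inner_diff_right algebra_simps)
 also have "... = - k * dlt A V Y" unfolding o by (simp add: dlt_def qf_def Z algebra_simps)
 finally have "k * dlt A V Y = mv T Y \<bullet> Z + mv T Z \<bullet> Y"
  using DYJ_offd[OF K_def] by simp
 hence "k = (mv T Y \<bullet> Z + mv T Z \<bullet> Y) / dlt A V Y" using dlt_nz by (simp add: field_simps)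
 thus ?thesis by (intro that[of g]) (use K K_def in simp)
qed

lemma DYJ_outer_Z: obtains g k where "DYJ sg j (0, 0, outer Y Z) = g *\<^sub>R Y + k *\<^sub>R Z" "k ~= 0"
proof -
 obtain g where g: "DYJ sg j (0, 0, outer Y Z) = g *\<^sub>R Y + ((mv (outer Y Z) Y \<bullet> Z + mv (outer Y Z) Z \<bullet> Y) / dlt A V Y) *\<^sub>R Z"
  using DYJ_third by blast
 have "mv (outer Y Z) Y \<bullet> Z + mv (outer Y Z) Z \<bullet> Y = (Z \<bullet> Z) * (Y \<bullet> Y)"
  by (simp add: mv_outer Zorth)
 also have "... ~= 0" using V Y0 by (simp add: ZZ)
 finally show ?thesis using that g dlt_nz by auto
qed

lemma DYJ_outer_V: obtains g where "DYJ sg j (0, 0, outer Y V) = g *\<^sub>R Y"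
proof -
 obtain g where g: "DYJ sg j (0, 0, outer Y V) = g *\<^sub>R Y + ((mv (outer Y V) Y \<bullet> Z + mv (outer Y V) Z \<bullet> Y) / dlt A V Y) *\<^sub>R Z"
  using DYJ_third by blast
 hence "DYJ sg j (0, 0, outer Y V) = g *\<^sub>R Y" by (simp add: mv_outer Zorth Yp)
 thus ?thesis by (rule that)
qed

text \<open>The chosen direction is antisymmetric up to scaling in the frame \<open>Y\<close>,
  \<open>Z\<close>. It does not affect \<open>offd\<close> to first order, so the eigenvector merely
  changes its length, while \<open>ha\<close>, which is the antisymmetric part, does change.\<close>

lemma Dha_outer:
 assumes h0: "ha sg j = 0"
 shows "FD (ha sg) j (0, 0, outer Y Z - outer Z Y) ~= 0"
proof -
 let ?A = "%j::jet. snd (snd j)" and ?V = "%j::jet. fst (snd j)"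
 let ?T = "outer Y Z - outer Z Y"
 note dY = YJ_has_derivative[of sg j]
 have "(ha sg has_derivative
  (%h. mv (?A j) (YJ sg j) \<bullet> (cross3 (?V j) (DYJ sg j h) + cross3 (?V h) (YJ sg j))
    + (mv (?A j) (DYJ sg j h) + mv (?A h) (YJ sg j)) \<bullet> cross3 (?V j) (YJ sg j))) (at j)"
  unfolding ha_def[abs_def]
  by (intro hd_inner hd_mv[OF hd_snd_snd dY] hd_cross3[OF hd_fst_snd dY])
 from has_derivative_unique[OF ha_has_derivative this]
 have D: "FD (ha sg) j (0, 0, ?T) =
  mv A Y \<bullet> cross3 V (DYJ sg j (0, 0, ?T)) + (mv A (DYJ sg j (0, 0, ?T)) + mv ?T Y) \<bullet> Z"
  by (simp add: j Y Z)
 have T: "mv ?T Y = - (Y \<bullet> Y) *\<^sub>R Z" "mv ?T Z = (Z \<bullet> Z) *\<^sub>R Y"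
  by (simp_all add: mv_simps mv_outer Zorth)
 obtain g where "DYJ sg j (0, 0, ?T) = g *\<^sub>R Y + ((mv ?T Y \<bullet> Z + mv ?T Z \<bullet> Y) / dlt A V Y) *\<^sub>R Z"
  using DYJ_third by blast
 hence g: "DYJ sg j (0, 0, ?T) = g *\<^sub>R Y" by (simp add: T)
 have h: "mv A Y \<bullet> Z = 0" using h0 by (simp add: ha_def j Y Z)
 have "FD (ha sg) j (0, 0, ?T) = - (Y \<bullet> Y) * (Z \<bullet> Z)"
  unfolding D g using h
  by (simp add: T cross_mult_right bounded_bilinear.scaleR_right[OF bounded_bilinear_mv] inner_add_left inner_diff_left flip: Z)
 thus ?thesis using ZZ V Y0 by simp
qed

end

section \<open>Localized test fields\<close>

lemma has_integral_step:
 assumes "0 <= a" "a <= b" "b <= (1::real)"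
 shows "((%t. if t \<in> {a..b} then e else 0) has_integral e * (b - a)) {0..1::real}"
proof -
 have "((%t. e) has_integral e * (b - a)) {a..b}"
  using has_integral_const_real[of e a b] assms by (simp add: mult.commute)
 thus ?thesis using assms by (subst has_integral_restrict) auto
qed

text \<open>The mass of \<open>b n\<close> is at least \<open>2 * c0 * r / n\<close>, while the
  error integrates to at most \<open>2 * e * R / n\<close>. Both are of order 1/n, so a small enough
  \<open>e\<close> is incompatible with \<open>C\<close> being nonzero.\<close>

lemma localized_integral_zero:
 fixes g b :: "nat => real => real"
 assumes t0: "t0 \<in> {0<..<1}" and R: "R > 0" and r: "r > 0" and c0: "c0 > 0"
  and int: "!!n. n >= n0 ==> (g n has_integral 0) {0..1}" "!!n. n >= n0 ==> b n integrable_on {0..1}"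
  and supp: "!!n t. n >= n0 ==> t \<in> {0..1} ==> \<bar>t - t0\<bar> > R / n ==> g n t = 0 & b n t = 0"
  and approx: "!!e. e > 0 ==> \<exists>N. \<forall>n\<ge>N. \<forall>t\<in>{0..1}. \<bar>g n t - C * b n t\<bar> <= e"
  and b: "!!n t. b n t >= 0" "!!n t. n >= n0 ==> t \<in> {0..1} ==> \<bar>t - t0\<bar> <= r / n ==> b n t >= c0"
 shows "C = 0"
proof (rule ccontr)
 assume C: "C ~= 0"
 \<comment> \<open>Makes the error \<open>\<bar>C\<bar> * c0 * r / n\<close>, half of the lower
   bound for the main term.\<close>
 define e where "e = \<bar>C\<bar> * c0 * r / (2 * R)"
 have e: "e > 0" using C c0 r R by (simp add: e_def)
 obtain N where N: "!!n t. n >= N ==> t \<in> {0..1} ==> \<bar>g n t - C * b n t\<bar> <= e"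
  using approx[OF e] by blast
 obtain M :: nat where M: "real M > (R + r) / min t0 (1 - t0)" using reals_Archimedean2 by blast
 define n where "n = Max {N, n0, M, 1}"
 have n: "n >= N" "n >= n0" "n >= M" "n >= 1" by (auto simp: n_def)
 have "real n > (R + r) / min t0 (1 - t0)" using M n(3) by (meson less_le_trans of_nat_mono)
 moreover have "min t0 (1 - t0) > 0" using t0 by auto
 ultimately have "(R + r) / n < min t0 (1 - t0)"
  using n(4) by (simp add: pos_divide_less_eq mult.commute del: min_less_iff_conj)
 hence Rr: "R / n < min t0 (1 - t0)" "r / n < min t0 (1 - t0)"
  using R r n(4) by (auto simp: add_divide_distrib intro: le_less_trans[rotated])
 have n0: "real n > 0" using n(4) by simp
 obtain i where i: "(b n has_integral i) {0..1}" using int(2)[OF n(2)] by blast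
 have "C * i - 0 <= e * ((t0 + R / n) - (t0 - R / n)) & 0 - C * i <= e * ((t0 + R / n) - (t0 - R / n))"
 proof
  have st: "((%t. if t \<in> {t0 - R / n..t0 + R / n} then e else 0) has_integral
    e * ((t0 + R / n) - (t0 - R / n))) {0..1}"
   using Rr R n0 by (intro has_integral_step) auto
  have 1: "((%t. C * b n t - g n t) has_integral (C * i - 0)) {0..1}"
   by (intro has_integral_diff has_integral_mult_right i int n)
  have 2: "((%t. g n t - C * b n t) has_integral (0 - C * i)) {0..1}"
   by (intro has_integral_diff has_integral_mult_right i int n)
  have le: "\<bar>g n t - C * b n t\<bar> <= (if t \<in> {t0 - R / n..t0 + R / n} then e else 0)" if "t \<in> {0..1}" for t
   using N[OF n(1) that] supp[OF n(2) that] by auto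
  show "C * i - 0 <= e * ((t0 + R / n) - (t0 - R / n))"
   by (rule has_integral_le[OF 1 st]) (use le in force)
  show "0 - C * i <= e * ((t0 + R / n) - (t0 - R / n))"
   by (rule has_integral_le[OF 2 st]) (use le in force)
 qed
 hence ub: "\<bar>C * i\<bar> <= e * (2 * R / n)" by (auto simp: abs_le_iff)
 have "c0 * ((t0 + r / n) - (t0 - r / n)) <= i"
 proof (rule has_integral_le[OF _ i])
  show "((%t. if t \<in> {t0 - r / n..t0 + r / n} then c0 else 0) has_integral
    c0 * ((t0 + r / n) - (t0 - r / n))) {0..1}"
   using Rr r n0 by (intro has_integral_step) auto
  show "(if t \<in> {t0 - r / n..t0 + r / n} then c0 else 0) <= b n t" if "t \<in> {0..1}" for t
   using b(1)[of n t] b(2)[OF n(2) that] by auto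
 qed
 hence "\<bar>C\<bar> * (c0 * (2 * r / n)) <= \<bar>C\<bar> * i" by (intro mult_left_mono) auto
 also have "... <= \<bar>C * i\<bar>" by (auto simp: abs_mult intro: mult_left_mono)
 also have "... <= e * (2 * R / n)" by (rule ub)
 also have "... = \<bar>C\<bar> * c0 * r / n" using R by (simp add: e_def)
 finally show False using C c0 r n0 by (simp add: field_simps)
qed

section \<open>Polynomial bumps and their derivatives\<close>

definition jac :: "(R3 => 'b::euclidean_space) => R3 => 'b^3" where
 "jac v x = (\<chi> i. FD v x (axis i 1))"

text \<open>The cut-off \<open>pq k (1 - (n * norm (x - q))\<^sup>2)\<close> lives on the ball of radius \<open>1/n\<close> about \<open>q\<close>.\<close>

definition ts :: "nat => real => R3 => real => R3 => real => R3 => R3 => real" where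
 "ts k n q c1 v1 c2 v2 x = pq k (1 - n\<^sup>2 * ((x - q) \<bullet> (x - q))) * ((c1 + v1 \<bullet> (x - q)) * (c2 + v2 \<bullet> (x - q)))"

definition tsD :: "nat => real => R3 => real => R3 => real => R3 => R3 => R3 => real" where
 "tsD k n q c1 v1 c2 v2 h x =
  (- (real k * n\<^sup>2) * pq (k - 2) (1 - n\<^sup>2 * ((x - q) \<bullet> (x - q)))) * (((x - q) \<bullet> h) * ((c1 + v1 \<bullet> (x - q)) * (c2 + v2 \<bullet> (x - q))))
  + pq k (1 - n\<^sup>2 * ((x - q) \<bullet> (x - q))) * ((v1 \<bullet> h) * (c2 + v2 \<bullet> (x - q)) + (c1 + v1 \<bullet> (x - q)) * (v2 \<bullet> h))"

definition tsDD :: "nat => real => R3 => real => R3 => real => R3 => R3 => R3 => R3 => real" where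
 "tsDD k n q c1 v1 c2 v2 h l x =
  (real k * real (k - 2) * n\<^sup>2 * n\<^sup>2 * pq (k - 4) (1 - n\<^sup>2 * ((x - q) \<bullet> (x - q))) * ((x - q) \<bullet> l)) * (((x - q) \<bullet> h) * ((c1 + v1 \<bullet> (x - q)) * (c2 + v2 \<bullet> (x - q))))
  + (- (real k * n\<^sup>2) * pq (k - 2) (1 - n\<^sup>2 * ((x - q) \<bullet> (x - q)))) * ((l \<bullet> h) * ((c1 + v1 \<bullet> (x - q)) * (c2 + v2 \<bullet> (x - q)))
     + ((x - q) \<bullet> h) * ((v1 \<bullet> l) * (c2 + v2 \<bullet> (x - q)) + (c1 + v1 \<bullet> (x - q)) * (v2 \<bullet> l)))
  + (- (real k * n\<^sup>2) * pq (k - 2) (1 - n\<^sup>2 * ((x - q) \<bullet> (x - q))) * ((x - q) \<bullet> l)) * ((v1 \<bullet> h) * (c2 + v2 \<bullet> (x - q)) + (c1 + v1 \<bullet> (x - q)) * (v2 \<bullet> h))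
  + pq k (1 - n\<^sup>2 * ((x - q) \<bullet> (x - q))) * ((v1 \<bullet> h) * (v2 \<bullet> l) + (v1 \<bullet> l) * (v2 \<bullet> h))"

lemma pq_cutoff_has_derivative:
 fixes q x :: "R3"
 assumes "k >= 3"
 shows "((%x. pq k (1 - n\<^sup>2 * ((x - q) \<bullet> (x - q)))) has_derivative
  (%h. - (real k * n\<^sup>2) * pq (k - 2) (1 - n\<^sup>2 * ((x - q) \<bullet> (x - q))) * ((x - q) \<bullet> h))) (at x)"
proof -
 have "((%x. 1 - n\<^sup>2 * ((x - q) \<bullet> (x - q))) has_derivative (%h. - (2 * n\<^sup>2 * ((x - q) \<bullet> h)))) (at x)"
  by (auto intro!: derivative_eq_intros simp: inner_commute)
 from has_derivative_compose[OF this has_field_derivative_imp_has_derivative[OF pq_has_field_derivative[OF assms]]]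
 show ?thesis by (rule has_derivative_eq_rhs) (simp add: fun_eq_iff)
qed

lemma ts_has_derivative:
 assumes "k >= 3"
 shows "(ts k n q c1 v1 c2 v2 has_derivative (%h. tsD k n q c1 v1 c2 v2 h x)) (at x)"
 unfolding ts_def[abs_def] tsD_def
 by (rule derivative_eq_intros pq_cutoff_has_derivative[OF assms] refl)+ (simp add: algebra_simps fun_eq_iff)

lemma tsD_has_derivative:
 assumes "k >= 5"
 shows "(tsD k n q c1 v1 c2 v2 h has_derivative (%l. tsDD k n q c1 v1 c2 v2 h l x)) (at x)"
proof -
 have k: "k >= 3" "k - 2 >= 3" "k - 2 - 2 = k - 4" using assms by auto
 show ?thesis
  unfolding tsD_def[abs_def] tsDD_def
  by (rule derivative_eq_intros pq_cutoff_has_derivative[OF k(1)] pq_cutoff_has_derivative[OF k(2)] refl)+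
   (simp add: algebra_simps fun_eq_iff k)
qed

definition tfield :: "nat => real => R3 => real => R3 => real => R3 => R3 => R3 => R3" where
 "tfield k n q c1 v1 c2 v2 e x = ts k n q c1 v1 c2 v2 x *\<^sub>R e"

lemma jac_eqI:
 assumes "(v has_derivative v') (at x)" shows "jac v x = (\<chi> i. v' (axis i 1))"
 using frechet_derivative_at[OF assms] by (simp add: jac_def)

lemma jac_tfield: "k >= 3 ==> jac (tfield k n q c1 v1 c2 v2 e) x = (\<chi> i. tsD k n q c1 v1 c2 v2 (axis i 1) x *\<^sub>R e)"
 unfolding tfield_def[abs_def]
 by (rule jac_eqI) (auto intro!: derivative_eq_intros ts_has_derivative)

lemma has_derivative_vec_lambda:
 fixes f :: "'a::real_normed_vector => 'i::finite => 'b::euclidean_space"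
 assumes "!!i. ((%x. f x i) has_derivative (%h. f' h i)) (at x within S)"
 shows "((%x. \<chi> i. f x i) has_derivative (%h. \<chi> i. f' h i)) (at x within S)"
proof (rule iffD2[OF has_derivative_componentwise_within], rule ballI)
 fix b :: "'b^'i" assume "b \<in> Basis"
 then obtain i u where b: "b = axis i u" by (auto simp: Basis_vec_def)
 show "((%x. (\<chi> i. f x i) \<bullet> b) has_derivative (%h. (\<chi> i. f' h i) \<bullet> b)) (at x within S)"
  using has_derivative_inner_left[OF assms[of i], of u] by (simp add: b inner_axis)
qed

lemma jac_jac_tfield:
 assumes "k >= 5"
 shows "jac (jac (tfield k n q c1 v1 c2 v2 e)) x = (\<chi> l. \<chi> i. tsDD k n q c1 v1 c2 v2 (axis i 1) (axis l 1) x *\<^sub>R e)"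
proof -
 have "jac (tfield k n q c1 v1 c2 v2 e) = (%x. \<chi> i. tsD k n q c1 v1 c2 v2 (axis i 1) x *\<^sub>R e)"
  using assms by (simp add: jac_tfield fun_eq_iff)
 moreover have "((%x. \<chi> i. tsD k n q c1 v1 c2 v2 (axis i 1) x *\<^sub>R e) has_derivative
  (%l. \<chi> i. tsDD k n q c1 v1 c2 v2 (axis i 1) l x *\<^sub>R e)) (at x)"
  by (rule has_derivative_vec_lambda) (auto intro!: derivative_eq_intros tsD_has_derivative assms)
 ultimately show ?thesis by (simp add: jac_eqI)
qed


text \<open>As the supports shrink to \<open>t0\<close>, each coefficient \<open>f i\<close> may be
  frozen at \<open>t0\<close>, and each \<open>G i n\<close> is asymptotically a multiple
  \<open>l i\<close> of the common bump \<open>b n\<close>. Thus the sum behaves like a single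
  localized function.\<close>

lemma localized_sum_zero:
 fixes b :: "nat => real => real" and G :: "'i => nat => real => real"
 assumes t0: "t0 \<in> {0<..<1}" and R: "R > 0" and r: "r > 0" and c0: "c0 > 0" and I: "finite I"
  and f: "!!i. i \<in> I ==> continuous_on {0..1} (f i)"
  and cb: "!!n. continuous_on {0..1} (b n)"
  and int: "!!n. n >= n0 ==> ((%t. \<Sum>i\<in>I. f i t * G i n t) has_integral 0) {0..1}"
  and supp: "!!n t. n >= n0 ==> t \<in> {0..1} ==> \<bar>t - t0\<bar> > R / n ==> b n t = 0 & (\<forall>i\<in>I. G i n t = 0)"
  and approx: "!!i e. i \<in> I ==> e > 0 ==> \<forall>\<^sub>F n in sequentially. \<forall>t\<in>{0..1}. \<bar>G i n t - l i * b n t\<bar> <= e"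
  and b: "!!n t. 0 <= b n t" "!!n t. b n t <= 1" "!!n t. n >= n0 ==> t \<in> {0..1} ==> \<bar>t - t0\<bar> <= r / n ==> b n t >= c0"
 shows "(\<Sum>i\<in>I. f i t0 * l i) = 0"
proof (rule localized_integral_zero[OF t0 R r c0, where ?n0.0 = "max n0 1" and b = b and g = "%n t. \<Sum>i\<in>I. f i t * G i n t"])
 have one: "\<forall>\<^sub>F n in sequentially. \<forall>t\<in>{0..1}. \<bar>f i t * G i n t - f i t0 * l i * b n t\<bar> <= e"
  if i: "i \<in> I" and e: "e > 0" for i e
 proof -
  obtain B where B: "B > 0" "!!t. t \<in> {0..1} ==> \<bar>f i t\<bar> <= B"
  proof -
   have "bounded (f i ` {0..1})" using f[OF i] by (intro compact_imp_bounded compact_continuous_image) auto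
   thus ?thesis using that unfolding bounded_pos by auto
  qed
  have "e / 2 / (\<bar>l i\<bar> + 1) > 0" using e by auto
  then obtain d where d: "d > 0" "!!t. t \<in> {0..1} ==> \<bar>t - t0\<bar> < d ==> \<bar>f i t - f i t0\<bar> < e / 2 / (\<bar>l i\<bar> + 1)"
   using f[OF i] t0 unfolding continuous_on_iff dist_real_def by (metis greaterThanLessThan_iff atLeastAtMost_iff less_imp_le)
  have "e / 2 / B > 0" using e B by auto
  from approx[OF i this]
  have 1: "\<forall>\<^sub>F n in sequentially. \<forall>t\<in>{0..1}. \<bar>G i n t - l i * b n t\<bar> <= e / 2 / B" .
  have 2: "\<forall>\<^sub>F n in sequentially. R / real n < d"
   using order_tendstoD(2)[OF lim_const_over_n[of R] d(1)] .
  show ?thesis using 1 2 eventually_ge_at_top[of n0]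
  proof eventually_elim
   case (elim n)
   show ?case
   proof
    fix t :: real assume t: "t \<in> {0..1}"
    show "\<bar>f i t * G i n t - f i t0 * l i * b n t\<bar> <= e"
    proof (cases "\<bar>t - t0\<bar> > R / n")
     case True
     thus ?thesis using supp[OF elim(3) t True] i e by auto
    next
     case False
     hence 3: "\<bar>f i t - f i t0\<bar> <= e / 2 / (\<bar>l i\<bar> + 1)" using d(2)[OF t] elim(2) by auto
     have "\<bar>f i t * (G i n t - l i * b n t)\<bar> <= B * (e / 2 / B)"
      unfolding abs_mult using B elim(1) t by (intro mult_mono) auto
     moreover have "\<bar>(f i t - f i t0) * (l i * b n t)\<bar> <= e / 2 / (\<bar>l i\<bar> + 1) * ((\<bar>l i\<bar> + 1) * 1)"
      unfolding abs_mult using 3 b(1,2)[of n t] e by (intro mult_mono) auto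
     moreover have "f i t * G i n t - f i t0 * l i * b n t = f i t * (G i n t - l i * b n t) + (f i t - f i t0) * (l i * b n t)"
      by (simp add: algebra_simps)
     ultimately have "\<bar>f i t * G i n t - f i t0 * l i * b n t\<bar> <= B * (e / 2 / B) + e / 2 / (\<bar>l i\<bar> + 1) * ((\<bar>l i\<bar> + 1) * 1)"
      by linarith
     also have "... = e"
     proof -
      have *: "B * (e / 2 / B) + e / 2 / x * (x * 1) = e" if "x ~= 0" for x :: real
       using that B by simp
      show ?thesis by (rule *) (simp add: add_nonneg_eq_0_iff)
     qed
     finally show ?thesis .
    qed
   qed
  qed
 qed
 show "\<exists>N. \<forall>n\<ge>N. \<forall>t\<in>{0..1}. \<bar>(\<Sum>i\<in>I. f i t * G i n t) - (\<Sum>i\<in>I. f i t0 * l i) * b n t\<bar> <= e" if e: "e > 0" for e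
 proof -
  have ec: "e / (card I + 1) > 0" using e by (auto intro!: divide_pos_pos)
  have "\<forall>\<^sub>F n in sequentially. \<forall>i\<in>I. \<forall>t\<in>{0..1}. \<bar>f i t * G i n t - f i t0 * l i * b n t\<bar> <= e / (card I + 1)"
   using I one[OF _ ec] by (intro eventually_ball_finite) auto
  hence "\<forall>\<^sub>F n in sequentially. \<forall>t\<in>{0..1}. \<bar>(\<Sum>i\<in>I. f i t * G i n t) - (\<Sum>i\<in>I. f i t0 * l i) * b n t\<bar> <= e"
  proof eventually_elim
   case (elim n)
   show ?case
   proof
    fix t :: real assume t: "t \<in> {0..1}"
    have "\<bar>(\<Sum>i\<in>I. f i t * G i n t) - (\<Sum>i\<in>I. f i t0 * l i) * b n t\<bar> = \<bar>\<Sum>i\<in>I. f i t * G i n t - f i t0 * l i * b n t\<bar>"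
     by (simp add: sum_subtractf sum_distrib_right)
    also have "... <= (\<Sum>i\<in>I. e / (card I + 1))"
     using elim t by (intro order_trans[OF sum_abs] sum_mono) auto
    also have "... <= e" using e by (simp add: field_simps)
    finally show "\<bar>(\<Sum>i\<in>I. f i t * G i n t) - (\<Sum>i\<in>I. f i t0 * l i) * b n t\<bar> <= e" .
   qed
  qed
  thus ?thesis by (simp add: eventually_sequentially)
 qed
qed (use int supp b in \<open>auto intro: integrable_continuous_real cb\<close>)

lemma pq_le1: "t <= 1 ==> pq k t <= 1"
 unfolding pq_def by (intro power_le_one) (auto simp: max_def)

lemma abs_mult_le: "\<bar>a\<bar> <= A ==> \<bar>b\<bar> <= B ==> \<bar>a * b\<bar> <= A * B" for a b A B :: real
 unfolding abs_mult by (intro mult_mono) auto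

lemma abs3:
 "\<bar>x\<bar> <= A' ==> \<bar>y\<bar> <= B' ==> \<bar>z\<bar> <= C ==> A' <= A ==> B' <= B ==> \<bar>x + y + z\<bar> <= A + B + C"
 for x y z A A' B B' C :: real
 by linarith

text \<open>Each derivative of the cut-off costs a factor \<open>N\<close>, which one of the affine
  factors repays, being of size \<open>e / N\<close> on the support. Only the term in which both
  affine factors are differentiated keeps its size.\<close>

lemma ts_bounds:
 fixes N e s :: real and k :: nat
 assumes k: "k >= 7" and N: "N >= 1" and y: "N * norm (x - p) <= 1"
  and h: "norm h <= 1" "norm l <= 1"
  and v: "\<bar>N * (v1 \<bullet> (x - p))\<bar> <= e" "\<bar>N * (v2 \<bullet> (x - p))\<bar> <= e" and e: "e <= 1"
  and s: "norm v1 <= s" "norm v2 <= s"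
 shows "\<bar>ts k N p 0 v1 0 v2 x\<bar> <= e"
  and "\<bar>tsD k N p 0 v1 0 v2 h x\<bar> <= (k + 2 * s) * e"
  and "\<bar>tsDD k N p 0 v1 0 v2 h l x - ((v1 \<bullet> h) * (v2 \<bullet> l) + (v1 \<bullet> l) * (v2 \<bullet> h)) * pq k (1 - N\<^sup>2 * ((x - p) \<bullet> (x - p)))\<bar>
   <= (real k * real k + k * (1 + 2 * s) + k * (2 * s)) * e"
proof -
 define Y where "Y u = N * ((x - p) \<bullet> u)" for u
 define a where "a = N * (v1 \<bullet> (x - p))"
 define b where "b = N * (v2 \<bullet> (x - p))"
 define P where "P m = pq m (1 - N\<^sup>2 * ((x - p) \<bullet> (x - p)))" for m
 have e0: "e >= 0" using v(1) by linarith
 have s0: "s >= 0" using s(1) norm_ge_zero order_trans by blast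
 have ab: "\<bar>a\<bar> <= e" "\<bar>b\<bar> <= e" using v by (auto simp: a_def b_def)
 have ee: "e * e <= e" using e e0 mult_left_mono[of e 1 e] by simp
 have P: "\<bar>P m\<bar> <= 1" for m using N by (auto simp: P_def intro!: pq_le1)
 have Y: "\<bar>Y u\<bar> <= 1" if "norm u <= 1" for u
 proof -
  have "\<bar>(x - p) \<bullet> u\<bar> <= norm (x - p) * 1"
   using Cauchy_Schwarz_ineq2[of "x - p" u] that by (meson mult_left_mono norm_ge_zero order_trans)
  hence "N * \<bar>(x - p) \<bullet> u\<bar> <= N * norm (x - p)" using N by (intro mult_left_mono) auto
  from order_trans[OF this y] show ?thesis using N by (simp add: Y_def abs_mult)
 qed
 have vh: "\<bar>v1 \<bullet> u\<bar> <= s" "\<bar>v2 \<bullet> u\<bar> <= s" if "norm u <= 1" for u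
 proof -
  have "norm v1 * norm u <= s * 1" "norm v2 * norm u <= s * 1"
   by (intro mult_mono that s s0 norm_ge_zero)+
  thus "\<bar>v1 \<bullet> u\<bar> <= s" "\<bar>v2 \<bullet> u\<bar> <= s"
   using Cauchy_Schwarz_ineq2[of v1 u] Cauchy_Schwarz_ineq2[of v2 u] by linarith+
 qed
 have small: "\<bar>v1 \<bullet> (x - p)\<bar> <= e" "\<bar>v2 \<bullet> (x - p)\<bar> <= e"
  using v N mult_right_mono[of 1 N "\<bar>v1 \<bullet> (x - p)\<bar>"] mult_right_mono[of 1 N "\<bar>v2 \<bullet> (x - p)\<bar>"]
  by (auto simp: abs_mult)
 have "\<bar>P k * ((v1 \<bullet> (x - p)) * (v2 \<bullet> (x - p)))\<bar> <= 1 * (e * e)"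
  by (intro abs_mult_le P small)
 thus "\<bar>ts k N p 0 v1 0 v2 x\<bar> <= e" using ee by (simp add: ts_def P_def)
 have "tsD k N p 0 v1 0 v2 h x = (- real k * P (k - 2)) * (Y h * (a * (v2 \<bullet> (x - p))))
  + P k * ((v1 \<bullet> h) * (v2 \<bullet> (x - p)) + (v1 \<bullet> (x - p)) * (v2 \<bullet> h))"
  unfolding tsD_def Y_def a_def P_def by (simp add: power2_eq_square algebra_simps)
 moreover have "\<bar>(- real k * P (k - 2)) * (Y h * (a * (v2 \<bullet> (x - p))))\<bar> <= (real k * 1) * (1 * (e * e))"
  by (intro abs_mult_le P Y h ab small) auto
 moreover have "\<bar>P k * ((v1 \<bullet> h) * (v2 \<bullet> (x - p)) + (v1 \<bullet> (x - p)) * (v2 \<bullet> h))\<bar> <= 1 * (s * e + e * s)"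
  by (intro abs_mult_le P order_trans[OF abs_triangle_ineq] add_mono vh small h)
 moreover have "real k * 1 * (1 * (e * e)) <= k * e" using ee by (simp add: mult_left_mono)
 ultimately show "\<bar>tsD k N p 0 v1 0 v2 h x\<bar> <= (k + 2 * s) * e" by (simp add: algebra_simps)
 have "tsDD k N p 0 v1 0 v2 h l x - ((v1 \<bullet> h) * (v2 \<bullet> l) + (v1 \<bullet> l) * (v2 \<bullet> h)) * pq k (1 - N\<^sup>2 * ((x - p) \<bullet> (x - p)))
  = ((real k * real (k - 2)) * (P (k - 4) * (Y l * (Y h * (a * b)))))
  + (- real k * P (k - 2)) * ((l \<bullet> h) * (a * b) + Y h * ((v1 \<bullet> l) * b + a * (v2 \<bullet> l)))
  + (- real k * P (k - 2)) * (Y l * ((v1 \<bullet> h) * b + a * (v2 \<bullet> h)))"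
  unfolding tsDD_def Y_def a_def b_def P_def by (simp add: power2_eq_square algebra_simps)
 moreover have "\<bar>(real k * real (k - 2)) * (P (k - 4) * (Y l * (Y h * (a * b))))\<bar> <= (real k * real k) * (1 * (1 * (1 * (e * e))))"
  by (intro abs_mult_le P Y h ab) auto
 moreover have "\<bar>(- real k * P (k - 2)) * ((l \<bullet> h) * (a * b) + Y h * ((v1 \<bullet> l) * b + a * (v2 \<bullet> l)))\<bar>
  <= (real k * 1) * (1 * (e * e) + 1 * (s * e + e * s))"
 proof -
  have "\<bar>l \<bullet> h\<bar> <= 1" using Cauchy_Schwarz_ineq2[of l h] h mult_mono[of "norm l" 1 "norm h" 1] by auto
  thus ?thesis
   by (intro abs_mult_le P order_trans[OF abs_triangle_ineq] add_mono Y vh ab h) auto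
 qed
 moreover have "\<bar>(- real k * P (k - 2)) * (Y l * ((v1 \<bullet> h) * b + a * (v2 \<bullet> h)))\<bar> <= (real k * 1) * (1 * (s * e + e * s))"
  by (intro abs_mult_le P order_trans[OF abs_triangle_ineq] add_mono Y vh ab h) auto
 moreover have "(real k * real k) * (1 * (1 * (1 * (e * e)))) <= (real k * real k) * e" using ee by (simp add: mult_left_mono)
 moreover have "real k * 1 * (1 * (e * e) + 1 * (s * e + e * s)) <= k * ((1 + 2 * s) * e)"
  using ee e0 s0 by (intro mult_mono) (auto simp: algebra_simps)
 moreover have "(real k * real k + k * (1 + 2 * s) + k * (2 * s)) * e
   = (real k * real k) * e + k * ((1 + 2 * s) * e) + (real k * 1) * (1 * (s * e + e * s))"
  by (simp add: algebra_simps)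
 ultimately show "\<bar>tsDD k N p 0 v1 0 v2 h l x - ((v1 \<bullet> h) * (v2 \<bullet> l) + (v1 \<bullet> l) * (v2 \<bullet> h)) * pq k (1 - N\<^sup>2 * ((x - p) \<bullet> (x - p)))\<bar>
   <= (real k * real k + k * (1 + 2 * s) + k * (2 * s)) * e"
  by (simp only:) (rule abs3; assumption)
qed

lemma ts_bounds1:
 fixes N e :: real and k :: nat
 assumes k: "k >= 7" and N: "N >= 1" and y: "N * norm (x - p) <= 1" and h: "norm h <= 1"
  and v: "\<bar>N * (v \<bullet> (x - p))\<bar> <= e"
 shows "\<bar>ts k N p 0 v 1 0 x\<bar> <= e"
  and "\<bar>tsD k N p 0 v 1 0 h x - (v \<bullet> h) * pq k (1 - N\<^sup>2 * ((x - p) \<bullet> (x - p)))\<bar> <= k * e"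
proof -
 define P where "P m = pq m (1 - N\<^sup>2 * ((x - p) \<bullet> (x - p)))" for m
 have P: "\<bar>P m\<bar> <= 1" for m using N by (auto simp: P_def intro!: pq_le1)
 have Y: "\<bar>N * ((x - p) \<bullet> h)\<bar> <= 1"
 proof -
  have "\<bar>(x - p) \<bullet> h\<bar> <= norm (x - p) * 1"
   using Cauchy_Schwarz_ineq2[of "x - p" h] h by (meson mult_left_mono norm_ge_zero order_trans)
  hence "N * \<bar>(x - p) \<bullet> h\<bar> <= N * norm (x - p)" using N by (intro mult_left_mono) auto
  from order_trans[OF this y] show ?thesis using N by (simp add: abs_mult)
 qed
 have small: "\<bar>v \<bullet> (x - p)\<bar> <= e"
  using v N mult_right_mono[of 1 N "\<bar>v \<bullet> (x - p)\<bar>"] by (auto simp: abs_mult)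
 have "\<bar>P k * (v \<bullet> (x - p))\<bar> <= 1 * e" by (intro abs_mult_le P small)
 thus "\<bar>ts k N p 0 v 1 0 x\<bar> <= e" by (simp add: ts_def P_def)
 have "tsD k N p 0 v 1 0 h x - (v \<bullet> h) * pq k (1 - N\<^sup>2 * ((x - p) \<bullet> (x - p)))
  = (- real k * P (k - 2)) * ((N * ((x - p) \<bullet> h)) * (N * (v \<bullet> (x - p))))"
  unfolding tsD_def P_def by (simp add: power2_eq_square algebra_simps)
 also have "\<bar>...\<bar> <= (real k * 1) * (1 * e)" by (intro abs_mult_le P Y v) auto
 finally show "\<bar>tsD k N p 0 v 1 0 h x - (v \<bullet> h) * pq k (1 - N\<^sup>2 * ((x - p) \<bullet> (x - p)))\<bar> <= k * e" by simp
qed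

section \<open>Bumps concentrated at a point of an injective curve\<close>

context
 fixes gam :: "real => R3" and D :: "R3" and q :: "nat => R3" and t0 :: real
 assumes cgam: "continuous_on {0..1} gam" and t0: "t0 \<in> {0<..<1}"
  and D: "(gam has_vector_derivative D) (at t0 within {0..1})" "D ~= 0"
  and inj: "!!t. t \<in> {0..1} ==> gam t = gam t0 ==> t = t0"
  and q: "!!n. n >= 1 ==> norm (q n - gam t0) <= 1 / (real n)\<^sup>2"
begin

lemma curve_near:
 assumes "e > 0"
 obtains d where "d > 0" "!!t. t \<in> {0..1} ==> \<bar>t - t0\<bar> < d ==> norm (gam t - gam t0 - (t - t0) *\<^sub>R D) <= e * \<bar>t - t0\<bar>"
 using D(1) assms unfolding has_vector_derivative_def has_derivative_within_alt by (force simp: dist_norm)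

text \<open>Close to \<open>t0\<close> because the velocity is nonzero, elsewhere because of
  injectivity and compactness.\<close>

lemma curve_lower:
 obtains c where "c > 0" "!!t. t \<in> {0..1} ==> c * \<bar>t - t0\<bar> <= norm (gam t - gam t0)"
proof -
 have "norm D / 2 > 0" using D by simp
 from curve_near[OF this]
 obtain d where d: "d > 0" "!!t. t \<in> {0..1} ==> \<bar>t - t0\<bar> < d ==> norm (gam t - gam t0 - (t - t0) *\<^sub>R D) <= norm D / 2 * \<bar>t - t0\<bar>" by metis
 have near: "norm D / 2 * \<bar>t - t0\<bar> <= norm (gam t - gam t0)" if "t \<in> {0..1}" "\<bar>t - t0\<bar> < d" for t
 proof -
  have "norm ((t - t0) *\<^sub>R D) <= norm (gam t - gam t0) + norm (gam t - gam t0 - (t - t0) *\<^sub>R D)"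
   by (metis norm_minus_commute norm_triangle_sub)
  hence "norm D * \<bar>t - t0\<bar> <= norm (gam t - gam t0) + norm (gam t - gam t0 - (t - t0) *\<^sub>R D)"
   by (simp add: mult.commute)
  thus ?thesis using d(2)[OF that] by linarith
 qed
 define F where "F = {0..1} - ball t0 d"
 have "compact F" unfolding F_def by (intro compact_diff) auto
 have cF: "continuous_on F (%t. norm (gam t - gam t0))"
  by (intro continuous_intros continuous_on_subset[OF cgam]) (auto simp: F_def)
 show ?thesis
 proof (cases "F = {}")
  case True
  show ?thesis
  proof (rule that[of "norm D / 2"])
   show "norm D / 2 * \<bar>t - t0\<bar> <= norm (gam t - gam t0)" if "t \<in> {0..1}" for t
    using near[OF that] True that by (auto simp: F_def dist_real_def abs_minus_commute)
  qed (use D in simp)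
 next
  case False
  obtain a where a: "a \<in> F" "!!t. t \<in> F ==> norm (gam a - gam t0) <= norm (gam t - gam t0)"
   using continuous_attains_inf[OF \<open>compact F\<close> False cF] by blast
  have m: "norm (gam a - gam t0) > 0" using inj[of a] a(1) d(1) by (auto simp: F_def)
  show ?thesis
  proof (rule that[of "min (norm D / 2) (norm (gam a - gam t0))"])
   fix t :: real assume t: "t \<in> {0..1}"
   show "min (norm D / 2) (norm (gam a - gam t0)) * \<bar>t - t0\<bar> <= norm (gam t - gam t0)"
   proof (cases "\<bar>t - t0\<bar> < d")
    case True
    have "min (norm D / 2) (norm (gam a - gam t0)) * \<bar>t - t0\<bar> <= norm D / 2 * \<bar>t - t0\<bar>"
     by (intro mult_right_mono) auto
    thus ?thesis using near[OF t True] by linarith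
   next
    case False
    hence "t \<in> F" using t by (auto simp: F_def dist_real_def abs_minus_commute)
    have "min (norm D / 2) (norm (gam a - gam t0)) * \<bar>t - t0\<bar> <= norm (gam a - gam t0) * 1"
     using t t0 by (intro mult_mono) auto
    thus ?thesis using a(2)[OF \<open>t \<in> F\<close>] by simp
   qed
  qed (use D m in simp)
 qed
qed

lemma curve_supp:
 obtains R where "R > 0" "!!n t. n >= 1 ==> t \<in> {0..1} ==> \<bar>t - t0\<bar> > R / real n ==> real n * norm (gam t - q n) > 1"
proof -
 obtain c where c: "c > 0" "!!t. t \<in> {0..1} ==> c * \<bar>t - t0\<bar> <= norm (gam t - gam t0)" using curve_lower by blast
 show ?thesis
 proof (rule that[of "2 / c"])
  fix n :: nat and t :: real assume *: "n >= 1" "t \<in> {0..1}" "\<bar>t - t0\<bar> > 2 / c / real n"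
  hence n: "real n >= 1" by simp
  have "2 / n < c * \<bar>t - t0\<bar>" using *(3) c(1) n by (simp add: field_simps)
  also have "... <= norm (gam t - gam t0)" using c(2) * by auto
  also have "... <= norm (gam t - q n) + norm (q n - gam t0)" using norm_triangle_ineq[of "gam t - q n" "q n - gam t0"] by simp
  also have "norm (q n - gam t0) <= 1 / n"
  proof -
   have "1 / (real n)\<^sup>2 <= 1 / n" using n by (simp add: power2_eq_square field_simps)
   thus ?thesis using q[OF *(1)] by linarith
  qed
  finally have "1 / n < norm (gam t - q n)" by simp
  thus "real n * norm (gam t - q n) > 1" using n by (simp add: field_simps)
 qed (use c in simp)
qed

lemma curve_inner:
 obtains r n0 where "r > 0" "n0 >= 1" "!!n t. n >= n0 ==> t \<in> {0..1} ==> \<bar>t - t0\<bar> <= r / real n ==> real n * norm (gam t - q n) <= 1 / 2"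
proof -
 have nD: "norm D > 0" using D by simp
 from curve_near[OF this]
 obtain d where d: "d > 0" "!!t. t \<in> {0..1} ==> \<bar>t - t0\<bar> < d ==> norm (gam t - gam t0 - (t - t0) *\<^sub>R D) <= norm D * \<bar>t - t0\<bar>" by metis
 define r where "r = 1 / (8 * norm D)"
 have r: "r > 0" using nD by (simp add: r_def)
 obtain M :: nat where M: "real M > r / d" using reals_Archimedean2 by blast
 show ?thesis
 proof (rule that[of r "max M 4"])
  fix n :: nat and t :: real assume *: "n >= max M 4" "t \<in> {0..1}" "\<bar>t - t0\<bar> <= r / real n"
  have n: "real n >= 4" "real n >= M" using *(1) by auto
  have "r / d < real n" using M n by linarith
  hence "r / n < d" using d n by (simp add: field_simps)
  hence td: "\<bar>t - t0\<bar> < d" using * by linarith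
  have "norm (gam t - q n) <= norm (gam t - gam t0 - (t - t0) *\<^sub>R D) + norm ((t - t0) *\<^sub>R D) + norm (q n - gam t0)"
   using norm_triangle_ineq[of "gam t - gam t0 - (t - t0) *\<^sub>R D" "(t - t0) *\<^sub>R D"]
    norm_triangle_ineq4[of "gam t - gam t0" "q n - gam t0"] by simp
  also have "... <= 2 * norm D * \<bar>t - t0\<bar> + 1 / (real n)\<^sup>2"
   using d(2)[OF *(2) td] q[of n] n by simp
  also have "... <= 2 * norm D * (r / n) + 1 / (real n)\<^sup>2"
   using * by (intro add_mono mult_left_mono) auto
  also have "... = 1 / (4 * n) + 1 / (real n)\<^sup>2" using nD n by (simp add: r_def)
  finally have "real n * norm (gam t - q n) <= real n * (1 / (4 * n) + 1 / (real n)\<^sup>2)"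
   using n by (intro mult_left_mono) auto
  also have "... = 1 / 4 + 1 / n" using n by (simp add: power2_eq_square field_simps)
  also have "... <= 1 / 2" using n by (simp add: field_simps)
  finally show "real n * norm (gam t - q n) <= 1 / 2" .
 qed (use r in auto)
qed

text \<open>Within the support \<open>t - t0\<close> is of order 1/n, where the curve departs from
  its tangent by o(1/n), and \<open>v\<close> does not see the tangent. The centres
  \<open>q n\<close> come from a prescribed dense set and may miss the curve; their error
  \<open>1 / n^2\<close> is negligible against the radius \<open>1 / n\<close>.\<close>

lemma curve_perp:
 assumes v: "v \<bullet> D = 0" and e: "e > 0"
 shows "\<forall>\<^sub>F n in sequentially. \<forall>t\<in>{0..1}. real n * norm (gam t - q n) <= 1 --> \<bar>real n * (v \<bullet> (gam t - q n))\<bar> <= e"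
proof -
 obtain R where R: "R > 0" "!!n t. n >= 1 ==> t \<in> {0..1} ==> \<bar>t - t0\<bar> > R / real n ==> real n * norm (gam t - q n) > 1"
  using curve_supp by blast
 define e' where "e' = e / (2 * (norm v + 1) * R)"
 have nv: "norm v + 1 > 0" using norm_ge_zero[of v] by linarith
 have e': "e' > 0" using e R(1) nv by (simp add: e'_def)
 obtain d where d: "d > 0" "!!t. t \<in> {0..1} ==> \<bar>t - t0\<bar> < d ==> norm (gam t - gam t0 - (t - t0) *\<^sub>R D) <= e' * \<bar>t - t0\<bar>"
  using curve_near[OF e'] by metis
 have 1: "\<forall>\<^sub>F n in sequentially. R / real n < d"
  using order_tendstoD(2)[OF lim_const_over_n[of R] d(1)] .
 have 2: "\<forall>\<^sub>F n in sequentially. norm v / real n < e / 2"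
  using order_tendstoD(2)[OF lim_const_over_n[of "norm v"], of "e/2"] e by simp
 show ?thesis using 1 2 eventually_ge_at_top[of 1]
 proof eventually_elim
  case (elim n)
  show ?case
  proof (intro ballI impI)
   fix t :: real assume t: "t \<in> {0..1}" and le: "real n * norm (gam t - q n) <= 1"
   have n: "real n >= 1" using elim by simp
   have tR: "\<bar>t - t0\<bar> <= R / n" using R(2)[OF elim(3) t] le by force
   have "v \<bullet> (gam t - q n) = v \<bullet> (gam t - gam t0 - (t - t0) *\<^sub>R D) - v \<bullet> (q n - gam t0)"
    by (simp add: inner_diff_right v)
   also have "\<bar>...\<bar> <= norm v * norm (gam t - gam t0 - (t - t0) *\<^sub>R D) + norm v * norm (q n - gam t0)"
    using Cauchy_Schwarz_ineq2[of v "gam t - gam t0 - (t - t0) *\<^sub>R D"] Cauchy_Schwarz_ineq2[of v "q n - gam t0"] by linarith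
   also have "... <= (norm v + 1) * (e' * (R / n)) + norm v * (1 / (real n)\<^sup>2)"
   proof (intro add_mono mult_mono)
    have "norm (gam t - gam t0 - (t - t0) *\<^sub>R D) <= e' * \<bar>t - t0\<bar>" using d(2)[OF t] tR elim(1) by linarith
    also have "... <= e' * (R / n)" using tR e' by (intro mult_left_mono) auto
    finally show "norm (gam t - gam t0 - (t - t0) *\<^sub>R D) <= e' * (R / n)" .
   qed (use q[OF elim(3)] in auto)
   also have "(norm v + 1) * (e' * (R / n)) = e / 2 / n"
   proof -
    have *: "a * (e / (2 * a * R) * (R / n)) = e / 2 / n" if "a > 0" for a :: real
     using that R(1) n by simp
    show ?thesis unfolding e'_def by (rule *[OF nv])
   qed
   finally have "real n * \<bar>v \<bullet> (gam t - q n)\<bar> <= real n * (e / 2 / n + norm v * (1 / (real n)\<^sup>2))"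
    using n by (intro mult_left_mono) auto
   also have "... = e / 2 + norm v / n" using n by (simp add: power2_eq_square field_simps)
   also have "... <= e" using elim(2) by linarith
   finally show "\<bar>real n * (v \<bullet> (gam t - q n))\<bar> <= e" using n by (simp add: abs_mult)
  qed
 qed
qed

private lemma cutoff_zero:
 assumes "k > 0" "real n * norm (gam t - q n) > 1"
 shows "pq k (1 - (real n)\<^sup>2 * ((gam t - q n) \<bullet> (gam t - q n))) = 0"
proof -
 have "(real n)\<^sup>2 * ((gam t - q n) \<bullet> (gam t - q n)) = (real n * norm (gam t - q n))\<^sup>2"
  by (simp add: power_mult_distrib power2_norm_eq_inner)
 also have "... >= 1" using assms(2) by simp
 finally show ?thesis using assms(1) by (simp add: pq_eq_0_iff)
qed

private lemma cutoff_le1: "pq k (1 - (real n)\<^sup>2 * ((gam t - q n) \<bullet> (gam t - q n))) <= 1"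
 by (rule pq_le1) simp

text \<open>An order whose coefficients vanish identically is exempt from the limit hypothesis,
  since its test functions may be exchanged for multiples of the bump (\<open>Z0\<close>,
  \<open>Z1\<close>, \<open>Z2\<close>). This matters for test fields of low order, whose higher
  derivatives grow with \<open>n\<close>.\<close>

lemma test_zero:
 assumes k: "k >= 7"
  and f: "continuous_on {0..1} f0" "!!i::3. continuous_on {0..1} (f1 i)" "!!(l::3) (i::3). continuous_on {0..1} (f2 l i)"
  and int: "!!n. n >= 1 ==> ((%t. f0 t * ts k (real n) (q n) c1 v1 c2 v2 (gam t)
   + (\<Sum>i\<in>UNIV. f1 i t * tsD k (real n) (q n) c1 v1 c2 v2 (axis i 1) (gam t))
   + (\<Sum>l\<in>UNIV. \<Sum>i\<in>UNIV. f2 l i t * tsDD k (real n) (q n) c1 v1 c2 v2 (axis i 1) (axis l 1) (gam t))) has_integral 0) {0..1}"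
  and A0: "(\<forall>t\<in>{0..1}. f0 t = 0) \<or> (\<forall>e>0. \<forall>\<^sub>F n in sequentially. \<forall>t\<in>{0..1}. real n * norm (gam t - q n) <= 1 -->
   \<bar>ts k (real n) (q n) c1 v1 c2 v2 (gam t) - l0 * pq k (1 - (real n)\<^sup>2 * ((gam t - q n) \<bullet> (gam t - q n)))\<bar> <= e)"
  and A1: "(\<forall>i. \<forall>t\<in>{0..1}. f1 i t = 0) \<or> (\<forall>i. \<forall>e>0. \<forall>\<^sub>F n in sequentially. \<forall>t\<in>{0..1}. real n * norm (gam t - q n) <= 1 -->
   \<bar>tsD k (real n) (q n) c1 v1 c2 v2 (axis i 1) (gam t) - l1 i * pq k (1 - (real n)\<^sup>2 * ((gam t - q n) \<bullet> (gam t - q n)))\<bar> <= e)"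
  and A2: "(\<forall>l i. \<forall>t\<in>{0..1}. f2 l i t = 0) \<or> (\<forall>l i. \<forall>e>0. \<forall>\<^sub>F n in sequentially. \<forall>t\<in>{0..1}. real n * norm (gam t - q n) <= 1 -->
   \<bar>tsDD k (real n) (q n) c1 v1 c2 v2 (axis i 1) (axis l 1) (gam t) - l2 l i * pq k (1 - (real n)\<^sup>2 * ((gam t - q n) \<bullet> (gam t - q n)))\<bar> <= e)"
 shows "f0 t0 * l0 + (\<Sum>i\<in>UNIV. f1 i t0 * l1 i) + (\<Sum>l\<in>UNIV. \<Sum>i\<in>UNIV. f2 l i t0 * l2 l i) = 0"
proof -
 \<comment> \<open>A single index set for the terms of order 0, 1 and 2, so that
   \<open>localized_sum_zero\<close> treats them at once.\<close>
 define I :: "((unit + 3) + 3 \<times> 3) set" where "I = {Inl (Inl ())} \<union> (Inl \<circ> Inr) ` (UNIV::3 set) \<union> Inr ` (UNIV :: (3\<times>3) set)"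
 define f where "f = case_sum (case_sum (%_::unit. f0) f1) (%(l, i). f2 l i)"
 define L where "L = case_sum (case_sum (%_::unit. l0) l1) (%(l, i). l2 l i)"
 define b where "b n t = pq k (1 - (real n)\<^sup>2 * ((gam t - q n) \<bullet> (gam t - q n)))" for n t
 define Z0 where "Z0 \<longleftrightarrow> (\<forall>t\<in>{0..1::real}. f0 t = 0)"
 define Z1 where "Z1 \<longleftrightarrow> (\<forall>i. \<forall>t\<in>{0..1::real}. f1 i t = 0)"
 define Z2 where "Z2 \<longleftrightarrow> (\<forall>l i. \<forall>t\<in>{0..1::real}. f2 l i t = 0)"
 define G where "G = case_sum
  (case_sum (%(_::unit) n t. if Z0 then l0 * b n t else ts k (real n) (q n) c1 v1 c2 v2 (gam t))
   (%i n t. if Z1 then l1 i * b n t else tsD k (real n) (q n) c1 v1 c2 v2 (axis i 1) (gam t)))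
  (%(l, i) n t. if Z2 then l2 l i * b n t else tsDD k (real n) (q n) c1 v1 c2 v2 (axis i 1) (axis l 1) (gam t))"
 have sumI: "(\<Sum>j\<in>I. h j) = h (Inl (Inl ())) + (\<Sum>i\<in>UNIV. h (Inl (Inr i))) + (\<Sum>l\<in>UNIV. \<Sum>i\<in>UNIV. h (Inr (l, i)))"
  for h :: "(unit + 3) + 3 \<times> 3 => real"
 proof -
  have "(\<Sum>j\<in>I. h j) = (\<Sum>j\<in>{Inl (Inl ())} \<union> (Inl \<circ> Inr) ` (UNIV::3 set). h j) + (\<Sum>j\<in>Inr ` (UNIV :: (3\<times>3) set). h j)"
   unfolding I_def by (rule sum.union_disjoint) auto
  also have "(\<Sum>j\<in>{Inl (Inl ())} \<union> (Inl \<circ> Inr) ` (UNIV::3 set). h j) = h (Inl (Inl ())) + (\<Sum>i\<in>UNIV. h (Inl (Inr i)))"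
   by (subst sum.union_disjoint) (auto simp: sum.reindex inj_on_def)
  also have "(\<Sum>j\<in>Inr ` (UNIV :: (3\<times>3) set). h j) = (\<Sum>l\<in>UNIV. \<Sum>i\<in>UNIV. h (Inr (l, i)))"
   by (simp add: sum.reindex inj_on_def sum.cartesian_product UNIV_Times_UNIV[symmetric] del: UNIV_Times_UNIV)
  finally show ?thesis .
 qed
 obtain R where R: "R > 0" "!!n t. n >= 1 ==> t \<in> {0..1} ==> \<bar>t - t0\<bar> > R / real n ==> real n * norm (gam t - q n) > 1"
  using curve_supp by blast
 obtain r n0 where r: "r > 0" "n0 >= 1" "!!n t. n >= n0 ==> t \<in> {0..1} ==> \<bar>t - t0\<bar> <= r / real n ==> real n * norm (gam t - q n) <= 1 / 2"
  using curve_inner by blast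
 have ts0: "ts k (real n) (q n) c1 v1 c2 v2 (gam t) = 0"
  "tsD k (real n) (q n) c1 v1 c2 v2 h (gam t) = 0"
  "tsDD k (real n) (q n) c1 v1 c2 v2 h h' (gam t) = 0" "b n t = 0"
  if "real n * norm (gam t - q n) > 1" for n t h h'
  using cutoff_zero[OF _ that] k by (auto simp: ts_def tsD_def tsDD_def b_def)
 have cb: "continuous_on {0..1} (b n)" for n
  unfolding b_def by (intro continuous_on_compose2[OF continuous_on_pq[of UNIV]] continuous_intros cgam) auto
 have "(\<Sum>j\<in>I. f j t0 * L j) = 0"
 proof (rule localized_sum_zero[OF t0 R(1) r(1), where ?c0.0 = "pq k (3 / 4)" and b = b and ?n0.0 = n0 and G = G])
  show "pq k (3 / 4) > 0" using k by (simp add: pq_pos_iff)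
  show "finite I" by (simp add: I_def)
  show "continuous_on {0..1} (f j)" if "j \<in> I" for j
   using that f by (auto simp: I_def f_def)
  show "((%t. \<Sum>j\<in>I. f j t * G j n t) has_integral 0) {0..1}" if n: "n >= n0" for n
  proof (rule has_integral_eq[OF _ int])
   show "f0 t * ts k (real n) (q n) c1 v1 c2 v2 (gam t)
   + (\<Sum>i\<in>UNIV. f1 i t * tsD k (real n) (q n) c1 v1 c2 v2 (axis i 1) (gam t))
   + (\<Sum>l\<in>UNIV. \<Sum>i\<in>UNIV. f2 l i t * tsDD k (real n) (q n) c1 v1 c2 v2 (axis i 1) (axis l 1) (gam t))
   = (\<Sum>j\<in>I. f j t * G j n t)" if "t \<in> {0..1}" for t
   proof -
    have 0: "f0 t * (if Z0 then x else y) = f0 t * y" for x y using that by (auto simp: Z0_def)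
    have 1: "f1 i t * (if Z1 then x else y) = f1 i t * y" for x y i using that by (auto simp: Z1_def)
    have 2: "f2 l i t * (if Z2 then x else y) = f2 l i t * y" for x y l i using that by (auto simp: Z2_def)
    show ?thesis unfolding sumI by (simp add: f_def G_def 0 1 2)
   qed
  qed (use n r in simp)
  show "b n t = 0 & (\<forall>j\<in>I. G j n t = 0)" if "n >= n0" "t \<in> {0..1}" "\<bar>t - t0\<bar> > R / n" for n t
   using ts0[OF R(2)[of n t]] that r(2) by (auto simp: I_def G_def)
  show "0 <= b n t" "b n t <= 1" for n t using cutoff_le1 by (auto simp: b_def)
  show "b n t >= pq k (3 / 4)" if "n >= n0" "t \<in> {0..1}" "\<bar>t - t0\<bar> <= r / n" for n t
  proof -
   have "(real n)\<^sup>2 * ((gam t - q n) \<bullet> (gam t - q n)) = (real n * norm (gam t - q n))\<^sup>2"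
    by (simp add: power_mult_distrib power2_norm_eq_inner)
   also have "... <= (1 / 2)\<^sup>2" using r(3)[OF that] by (intro power_mono) auto
   finally have "3 / 4 <= 1 - (real n)\<^sup>2 * ((gam t - q n) \<bullet> (gam t - q n))" by (simp add: power2_eq_square)
   thus ?thesis unfolding b_def pq_def by (intro power_mono) auto
  qed
  show "\<forall>\<^sub>F n in sequentially. \<forall>t\<in>{0..1}. \<bar>G j n t - L j * b n t\<bar> <= e" if j: "j \<in> I" and e: "e > 0" for j e
  proof -
   have "\<forall>\<^sub>F n in sequentially. \<forall>t\<in>{0..1}. real n * norm (gam t - q n) <= 1 --> \<bar>G j n t - L j * b n t\<bar> <= e"
    using j A0 A1 A2 e
    by (auto simp: I_def G_def L_def b_def Z0_def[symmetric] Z1_def[symmetric] Z2_def[symmetric])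
   thus ?thesis
   proof eventually_elim
    case (elim n)
    show ?case
    proof
     fix t :: real assume t: "t \<in> {0..1}"
     show "\<bar>G j n t - L j * b n t\<bar> <= e"
     proof (cases "real n * norm (gam t - q n) <= 1")
      case False
      hence "real n * norm (gam t - q n) > 1" by simp
      note z = ts0[OF this]
      have "G j n t = 0" using j by (auto simp: I_def G_def z)
      thus ?thesis using z(4) e by simp
     qed (use elim t in blast)
    qed
   qed
  qed
 qed (use cb in auto)
 thus ?thesis unfolding sumI f_def L_def by simp
qed

lemma test_second_order:
 assumes k: "k >= 7" and v: "v1 \<bullet> D = 0" "v2 \<bullet> D = 0"
  and f: "continuous_on {0..1} f0" "!!i::3. continuous_on {0..1} (f1 i)" "!!(l::3) (i::3). continuous_on {0..1} (f2 l i)"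
  and int: "!!n. n >= 1 ==> ((%t. f0 t * ts k (real n) (q n) 0 v1 0 v2 (gam t)
   + (\<Sum>i\<in>UNIV. f1 i t * tsD k (real n) (q n) 0 v1 0 v2 (axis i 1) (gam t))
   + (\<Sum>l\<in>UNIV. \<Sum>i\<in>UNIV. f2 l i t * tsDD k (real n) (q n) 0 v1 0 v2 (axis i 1) (axis l 1) (gam t))) has_integral 0) {0..1}"
 shows "(\<Sum>l\<in>UNIV. \<Sum>i\<in>UNIV. f2 l i t0 * (v1 $ i * v2 $ l + v1 $ l * v2 $ i)) = 0"
proof -
 define s where "s = max (norm v1) (norm v2)"
 define M where "M = 1 + (real k * k + k * (1 + 2 * s) + k * (2 * s)) + (k + 2 * s)"
 have s0: "s >= 0" unfolding s_def by (rule order_trans[OF norm_ge_zero max.cobounded1])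
 have M: "M >= 1" "k + 2 * s <= M" "real k * k + k * (1 + 2 * s) + k * (2 * s) <= M"
  using s0 by (auto simp: M_def intro!: add_nonneg_nonneg mult_nonneg_nonneg)
 have ev: "\<forall>\<^sub>F n in sequentially. \<forall>t\<in>{0..1}. real n * norm (gam t - q n) <= 1 -->
   \<bar>ts k n (q n) 0 v1 0 v2 (gam t)\<bar> <= e & (\<forall>i. \<bar>tsD k n (q n) 0 v1 0 v2 (axis i 1) (gam t)\<bar> <= e) &
   (\<forall>l i. \<bar>tsDD k n (q n) 0 v1 0 v2 (axis i 1) (axis l 1) (gam t)
    - (v1 $ i * v2 $ l + v1 $ l * v2 $ i) * pq k (1 - (real n)\<^sup>2 * ((gam t - q n) \<bullet> (gam t - q n)))\<bar> <= e)"
  if e: "e > 0" for e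
 proof -
  define e' where "e' = min 1 (e / M)"
  have e': "e' > 0" "e' <= 1" "M * e' <= e" using e M by (auto simp: e'_def min_def field_simps)
  have le: "c * e' <= e" if "c <= M" for c using that e' mult_right_mono[OF that, of e'] by linarith
  show ?thesis
   using curve_perp[OF v(1) e'(1)] curve_perp[OF v(2) e'(1)] eventually_ge_at_top[of 1]
  proof eventually_elim
   case (elim n)
   show ?case
   proof (intro ballI impI)
    fix t :: real assume t: "t \<in> {0..1}" and y: "real n * norm (gam t - q n) <= 1"
    have n: "real n >= 1" using elim by simp
    have ax: "norm (axis i 1 :: R3) <= 1" for i by simp
    have vv: "\<bar>n * (v1 \<bullet> (gam t - q n))\<bar> <= e'" "\<bar>n * (v2 \<bullet> (gam t - q n))\<bar> <= e'"
     using elim t y by auto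
    have ss: "norm v1 <= s" "norm v2 <= s" by (auto simp: s_def)
    note B = ts_bounds[OF k n y ax ax vv e'(2) ss]
    show "\<bar>ts k n (q n) 0 v1 0 v2 (gam t)\<bar> <= e & (\<forall>i. \<bar>tsD k n (q n) 0 v1 0 v2 (axis i 1) (gam t)\<bar> <= e) &
     (\<forall>l i. \<bar>tsDD k n (q n) 0 v1 0 v2 (axis i 1) (axis l 1) (gam t)
      - (v1 $ i * v2 $ l + v1 $ l * v2 $ i) * pq k (1 - (real n)\<^sup>2 * ((gam t - q n) \<bullet> (gam t - q n)))\<bar> <= e)"
     using B(1) le[OF M(1)] order_trans[OF B(2) le[OF M(2)]] order_trans[OF B(3) le[OF M(3)]]
     by (auto simp: inner_axis)
   qed
  qed
 qed
 let ?c = "%n t. pq k (1 - (real n)\<^sup>2 * ((gam t - q n) \<bullet> (gam t - q n)))"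
 have A0: "\<forall>e>0. \<forall>\<^sub>F n in sequentially. \<forall>t\<in>{0..1}. real n * norm (gam t - q n) <= 1 -->
   \<bar>ts k (real n) (q n) 0 v1 0 v2 (gam t) - 0 * ?c n t\<bar> <= e"
  by (intro allI impI) (rule eventually_mono[OF ev]; auto)
 have A1: "\<forall>i. \<forall>e>0. \<forall>\<^sub>F n in sequentially. \<forall>t\<in>{0..1}. real n * norm (gam t - q n) <= 1 -->
   \<bar>tsD k (real n) (q n) 0 v1 0 v2 (axis i 1) (gam t) - 0 * ?c n t\<bar> <= e"
  by (intro allI impI) (rule eventually_mono[OF ev]; auto)
 have A2: "\<forall>l i. \<forall>e>0. \<forall>\<^sub>F n in sequentially. \<forall>t\<in>{0..1}. real n * norm (gam t - q n) <= 1 -->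
   \<bar>tsDD k (real n) (q n) 0 v1 0 v2 (axis i 1) (axis l 1) (gam t)
    - (v1 $ i * v2 $ l + v1 $ l * v2 $ i) * ?c n t\<bar> <= e"
  by (intro allI impI) (rule eventually_mono[OF ev]; auto)
 show ?thesis
  using test_zero[OF k f int disjI2[OF A0] disjI2[OF A1] disjI2[OF A2]] by simp
qed

lemma test_first_order:
 assumes k: "k >= 7" and v: "v \<bullet> D = 0"
  and f: "continuous_on {0..1} f0" "!!i::3. continuous_on {0..1} (f1 i)"
  and int: "!!n. n >= 1 ==> ((%t. f0 t * ts k (real n) (q n) 0 v 1 0 (gam t)
   + (\<Sum>i\<in>UNIV. f1 i t * tsD k (real n) (q n) 0 v 1 0 (axis i 1) (gam t))) has_integral 0) {0..1}"
 shows "(\<Sum>i\<in>UNIV. f1 i t0 * v $ i) = 0"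
proof -
 have ev: "\<forall>\<^sub>F n in sequentially. \<forall>t\<in>{0..1}. real n * norm (gam t - q n) <= 1 -->
   \<bar>ts k n (q n) 0 v 1 0 (gam t)\<bar> <= e &
   (\<forall>i. \<bar>tsD k n (q n) 0 v 1 0 (axis i 1) (gam t) - v $ i * pq k (1 - (real n)\<^sup>2 * ((gam t - q n) \<bullet> (gam t - q n)))\<bar> <= e)"
  if e: "e > 0" for e
 proof -
  have e': "e / k > 0" using e k by simp
  have le: "e / k <= e" using e k by (simp add: field_simps)
  show ?thesis
   using curve_perp[OF v e'] eventually_ge_at_top[of 1]
  proof eventually_elim
   case (elim n)
   show ?case
   proof (intro ballI impI)
    fix t :: real assume t: "t \<in> {0..1}" and y: "real n * norm (gam t - q n) <= 1"
    have n: "real n >= 1" using elim by simp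
    have ax: "norm (axis i 1 :: R3) <= 1" for i by simp
    have vv: "\<bar>n * (v \<bullet> (gam t - q n))\<bar> <= e / k" using elim t y by auto
    note B = ts_bounds1[OF k n y ax vv]
    show "\<bar>ts k n (q n) 0 v 1 0 (gam t)\<bar> <= e &
     (\<forall>i. \<bar>tsD k n (q n) 0 v 1 0 (axis i 1) (gam t) - v $ i * pq k (1 - (real n)\<^sup>2 * ((gam t - q n) \<bullet> (gam t - q n)))\<bar> <= e)"
     using B(1) le B(2) k by (auto simp: inner_axis)
   qed
  qed
 qed
 let ?c = "%n t. pq k (1 - (real n)\<^sup>2 * ((gam t - q n) \<bullet> (gam t - q n)))"
 have A0: "\<forall>e>0. \<forall>\<^sub>F n in sequentially. \<forall>t\<in>{0..1}. real n * norm (gam t - q n) <= 1 -->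
   \<bar>ts k (real n) (q n) 0 v 1 0 (gam t) - 0 * ?c n t\<bar> <= e"
  by (intro allI impI) (rule eventually_mono[OF ev]; auto)
 have A1: "\<forall>i. \<forall>e>0. \<forall>\<^sub>F n in sequentially. \<forall>t\<in>{0..1}. real n * norm (gam t - q n) <= 1 -->
   \<bar>tsD k (real n) (q n) 0 v 1 0 (axis i 1) (gam t) - v $ i * ?c n t\<bar> <= e"
  by (intro allI impI) (rule eventually_mono[OF ev]; auto)
 have A2: "\<forall>(l::3) (i::3). \<forall>t\<in>{0..1::real}. (%_ _ _. 0) l i t = (0::real)" by simp
 have int': "((%t. f0 t * ts k (real n) (q n) 0 v 1 0 (gam t)
   + (\<Sum>i\<in>UNIV. f1 i t * tsD k (real n) (q n) 0 v 1 0 (axis i 1) (gam t))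
   + (\<Sum>l\<in>UNIV. \<Sum>i\<in>UNIV. (%_ _ _. 0) (l::3) (i::3) t * tsDD k (real n) (q n) 0 v 1 0 (axis i 1) (axis l 1) (gam t)))
   has_integral 0) {0..1}" if "n >= 1" for n
  using int[OF that] by simp
 show ?thesis
  using test_zero[OF k f _ int' disjI2[OF A0] disjI2[OF A1] disjI1[OF A2]] by simp
qed

lemma test_zeroth_order:
 assumes k: "k >= 7" and f: "continuous_on {0..1} f0"
  and int: "!!n. n >= 1 ==> ((%t. f0 t * ts k (real n) (q n) 1 0 1 0 (gam t)) has_integral 0) {0..1}"
 shows "f0 t0 = 0"
proof -
 have "f0 t0 * 1 + (\<Sum>i\<in>UNIV. (%_ _. 0) (i::3) t0 * 0) + (\<Sum>l\<in>UNIV. \<Sum>i\<in>UNIV. (%_ _ _. 0) (l::3) (i::3) t0 * 0) = 0"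
  by (rule test_zero[OF k f, where ?v1.0 = 0 and ?v2.0 = 0 and ?c1.0 = 1 and ?c2.0 = 1])
   (use int in \<open>auto simp: ts_def\<close>)
 thus ?thesis by simp
qed

end

section \<open>Covectors that annihilate all localized variations\<close>

definition jt :: "(R3 => R3) => (R3 => R3) => R3 => jet" where
 "jt w V x = (w x, V x, jac V x)"

text \<open>The variation of the jet caused by adding \<open>v\<close> to the field. The first
  component is 0 because the orienting field \<open>w\<close> is kept.\<close>

definition jv :: "(R3 => R3) => R3 => jet" where
 "jv v x = (0, v x, jac v x)"

definition mvv :: "real^3^3^3 => R3 => real^3^3" where
 "mvv C h = (\<Sum>k\<in>UNIV. h $ k *\<^sub>R C $ k)"

definition jvD :: "(R3 => R3) => R3 => R3 => jet" where
 "jvD v x h = (0, mv (jac v x) h, mvv (jac (jac v) x) h)"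

text \<open>The fibre part of the tangent map of \<open>YJ\<close>. Its derivative
  \<open>DTJ\<close> therefore contains the second derivative of \<open>YJ\<close>, which governs
  how a variation acts on the linearised flow.\<close>

definition TJ :: "real => jet \<times> jet => R3" where
 "TJ sg p = DYJ sg (fst p) (snd p)"

abbreviation DTJ :: "real => jet \<times> jet => jet \<times> jet => R3" where
 "DTJ sg p \<equiv> FD (TJ sg) p"

lemma Ck_TJ: "n <= 1 ==> Ck n (%_. TJ sg)"
 unfolding TJ_def by (rule Ck_directional[of n "%_. YJ sg" "%_. fst" "%_. snd"])
  (auto intro!: Ck_YJ Ck_fst Ck_snd Ck_id simp del: Ck.simps)

lemma TJ_has_derivative: "(TJ sg has_derivative DTJ sg p) (at p)"
 using Ck_has_derivative[of 0 "%_::real. TJ sg"] Ck_TJ[of 1 sg] by (simp del: Ck.simps)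

lemma linear_DTJ: "linear (DTJ sg p)"
 using TJ_has_derivative has_derivative_linear by blast

lemma DTJ_snd: "DTJ sg (a, b) (0, k) = DYJ sg a k"
proof -
 have "((%c. TJ sg (a, c)) has_derivative (%k. DTJ sg (a, b) (0, k))) (at b)"
  by (rule has_derivative_compose[of "%c. (a, c)", OF _ TJ_has_derivative]) (auto intro!: derivative_eq_intros)
 moreover have "((%c. TJ sg (a, c)) has_derivative (%k. DYJ sg a k)) (at b)"
  unfolding TJ_def by (simp add: linear_imp_has_derivative linear_DYJ linear_conv_bounded_linear[THEN iffD1] bounded_linear_imp_has_derivative)
 ultimately show ?thesis using has_derivative_unique by metis
qed

lemma DTJ_split: "DTJ sg (a, b) (l, k) = DTJ sg (a, b) (l, 0) + DYJ sg a k"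
proof -
 have "DTJ sg (a, b) ((l, 0) + (0, k)) = DTJ sg (a, b) (l, 0) + DTJ sg (a, b) (0, k)"
  by (rule linear_add[OF linear_DTJ])
 thus ?thesis by (simp add: DTJ_snd)
qed

lemma vec_sum_axis: "(\<chi> i. c i *\<^sub>R (e::'a::real_vector)) = (\<Sum>i\<in>UNIV. c i *\<^sub>R axis i e)"
 by (simp add: vec_eq_iff axis_def if_distrib cong: if_cong)

lemma outer_sum: "outer e v = (\<Sum>i\<in>UNIV. v $ i *\<^sub>R axis i e)"
 unfolding outer_def by (rule vec_sum_axis)

text \<open>The operator that sums the tensor products of the rows of \<open>N\<close> and
  \<open>n\<close>. The rows of \<open>N\<close> will solve the linearised equation and those of
  \<open>n\<close> its adjoint, so this operator is transported along the orbit by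
  conjugation.\<close>

definition Wop :: "(real => real^3^3) => (real => real^3^3) => real => R3 => R3" where
 "Wop N n t z = (\<Sum>r\<in>UNIV. (n t $ r \<bullet> z) *\<^sub>R N t $ r)"

context
 fixes k :: nat assumes k: "k >= 7"
begin

lemma jv_tfield:
 "jv (tfield k n q c1 v1 c2 v2 e) x =
  ts k n q c1 v1 c2 v2 x *\<^sub>R (0, e, 0) + (\<Sum>i\<in>UNIV. tsD k n q c1 v1 c2 v2 (axis i 1) x *\<^sub>R (0, 0, axis i e))"
proof -
 have "(\<Sum>i\<in>UNIV. tsD k n q c1 v1 c2 v2 (axis i 1) x *\<^sub>R (0, 0, axis i e)) =
  (0::R3, 0::R3, \<Sum>i\<in>UNIV. tsD k n q c1 v1 c2 v2 (axis i 1) x *\<^sub>R axis i e)"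
  by (simp add: prod_eq_iff fst_sum snd_sum)
 thus ?thesis using k
  by (simp add: jv_def jac_tfield vec_sum_axis) (simp add: tfield_def)
qed

lemma jvD_tfield:
 "jvD (tfield k n q c1 v1 c2 v2 e) x h =
  (\<Sum>i\<in>UNIV. tsD k n q c1 v1 c2 v2 (axis i 1) x *\<^sub>R (h $ i *\<^sub>R (0, e, 0)))
  + (\<Sum>l\<in>UNIV. \<Sum>i\<in>UNIV. tsDD k n q c1 v1 c2 v2 (axis i 1) (axis l 1) x *\<^sub>R (h $ l *\<^sub>R (0, 0, axis i e)))"
proof -
 let ?v = "tfield k n q c1 v1 c2 v2 e"
 have "mv (jac ?v x) h = (\<Sum>i\<in>UNIV. tsD k n q c1 v1 c2 v2 (axis i 1) x *\<^sub>R (h $ i *\<^sub>R e))"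
  using k by (simp add: mv_def jac_tfield mult.commute)
 moreover have "mvv (jac (jac ?v) x) h = (\<Sum>l\<in>UNIV. \<Sum>i\<in>UNIV. tsDD k n q c1 v1 c2 v2 (axis i 1) (axis l 1) x *\<^sub>R (h $ l *\<^sub>R axis i e))"
  using k by (simp add: mvv_def jac_jac_tfield vec_sum_axis scaleR_sum_right mult.commute)
 ultimately show ?thesis
  by (simp add: jvD_def prod_eq_iff fst_sum snd_sum)
qed

context
 fixes sg tau :: real and w V :: "R3 => R3" and gam :: "real => R3" and N m n QS
 assumes sg: "sg = 1 \<or> sg = -1" and w: "Ck 3 (%_::real. w)" and V: "Ck 3 (%_::real. V)"
  and tau: "tau > 0"
  and gam: "!!t. t \<in> {0..1} ==> (gam has_vector_derivative tau *\<^sub>R YJ sg (jt w V (gam t))) (at t within {0..1})"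
  and N: "continuous_on {0..1} (N :: real => real^3^3)"
  and m: "continuous_on {0..1} (m :: real => R3)"
  and n: "continuous_on {0..1} (n :: real => real^3^3)"
  and Y0: "!!t. t \<in> {0..1} ==> YJ sg (jt w V (gam t)) ~= 0"
  and V0: "!!x. V x ~= 0"
  and inj: "!!t s. t \<in> {0<..<1} ==> s \<in> {0..1} ==> gam s = gam t ==> s = t"
  and dense: "!!p e. e > 0 ==> \<exists>q\<in>QS. norm (q - p :: R3) <= e"
  and fn: "!!i q c1 v1 c2 v2 e. i >= 1 ==> q \<in> QS ==>
   ((%t. m t \<bullet> DYJ sg (jt w V (gam t)) (jv (tfield k (real i) q c1 v1 c2 v2 e) (gam t))
    + (\<Sum>r\<in>UNIV. n t $ r \<bullet> DTJ sg (jt w V (gam t), FD (jt w V) (gam t) (N t $ r))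
      (jv (tfield k (real i) q c1 v1 c2 v2 e) (gam t), jvD (tfield k (real i) q c1 v1 c2 v2 e) (gam t) (N t $ r))))
   has_integral 0) {0..1}"
begin

private abbreviation "jj \<equiv> jt w V"
private abbreviation "YY' x \<equiv> YJ sg (jt w V x)"

lemma Ck_jac: "Ck (Suc i) (%_::real. f) ==> Ck i (%_::real. jac f)" for f :: "R3 => R3"
 unfolding jac_def by (rule Ck_vec) (simp add: axis_in_Basis_iff)

lemma Ck_jt: "Ck 2 (%_::real. jj)"
 unfolding jt_def using Ck_jac[of 2 V] V Ck_mono[OF w, of 2] Ck_mono[OF V, of 2]
 by (intro Ck_Pair) (auto simp: eval_nat_numeral simp del: Ck.simps)

private lemma cgam: "continuous_on {0..1} gam"
 using gam by (intro continuous_on_vector_derivative)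

private lemma cj: "continuous_on {0..1} (%t. jj (gam t))"
 by (rule continuous_on_compose2[OF Ck_continuous_arg[OF Ck_jt, of UNIV] cgam]) auto

private lemma cN: "continuous_on {0..1} (%t. N t $ r)"
 by (intro continuous_on_vec_lambda continuous_intros N)

private lemma cDY: "continuous_on {0..1} (%t. DYJ sg (jj (gam t)) h)"
proof -
 have "Ck 0 (%(_::real) i. DYJ sg i h)"
  using Ck_directional[of 0 "%_. YJ sg" "%(_::real) i. i" "%_ _. h"] Ck_YJ[of 1 sg] by (simp del: Ck.simps)
 from continuous_on_compose2[OF Ck_continuous_arg[OF this, of UNIV] cj] show ?thesis by simp
qed

private lemma cDj: "continuous_on {0..1} (%t. FD jj (gam t) (N t $ r))"
proof -
 have "Ck 0 (%(_::real) p. FD jj (fst p) (snd p))"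
  using Ck_directional[of 0 "%_::real. jj" "%(_::real). fst" "%_. snd"] Ck_mono[OF Ck_jt, of 1]
  by (simp add: Ck_fst Ck_snd del: Ck.simps)
 from continuous_on_compose2[OF Ck_continuous_arg[OF this, of UNIV], of "{0..1}" "%t. (gam t, N t $ r)"]
 show ?thesis using cgam cN by (simp add: continuous_on_Pair)
qed

private lemma cDT: "continuous_on {0..1} (%t. DTJ sg (jj (gam t), FD jj (gam t) (N t $ r)) h)"
proof -
 have "Ck 0 (%(_::real) i. DTJ sg i h)"
  using Ck_directional[of 0 "%_. TJ sg" "%(_::real) i. i" "%_ _. h"] Ck_TJ[of 1 sg] by (simp del: Ck.simps)
 from continuous_on_compose2[OF Ck_continuous_arg[OF this, of UNIV], of "{0..1}"
  "%t. (jj (gam t), FD jj (gam t) (N t $ r))"]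
 show ?thesis using cj cDj by (simp add: continuous_on_Pair)
qed

private definition f0 where "f0 e t = m t \<bullet> DYJ sg (jj (gam t)) (0, e, 0)
 + (\<Sum>r\<in>UNIV. n t $ r \<bullet> DTJ sg (jj (gam t), FD jj (gam t) (N t $ r)) ((0, e, 0), 0))"
private definition f1 where "f1 e i t = m t \<bullet> DYJ sg (jj (gam t)) (0, 0, axis i e)
 + (\<Sum>r\<in>UNIV. n t $ r \<bullet> DTJ sg (jj (gam t), FD jj (gam t) (N t $ r)) ((0, 0, axis i e), 0)
   + n t $ r \<bullet> (N t $ r $ i *\<^sub>R DYJ sg (jj (gam t)) (0, e, 0)))"
private definition f2 where "f2 e l i t = (\<Sum>r\<in>UNIV. n t $ r \<bullet> (N t $ r $ l *\<^sub>R DYJ sg (jj (gam t)) (0, 0, axis i e)))"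

private lemma cf: "continuous_on {0..1} (f0 e)" "continuous_on {0..1} (f1 e i)" "continuous_on {0..1} (f2 e l i)"
 unfolding f0_def f1_def f2_def by (intro continuous_intros cDY cDT m n N)+

private lemma expand:
 "m t \<bullet> DYJ sg (jj (gam t)) (jv (tfield k a q c1 v1 c2 v2 e) (gam t))
  + (\<Sum>r\<in>UNIV. n t $ r \<bullet> DTJ sg (jj (gam t), FD jj (gam t) (N t $ r))
    (jv (tfield k a q c1 v1 c2 v2 e) (gam t), jvD (tfield k a q c1 v1 c2 v2 e) (gam t) (N t $ r)))
 = f0 e t * ts k a q c1 v1 c2 v2 (gam t)
   + (\<Sum>i\<in>UNIV. f1 e i t * tsD k a q c1 v1 c2 v2 (axis i 1) (gam t))
   + (\<Sum>l\<in>UNIV. \<Sum>i\<in>UNIV. f2 e l i t * tsDD k a q c1 v1 c2 v2 (axis i 1) (axis l 1) (gam t))"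
proof -
 let ?s = "ts k a q c1 v1 c2 v2 (gam t)" and ?d = "%i. tsD k a q c1 v1 c2 v2 (axis i 1) (gam t)"
  and ?dd = "%i l. tsDD k a q c1 v1 c2 v2 (axis i 1) (axis l 1) (gam t)"
 let ?L = "DYJ sg (jj (gam t))" and ?J = "jv (tfield k a q c1 v1 c2 v2 e) (gam t)"
 have L: "?L ?J = ?s *\<^sub>R ?L (0, e, 0) + (\<Sum>i\<in>UNIV. ?d i *\<^sub>R ?L (0, 0, axis i e))"
  unfolding jv_tfield by (simp only: linear_add[OF linear_DYJ] linear_sum[OF linear_DYJ] linear_scale[OF linear_DYJ])
 have L2: "?L (jvD (tfield k a q c1 v1 c2 v2 e) (gam t) h) =
   (\<Sum>i\<in>UNIV. ?d i *\<^sub>R (h $ i *\<^sub>R ?L (0, e, 0))) + (\<Sum>l\<in>UNIV. \<Sum>i\<in>UNIV. ?dd i l *\<^sub>R (h $ l *\<^sub>R ?L (0, 0, axis i e)))" for h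
  unfolding jvD_tfield by (simp only: linear_add[OF linear_DYJ] linear_sum[OF linear_DYJ] linear_scale[OF linear_DYJ])
 have T: "DTJ sg (a, b) (?J, c) = ?s *\<^sub>R DTJ sg (a, b) ((0, e, 0), 0) + (\<Sum>i\<in>UNIV. ?d i *\<^sub>R DTJ sg (a, b) ((0, 0, axis i e), 0)) + DYJ sg a c" for a b c
 proof -
  have "(?J, 0) = ?s *\<^sub>R ((0, e, 0), 0::jet) + (\<Sum>i\<in>UNIV. ?d i *\<^sub>R ((0, 0, axis i e), 0))"
   unfolding jv_tfield by (simp add: prod_eq_iff fst_sum snd_sum)
  hence "DTJ sg (a, b) (?J, 0) = ?s *\<^sub>R DTJ sg (a, b) ((0, e, 0), 0) + (\<Sum>i\<in>UNIV. ?d i *\<^sub>R DTJ sg (a, b) ((0, 0, axis i e), 0))"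
   by (simp only: linear_add[OF linear_DTJ] linear_sum[OF linear_DTJ] linear_scale[OF linear_DTJ])
  thus ?thesis using DTJ_split by metis
 qed
 show ?thesis
  unfolding L T L2 f0_def f1_def f2_def sum_3
  by (simp add: inner_add_right inner_sum_right algebra_simps)
qed

private lemma test_seq:
 obtains q where "!!i. q i \<in> QS" "!!i. i >= 1 ==> norm (q i - p) <= 1 / (real i)\<^sup>2"
proof -
 have "\<exists>q\<in>QS. norm (q - p) <= 1 / (real (max 1 i))\<^sup>2" for i by (rule dense) auto
 then obtain q where q: "!!i. q i \<in> QS & norm (q i - p) <= 1 / (real (max 1 i))\<^sup>2" by metis
 show ?thesis
 proof (rule that[of q])
  show "norm (q i - p) <= 1 / (real i)\<^sup>2" if "i >= 1" for i using q[of i] that by (simp add: max_def)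
 qed (use q in blast)
qed

private lemma curve_facts:
 assumes "t \<in> {0<..<1}"
 shows "(gam has_vector_derivative tau *\<^sub>R YY' (gam t)) (at t within {0..1})" "tau *\<^sub>R YY' (gam t) ~= 0"
  "!!s. s \<in> {0..1} ==> gam s = gam t ==> s = t"
 using gam[of t] Y0[of t] inj[OF assms] tau assms by auto

text \<open>The condition is symmetric in \<open>v1\<close> and \<open>v2\<close> because a test
  field with these two linear factors has a symmetric second derivative. No test reaches the two
  summands separately.\<close>

lemma W_test:
 assumes t: "t \<in> {0<..<1}" and v: "v1 \<bullet> YY' (gam t) = 0" "v2 \<bullet> YY' (gam t) = 0"
 shows "v2 \<bullet> Wop N n t (DYJ sg (jj (gam t)) (0, 0, outer e v1)) + v1 \<bullet> Wop N n t (DYJ sg (jj (gam t)) (0, 0, outer e v2)) = 0"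
proof -
 obtain q where q: "!!i. q i \<in> QS" "!!i. i >= 1 ==> norm (q i - gam t) <= 1 / (real i)\<^sup>2"
  using test_seq by blast
 have "(\<Sum>l\<in>UNIV. \<Sum>i\<in>UNIV. f2 e l i t * (v1 $ i * v2 $ l + v1 $ l * v2 $ i)) = 0"
  by (rule test_second_order[OF cgam t curve_facts[OF t] q(2) k _ _ cf])
   (use v fn[OF _ q(1)] in \<open>auto simp: expand\<close>)
 moreover have K: "DYJ sg (jj (gam t)) (0, 0, outer e v) = (\<Sum>i\<in>UNIV. v $ i *\<^sub>R DYJ sg (jj (gam t)) (0, 0, axis i e))" for v
 proof -
  have "(0, 0, outer e v) = (\<Sum>i\<in>UNIV. v $ i *\<^sub>R (0::R3, 0::R3, axis i e))"
   by (simp add: outer_sum prod_eq_iff fst_sum snd_sum)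
  thus ?thesis by (simp only: linear_sum[OF linear_DYJ] linear_scale[OF linear_DYJ])
 qed
 ultimately show ?thesis
  unfolding K Wop_def f2_def inner_vec_def[of v1] inner_vec_def[of v2]
  by (simp add: sum_3 inner_add_right algebra_simps)
qed

lemma m_test_first:
 assumes n0: "!!s. s \<in> {0..1} ==> n s = 0" and t: "t \<in> {0<..<1}" and v: "v \<bullet> YY' (gam t) = 0"
 shows "m t \<bullet> DYJ sg (jj (gam t)) (0, 0, outer e v) = 0"
proof -
 obtain q where q: "!!i. q i \<in> QS" "!!i. i >= 1 ==> norm (q i - gam t) <= 1 / (real i)\<^sup>2"
  using test_seq by blast
 have int: "((%s. f0 e s * ts k (real i) (q i) 0 v 1 0 (gam s)
   + (\<Sum>l\<in>UNIV. f1 e l s * tsD k (real i) (q i) 0 v 1 0 (axis l 1) (gam s))) has_integral 0) {0..1}" if "i >= 1" for i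
  by (rule has_integral_eq[OF _ fn[OF that q(1)[of i], of 0 v 1 0 e]]) (simp add: expand, simp add: f2_def n0)
 have "(\<Sum>i\<in>UNIV. f1 e i t * v $ i) = 0"
  by (rule test_first_order[OF cgam t curve_facts[OF t] q(2) k _ cf(1,2) int]) (use v in auto)
 moreover have "(0, 0, outer e v) = (\<Sum>i\<in>UNIV. v $ i *\<^sub>R (0::R3, 0::R3, axis i e))"
  by (simp add: outer_sum prod_eq_iff fst_sum snd_sum)
 hence "DYJ sg (jj (gam t)) (0, 0, outer e v) = (\<Sum>i\<in>UNIV. v $ i *\<^sub>R DYJ sg (jj (gam t)) (0, 0, axis i e))"
  by (simp only: linear_sum[OF linear_DYJ] linear_scale[OF linear_DYJ])
 ultimately show ?thesis
  using n0[of t] t by (simp add: f1_def inner_sum_right mult.commute)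
qed

lemma m_test_zeroth:
 assumes n0: "!!s. s \<in> {0..1} ==> n s = 0" and t: "t \<in> {0<..<1}"
  and z: "!!s i. s \<in> {0..1} ==> m s \<bullet> DYJ sg (jj (gam s)) (0, 0, axis i e) = 0"
 shows "m t \<bullet> DYJ sg (jj (gam t)) (0, e, 0) = 0"
proof -
 obtain q where q: "!!i. q i \<in> QS" "!!i. i >= 1 ==> norm (q i - gam t) <= 1 / (real i)\<^sup>2"
  using test_seq by blast
 have int: "((%s. f0 e s * ts k (real i) (q i) 1 0 1 0 (gam s)) has_integral 0) {0..1}" if "i >= 1" for i
  by (rule has_integral_eq[OF _ fn[OF that q(1)[of i], of 1 0 1 0 e]]) (simp add: expand, simp add: f1_def f2_def n0 z)
 have "f0 e t = 0"
  by (rule test_zeroth_order[OF cgam t curve_facts[OF t] q(2) k cf(1) int])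
 thus ?thesis using n0[of t] t by (simp add: f0_def)
qed

private lemma facts:
 assumes "t \<in> {0..1}"
 defines "j \<equiv> jj (gam t)" and "Y \<equiv> YY' (gam t)" and "Z \<equiv> cross3 (V (gam t)) (YY' (gam t))"
 shows "V (gam t) \<bullet> Y = 0" "Z \<bullet> Y = 0" "V (gam t) \<bullet> Z = 0" "Y ~= 0"
  "!!a e T. V (gam t) \<bullet> DYJ sg j (a, e, T) = - (e \<bullet> Y)"
  "\<exists>g k. DYJ sg j (0, 0, outer Y Z) = g *\<^sub>R Y + k *\<^sub>R Z & k ~= 0"
  "\<exists>g. DYJ sg j (0, 0, outer Y (V (gam t))) = g *\<^sub>R Y"
proof -
 have jd: "j = (w (gam t), V (gam t), jac V (gam t))" by (simp add: j_def jt_def)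
 have Yd: "Y = YJ sg j" by (simp add: Y_def j_def)
 show Y: "Y ~= 0" using Y0[OF assms(1)] by (simp add: Y_def)
 show "V (gam t) \<bullet> Y = 0" using YJ_perp[OF sg, of j] by (simp add: jd Yd)
 show "Z \<bullet> Y = 0" "V (gam t) \<bullet> Z = 0" by (auto simp: Z_def Y_def dot_cross_self)
 have Zd: "Z = cross3 (V (gam t)) Y" by (simp add: Z_def Y_def)
 show "V (gam t) \<bullet> DYJ sg j (a, e, T) = - (e \<bullet> Y)" for a e T
  by (rule DYJ_perp[OF sg V0 jd Yd Y Zd])
 show "\<exists>g k. DYJ sg j (0, 0, outer Y Z) = g *\<^sub>R Y + k *\<^sub>R Z & k ~= 0"
  using DYJ_outer_Z[OF sg V0 jd Yd Y Zd] by metis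
 show "\<exists>g. DYJ sg j (0, 0, outer Y (V (gam t))) = g *\<^sub>R Y"
  using DYJ_outer_V[OF sg V0 jd Yd Y Zd] by metis
qed

text \<open>First-order tests remove the component of \<open>m\<close> along \<open>Z\<close>; with
  \<open>mY\<close> this leaves \<open>m\<close> parallel to \<open>V\<close>. Variations of the
  derivative alone move the field orthogonally to \<open>V\<close>, so the first-order coefficients
  now vanish and a zeroth-order test is admissible. Taken in direction of the field itself, it
  removes the component along \<open>V\<close>.\<close>

lemma m_zero:
 assumes n0: "!!s. s \<in> {0..1} ==> n s = 0" and mY: "!!s. s \<in> {0..1} ==> m s \<bullet> YY' (gam s) = 0"
  and t: "t \<in> {0<..<1}"
 shows "m t = 0"
proof -
 have par: "m s = (m s \<bullet> V (gam s) / (V (gam s) \<bullet> V (gam s))) *\<^sub>R V (gam s)" if s: "s \<in> {0<..<1}" for s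
 proof -
  have s': "s \<in> {0..1}" using s by auto
  let ?Y = "YY' (gam s)" and ?Z = "cross3 (V (gam s)) (YY' (gam s))"
  note F = facts[OF s']
  obtain g k where gk: "DYJ sg (jj (gam s)) (0, 0, outer ?Y ?Z) = g *\<^sub>R ?Y + k *\<^sub>R ?Z" "k ~= 0" using F(6) by blast
  have "m s \<bullet> DYJ sg (jj (gam s)) (0, 0, outer ?Y ?Z) = 0"
   by (rule m_test_first[OF n0 s F(2)])
  hence mZ: "m s \<bullet> ?Z = 0" using gk mY[OF s'] by (simp add: inner_add_right)
  define R where "R = m s - (m s \<bullet> V (gam s) / (V (gam s) \<bullet> V (gam s))) *\<^sub>R V (gam s)"
  have "V (gam s) \<bullet> R = 0" using V0[of "gam s"] by (simp add: R_def inner_diff_right inner_commute)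
  from perp_decomp[OF V0 F(4) F(1) this]
  have "R = (R \<bullet> ?Y / (?Y \<bullet> ?Y)) *\<^sub>R ?Y + (R \<bullet> ?Z / ((V (gam s) \<bullet> V (gam s)) * (?Y \<bullet> ?Y))) *\<^sub>R ?Z" .
  moreover have "R \<bullet> ?Y = 0" "R \<bullet> ?Z = 0" using mY[OF s'] mZ F(1,3) by (simp_all add: R_def inner_diff_left)
  ultimately have "R = 0" by simp
  thus ?thesis by (simp add: R_def)
 qed
 \<comment> \<open>The open interval is reached by \<open>par\<close>, the end points by
   continuity.\<close>
 have z: "m s \<bullet> DYJ sg (jj (gam s)) (0, 0, axis i e) = 0" if s: "s \<in> {0..1}" for s i e
 proof -
  have "m s \<bullet> DYJ sg (jj (gam s)) (0, 0, axis i e) = 0" if s: "s \<in> {0<..<1}" for s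
  proof -
   have "V (gam s) \<bullet> DYJ sg (jj (gam s)) (0, 0, axis i e) = 0" using facts(5)[of s 0 0 "axis i e"] s by simp
   thus ?thesis using par[OF s] by (metis inner_scaleR_left mult_zero_right)
  qed
  moreover have "continuous_on (closure {0<..<1}) (%s. m s \<bullet> DYJ sg (jj (gam s)) (0, 0, axis i e))"
   by (simp add: continuous_on_inner m cDY)
  ultimately show ?thesis
   using continuous_constant_on_closure[of "{0<..<1}" "%s. m s \<bullet> DYJ sg (jj (gam s)) (0, 0, axis i e)" 0 s] s by simp
 qed
 have "m t \<bullet> DYJ sg (jj (gam t)) (0, YY' (gam t), 0) = 0"
  by (rule m_test_zeroth[OF n0 t z])
 moreover have "V (gam t) \<bullet> DYJ sg (jj (gam t)) (0, YY' (gam t), 0) ~= 0"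
  using facts(4)[of t] facts(5)[of t 0 "YY' (gam t)" 0] t by simp
 ultimately have c0: "m t \<bullet> V (gam t) / (V (gam t) \<bullet> V (gam t)) = 0"
  using par[OF t] by (metis inner_scaleR_left mult_eq_0_iff)
 show ?thesis by (subst par[OF t]) (simp only: c0 scale_zero_left)
qed

private lemma Wop_lin: "Wop N n t (a *\<^sub>R x + b *\<^sub>R y) = a *\<^sub>R Wop N n t x + b *\<^sub>R Wop N n t y"
 by (simp add: Wop_def inner_add_right algebra_simps sum.distrib scaleR_sum_right)

private lemma W_parallel:
 assumes WY: "!!t. t \<in> {0..1} ==> Wop N n t (YY' (gam t)) = \<omega> *\<^sub>R YY' (gam t)"
  and t: "t \<in> {0<..<1}"
 defines "Y \<equiv> YY' (gam t)" and "Z \<equiv> cross3 (V (gam t)) (YY' (gam t))"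
 shows "Wop N n t Z = (Wop N n t Z \<bullet> Y / (Y \<bullet> Y)) *\<^sub>R Y"
proof -
 have t': "t \<in> {0..1}" using t by auto
 note F = facts[OF t', folded Y_def Z_def]
 obtain g k where gk: "DYJ sg (jj (gam t)) (0, 0, outer Y Z) = g *\<^sub>R Y + k *\<^sub>R Z" "k ~= 0" using F(6) by blast
 obtain g' where g': "DYJ sg (jj (gam t)) (0, 0, outer Y (V (gam t))) = g' *\<^sub>R Y" using F(7) by blast
 have WY': "Wop N n t Y = \<omega> *\<^sub>R Y" using WY[OF t'] by (simp add: Y_def)
 have lin: "Wop N n t (g *\<^sub>R Y + k *\<^sub>R Z) = (g * \<omega>) *\<^sub>R Y + k *\<^sub>R Wop N n t Z" by (simp add: Wop_lin WY')
 have lin': "Wop N n t (g' *\<^sub>R Y) = (g' * \<omega>) *\<^sub>R Y" using Wop_lin[of t g' Y 0 Y] by (simp add: WY')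
 have "Z \<bullet> Wop N n t (DYJ sg (jj (gam t)) (0, 0, outer Y Z)) + Z \<bullet> Wop N n t (DYJ sg (jj (gam t)) (0, 0, outer Y Z)) = 0"
  by (rule W_test[OF t]) (use F in \<open>auto simp: Y_def\<close>)
 hence 1: "Z \<bullet> Wop N n t Z = 0" using gk F(2) by (simp add: lin inner_add_right)
 have "V (gam t) \<bullet> Wop N n t (DYJ sg (jj (gam t)) (0, 0, outer Y Z)) + Z \<bullet> Wop N n t (DYJ sg (jj (gam t)) (0, 0, outer Y (V (gam t)))) = 0"
  by (rule W_test[OF t]) (use F in \<open>auto simp: Y_def\<close>)
 hence 2: "V (gam t) \<bullet> Wop N n t Z = 0" using gk F(1,2) by (simp add: lin g' lin' inner_add_right)
 from perp_decomp[OF V0 F(4) F(1) 2]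
 show ?thesis using 1 by (simp add: Z_def Y_def inner_commute)
qed

lemma Ck_Yx: "Ck 2 (%_::real. %x. YY' x)"
 by (rule Ck_compose[OF Ck_YJ Ck_jt]) simp

text \<open>Differentiating along the orbit the fact that \<open>Z\<close> is mapped to the line of
  \<open>Y\<close> produces a third vector \<open>U\<close> that is mapped there too. Its component
  along \<open>V\<close> is \<open>- 2 * tau * ha\<close>, so \<open>Y\<close>, \<open>Z\<close>,
  \<open>U\<close> form a basis where \<open>ha\<close> is nonzero. The operator then has rank at
  most one with range in the line of \<open>Y\<close>, and its trace is its factor \<omega> on
  \<open>Y\<close>.\<close>

lemma W_rank_one:
 assumes N': "!!t r. t \<in> {0..1} ==> ((%t. N t $ r) has_vector_derivative
    tau *\<^sub>R FD (%x. YY' x) (gam t) (N t $ r)) (at t within {0..1})"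
  and n': "!!t r. t \<in> {0..1} ==> ((%t. n t $ r) has_vector_derivative n' t r) (at t within {0..1})"
  and n'h: "!!t r h. t \<in> {0..1} ==> n' t r \<bullet> h = - (tau * (n t $ r \<bullet> FD (%x. YY' x) (gam t) h))"
  and WY: "!!t. t \<in> {0..1} ==> Wop N n t (YY' (gam t)) = \<omega> *\<^sub>R YY' (gam t)"
  and t: "t \<in> {0<..<1}" and ha: "ha sg (jj (gam t)) ~= 0"
 shows "(\<Sum>r\<in>UNIV. n t $ r \<bullet> N t $ r) = \<omega>"
proof -
 have t': "t \<in> {0..1}" using t by auto
 have at: "at t within {0..1} = at t" using t by (intro at_within_Icc_at) auto
 define Y where "Y = YY' (gam t)"
 define Zf where "Zf x = cross3 (V x) (YY' x)" for x
 define Z where "Z = Zf (gam t)"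
 let ?DY = "FD (%x. YY' x) (gam t)"
 define A where "A h = tau *\<^sub>R ?DY h" for h
 note F = facts[OF t', folded Y_def Zf_def, folded Z_def]
 have dY: "((%x. YY' x) has_derivative ?DY) (at (gam t))"
  using Ck_has_derivative[of 1 "%_::real. %x. YY' x"] Ck_Yx by (simp add: numeral_2_eq_2 del: Ck.simps)
 have dV: "(V has_derivative FD V (gam t)) (at (gam t))"
  using Ck_has_derivative[of 2 "%_::real. V"] V by (simp add: num23 del: Ck.simps)
 have dV_mv: "FD V (gam t) h = mv (jac V (gam t)) h" for h
 proof -
  have "V differentiable (at (gam t))" using dV by (auto simp: differentiable_def)
  from frechet_derivative_expand[OF this, of h] show ?thesis
   by (simp add: mv_def jac_def Basis_vec_def sum.UNION_disjoint axis_eq_axis inner_axis)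
 qed
 have linA: "linear A" unfolding A_def
  by (intro linear_compose_scale_right has_derivative_linear[OF dY])
 define dZ where "dZ h = cross3 (V (gam t)) (?DY h) + cross3 (mv (jac V (gam t)) h) Y" for h
 have dZ: "(Zf has_derivative dZ) (at (gam t))"
  unfolding Zf_def[abs_def] dZ_def Y_def using hd_cross3[OF dV dY] by (simp add: dV_mv)
 \<comment> \<open>The amount by which \<open>Z\<close> along the orbit fails to be a solution of
   the linearised equation.\<close>
 define U where "U = tau *\<^sub>R dZ Y - A Z"
 have g1: "(gam has_vector_derivative tau *\<^sub>R Y) (at t)" using gam[OF t'] by (simp add: at Y_def)
 have Yg: "((%t. YY' (gam t)) has_vector_derivative A Y) (at t)"
  using vector_derivative_diff_chain_within[of gam "tau *\<^sub>R Y" t UNIV "%x. YY' x" ?DY] g1 has_derivative_at_withinI[OF dY]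
  by (simp add: o_def A_def linear_scale[OF has_derivative_linear[OF dY]])
 have Zg: "((%t. Zf (gam t)) has_vector_derivative tau *\<^sub>R dZ Y) (at t)"
  using vector_derivative_diff_chain_within[of gam "tau *\<^sub>R Y" t UNIV Zf dZ] g1 has_derivative_at_withinI[OF dZ]
  by (simp add: o_def linear_scale[OF has_derivative_linear[OF dZ]])
 have Nr: "((%t. N t $ r) has_vector_derivative A (N t $ r)) (at t)" for r
  using N'[OF t', of r] by (simp add: at A_def)
 have nr: "((%t. n t $ r) has_vector_derivative n' t r) (at t)" for r
  using n'[OF t', of r] by (simp add: at)
 have n'A: "n' t r \<bullet> h = - (n t $ r \<bullet> A h)" for r h using n'h[OF t'] by (simp add: A_def)
 have G: "((%t. Wop N n t (Zf (gam t))) has_vector_derivative (A (Wop N n t Z) + Wop N n t U)) (at t)"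
 proof -
  have "((%t. Wop N n t (Zf (gam t))) has_vector_derivative
   (\<Sum>r\<in>UNIV. (n t $ r \<bullet> Z) *\<^sub>R A (N t $ r) + (n t $ r \<bullet> tau *\<^sub>R dZ Y + n' t r \<bullet> Z) *\<^sub>R N t $ r)) (at t)"
   unfolding Wop_def Z_def
   by (intro has_vector_derivative_sum has_vector_derivative_scaleR
     bounded_bilinear.has_vector_derivative[OF bounded_bilinear_inner, THEN iffD2[OF has_real_derivative_iff_has_vector_derivative]] nr Nr Zg)
  moreover have "(\<Sum>r\<in>UNIV. (n t $ r \<bullet> Z) *\<^sub>R A (N t $ r) + (n t $ r \<bullet> tau *\<^sub>R dZ Y + n' t r \<bullet> Z) *\<^sub>R N t $ r) = A (Wop N n t Z) + Wop N n t U"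
   by (simp add: Wop_def linear_sum[OF linA] linear_scale[OF linA] n'A U_def inner_diff_right sum.distrib)
  ultimately show ?thesis by simp
 qed
 define \<mu> where "\<mu> t = Wop N n t (Zf (gam t)) \<bullet> YY' (gam t) / (YY' (gam t) \<bullet> YY' (gam t))" for t
 have par: "Wop N n s (Zf (gam s)) = \<mu> s *\<^sub>R YY' (gam s)" if "s \<in> {0<..<1}" for s
  using W_parallel[OF WY that] by (simp add: \<mu>_def Zf_def)
 \<comment> \<open>Only the existence of the derivative of \<mu> matters: its value contributes a
   multiple of \<open>Y\<close>.\<close>
 have "\<exists>d. (\<mu> has_real_derivative d) (at t)"
 proof -
  have i1: "((%t. Wop N n t (Zf (gam t)) \<bullet> YY' (gam t)) has_real_derivative
   (Wop N n t Z \<bullet> A Y + (A (Wop N n t Z) + Wop N n t U) \<bullet> Y)) (at t)"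
   using bounded_bilinear.has_vector_derivative[OF bounded_bilinear_inner G Yg]
   by (simp add: has_real_derivative_iff_has_vector_derivative Z_def Y_def)
  have i2: "((%t. YY' (gam t) \<bullet> YY' (gam t)) has_real_derivative (Y \<bullet> A Y + A Y \<bullet> Y)) (at t)"
   using bounded_bilinear.has_vector_derivative[OF bounded_bilinear_inner Yg Yg]
   by (simp add: has_real_derivative_iff_has_vector_derivative Y_def)
  show ?thesis unfolding \<mu>_def using DERIV_divide[OF i1 i2] F(4) by (auto simp: Y_def)
 qed
 then obtain d where d: "(\<mu> has_real_derivative d) (at t)" by blast
 have "((%t. \<mu> t *\<^sub>R YY' (gam t)) has_vector_derivative (\<mu> t *\<^sub>R A Y + d *\<^sub>R Y)) (at t)"
  using has_vector_derivative_scaleR[OF d Yg] by (simp add: Y_def)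
 hence "((%t. Wop N n t (Zf (gam t))) has_vector_derivative (\<mu> t *\<^sub>R A Y + d *\<^sub>R Y)) (at t)"
  by (rule has_vector_derivative_transform_within_open[where S = "{0<..<1}"]) (use t par in auto)
 from vector_derivative_unique_at[OF G this]
 have "A (Wop N n t Z) + Wop N n t U = \<mu> t *\<^sub>R A Y + d *\<^sub>R Y" .
 moreover have WZ: "Wop N n t Z = \<mu> t *\<^sub>R Y" using par[OF t] by (simp add: Z_def Y_def)
 ultimately have WU: "Wop N n t U = d *\<^sub>R Y" by (simp add: linear_scale[OF linA])
 have h: "ha sg (jj (gam t)) = mv (jac V (gam t)) Y \<bullet> Z"
  by (simp add: ha_def jt_def Y_def Z_def Zf_def)
 have o: "mv (jac V (gam t)) Y \<bullet> Z + mv (jac V (gam t)) Z \<bullet> Y = 0"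
  using YJ_offd[OF sg, of "jj (gam t)"] by (simp add: offd_def jt_def Y_def Z_def Zf_def)
 have VDY: "V (gam t) \<bullet> ?DY h = - (mv (jac V (gam t)) h \<bullet> Y)" for h
 proof -
  have "((%x. V x \<bullet> YY' x) has_derivative (%h. V (gam t) \<bullet> ?DY h + mv (jac V (gam t)) h \<bullet> Y)) (at (gam t))"
   using hd_inner[OF dV dY] by (simp add: dV_mv Y_def)
  moreover have "(%x. V x \<bullet> YY' x) = (%x. 0)"
  proof
   fix x show "V x \<bullet> YY' x = 0" using YJ_perp[OF sg, of "jj x"] by (simp add: jt_def)
  qed
  ultimately have "((%x. 0::real) has_derivative (%h. V (gam t) \<bullet> ?DY h + mv (jac V (gam t)) h \<bullet> Y)) (at (gam t))" by simp
  from has_derivative_unique[OF this has_derivative_const] have "V (gam t) \<bullet> ?DY h + mv (jac V (gam t)) h \<bullet> Y = 0" by metis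
  thus ?thesis by simp
 qed
 have VdZ: "V (gam t) \<bullet> dZ Y = - (mv (jac V (gam t)) Y \<bullet> Z)"
 proof -
  have "V (gam t) \<bullet> cross3 (mv (jac V (gam t)) Y) Y = - (mv (jac V (gam t)) Y \<bullet> cross3 (V (gam t)) Y)"
   by (simp add: cross3_simps)
  thus ?thesis by (simp add: dZ_def inner_add_right dot_cross_self Z_def Zf_def Y_def)
 qed
 have "V (gam t) \<bullet> U = - 2 * tau * ha sg (jj (gam t))"
 proof -
  have o': "mv (jac V (gam t)) Z \<bullet> Y = - (mv (jac V (gam t)) Y \<bullet> Z)" using o by linarith
  show ?thesis by (simp add: o' U_def A_def inner_diff_right VDY VdZ h algebra_simps)
 qed
 hence VU: "V (gam t) \<bullet> U ~= 0" using tau ha by simp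
 have WYt: "Wop N n t Y = \<omega> *\<^sub>R Y" using WY[OF t'] by (simp add: Y_def)
 have all: "\<exists>c. Wop N n t z = c *\<^sub>R Y" for z
 proof -
  define c where "c = (V (gam t) \<bullet> z) / (V (gam t) \<bullet> U)"
  have "V (gam t) \<bullet> (z - c *\<^sub>R U) = 0" using VU by (simp add: c_def inner_diff_right)
  from perp_decomp[OF V0 F(4) F(1) this]
  obtain a b where "z - c *\<^sub>R U = a *\<^sub>R Y + b *\<^sub>R Z" unfolding Z_def Zf_def Y_def by blast
  hence z: "z = 1 *\<^sub>R (a *\<^sub>R Y + b *\<^sub>R Z) + c *\<^sub>R U" by (simp add: algebra_simps)
  have "Wop N n t z = (a * \<omega> + b * \<mu> t + c * d) *\<^sub>R Y"
   unfolding z by (simp only: Wop_lin WYt WZ WU) (simp add: algebra_simps)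
  thus ?thesis by blast
 qed
 define c where "c i = (SOME c. Wop N n t (axis i 1) = c *\<^sub>R Y)" for i
 have c: "Wop N n t (axis i 1) = c i *\<^sub>R Y" for i
  unfolding c_def by (rule someI_ex[OF all])
 have "Wop N n t Y = (\<Sum>i\<in>UNIV. Y $ i *\<^sub>R Wop N n t (axis i 1))"
  by (simp add: Wop_def inner_axis inner_vec_def[of _ Y] sum_3 algebra_simps)
 also have "... = (\<Sum>i\<in>UNIV. Y $ i * c i) *\<^sub>R Y" by (simp add: c scaleR_sum_left)
 finally have "\<omega> = (\<Sum>i\<in>UNIV. Y $ i * c i)" using WYt F(4) by simp
 also have "... = (\<Sum>i\<in>UNIV. Wop N n t (axis i 1) $ i)" by (simp add: c mult.commute)
 also have "... = (\<Sum>r\<in>UNIV. n t $ r \<bullet> N t $ r)"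
  by (simp add: Wop_def inner_axis inner_vec_def sum_3 axis_def)
 finally show ?thesis by simp
qed

end

end

section \<open>Flows\<close>

definition clamp01 :: "real => real" where "clamp01 t = max 0 (min 1 t)"

lemma clamp01: "clamp01 t \<in> {0..1}" "t \<in> {0..1} ==> clamp01 t = t" "continuous_on S clamp01"
 by (auto simp: clamp01_def[abs_def] intro!: continuous_intros)

lemma linear_ode_exists:
 fixes A :: "real => 'e::euclidean_space => 'e"
 assumes lin: "!!t. t \<in> {0..1} ==> linear (A t)" and c: "!!h. continuous_on {0..1} (%t. A t h)"
 obtains y where "y 0 = d" "!!t. t \<in> {0..1} ==> (y has_vector_derivative A t (y t)) (at t within {0..1})"
proof -
 define B where "B t h = A (clamp01 t) h" for t h
 have linB: "linear (B t)" for t unfolding B_def using lin clamp01(1) by blast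
 have exp: "B t h = (\<Sum>i\<in>Basis. (h \<bullet> i) *\<^sub>R B t i)" for t h
  by (subst euclidean_representation[of h, symmetric]) (simp only: linear_sum[OF linB] linear_scale[OF linB])
 have cB: "continuous_on UNIV (%t. B t h)" for h
  unfolding B_def by (rule continuous_on_compose2[OF c clamp01(3)]) (use clamp01(1) in auto)
 have cB2: "continuous_on UNIV (%p. B (fst p) (snd p))"
 proof -
  have "continuous_on UNIV (%p::real\<times>'e. B (fst p) i)" for i
   by (rule continuous_on_compose2[OF cB continuous_on_fst]) (auto intro: continuous_intros)
  hence "continuous_on UNIV (%p::real\<times>'e. \<Sum>i\<in>Basis. (snd p \<bullet> i) *\<^sub>R B (fst p) i)"
   by (intro continuous_intros)
  thus ?thesis by (subst exp) simp
 qed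
 have "continuous_on {0..1} (%t. \<Sum>i\<in>Basis. norm (A t i))"
  by (intro continuous_intros c)
 from continuous_on_compact_bound[OF compact_Icc this]
 obtain L where "!!t. t \<in> {0..1} ==> norm (\<Sum>i\<in>Basis. norm (A t i)) <= L" by metis
 hence L: "!!t. t \<in> {0..1} ==> (\<Sum>i\<in>Basis. norm (A t i)) <= L" by force
 have lip: "norm (B t u - B t v) <= L * norm (u - v)" for t u v
 proof -
  have "norm (B t (u - v)) <= (\<Sum>i\<in>Basis. norm (B t i)) * norm (u - v)"
   unfolding exp[of t "u - v"] sum_distrib_right
   by (intro order_trans[OF norm_sum] sum_mono)
    (auto simp: mult.commute[of _ "norm (u - v)"] intro!: mult_right_mono Basis_le_norm)
  also have "... <= L * norm (u - v)" using L[OF clamp01(1)] by (intro mult_right_mono) (auto simp: B_def)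
  finally show ?thesis by (simp add: linear_diff[OF linB])
 qed
 have b0: "norm (B t 0) <= 0" for t by (simp add: linear_0[OF linB])
 obtain y where y: "y 0 = d" "!!T t. t \<in> {0..T} ==> (y has_vector_derivative B t (y t)) (at t within {0..T})"
  using ode_exists[OF cB2 lip b0, of d] by metis
 show ?thesis by (rule that[of y]) (use y(1) y(2)[of _ 1] clamp01(2) in \<open>auto simp: B_def\<close>)
qed

lemma linear_ode_unique:
 fixes A :: "real => 'e::euclidean_space => 'e"
 assumes lin: "!!t. t \<in> {0..1} ==> linear (A t)" and c: "!!h. continuous_on {0..1} (%t. A t h)"
  and y: "!!t. t \<in> {0..1} ==> (y has_vector_derivative A t (y t)) (at t within {0..1})"
  and z: "!!t. t \<in> {0..1} ==> (z has_vector_derivative A t (z t)) (at t within {0..1})"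
  and a: "a \<in> {0..1}" "y a = z a" and t: "t \<in> {0..1}"
 shows "y t = z t"
proof -
 have "continuous_on {0..1} (%t. \<Sum>i\<in>Basis. norm (A t i))"
  by (intro continuous_intros c)
 from continuous_on_compact_bound[OF compact_Icc this]
 obtain L where "!!t. t \<in> {0..1} ==> norm (\<Sum>i\<in>Basis. norm (A t i)) <= L" by metis
 hence L: "!!t. t \<in> {0..1} ==> (\<Sum>i\<in>Basis. norm (A t i)) <= L" by force
 have L0: "L >= 0" using L[of 0] sum_nonneg[of Basis "%i. norm (A 0 i)"] by (auto intro: order_trans)
 have bd: "norm (A t h) <= L * norm h" if "t \<in> {0..1}" for t h
 proof -
  have "A t h = (\<Sum>i\<in>Basis. (h \<bullet> i) *\<^sub>R A t i)"
   by (subst euclidean_representation[of h, symmetric]) (simp only: linear_sum[OF lin[OF that]] linear_scale[OF lin[OF that]])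
  hence "norm (A t h) <= (\<Sum>i\<in>Basis. norm (A t i)) * norm h"
   unfolding sum_distrib_right
   by (auto intro!: order_trans[OF norm_sum] sum_mono simp: mult.commute[of _ "norm h"] intro!: mult_right_mono Basis_le_norm)
  also have "... <= L * norm h" using L[OF that] by (intro mult_right_mono) auto
  finally show ?thesis .
 qed
 define f where "f t = y t - z t" for t
 have f: "(f has_vector_derivative A t (f t)) (at t within {0..1})" if "t \<in> {0..1}" for t
  using has_vector_derivative_diff[OF y[OF that] z[OF that]] unfolding f_def by (simp add: linear_diff[OF lin[OF that]])
 have "f t = 0"
 proof (cases "t >= a")
  case True
  have "norm ((%s. f (a + s)) (t - a)) <= (norm ((%s. f (a + s)) 0) + 0 * (t - a)) * exp (L * (t - a))"
  proof (rule gronwall[where T = "1 - a" and f' = "%s. A (a + s) (f (a + s))"])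
   fix s assume s: "s \<in> {0..1 - a}"
   have "((f \<circ> (%s. a + s)) has_vector_derivative 1 *\<^sub>R A (a + s) (f (a + s))) (at s within {0..1 - a})"
    by (rule vector_diff_chain_within)
     (use f[of "a + s"] s a in \<open>auto intro!: derivative_eq_intros elim: has_vector_derivative_within_subset\<close>)
   thus "((%s. f (a + s)) has_vector_derivative A (a + s) (f (a + s))) (at s within {0..1 - a})" by (simp add: o_def)
   show "norm (A (a + s) (f (a + s))) <= L * norm (f (a + s)) + 0" using bd[of "a + s"] s a by auto
  qed (use L0 t True a in auto)
  thus ?thesis using a(2) by (simp add: f_def)
 next
  case False
  have "norm ((%s. f (a - s)) (a - t)) <= (norm ((%s. f (a - s)) 0) + 0 * (a - t)) * exp (L * (a - t))"
  proof (rule gronwall[where T = a and f' = "%s. - A (a - s) (f (a - s))"])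
   fix s assume s: "s \<in> {0..a}"
   have "((f \<circ> (%s. a - s)) has_vector_derivative (-1) *\<^sub>R A (a - s) (f (a - s))) (at s within {0..a})"
    by (rule vector_diff_chain_within)
     (use f[of "a - s"] s a in \<open>auto intro!: derivative_eq_intros elim: has_vector_derivative_within_subset\<close>)
   thus "((%s. f (a - s)) has_vector_derivative - A (a - s) (f (a - s))) (at s within {0..a})" by (simp add: o_def)
   show "norm (- A (a - s) (f (a - s))) <= L * norm (f (a - s)) + 0" using bd[of "a - s"] s a by auto
  qed (use L0 t False a in auto)
  thus ?thesis using a(2) by (simp add: f_def)
 qed
 thus ?thesis by (simp add: f_def)
qed

lemma sol1_unique:
 fixes G :: "'e::euclidean_space => 'e"
 assumes G: "Ck 1 (%_::real. G)" and u: "sol1 G u" "sol1 G v" "u 0 = v 0" and t: "t \<in> {0..1}"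
 shows "u t = v t"
proof -
 have "norm (u t - v t) < e" if e: "e > 0" for e
 proof -
  obtain S d where "open S" "(0::real) \<in> S" "d > 0"
   "!!s u t. s \<in> S ==> sol1 G u ==> norm (u 0 - v 0) < d ==> t \<in> {0..1} ==> norm (u t - v t) < e"
   using flow_continuous[where G = "%_::real. G" and ?s0.0 = 0 and ?u0.0 = v, OF G u(2) e] by metis
  thus ?thesis using u t by auto
 qed
 hence "norm (u t - v t) <= 0" by (meson not_le less_irrefl)
 thus ?thesis by simp
qed

lemma varsol_linear_coeff:
 fixes G :: "'e::euclidean_space => 'e"
 assumes G: "Ck 1 (%_::real. G)" and u: "sol1 G u"
 shows "linear (FD G (u t))" "continuous_on {0..1} (%t. FD G (u t) h)"
proof -
 show "linear (FD G (u t))" using G by (auto intro: linear_frechet_derivative)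
 have "Ck 0 (%(_::real) x. FD G x h)"
  using Ck_directional[of 0 "%_. G" "%(_::real) x. x" "%_ _. h"] G by (simp del: Ck.simps)
 from continuous_on_compose2[OF Ck_continuous_arg[OF this, of UNIV] sol1_continuous[OF u]]
 show "continuous_on {0..1} (%t. FD G (u t) h)" by simp
qed

lemma varsol_flow:
 fixes G :: "'e::euclidean_space => 'e"
 assumes G: "Ck 1 (%_::real. G)" and u: "sol1 G u"
 obtains Psi where "bounded_linear Psi" "!!d. \<exists>y. varsol G u y & y 0 = d"
  "!!y. varsol G u y ==> y 1 = Psi (y 0)"
proof -
 note lc = varsol_linear_coeff[OF G u]
 have ex: "\<exists>y. varsol G u y & y 0 = d" for d
  using linear_ode_exists[OF lc, of d] unfolding varsol_def by metis
 define Y where "Y d = (SOME y. varsol G u y & y 0 = d)" for d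
 have Y: "varsol G u (Y d)" "Y d 0 = d" for d
  using someI_ex[OF ex[of d]] by (auto simp: Y_def)
 have un: "y 1 = Y (y 0) 1" if "varsol G u y" for y
  by (rule linear_ode_unique[OF lc, where a = 0]) (use that Y[of "y 0"] in \<open>auto simp: varsol_def\<close>)
 have "linear (%d. Y d 1)"
 proof (rule linearI)
  fix a b
  have "varsol G u (%t. Y a t + Y b t)"
   using Y(1) unfolding varsol_def by (auto simp: linear_add[OF lc(1)] intro!: has_vector_derivative_add)
  from un[OF this] show "Y (a + b) 1 = Y a 1 + Y b 1" by (simp add: Y)
 next
  fix c :: real and a
  have "varsol G u (%t. c *\<^sub>R Y a t)"
   using Y(1) unfolding varsol_def
   by (auto simp: linear_scale[OF lc(1)] intro!: bounded_linear.has_vector_derivative[OF bounded_linear_scaleR_right])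
  from un[OF this] show "Y (c *\<^sub>R a) 1 = c *\<^sub>R Y a 1" by (simp add: Y)
 qed
 thus ?thesis using that ex un by (simp add: linear_conv_bounded_linear)
qed

text \<open>Strict differentiability at \<open>p0\<close>, uniform for parameters near
  \<open>s0\<close>, joined with continuity there. Strictness compares two arbitrary points near
  \<open>p0\<close>, which is what separates two zeros of the same equation in
  \<open>local_lipschitz_zeros\<close>.\<close>

definition SD :: "('s::topological_space => 'p::real_normed_vector => 'q::real_normed_vector) => 's => 'p => ('p => 'q) => bool" where
 "SD f s0 p0 L \<longleftrightarrow> bounded_linear L &
  (\<forall>e>0. \<exists>S d. open S & s0 \<in> S & d > 0 & (\<forall>s\<in>S. \<forall>p p'. norm (p - p0) < d --> norm (p' - p0) < d -->
    norm (f s p - f s p' - L (p - p')) <= e * norm (p - p'))) &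
  (\<forall>e>0. \<exists>S d. open S & s0 \<in> S & d > 0 & (\<forall>s\<in>S. \<forall>p. norm (p - p0) < d --> norm (f s p - f s0 p0) < e))"

lemma SD_D:
 assumes "SD f s0 p0 L"
 shows "bounded_linear L"
  and "e > 0 ==> \<exists>S d. open S & s0 \<in> S & d > 0 & (\<forall>s\<in>S. \<forall>p p'. norm (p - p0) < d --> norm (p' - p0) < d -->
    norm (f s p - f s p' - L (p - p')) <= e * norm (p - p'))"
  and "e > 0 ==> \<exists>S d. open S & s0 \<in> S & d > 0 & (\<forall>s\<in>S. \<forall>p. norm (p - p0) < d --> norm (f s p - f s0 p0) < e)"
 using assms unfolding SD_def by auto

lemma SD_Ck:
 fixes f :: "'s::topological_space => 'p::euclidean_space => 'q::euclidean_space"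
 assumes f: "Ck 1 f"
 shows "SD f s0 p0 (FD (f s0) p0)"
 unfolding SD_def
proof (intro conjI allI impI)
 have d: "f s differentiable (at x)" for s x using f by simp
 show bl: "bounded_linear (FD (f s0) p0)"
  using d frechet_derivative_works has_derivative_bounded_linear by blast
 fix e :: real assume e: "e > 0"
 obtain S rho where S: "open S" "s0 \<in> S" "rho > 0"
  and near: "!!s t d h. s \<in> S ==> t \<in> {0..1::real} ==> norm d < rho ==>
   norm (FD (f s) (p0 + d) h - FD (f s0) p0 h) <= e * norm h"
  using uniform_near[where ?s0.0 = s0, OF f continuous_on_const[where c = p0] e] by metis
 show "\<exists>S d. open S & s0 \<in> S & d > 0 & (\<forall>s\<in>S. \<forall>p p'. norm (p - p0) < d --> norm (p' - p0) < d -->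
    norm (f s p - f s p' - FD (f s0) p0 (p - p')) <= e * norm (p - p'))"
 proof (intro exI[of _ S] exI[of _ rho] conjI ballI allI impI S)
  fix s p p' assume "s \<in> S" "norm (p - p0) < rho" "norm (p' - p0) < rho"
  thus "norm (f s p - f s p' - FD (f s0) p0 (p - p')) <= e * norm (p - p')"
   using near[of s 0] by (intro near_mvt[OF d bl]) auto
 qed
 have "continuous_on UNIV (%p. f (fst p) (snd p))" using f by simp
 hence o: "open ((%p. f (fst p) (snd p)) -` ball (f s0 p0) e)" by (intro open_vimage) auto
 have "(s0, p0) \<in> (%p. f (fst p) (snd p)) -` ball (f s0 p0) e" using e by simp
 from open_prod_elim[OF o this]
 obtain A B where AB: "open A" "open B" "s0 \<in> A" "p0 \<in> B" "A \<times> B \<subseteq> (%p. f (fst p) (snd p)) -` ball (f s0 p0) e"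
  by (metis SigmaE2)
 obtain d where "d > 0" "ball p0 d \<subseteq> B" using AB open_contains_ball by blast
 thus "\<exists>S d. open S & s0 \<in> S & d > 0 & (\<forall>s\<in>S. \<forall>p. norm (p - p0) < d --> norm (f s p - f s0 p0) < e)"
 proof (intro exI[of _ A] exI[of _ d] conjI ballI allI impI)
  fix s p assume "s \<in> A" "norm (p - p0) < d"
  hence "(s, p) \<in> A \<times> B" using \<open>ball p0 d \<subseteq> B\<close> by (auto simp: dist_norm norm_minus_commute)
  thus "norm (f s p - f s0 p0) < e" using AB(5) by (auto simp: dist_norm norm_minus_commute)
 qed (use AB \<open>d > 0\<close> in auto)
qed

lemma SD_compose:
 assumes f: "SD f s0 p0 L" and g: "SD g s0 (f s0 p0) M"
 shows "SD (%s p. g s (f s p)) s0 p0 (%d. M (L d))"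
 unfolding SD_def
proof (intro conjI allI impI)
 note fb = SD_D(1)[OF f] and gb = SD_D(1)[OF g]
 show "bounded_linear (%d. M (L d))" using bounded_linear_compose[OF gb fb] .
 fix e :: real assume e: "e > 0"
 obtain BL where BL: "BL > 0" "!!x. norm (L x) <= norm x * BL" using bounded_linear.pos_bounded[OF fb] by blast
 obtain BM where BM: "BM > 0" "!!x. norm (M x) <= norm x * BM" using bounded_linear.pos_bounded[OF gb] by blast
 define e1 where "e1 = min 1 (e / (2 * BM))"
 define e2 where "e2 = e / (2 * (BL + 1))"
 have e12: "e1 > 0" "e2 > 0" "e1 <= 1" "e1 * BM <= e / 2" "e2 * (BL + 1) = e / 2"
  using e BL BM by (auto simp: e1_def e2_def min_def field_simps)
 obtain S1 d1 where 1: "open S1" "s0 \<in> S1" "d1 > 0" "!!s p p'. s \<in> S1 ==> norm (p - p0) < d1 ==> norm (p' - p0) < d1 ==>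
    norm (f s p - f s p' - L (p - p')) <= e1 * norm (p - p')"
  using SD_D(2)[OF f e12(1)] by metis
 obtain S2 d2 where 2: "open S2" "s0 \<in> S2" "d2 > 0" "!!s p p'. s \<in> S2 ==> norm (p - f s0 p0) < d2 ==> norm (p' - f s0 p0) < d2 ==>
    norm (g s p - g s p' - M (p - p')) <= e2 * norm (p - p')"
  using SD_D(2)[OF g e12(2)] by metis
 obtain S3 d3 where 3: "open S3" "s0 \<in> S3" "d3 > 0" "!!s p. s \<in> S3 ==> norm (p - p0) < d3 ==> norm (f s p - f s0 p0) < d2"
  using SD_D(3)[OF f 2(3)] by metis
 show "\<exists>S d. open S & s0 \<in> S & d > 0 & (\<forall>s\<in>S. \<forall>p p'. norm (p - p0) < d --> norm (p' - p0) < d -->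
    norm (g s (f s p) - g s (f s p') - M (L (p - p'))) <= e * norm (p - p'))"
 proof (intro exI[of _ "S1 \<inter> S2 \<inter> S3"] exI[of _ "min d1 d3"] conjI ballI allI impI)
  fix s p p' assume s: "s \<in> S1 \<inter> S2 \<inter> S3" and p: "norm (p - p0) < min d1 d3" "norm (p' - p0) < min d1 d3"
  define D where "D = f s p - f s p'"
  have D: "norm (D - L (p - p')) <= e1 * norm (p - p')" unfolding D_def using 1(4) s p by auto
  have "norm D <= norm (L (p - p')) + norm (D - L (p - p'))" by (metis norm_triangle_sub add.commute)
  also have "... <= norm (p - p') * BL + 1 * norm (p - p')"
   by (intro add_mono BL(2) order_trans[OF D] mult_right_mono e12(3)) auto
  finally have nD: "norm D <= (BL + 1) * norm (p - p')" by (simp add: algebra_simps)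
  have "norm (g s (f s p) - g s (f s p') - M D) <= e2 * norm D"
   unfolding D_def using 2(4) 3(4) s p by auto
  also have "... <= e2 * ((BL + 1) * norm (p - p'))" using nD e12 by (intro mult_left_mono) auto
  also have "... = (e2 * (BL + 1)) * norm (p - p')" by (simp only: mult.assoc)
  also have "... = e / 2 * norm (p - p')" by (simp only: e12(5))
  finally have a: "norm (g s (f s p) - g s (f s p') - M D) <= e / 2 * norm (p - p')" .
  have "norm (M (D - L (p - p'))) <= norm (D - L (p - p')) * BM" by (rule BM)
  also have "... <= (e1 * norm (p - p')) * BM" using D BM by (intro mult_right_mono) auto
  also have "... = (e1 * BM) * norm (p - p')" by simp
  also have "... <= e / 2 * norm (p - p')" using e12 by (intro mult_right_mono) auto
  finally have b: "norm (M D - M (L (p - p'))) <= e / 2 * norm (p - p')"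
   by (simp add: linear_diff[OF bounded_linear.linear[OF gb]])
  have "g s (f s p) - g s (f s p') - M (L (p - p')) = (g s (f s p) - g s (f s p') - M D) + (M D - M (L (p - p')))" by simp
  thus "norm (g s (f s p) - g s (f s p') - M (L (p - p'))) <= e * norm (p - p')"
   using a b norm_triangle_ineq[of "g s (f s p) - g s (f s p') - M D" "M D - M (L (p - p'))"] by simp
 qed (use 1 2 3 in auto)
 obtain S4 d4 where 4: "open S4" "s0 \<in> S4" "d4 > 0" "!!s p. s \<in> S4 ==> norm (p - f s0 p0) < d4 ==> norm (g s p - g s0 (f s0 p0)) < e"
  using SD_D(3)[OF g e] by metis
 obtain S5 d5 where 5: "open S5" "s0 \<in> S5" "d5 > 0" "!!s p. s \<in> S5 ==> norm (p - p0) < d5 ==> norm (f s p - f s0 p0) < d4"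
  using SD_D(3)[OF f 4(3)] by metis
 show "\<exists>S d. open S & s0 \<in> S & d > 0 & (\<forall>s\<in>S. \<forall>p. norm (p - p0) < d --> norm (g s (f s p) - g s0 (f s0 p0)) < e)"
  using 4 5 by (intro exI[of _ "S4 \<inter> S5"] exI[of _ d5]) auto
qed

lemma SD_Pair:
 assumes f: "SD f s0 p0 L" and g: "SD g s0 p0 M"
 shows "SD (%s p. (f s p, g s p)) s0 p0 (%d. (L d, M d))"
 unfolding SD_def
proof (intro conjI allI impI)
 show "bounded_linear (%d. (L d, M d))" by (intro bounded_linear_Pair SD_D(1)[OF f] SD_D(1)[OF g])
 fix e :: real assume e: "e > 0"
 hence e2: "e / 2 > 0" by simp
 have np: "norm (a, b) <= norm a + norm b" for a :: 'c and b :: 'd by (simp add: norm_Pair_le)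
 obtain S1 d1 where 1: "open S1" "s0 \<in> S1" "d1 > 0" "!!s p p'. s \<in> S1 ==> norm (p - p0) < d1 ==> norm (p' - p0) < d1 ==>
    norm (f s p - f s p' - L (p - p')) <= e / 2 * norm (p - p')"
  using SD_D(2)[OF f e2] by metis
 obtain S2 d2 where 2: "open S2" "s0 \<in> S2" "d2 > 0" "!!s p p'. s \<in> S2 ==> norm (p - p0) < d2 ==> norm (p' - p0) < d2 ==>
    norm (g s p - g s p' - M (p - p')) <= e / 2 * norm (p - p')"
  using SD_D(2)[OF g e2] by metis
 show "\<exists>S d. open S & s0 \<in> S & d > 0 & (\<forall>s\<in>S. \<forall>p p'. norm (p - p0) < d --> norm (p' - p0) < d -->
    norm ((f s p, g s p) - (f s p', g s p') - (L (p - p'), M (p - p'))) <= e * norm (p - p'))"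
 proof (intro exI[of _ "S1 \<inter> S2"] exI[of _ "min d1 d2"] conjI ballI allI impI)
  fix s p p' assume s: "s \<in> S1 \<inter> S2" and p: "norm (p - p0) < min d1 d2" "norm (p' - p0) < min d1 d2"
  have "norm (f s p - f s p' - L (p - p')) <= e / 2 * norm (p - p')" using 1(4) s p by auto
  moreover have "norm (g s p - g s p' - M (p - p')) <= e / 2 * norm (p - p')" using 2(4) s p by auto
  ultimately show "norm ((f s p, g s p) - (f s p', g s p') - (L (p - p'), M (p - p'))) <= e * norm (p - p')"
   using np[of "f s p - f s p' - L (p - p')" "g s p - g s p' - M (p - p')"] by simp
 qed (use 1 2 in auto)
 obtain S4 d4 where 4: "open S4" "s0 \<in> S4" "d4 > 0" "!!s p. s \<in> S4 ==> norm (p - p0) < d4 ==> norm (f s p - f s0 p0) < e / 2"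
  using SD_D(3)[OF f e2] by metis
 obtain S5 d5 where 5: "open S5" "s0 \<in> S5" "d5 > 0" "!!s p. s \<in> S5 ==> norm (p - p0) < d5 ==> norm (g s p - g s0 p0) < e / 2"
  using SD_D(3)[OF g e2] by metis
 show "\<exists>S d. open S & s0 \<in> S & d > 0 & (\<forall>s\<in>S. \<forall>p. norm (p - p0) < d --> norm ((f s p, g s p) - (f s0 p0, g s0 p0)) < e)"
 proof (intro exI[of _ "S4 \<inter> S5"] exI[of _ "min d4 d5"] conjI ballI allI impI)
  fix s p assume "s \<in> S4 \<inter> S5" "norm (p - p0) < min d4 d5"
  hence "norm (f s p - f s0 p0) < e / 2" "norm (g s p - g s0 p0) < e / 2" using 4 5 by auto
  thus "norm ((f s p, g s p) - (f s0 p0, g s0 p0)) < e"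
   using np[of "f s p - f s0 p0" "g s p - g s0 p0"] by simp
 qed (use 4 5 in auto)
qed

lemma SD_flow:
 fixes G :: "'s::topological_space => 'e::euclidean_space => 'e"
 assumes G: "Ck 1 G" and U: "!!s p. sol1 (G s) (U s p)" "!!s p. U s p 0 = \<iota> p"
  and \<iota>: "!!p q. \<iota> p - \<iota> q = lam (p - q)" and lam: "bounded_linear lam"
  and Psi: "bounded_linear Psi" "!!d. \<exists>y. varsol (G s0) (U s0 p0) y & y 0 = d"
   "!!y. varsol (G s0) (U s0 p0) y ==> y 1 = Psi (y 0)"
 shows "SD (%s p. U s p 1) s0 p0 (%d. Psi (lam d))"
 unfolding SD_def
proof (intro conjI allI impI)
 show "bounded_linear (%d. Psi (lam d))" using bounded_linear_compose[OF Psi(1) lam] .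
 obtain B where B: "B > 0" "!!x. norm (lam x) <= norm x * B" using bounded_linear.pos_bounded[OF lam] by blast
 fix e :: real assume e: "e > 0"
 hence eB: "e / B > 0" using B by simp
 obtain S d where S: "open S" "s0 \<in> S" "d > 0"
  and st: "!!s u v y t. s \<in> S ==> sol1 (G s) u ==> sol1 (G s) v ==> varsol (G s0) (U s0 p0) y ==> y 0 = u 0 - v 0 ==>
   norm (u 0 - U s0 p0 0) < d ==> norm (v 0 - U s0 p0 0) < d ==> t \<in> {0..1} ==>
   norm (u t - v t - y t) <= e / B * norm (u 0 - v 0)"
  using flow_strict[OF G U(1) eB] by metis
 have small: "norm (\<iota> p - \<iota> p0) < d" if "norm (p - p0) < d / B" for p d
  using that B by (auto simp: \<iota> field_simps intro: le_less_trans)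
 show "\<exists>S d. open S & s0 \<in> S & d > 0 & (\<forall>s\<in>S. \<forall>p p'. norm (p - p0) < d --> norm (p' - p0) < d -->
    norm (U s p 1 - U s p' 1 - Psi (lam (p - p'))) <= e * norm (p - p'))"
 proof (intro exI[of _ S] exI[of _ "d / B"] conjI ballI allI impI S)
  fix s p p' assume s: "s \<in> S" and p: "norm (p - p0) < d / B" "norm (p' - p0) < d / B"
  obtain y where y: "varsol (G s0) (U s0 p0) y" "y 0 = lam (p - p')" using Psi(2) by blast
  have "norm (U s p 1 - U s p' 1 - y 1) <= e / B * norm (U s p 0 - U s p' 0)"
   by (rule st[OF s U(1) U(1) y(1)]) (use small p y(2) in \<open>auto simp: U \<iota>\<close>)
  also have "... <= e / B * (norm (p - p') * B)" using B eB by (intro mult_left_mono) (auto simp: U \<iota>)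
  finally show "norm (U s p 1 - U s p' 1 - Psi (lam (p - p'))) <= e * norm (p - p')"
   using Psi(3)[OF y(1)] y(2) B by simp
 qed (use S B in auto)
 obtain S d where S: "open S" "s0 \<in> S" "d > 0"
  and st: "!!s u t. s \<in> S ==> sol1 (G s) u ==> norm (u 0 - U s0 p0 0) < d ==> t \<in> {0..1} ==> norm (u t - U s0 p0 t) < e"
  using flow_continuous[OF G U(1) e] by metis
 show "\<exists>S d. open S & s0 \<in> S & d > 0 & (\<forall>s\<in>S. \<forall>p. norm (p - p0) < d --> norm (U s p 1 - U s0 p0 1) < e)"
  using S st small B by (intro exI[of _ S] exI[of _ "d / B"]) (auto simp: U)
qed

section \<open>Principal fields depending on parameters, with their linearised flows\<close>

lemma Ck_jac_param:
 fixes f :: "'s::topological_space => R3 => R3"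
 shows "Ck (Suc i) f ==> Ck i (%s. jac (f s))"
 unfolding jac_def by (rule Ck_vec) (simp add: axis_in_Basis_iff)

lemma jac_mv:
 fixes v :: "R3 => R3"
 assumes "v differentiable (at x)" shows "FD v x h = mv (jac v x) h"
 using frechet_derivative_expand[OF assms, of h]
 by (simp add: mv_def jac_def Basis_vec_def sum.UNION_disjoint axis_eq_axis inner_axis)

lemma jac_mvv:
 fixes v :: "R3 => real^3^3"
 assumes "v differentiable (at x)" shows "FD v x h = mvv (jac v x) h"
 using frechet_derivative_expand[OF assms, of h]
 by (simp add: mvv_def jac_def Basis_vec_def sum.UNION_disjoint axis_eq_axis inner_axis)

type_synonym state = "(real \<times> R3) \<times> R3 \<times> (real^3^3)"

lemma periodic_reduce:
 fixes f :: "real => 'a"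
 assumes T: "T > 0" and per: "!!t. f (t + T) = f t"
 obtains u where "u \<in> {0..<T}" "f t = f u"
proof -
 have pern: "f (t + real n * T) = f t" for n t
 proof (induction n)
  case (Suc n) thus ?case using per[of "t + real n * T"] by (simp add: algebra_simps)
 qed simp
 define u where "u = t - of_int \<lfloor>t / T\<rfloor> * T"
 have u: "u \<in> {0..<T}"
  using T floor_divide_lower[OF T, of t] floor_divide_upper[OF T, of t] by (auto simp: u_def algebra_simps)
 have "f t = f u"
 proof (cases "\<lfloor>t / T\<rfloor> >= 0")
  case True thus ?thesis using pern[of u "nat \<lfloor>t / T\<rfloor>"] by (simp add: u_def)
 next
  case False thus ?thesis using pern[of t "nat (- \<lfloor>t / T\<rfloor>)"] by (simp add: u_def)
 qed
 thus ?thesis using that u by blast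
qed

locale principal_family =
 fixes sg :: real and w :: "R3 => R3"
  and Vs :: "'s::topological_space => R3 => R3" and wk :: "nat => R3 => R3"
 assumes sg: "sg = 1 \<or> sg = -1"
  and w: "Ck 3 (%_::real. w)" and wsupp: "\<exists>R. \<forall>x. norm x > R --> w x = 0"
  and Vs: "Ck 3 Vs" and Vs0: "Vs s x ~= 0"
  and wk: "Ck 3 (%_::real. wk k)"
begin

lemma w': "Ck 3 (%_::'s. w)" and wk': "Ck 3 (%_::'s. wk k)"
 using Ck_reparam[of "%_::'s. 0::real" 3 "%_. w"] w Ck_reparam[of "%_::'s. 0::real" 3 "%_. wk k"] wk by auto

text \<open>The jet of \<open>Vs s\<close> plus a combination of three of the fields
  \<open>wk\<close>, chosen by \<open>kk\<close>, as a function of the coefficients and the point.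
  Three coefficients and the period balance the four equations.\<close>

definition JF :: "(3 => nat) => 's => R3 \<times> R3 => jet" where
 "JF kk s z = (w (snd z), Vs s (snd z) + (\<Sum>i\<in>UNIV. fst z $ i *\<^sub>R wk (kk i) (snd z)),
  jac (Vs s) (snd z) + (\<Sum>i\<in>UNIV. fst z $ i *\<^sub>R jac (wk (kk i)) (snd z)))"

lemma Ck_JF: "Ck 2 (JF kk)"
proof -
 have S: "Ck 2 (%(_::'s). snd :: R3 \<times> R3 => R3)" by (rule Ck_snd[OF Ck_id])
 have A: "Ck 2 (%(_::'s) z :: R3 \<times> R3. fst z $ i)" for i by (intro Ck_nth Ck_fst Ck_id)
 have j: "Ck 2 (%s. jac (Vs s))" using Ck_jac_param[of 2 Vs] Vs by (simp add: num23 del: Ck.simps)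
 have jk: "Ck 2 (%_::'s. jac (wk k))" for k
  using Ck_jac_param[of 2 "%_::'s. wk k"] wk' by (simp add: num23 del: Ck.simps)
 have 2: "Ck 2 (%_::'s. w)" "Ck 2 Vs" "Ck 2 (%_::'s. wk k)" for k
  using Ck_mono[OF w', of 2] Ck_mono[OF Vs, of 2] Ck_mono[OF wk', of 2] by auto
 show ?thesis
  unfolding JF_def[abs_def]
  by (intro Ck_Pair Ck_add Ck_sum Ck_scaleR A Ck_compose[OF 2(1) S] Ck_compose[OF 2(2) S]
   Ck_compose[OF 2(3) S] Ck_compose[OF j S] Ck_compose[OF jk S])
qed

definition YF :: "(3 => nat) => 's => R3 \<times> R3 => R3" where
 "YF kk s z = YJ sg (JF kk s z)"

lemma Ck_YF: "Ck 2 (YF kk)"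
 unfolding YF_def[abs_def] by (rule Ck_compose[OF Ck_YJ Ck_JF]) simp

definition TF :: "(3 => nat) => 's => (R3 \<times> R3) \<times> R3 => R3" where
 "TF kk s p = FD (YF kk s) (fst p) (0, snd p)"

lemma Ck_TF: "Ck 1 (TF kk)"
 unfolding TF_def
proof (rule Ck_directional)
 show "Ck (Suc 1) (YF kk)" using Ck_YF by (simp only: numeral_2_eq_2 One_nat_def)
qed (intro Ck_Pair Ck_snd Ck_fst Ck_id Ck_const)+

text \<open>Period and coefficients are carried along as constant components of the state, so that
  derivatives of the time-one map in these quantities are again derivatives in the initial state.
  The last component evolves row by row under the linearised equation; started at
  \<open>mat 1\<close>, it is the transposed Jacobian of the flow.\<close>

definition GG :: "(3 => nat) => 's => state => state" where
 "GG kk s u = (0, fst (fst u) *\<^sub>R YF kk s (snd (fst u), fst (snd u)),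
  \<chi> i. fst (fst u) *\<^sub>R TF kk s ((snd (fst u), fst (snd u)), snd (snd u) $ i))"

lemma Ck_GG: "Ck 1 (GG kk)"
proof -
 have Y: "Ck 1 (YF kk)" by (rule Ck_mono[OF Ck_YF]) simp
 have z: "Ck 1 (%(_::'s) u::state. (snd (fst u), fst (snd u)))" by (intro Ck_Pair Ck_fst Ck_snd Ck_id)
 have t: "Ck 1 (%(_::'s) u::state. fst (fst u))" by (intro Ck_fst Ck_id)
 have n: "Ck 1 (%(_::'s) u::state. snd (snd u) $ i)" for i by (intro Ck_nth Ck_snd Ck_id)
 have v: "Ck 1 (%s u. \<chi> i. fst (fst u) *\<^sub>R TF kk s ((snd (fst u), fst (snd u)), snd (snd u) $ i))"
  by (rule Ck_vec) (simp only: vec_lambda_beta, intro Ck_scaleR Ck_compose[OF Ck_TF] Ck_Pair Ck_nth Ck_fst Ck_snd Ck_id)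
 show ?thesis unfolding GG_def[abs_def]
  by (intro Ck_Pair Ck_const Ck_scaleR t Ck_compose[OF Y z] v)
qed

lemma YF_support: obtains R where "!!kk s a x. norm x > R ==> YF kk s (a, x) = 0"
proof -
 obtain R where R: "!!x. norm x > R ==> w x = 0" using wsupp by blast
 have "YF kk s (a, x) = 0" if "norm x > R" for kk s a x
  using R[OF that] by (simp add: YF_def YJ_def JF_def YY_def YX_def prX_def)
 thus ?thesis using that by blast
qed

abbreviation Ys :: "'s => R3 => R3" where "Ys s x \<equiv> YJ sg (jt w (Vs s) x)"

lemma YF_0: "YF kk s (0, x) = Ys s x"
 by (simp add: YF_def JF_def jt_def)

lemma YF_differentiable: "YF kk s differentiable (at z)"
 by (rule Ck_differentiable[of 1]) (use Ck_YF in \<open>simp only: numeral_2_eq_2 One_nat_def\<close>)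

lemma YF_hd: "(YF kk s has_derivative FD (YF kk s) z) (at z)"
 using YF_differentiable frechet_derivative_works by blast

lemma YF_x_hd: "((%x. YF kk s (a, x)) has_derivative (%h. TF kk s ((a, x), h))) (at x)"
 unfolding TF_def fst_conv snd_conv
 by (rule has_derivative_compose[of "%x. (a, x)", OF _ YF_hd]) (auto intro!: derivative_eq_intros)

lemma TF_0: "TF kk s ((0, x), h) = FD (Ys s) x h"
proof -
 have "(Ys s has_derivative (%h. TF kk s ((0, x), h))) (at x)"
  using YF_x_hd[of kk s 0 x] by (simp add: YF_0)
 from fun_cong[OF frechet_derivative_at[OF this]] show ?thesis .
qed

lemma linear_TF: "linear (%h. TF kk s (z, h))"
 using YF_x_hd[of kk s "fst z" "snd z"] has_derivative_linear by fastforce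

lemma continuous_YF: "continuous_on UNIV (YF kk s)"
 using Ck_continuous_arg[OF Ck_YF] .

lemma continuous_TF: "continuous_on UNIV (TF kk s)"
 using Ck_continuous_arg[OF Ck_TF] .

text \<open>The field vanishes outside the support of \<open>w\<close>, so compactness turns local
  bounds into global ones; this is what makes the flow exist up to time 1 from every point.\<close>

lemma YF_lipschitz: obtains L where "L >= 0" "!!x y. norm (YF kk s (a, x) - YF kk s (a, y)) <= L * norm (x - y)"
 "!!x. norm (YF kk s (a, x)) <= L" "!!x h. norm (TF kk s ((a, x), h)) <= L * norm h"
proof -
 obtain R where R: "!!x. norm x > R ==> YF kk s (a, x) = 0" using YF_support by metis
 have T0: "TF kk s ((a, x), h) = 0" if "norm x > R" for x h
 proof -
  have "((%x. YF kk s (a, x)) has_derivative (%h. 0)) (at x)"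
   by (rule has_derivative_transform_within_open[where f = "%_. 0" and s = "- cball 0 R"])
    (use that R in \<open>auto simp: dist_norm\<close>)
  from has_derivative_unique[OF YF_x_hd this] show ?thesis by meson
 qed
 have c: "continuous_on (cball 0 R) (%x. norm (YF kk s (a, x)) + (\<Sum>i\<in>Basis. norm (TF kk s ((a, x), i))))"
  by (intro continuous_intros continuous_on_compose2[OF continuous_YF] continuous_on_compose2[OF continuous_TF]) auto
 obtain B where B: "B >= 0" "!!x. x \<in> cball 0 R ==> norm (norm (YF kk s (a, x)) + (\<Sum>i\<in>Basis. norm (TF kk s ((a, x), i)))) <= B"
  using continuous_on_compact_bound[OF compact_cball c] by metis
 have s0: "(\<Sum>i\<in>Basis. norm (TF kk s ((a, x), i))) >= 0" for x by (intro sum_nonneg) auto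
 have Y: "norm (YF kk s (a, x)) <= B" for x
  using B(1) B(2)[of x] R[of x] s0[of x] by (cases "norm x > R") auto
 have Tb: "norm (TF kk s ((a, x), h)) <= B * norm h" for x h
 proof (cases "norm x > R")
  case True thus ?thesis using T0 B(1) by simp
 next
  case False
  have d: "(%x. YF kk s (a, x)) differentiable (at x)" unfolding differentiable_def using YF_x_hd by blast
  have e: "FD (%x. YF kk s (a, x)) x = (%h. TF kk s ((a, x), h))"
   using frechet_derivative_at[OF YF_x_hd] by simp
  have "norm (TF kk s ((a, x), h)) <= (\<Sum>i\<in>Basis. norm (TF kk s ((a, x), i))) * norm h"
   using frechet_derivative_bound[OF d, of h] by (simp add: e)
  also have "... <= B * norm h"
  proof (intro mult_right_mono)
   show "(\<Sum>i\<in>Basis. norm (TF kk s ((a, x), i))) <= B"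
   proof -
    have "(\<Sum>i\<in>Basis. norm (TF kk s ((a, x), i))) <= norm (YF kk s (a, x)) + (\<Sum>i\<in>Basis. norm (TF kk s ((a, x), i)))"
     by simp
    also have "... <= norm (norm (YF kk s (a, x)) + (\<Sum>i\<in>Basis. norm (TF kk s ((a, x), i))))" by simp
    also have "... <= B" using B(2)[of x] False by simp
    finally show ?thesis .
   qed
  qed simp
  finally show ?thesis .
 qed
 show ?thesis
 proof (rule that[of B])
  fix x y
  have "norm ((%x. YF kk s (a, x)) x - (%x. YF kk s (a, x)) y) <= B * norm (x - y)"
   by (rule differentiable_bound[where S = UNIV and f' = "%x h. TF kk s ((a, x), h)"])
    (use YF_x_hd Tb in \<open>auto intro: onorm_le\<close>)
  thus "norm (YF kk s (a, x) - YF kk s (a, y)) <= B * norm (x - y)" by simp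
 qed (use B Y Tb in auto)
qed

lemma flow_exists: "\<exists>U. sol1 (GG kk s) U & U 0 = (a, x, mat 1) & (\<forall>t\<in>{0..1}. fst (U t) = a)"
proof -
 obtain tau alp where a: "a = (tau, alp)" by (cases a)
 obtain L where L: "L >= 0" "!!x y. norm (YF kk s (alp, x) - YF kk s (alp, y)) <= L * norm (x - y)"
  "!!x. norm (YF kk s (alp, x)) <= L" "!!x h. norm (TF kk s ((alp, x), h)) <= L * norm h"
  using YF_lipschitz by metis
 have c1: "continuous_on UNIV (%p::real \<times> R3. tau *\<^sub>R YF kk s (alp, snd p))"
  by (intro continuous_intros continuous_on_compose2[OF continuous_YF]) auto
 have l1: "norm (tau *\<^sub>R YF kk s (alp, u) - tau *\<^sub>R YF kk s (alp, v)) <= (\<bar>tau\<bar> * L) * norm (u - v)" for u v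
  using L(2)[of u v] by (simp flip: scaleR_diff_right add: mult.assoc mult_left_mono)
 obtain u where u: "u 0 = x" "continuous_on UNIV u"
  "!!T t. t \<in> {0..T} ==> (u has_vector_derivative tau *\<^sub>R YF kk s (alp, u t)) (at t within {0..T})"
  using ode_exists[where F = "%_ x. tau *\<^sub>R YF kk s (alp, x)", OF c1 l1, of "norm (tau *\<^sub>R YF kk s (alp, 0))" x] by auto
 have c2: "continuous_on {0..1} (%t. (\<chi> i. tau *\<^sub>R TF kk s ((alp, u t), N $ i)) :: real^3^3)" for N :: "real^3^3"
  by (intro continuous_on_vec_lambda continuous_intros continuous_on_compose2[OF continuous_TF] continuous_on_subset[OF u(2)]) auto
 have l2: "linear (%N. (\<chi> i. tau *\<^sub>R TF kk s ((alp, u t), N $ i)) :: real^3^3)" for t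
  by (rule linearI) (simp_all add: vec_eq_iff linear_add[OF linear_TF] linear_scale[OF linear_TF] algebra_simps)
 obtain N :: "real => real^3^3" where N: "N 0 = mat 1"
  "!!t. t \<in> {0..1} ==> (N has_vector_derivative (\<chi> i. tau *\<^sub>R TF kk s ((alp, u t), N t $ i))) (at t within {0..1})"
  using linear_ode_exists[where A = "%t N. (\<chi> i. tau *\<^sub>R TF kk s ((alp, u t), N $ i))", OF l2 c2, of "mat 1"] by metis
 have "sol1 (GG kk s) (%t. (a, u t, N t))"
  unfolding sol1_def GG_def a using u(3)[of _ 1] N(2)
  by (auto intro!: has_vector_derivative_Pair has_vector_derivative_const simp: zero_prod_def)
 thus ?thesis using u(1) N(1) by (intro exI[of _ "%t. (a, u t, N t)"]) auto
qed

definition UU :: "(3 => nat) => 's => (real \<times> R3) \<times> R3 => real => state" where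
 "UU kk s p = (SOME U. sol1 (GG kk s) U & U 0 = (fst p, snd p, mat 1) & (\<forall>t\<in>{0..1}. fst (U t) = fst p))"

lemma UU: "sol1 (GG kk s) (UU kk s p)" "UU kk s p 0 = (fst p, snd p, mat 1)"
 "t \<in> {0..1} ==> fst (UU kk s p t) = fst p"
 using someI_ex[OF flow_exists[of kk s "fst p" "snd p"]] unfolding UU_def by auto

lemma UU_unique: "sol1 (GG kk s) U ==> U 0 = (a, x, mat 1) ==> t \<in> {0..1} ==> U t = UU kk s (a, x) t"
 using sol1_unique[OF Ck_fixed_param[OF Ck_GG], of kk s U "UU kk s (a, x)"] UU by simp

lemma JF_hd0: "(JF kk s has_derivative (%(a, h). (\<Sum>i\<in>UNIV. a $ i *\<^sub>R jv (wk (kk i)) x) + FD (jt w (Vs s)) x h)) (at (0, x))"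
proof -
 have dw: "(w has_derivative FD w x) (at x)"
  using Ck_has_derivative[of 2 "%_::real. w"] w by (simp add: num23 del: Ck.simps)
 have dV: "(Vs s has_derivative FD (Vs s) x) (at x)"
  using Ck_has_derivative[of 2 Vs] Vs by (simp add: num23 del: Ck.simps)
 have djV: "(jac (Vs s) has_derivative FD (jac (Vs s)) x) (at x)"
  using Ck_has_derivative[of 1 "%s. jac (Vs s)"] Ck_jac_param[of 2 Vs] Vs by (simp add: num23 del: Ck.simps)
 have dk: "(wk k has_derivative FD (wk k) x) (at x)" for k
  using Ck_has_derivative[of 2 "%_::real. wk k"] wk by (simp add: num23 del: Ck.simps)
 have djk: "(jac (wk k) has_derivative FD (jac (wk k)) x) (at x)" for k
  using Ck_has_derivative[of 1 "%_::real. jac (wk k)"] Ck_jac_param[of 2 "%_::real. wk k"] wk by (simp add: num23 del: Ck.simps)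
 have sn: "(f has_derivative f') (at x) ==> ((%z::R3\<times>R3. f (snd z)) has_derivative (%h. f' (snd h))) (at (0, x))" for f :: "R3 => 'b::real_normed_vector" and f'
  by (rule has_derivative_compose[where f = snd, OF bounded_linear_imp_has_derivative[OF bounded_linear_snd]]) simp
 have coef: "((%z::R3\<times>R3. fst z $ i) has_derivative (%h. fst h $ i)) (at (0, x))" for i
  by (rule bounded_linear_imp_has_derivative) (intro bounded_linear_compose[OF bounded_linear_vec_nth] bounded_linear_fst)
 have jtd: "FD (jt w (Vs s)) x h = (FD w x h, FD (Vs s) x h, FD (jac (Vs s)) x h)" for h
 proof -
  have "(jt w (Vs s) has_derivative (%h. (FD w x h, FD (Vs s) x h, FD (jac (Vs s)) x h))) (at x)"
   unfolding jt_def[abs_def] by (intro has_derivative_Pair dw dV djV)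
  from fun_cong[OF frechet_derivative_at[OF this], of h] show ?thesis by simp
 qed
 have "(JF kk s has_derivative (%h. (FD w x (snd h),
   FD (Vs s) x (snd h) + (\<Sum>i\<in>UNIV. fst (0::R3, x) $ i *\<^sub>R FD (wk (kk i)) x (snd h) + fst h $ i *\<^sub>R wk (kk i) (snd (0::R3, x))),
   FD (jac (Vs s)) x (snd h) + (\<Sum>i\<in>UNIV. fst (0::R3, x) $ i *\<^sub>R FD (jac (wk (kk i))) x (snd h) + fst h $ i *\<^sub>R jac (wk (kk i)) (snd (0::R3, x)))))) (at (0, x))"
  unfolding JF_def[abs_def]
  by (intro has_derivative_Pair has_derivative_add has_derivative_sum sn dw dV djV
   bounded_bilinear.FDERIV[OF bounded_bilinear_scaleR coef sn[OF dk]]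
   bounded_bilinear.FDERIV[OF bounded_bilinear_scaleR coef sn[OF djk]])
 thus ?thesis
  by (rule has_derivative_eq_rhs) (auto simp: fun_eq_iff jtd jv_def prod_eq_iff fst_sum snd_sum add.commute)
qed

lemma YF_fd0: "FD (YF kk s) (0, x) (a, h) =
  DYJ sg (jt w (Vs s) x) (\<Sum>i\<in>UNIV. a $ i *\<^sub>R jv (wk (kk i)) x) + FD (Ys s) x h"
proof -
 have J0: "JF kk s (0, x) = jt w (Vs s) x" by (simp add: JF_def jt_def)
 have "((%z. YJ sg (JF kk s z)) has_derivative (%h. DYJ sg (JF kk s (0, x)) ((%(a, h). (\<Sum>i\<in>UNIV. a $ i *\<^sub>R jv (wk (kk i)) x) + FD (jt w (Vs s)) x h) h))) (at (0, x))"
  by (rule has_derivative_compose[OF JF_hd0 YJ_has_derivative])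
 note fd = frechet_derivative_at[OF this]
 have e: "FD (YF kk s) (0, x) (a, h) = DYJ sg (jt w (Vs s) x) ((\<Sum>i\<in>UNIV. a $ i *\<^sub>R jv (wk (kk i)) x) + FD (jt w (Vs s)) x h)" for a h
  using fun_cong[OF fd, of "(a, h)"] by (simp add: YF_def[abs_def] J0)
 have "TF kk s ((0, x), h) = DYJ sg (jt w (Vs s) x) (FD (jt w (Vs s)) x h)"
  by (simp add: TF_def e)
 thus ?thesis unfolding e TF_0 by (simp only: linear_add[OF linear_DYJ])
qed

lemma jv_hd:
 assumes "Ck 3 (%_::real. v)" shows "(jv v has_derivative jvD v x) (at x)"
proof -
 have v2: "Ck (Suc 2) (%_::real. v)" using assms by (simp only: num23)
 have j: "Ck (Suc 1) (%_::real. jac v)" using Ck_jac_param[OF v2] by (simp only: numeral_2_eq_2 One_nat_def)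
 have "(jv v has_derivative (%h. (0, FD v x h, FD (jac v) x h))) (at x)"
  unfolding jv_def[abs_def]
  using Ck_has_derivative[OF v2, of x] Ck_has_derivative[OF j, of x] by (intro has_derivative_Pair) auto
 thus ?thesis
  by (rule has_derivative_eq_rhs)
   (simp add: fun_eq_iff jvD_def jac_mv[OF Ck_differentiable[OF v2]] jac_mvv[OF Ck_differentiable[OF j]])
qed

lemma Ck_jt_s: "Ck 2 (%s. jt w (Vs s))"
 unfolding jt_def using Ck_jac_param[of 2 Vs] Vs Ck_mono[OF w', of 2] Ck_mono[OF Vs, of 2]
 by (intro Ck_Pair) (auto simp: eval_nat_numeral simp del: Ck.simps)

lemma Ck_Ys: "Ck 2 (%s. Ys s)"
 by (rule Ck_compose[OF Ck_YJ Ck_jt_s]) simp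

lemma jt_hd: "(jt w (Vs s) has_derivative FD (jt w (Vs s)) x) (at x)"
 by (rule Ck_has_derivative[of 1 "%s. jt w (Vs s)"]) (use Ck_jt_s in \<open>simp only: numeral_2_eq_2 One_nat_def\<close>)

lemma Ys_hd: "(Ys s has_derivative FD (Ys s) x) (at x)"
 by (rule Ck_has_derivative[of 1 "%s. Ys s"]) (use Ck_Ys in \<open>simp only: numeral_2_eq_2 One_nat_def\<close>)

lemma TF_hd: "(TF kk s has_derivative FD (TF kk s) p) (at p)"
 using Ck_has_derivative[of 0 "TF kk"] Ck_TF by (simp only: One_nat_def)

text \<open>The mixed derivative in the parameter and in \<open>x\<close>: along \<open>alp\<close>, with \<open>x\<close> fixed, the jet
 and its derivative are affine in \<open>alp\<close>.\<close>

lemma TF_alpha: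
 "FD (TF kk s) ((0, x), h) ((a, 0), 0) =
  DTJ sg (jt w (Vs s) x, FD (jt w (Vs s)) x h)
   (\<Sum>i\<in>UNIV. a $ i *\<^sub>R jv (wk (kk i)) x, \<Sum>i\<in>UNIV. a $ i *\<^sub>R jvD (wk (kk i)) x h)"
proof -
 let ?j = "jt w (Vs s) x" and ?j' = "FD (jt w (Vs s)) x h"
 have JFa: "JF kk s (b, y) = jt w (Vs s) y + (\<Sum>i\<in>UNIV. b $ i *\<^sub>R jv (wk (kk i)) y)" for b y
  by (simp add: JF_def jt_def jv_def prod_eq_iff fst_sum snd_sum)
 have T: "TF kk s ((b, x), h) = TJ sg (?j + (\<Sum>i\<in>UNIV. b $ i *\<^sub>R jv (wk (kk i)) x), ?j' + (\<Sum>i\<in>UNIV. b $ i *\<^sub>R jvD (wk (kk i)) x h))" for b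
 proof -
  have "((%y. YJ sg (JF kk s (b, y))) has_derivative (%h. DYJ sg (JF kk s (b, x))
   (FD (jt w (Vs s)) x h + (\<Sum>i\<in>UNIV. b $ i *\<^sub>R jvD (wk (kk i)) x h)))) (at x)"
   by (rule has_derivative_compose[OF _ YJ_has_derivative], unfold JFa)
    (intro has_derivative_add jt_hd has_derivative_sum has_derivative_scaleR_right jv_hd wk)
  from has_derivative_unique[OF YF_x_hd[unfolded YF_def] this] show ?thesis
   by (simp add: TJ_def JFa fun_eq_iff)
 qed
 have lin: "((%b::R3. \<Sum>i\<in>UNIV. b $ i *\<^sub>R (c i :: jet)) has_derivative (%a. \<Sum>i\<in>UNIV. a $ i *\<^sub>R c i)) (at b)" for c b
  by (intro has_derivative_sum has_derivative_scaleR_left bounded_linear_imp_has_derivative bounded_linear_vec_nth)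
 have A: "((%b. TJ sg (?j + (\<Sum>i\<in>UNIV. b $ i *\<^sub>R jv (wk (kk i)) x), ?j' + (\<Sum>i\<in>UNIV. b $ i *\<^sub>R jvD (wk (kk i)) x h))) has_derivative
   (%a. DTJ sg (?j + (\<Sum>i\<in>UNIV. 0 $ i *\<^sub>R jv (wk (kk i)) x), ?j' + (\<Sum>i\<in>UNIV. 0 $ i *\<^sub>R jvD (wk (kk i)) x h))
    (0 + (\<Sum>i\<in>UNIV. a $ i *\<^sub>R jv (wk (kk i)) x), 0 + (\<Sum>i\<in>UNIV. a $ i *\<^sub>R jvD (wk (kk i)) x h)))) (at 0)"
  by (rule has_derivative_compose[OF _ TJ_has_derivative])
   (intro has_derivative_Pair has_derivative_add has_derivative_const lin)
 have B: "((%b. TF kk s ((b, x), h)) has_derivative (%a. FD (TF kk s) ((0, x), h) ((a, 0), 0))) (at 0)"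
  by (rule has_derivative_compose[of "%b. ((b, x), h)", OF _ TF_hd]) (auto intro!: derivative_eq_intros)
 from fun_cong[OF has_derivative_unique[OF B[unfolded T] A], of a] show ?thesis by simp
qed

definition D2Y :: "'s => R3 => R3 => R3 => R3" where
 "D2Y s x h l = FD (%x. FD (Ys s) x h) x l"

lemma D2Y_eq: "D2Y s x h l = FD (TF kk s) ((0, x), h) ((0, l), 0)"
proof -
 have "((%y. TF kk s ((0, y), h)) has_derivative (%l. FD (TF kk s) ((0, x), h) ((0, l), 0))) (at x)"
  by (rule has_derivative_compose[of "%y. ((0, y), h)", OF _ TF_hd]) (auto intro!: derivative_eq_intros simp: zero_prod_def)
 from fun_cong[OF frechet_derivative_at[OF this], of l] show ?thesis unfolding D2Y_def TF_0 by simp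
qed

lemma D2Y_0: "D2Y s x h 0 = 0"
 using linear_0[of "FD (TF (%_. 0) s) ((0, x), h)"] has_derivative_linear[OF TF_hd]
 by (simp add: D2Y_eq[of s x h 0 "%_. 0"] zero_prod_def)

lemma TF_fd0:
 "FD (TF kk s) ((0, x), h) ((a, l), h') =
  DTJ sg (jt w (Vs s) x, FD (jt w (Vs s)) x h)
   (\<Sum>i\<in>UNIV. a $ i *\<^sub>R jv (wk (kk i)) x, \<Sum>i\<in>UNIV. a $ i *\<^sub>R jvD (wk (kk i)) x h)
  + D2Y s x h l + FD (Ys s) x h'"
proof -
 let ?D = "FD (TF kk s) ((0, x), h)"
 have lin: "linear ?D" using TF_hd has_derivative_linear by blast
 have 1: "?D ((0, l), 0) = D2Y s x h l" by (rule D2Y_eq[symmetric])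
 have "((%h. TF kk s ((0, x), h)) has_derivative (%l. ?D ((0, 0), l))) (at h)"
  by (rule has_derivative_compose[of "%h. ((0, x), h)", OF _ TF_hd]) (auto intro!: derivative_eq_intros simp: zero_prod_def)
 moreover have "((%h. TF kk s ((0, x), h)) has_derivative (%h. TF kk s ((0, x), h))) (at h)"
  using linear_TF by (simp add: linear_conv_bounded_linear bounded_linear_imp_has_derivative)
 ultimately have 2: "?D ((0, 0), h') = FD (Ys s) x h'"
  using has_derivative_unique TF_0 by metis
 have "((a, l), h') = ((a, 0), 0) + (((0, l), 0) + ((0, 0), h'))" by simp
 hence "?D ((a, l), h') = ?D ((a, 0), 0) + (?D ((0, l), 0) + ?D ((0, 0), h'))"
  by (simp only: linear_add[OF lin])
 thus ?thesis by (simp add: 1 2 TF_alpha)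
qed

lemma GG_fd0:
 "FD (GG kk s) ((tau, 0), x, N) ((d, a), l, M) =
  (0, d *\<^sub>R Ys s x + tau *\<^sub>R (DYJ sg (jt w (Vs s) x) (\<Sum>i\<in>UNIV. a $ i *\<^sub>R jv (wk (kk i)) x) + FD (Ys s) x l),
  \<chi> r. d *\<^sub>R FD (Ys s) x (N $ r) + tau *\<^sub>R
   (DTJ sg (jt w (Vs s) x, FD (jt w (Vs s)) x (N $ r))
    (\<Sum>i\<in>UNIV. a $ i *\<^sub>R jv (wk (kk i)) x, \<Sum>i\<in>UNIV. a $ i *\<^sub>R jvD (wk (kk i)) x (N $ r))
   + D2Y s x (N $ r) l + FD (Ys s) x (M $ r)))"
proof -
 let ?u = "((tau, 0), x, N) :: state"
 have c: "((%u::state. (snd (fst u), fst (snd u))) has_derivative (%h. (snd (fst h), fst (snd h)))) (at ?u)"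
  by (auto intro!: derivative_eq_intros)
 have c2: "((%u::state. ((snd (fst u), fst (snd u)), snd (snd u) $ r)) has_derivative (%h. ((snd (fst h), fst (snd h)), snd (snd h) $ r))) (at ?u)" for r
  by (intro has_derivative_Pair c bounded_linear_imp_has_derivative bounded_linear_compose[OF bounded_linear_vec_nth]
   bounded_linear_compose[OF bounded_linear_snd] bounded_linear_snd)
 have t: "((%u::state. fst (fst u)) has_derivative (%h. fst (fst h))) (at ?u)"
  by (auto intro!: derivative_eq_intros)
 have yf: "(YF kk s has_derivative FD (YF kk s) (0, x)) (at (snd (fst ?u), fst (snd ?u)))"
  using YF_hd[of kk s "(0, x)"] by simp
 have tf: "(TF kk s has_derivative FD (TF kk s) ((0, x), N $ r)) (at ((snd (fst ?u), fst (snd ?u)), snd (snd ?u) $ r))" for r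
  using TF_hd[of kk s "((0, x), N $ r)"] by simp
 have "(GG kk s has_derivative (%h. (0,
   fst (fst ?u) *\<^sub>R FD (YF kk s) (0, x) (snd (fst h), fst (snd h)) + fst (fst h) *\<^sub>R YF kk s (snd (fst ?u), fst (snd ?u)),
   \<chi> r. fst (fst ?u) *\<^sub>R FD (TF kk s) ((0, x), N $ r) ((snd (fst h), fst (snd h)), snd (snd h) $ r)
    + fst (fst h) *\<^sub>R TF kk s ((snd (fst ?u), fst (snd ?u)), snd (snd ?u) $ r)))) (at ?u)"
  unfolding GG_def[abs_def]
  by (intro has_derivative_Pair has_derivative_const has_derivative_vec_lambda has_derivative_scaleR t
   has_derivative_compose[OF c yf] has_derivative_compose[OF c2 tf])
 from fun_cong[OF frechet_derivative_at[OF this], of "((d, a), l, M)"]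
 show ?thesis by (simp add: YF_fd0 TF_fd0 YF_0 TF_0 vec_eq_iff add.commute)
qed

end

section \<open>The rank lemma\<close>

lemma adjoint_ode:
 fixes A :: "real => 'e::euclidean_space => 'e"
 assumes lin: "!!t. t \<in> {0..1} ==> linear (A t)" and c: "!!h. continuous_on {0..1} (%t. A t h)"
 obtains p p' where "p 1 = p1" "!!t. t \<in> {0..1} ==> (p has_vector_derivative p' t) (at t within {0..1})"
  "!!t h. t \<in> {0..1} ==> p' t \<bullet> h = - (p t \<bullet> A t h)"
proof -
 have la: "linear (adjoint (A (1 - t)))" if "t \<in> {0..1}" for t
  using that by (intro adjoint_linear lin) auto
 have ca: "continuous_on {0..1} (%t. adjoint (A (1 - t)) h)" for h
 proof (rule continuous_on_componentwise[THEN iffD2], rule ballI)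
  fix b :: 'e assume "b \<in> Basis"
  have "continuous_on {0..1} (%t. A (1 - t) b \<bullet> h)"
   by (intro continuous_intros continuous_on_compose2[OF c]) auto
  thus "continuous_on {0..1} (%t. adjoint (A (1 - t)) h \<bullet> b)"
   by (rule continuous_on_eq) (simp add: inner_commute[of _ b] adjoint_works[OF lin])
 qed
 \<comment> \<open>The value is prescribed at time 1, so the equation is solved in reversed time
   \<open>1 - t\<close>.\<close>
 obtain y where y: "y 0 = p1" "!!t. t \<in> {0..1} ==> (y has_vector_derivative adjoint (A (1 - t)) (y t)) (at t within {0..1})"
  using linear_ode_exists[where A = "%t. adjoint (A (1 - t))", OF la ca, of p1] by blast
 have im: "(%t. 1 - t) ` {0..1::real} = {0..1}"
  by (auto intro!: image_eqI[of _ _ "1 - _"])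
 have "((%t. y (1 - t)) has_vector_derivative - adjoint (A t) (y (1 - t))) (at t within {0..1})" if t: "t \<in> {0..1}" for t
 proof -
  have "((%t. 1 - t) has_vector_derivative - 1) (at t within {0..1})"
   by (auto intro!: derivative_eq_intros)
  from vector_diff_chain_within[OF this, of y] y(2)[of "1 - t"] t show ?thesis
   unfolding im comp_def by simp
 qed
 moreover have "- adjoint (A t) (y (1 - t)) \<bullet> h = - (y (1 - t) \<bullet> A t h)" if "t \<in> {0..1}" for t h
  using adjoint_works[OF lin[OF that], of h "y (1 - t)"] by (simp add: inner_commute)
 ultimately show ?thesis
  by (intro that[of "%t. y (1 - t)"]) (use y(1) in auto)
qed

text \<open>Variation of constants in dual form: pairing with an adjoint solution removes the
  homogeneous part and leaves only the forcing term under the integral.\<close>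

lemma adjoint_pairing:
 fixes p y :: "real => 'e::euclidean_space"
 assumes p: "!!t. t \<in> {0..1} ==> (p has_vector_derivative p' t) (at t within {0..1})"
   "!!t h. t \<in> {0..1} ==> p' t \<bullet> h = - (p t \<bullet> A t h)"
  and y: "!!t. t \<in> {0..1} ==> (y has_vector_derivative c t + A t (y t)) (at t within {0..1})"
 shows "((%t. p t \<bullet> c t) has_integral (p 1 \<bullet> y 1 - p 0 \<bullet> y 0)) {0..1}"
proof (rule fundamental_theorem_of_calculus)
 fix t :: real assume t: "t \<in> {0..1}"
 have "((%t. p t \<bullet> y t) has_vector_derivative (p t \<bullet> (c t + A t (y t)) + p' t \<bullet> y t)) (at t within {0..1})"
  using bounded_bilinear.has_vector_derivative[OF bounded_bilinear_inner p(1)[OF t] y[OF t]] .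
 thus "((%t. p t \<bullet> y t) has_vector_derivative p t \<bullet> c t) (at t within {0..1})"
  by (simp add: p(2)[OF t] inner_add_right)
qed simp

lemma adjoint_pairing_const:
 fixes p y :: "real => 'e::euclidean_space"
 assumes p: "!!t. t \<in> {0..1} ==> (p has_vector_derivative p' t) (at t within {0..1})"
   "!!t h. t \<in> {0..1} ==> p' t \<bullet> h = - (p t \<bullet> A t h)"
  and y: "!!t. t \<in> {0..1} ==> (y has_vector_derivative A t (y t)) (at t within {0..1})"
  and t: "t \<in> {0..1}"
 shows "p t \<bullet> y t = p 1 \<bullet> y 1"
proof -
 have "((%t. p t \<bullet> y t) has_vector_derivative 0) (at t within {0..1})" if "t \<in> {0..1}" for t
  using bounded_bilinear.has_vector_derivative[OF bounded_bilinear_inner p(1)[OF that] y[OF that]]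
  by (simp add: p(2)[OF that])
 thus ?thesis
  using has_derivative_zero_unique[of "{0..1::real}" "%t. p t \<bullet> y t" t 1] t
  by (metis (no_types, lifting) atLeastAtMost_iff convex_closed_interval has_vector_derivative_zero_constant le_numeral_extra(4) zero_le_one)
qed

lemma has_vector_derivative_vec_lambda:
 fixes f :: "real => 'n::finite => 'b::euclidean_space"
 assumes "!!i. ((%t. f t i) has_vector_derivative f' i) (at t within S)"
 shows "((%t. \<chi> i. f t i) has_vector_derivative (\<chi> i. f' i)) (at t within S)"
proof -
 have "((%t. \<chi> i. f t i) has_derivative (%h. \<chi> i. h *\<^sub>R f' i)) (at t within S)"
  by (rule has_derivative_vec_lambda) (use assms in \<open>simp add: has_vector_derivative_def\<close>)
 moreover have "(%h::real. \<chi> i. h *\<^sub>R f' i) = (%h. h *\<^sub>R (\<chi> i. f' i))"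
  by (simp add: fun_eq_iff vec_eq_iff)
 ultimately show ?thesis by (simp add: has_vector_derivative_def)
qed

section \<open>Trace and determinant of the monodromy matrix\<close>

definition tr3 :: "real^3^3 => real" where "tr3 N = (\<Sum>i\<in>UNIV. N $ i $ i)"
definition dt3 :: "real^3^3 => real" where "dt3 N = N $ 1 \<bullet> cross3 (N $ 2) (N $ 3)"
text \<open>The cofactor matrix, which is the gradient of the determinant.\<close>

definition cof3 :: "real^3^3 => real^3^3" where
 "cof3 N = vector [cross3 (N $ 2) (N $ 3), cross3 (N $ 3) (N $ 1), cross3 (N $ 1) (N $ 2)]"

lemma Ck_tr3: "Ck n (%_. tr3)" unfolding tr3_def by (intro Ck_sum Ck_nth Ck_id)
lemma Ck_dt3: "Ck n (%_. dt3)" unfolding dt3_def by (intro Ck_inner Ck_cross3 Ck_nth Ck_id)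

lemma tr3_hd: "(tr3 has_derivative tr3) (at N)"
 unfolding tr3_def by (intro bounded_linear_imp_has_derivative bounded_linear_sum bounded_linear_compose[OF bounded_linear_vec_nth bounded_linear_vec_nth])

lemma dt3_hd: "(dt3 has_derivative (%M. cof3 N \<bullet> M)) (at N)"
proof -
 have n: "((%N. N $ i) has_derivative (%M. M $ i)) (at N)" for N :: "real^3^3" and i
  by (rule bounded_linear_imp_has_derivative) (rule bounded_linear_vec_nth)
 have "(dt3 has_derivative (%M. N $ 1 \<bullet> (cross3 (N $ 2) (M $ 3) + cross3 (M $ 2) (N $ 3)) + M $ 1 \<bullet> cross3 (N $ 2) (N $ 3))) (at N)"
  unfolding dt3_def[abs_def] by (intro hd_inner hd_cross3 n)
 thus ?thesis
  by (rule has_derivative_eq_rhs) (simp add: fun_eq_iff cof3_def inner_vec_def sum_3 cross3_simps)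
qed

lemma cof3_sum: "(\<Sum>r\<in>UNIV. (cof3 N $ r \<bullet> y) *\<^sub>R N $ r) = dt3 N *\<^sub>R y"
 by (simp add: vec_eq_iff forall_3 cof3_def dt3_def inner_vec_def sum_3 cross3_simps)

lemma cof3_inner: "cof3 N \<bullet> N = 3 * dt3 N"
 by (simp add: cof3_def dt3_def inner_vec_def sum_3 cross3_simps)

lemma tr3_inner: "tr3 M = mat 1 \<bullet> M"
 by (simp add: tr3_def inner_vec_def sum_3 mat_def)


section \<open>Variations of an orbit and the four equations\<close>

context principal_family
begin

abbreviation DY :: "'s => R3 => R3 => R3" where
 "DY s x \<equiv> FD (Ys s) x"

lemma linear_DY: "linear (DY s x)"
 using Ys_hd has_derivative_linear by blast

text \<open>\<open>None\<close> stands for the function \<open>ha\<close> at the initial point, \<open>Some (a, b, d)\<close> for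
 \<open>a + b tr N + d det N\<close> at time 1.\<close>

definition hs :: "(real \<times> real \<times> real) option => (3 => nat) => 's => ((real \<times> R3) \<times> R3) \<times> state => real" where
 "hs kd kk s z = (case kd of None => ha sg (JF kk s (snd (fst (fst z)), snd (fst z)))
  | Some (a, b, d) => a + b * tr3 (snd (snd (snd z))) + d * dt3 (snd (snd (snd z))))"

definition HH :: "(real \<times> real \<times> real) option => (3 => nat) => 's => (real \<times> R3) \<times> R3 => R3 \<times> real" where
 "HH kd kk s p = (fst (snd (UU kk s p 1)) - snd p, hs kd kk s (p, UU kk s p 1))"

lemma Ck_hs: "Ck 1 (hs kd kk)"
proof (cases kd)
 case None
 have "Ck 1 (%s (z::((real \<times> R3) \<times> R3) \<times> state). ha sg (JF kk s (snd (fst (fst z)), snd (fst z))))"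
  by (rule Ck_compose[OF Ck_ha Ck_compose[OF Ck_mono[OF Ck_JF]]]) (simp_all add: Ck_Pair Ck_snd Ck_fst Ck_id del: Ck.simps One_nat_def)
 thus ?thesis by (simp add: hs_def[abs_def] None del: Ck.simps)
next
 case (Some x)
 obtain a b d where x: "x = (a, b, d)" by (cases x)
 have "Ck 1 (%(s::'s) (z::((real \<times> R3) \<times> R3) \<times> state). a + b * tr3 (snd (snd (snd z))) + d * dt3 (snd (snd (snd z))))"
  by (intro Ck_add Ck_mult Ck_const Ck_compose[OF Ck_tr3] Ck_compose[OF Ck_dt3] Ck_snd Ck_id)
 thus ?thesis by (simp add: hs_def[abs_def] Some x del: Ck.simps)
qed

text \<open>With zero coefficients every choice \<open>kk\<close> gives the same equation; this
  justifies the fixed choice in \<open>orb\<close> and \<open>orbN\<close>.\<close>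

lemma base_sol: "t \<in> {0..1} ==> UU kk s ((tau, 0), x) t = UU kk' s ((tau, 0), x) t"
proof (rule UU_unique)
 have e: "GG kk s ((tau, 0), z) = GG kk' s ((tau, 0), z)" for z
  by (simp add: GG_def YF_0 TF_0)
 show "sol1 (GG kk' s) (UU kk s ((tau, 0), x))"
  unfolding sol1_def
 proof
  fix t :: real assume t: "t \<in> {0..1}"
  have "UU kk s ((tau, 0), x) t = ((tau, 0), snd (UU kk s ((tau, 0), x) t))"
   using UU(3)[OF t, of kk s "((tau, 0), x)"] by (simp add: prod_eq_iff)
  thus "(UU kk s ((tau, 0), x) has_vector_derivative GG kk' s (UU kk s ((tau, 0), x) t)) (at t within {0..1})"
   using UU(1)[of kk s "((tau, 0), x)"] t e unfolding sol1_def by metis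
 qed
 show "UU kk s ((tau, 0), x) 0 = ((tau, 0), x, mat 1)" using UU(2) by simp
qed auto

definition orb :: "'s => real => R3 => real => R3" where
 "orb s tau x t = fst (snd (UU (%_. 0) s ((tau, 0), x) t))"
definition orbN :: "'s => real => R3 => real => real^3^3" where
 "orbN s tau x t = snd (snd (UU (%_. 0) s ((tau, 0), x) t))"

lemma UU_orb: "t \<in> {0..1} ==> UU kk s ((tau, 0), x) t = ((tau, 0), orb s tau x t, orbN s tau x t)"
 using base_sol[of t kk s tau x "%_. 0"] UU(3)[of t "%_. 0" s "((tau, 0), x)"]
 by (simp add: orb_def orbN_def prod_eq_iff)

lemma orb_0: "orb s tau x 0 = x" "orbN s tau x 0 = mat 1"
 by (simp_all add: orb_def orbN_def UU)

lemma UU_vd: "t \<in> {0..1} ==> (UU kk s p has_vector_derivative GG kk s (UU kk s p t)) (at t within {0..1})"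
 using UU(1)[of kk s p] unfolding sol1_def by blast

lemma orb_vd: "t \<in> {0..1} ==> (orb s tau x has_vector_derivative tau *\<^sub>R Ys s (orb s tau x t)) (at t within {0..1})"
 and orbN_vd: "t \<in> {0..1} ==> (orbN s tau x has_vector_derivative (\<chi> r. tau *\<^sub>R DY s (orb s tau x t) (orbN s tau x t $ r))) (at t within {0..1})"
proof -
 let ?k = "%_::3. 0::nat"
 assume t: "t \<in> {0..1}"
 have oe: "(%t. fst (snd (UU (%_. 0) s ((tau, 0), x) t))) = orb s tau x"
  and oNe: "(%t. snd (snd (UU (%_. 0) s ((tau, 0), x) t))) = orbN s tau x"
  by (simp_all add: orb_def orbN_def fun_eq_iff)
 note v = UU_vd[OF t, of ?k s "((tau, 0), x)"]
 have v2: "((%t. snd (UU ?k s ((tau, 0), x) t)) has_vector_derivative snd (GG ?k s (UU ?k s ((tau, 0), x) t))) (at t within {0..1})"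
  using bounded_linear.has_vector_derivative[OF bounded_linear_snd v] .
 show "(orb s tau x has_vector_derivative tau *\<^sub>R Ys s (orb s tau x t)) (at t within {0..1})"
  using bounded_linear.has_vector_derivative[OF bounded_linear_fst v2]
  by (simp add: UU_orb[OF t] GG_def YF_0 oe)
 show "(orbN s tau x has_vector_derivative (\<chi> r. tau *\<^sub>R DY s (orb s tau x t) (orbN s tau x t $ r))) (at t within {0..1})"
  using bounded_linear.has_vector_derivative[OF bounded_linear_snd v2]
  by (simp add: UU_orb[OF t] GG_def TF_0 oNe)
qed

lemma orbN_row_vd: "t \<in> {0..1} ==> ((%t. orbN s tau x t $ r) has_vector_derivative tau *\<^sub>R DY s (orb s tau x t) (orbN s tau x t $ r)) (at t within {0..1})"
 using bounded_linear.has_vector_derivative[OF bounded_linear_vec_nth orbN_vd[of t s tau x], of r] by simp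

lemma continuous_orb: "continuous_on {0..1} (orb s tau x)" "continuous_on {0..1} (orbN s tau x)"
 by (rule continuous_on_vector_derivative, erule orb_vd orbN_vd)+

definition Bv :: "'s => real => R3 => real => R3 \<times> (real^3^3) => R3 \<times> (real^3^3)" where
 "Bv s tau x t z = (tau *\<^sub>R DY s (orb s tau x t) (fst z),
  \<chi> r. tau *\<^sub>R (D2Y s (orb s tau x t) (orbN s tau x t $ r) (fst z) + DY s (orb s tau x t) (snd z $ r)))"

text \<open>The forcing term produced by varying \<open>tau\<close>. It is also a solution of the
  homogeneous linearised equation (\<open>CT_vd\<close>), so the forced solution starting at 0 is
  simply \<open>t *\<^sub>R CT s tau x t\<close>.\<close>

definition CT :: "'s => real => R3 => real => R3 \<times> (real^3^3)" where
 "CT s tau x t = (Ys s (orb s tau x t), \<chi> r. DY s (orb s tau x t) (orbN s tau x t $ r))"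

definition Cv :: "'s => real => R3 => real => (R3 => R3) => R3 \<times> (real^3^3)" where
 "Cv s tau x t v = (tau *\<^sub>R DYJ sg (jt w (Vs s) (orb s tau x t)) (jv v (orb s tau x t)),
  \<chi> r. tau *\<^sub>R DTJ sg (jt w (Vs s) (orb s tau x t), FD (jt w (Vs s)) (orb s tau x t) (orbN s tau x t $ r))
    (jv v (orb s tau x t), jvD v (orb s tau x t) (orbN s tau x t $ r)))"

lemma GG_var:
 assumes t: "t \<in> {0..1}"
 shows "FD (GG kk s) (UU kk s ((tau, 0), x) t) ((d, a), z) =
  (0, d *\<^sub>R CT s tau x t + (\<Sum>i\<in>UNIV. a $ i *\<^sub>R Cv s tau x t (wk (kk i))) + Bv s tau x t z)"
proof -
 let ?g = "orb s tau x t" and ?N = "orbN s tau x t"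
 have D: "DYJ sg j (\<Sum>i\<in>UNIV. a $ i *\<^sub>R jv (wk (kk i)) y) = (\<Sum>i\<in>UNIV. a $ i *\<^sub>R DYJ sg j (jv (wk (kk i)) y))" for j y
  by (simp only: linear_sum[OF linear_DYJ] linear_scale[OF linear_DYJ])
 have T: "DTJ sg p (\<Sum>i\<in>UNIV. a $ i *\<^sub>R jv (wk (kk i)) y, \<Sum>i\<in>UNIV. a $ i *\<^sub>R jvD (wk (kk i)) y h)
   = (\<Sum>i\<in>UNIV. a $ i *\<^sub>R DTJ sg p (jv (wk (kk i)) y, jvD (wk (kk i)) y h))" for p y h
 proof -
  have "(\<Sum>i\<in>UNIV. a $ i *\<^sub>R jv (wk (kk i)) y, \<Sum>i\<in>UNIV. a $ i *\<^sub>R jvD (wk (kk i)) y h) =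
   (\<Sum>i\<in>UNIV. a $ i *\<^sub>R (jv (wk (kk i)) y, jvD (wk (kk i)) y h))"
   by (simp add: prod_eq_iff fst_sum snd_sum)
  thus ?thesis by (simp only: linear_sum[OF linear_DTJ] linear_scale[OF linear_DTJ])
 qed
 obtain l M where z: "z = (l, M)" by (cases z)
 show ?thesis
  unfolding UU_orb[OF t] z GG_fd0 D T
  by (simp add: CT_def Cv_def Bv_def prod_eq_iff fst_sum snd_sum vec_eq_iff scaleR_sum_right
   scaleR_add_right mult.commute algebra_simps)
qed

lemma lin_coeff:
 assumes "t \<in> {0..1}" shows "linear (Bv s tau x t)"
proof -
 have l: "linear (FD (GG kk s) (UU kk s ((tau, 0), x) t))" for kk
  by (rule varsol_linear_coeff(1)[OF Ck_fixed_param[OF Ck_GG] UU(1)])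
 have e: "Bv s tau x t z = snd (FD (GG (%_. 0) s) (UU (%_. 0) s ((tau, 0), x) t) ((0, 0), z))" for z
  by (simp add: GG_var[OF assms])
 have p: "((0::real, 0::R3), a + b) = ((0, 0), a) + ((0, 0), b)" "((0::real, 0::R3), c *\<^sub>R a) = c *\<^sub>R ((0, 0), a)" for a b :: "R3 \<times> (real^3^3)" and c :: real
  by (simp_all add: zero_prod_def)
 show ?thesis
  by (rule linearI) (simp_all only: e p linear_add[OF l] linear_scale[OF l] snd_add snd_scaleR)
qed

lemma continuous_coeff:
 "continuous_on {0..1} (%t. Bv s tau x t z)" "continuous_on {0..1} (%t. Cv s tau x t (wk k))"
proof -
 have c: "continuous_on {0..1} (%t. snd (FD (GG kk s) (UU kk s ((tau, 0), x) t) h))" for kk h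
  by (intro continuous_on_snd varsol_linear_coeff(2)[OF Ck_fixed_param[OF Ck_GG] UU(1)])
 show "continuous_on {0..1} (%t. Bv s tau x t z)"
  by (rule continuous_on_eq[OF c[of "%_. 0" "((0, 0), z)"]]) (simp add: GG_var)
 have B0: "Bv s tau x t 0 = 0" if "t \<in> {0..1}" for t
  using linear_0[OF lin_coeff[OF that]] .
 show "continuous_on {0..1} (%t. Cv s tau x t (wk k))"
  by (rule continuous_on_eq[OF c[of "%_. k" "((0, axis 1 1), 0)"]])
   (simp add: GG_var B0 axis_def if_distrib[of "%c. c *\<^sub>R _"] cong: if_cong)
qed

lemma vk_exists: "\<exists>y. y 0 = 0 & (\<forall>t\<in>{0..1}. (y has_vector_derivative Cv s tau x t (wk k) + Bv s tau x t (y t)) (at t within {0..1}))"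
proof -
 \<comment> \<open>All three slots carry the same field; the unit coefficient vector of the first
   slot then yields the variation by \<open>wk k\<close> alone.\<close>
 let ?kk = "%_::3. k"
 obtain y where y: "varsol (GG ?kk s) (UU ?kk s ((tau, 0), x)) y" "y 0 = ((0, axis 1 1), 0)"
  using varsol_flow[OF Ck_fixed_param[OF Ck_GG] UU(1), of ?kk s "((tau, 0), x)"] by metis
 have vy: "(y has_vector_derivative (0, fst (fst (y t)) *\<^sub>R CT s tau x t + (\<Sum>i\<in>UNIV. snd (fst (y t)) $ i *\<^sub>R Cv s tau x t (wk k)) + Bv s tau x t (snd (y t)))) (at t within {0..1})"
  if t: "t \<in> {0..1}" for t
  using y(1) t GG_var[OF t, of ?kk s tau x "fst (fst (y t))" "snd (fst (y t))" "snd (y t)"]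
  unfolding varsol_def by (metis prod.collapse)
 have "((%t. fst (y t)) has_vector_derivative 0) (at t within {0..1})" if "t \<in> {0..1}" for t
  using bounded_linear.has_vector_derivative[OF bounded_linear_fst vy[OF that]] by simp
 then obtain c where c: "!!t. t \<in> {0..1} ==> fst (y t) = c"
  using has_vector_derivative_zero_constant[of "{0..1::real}" "%t. fst (y t)"] by auto
 from c[of 0] y(2) have c': "c = (0, axis 1 1)" by simp
 have "((%t. snd (y t)) has_vector_derivative Cv s tau x t (wk k) + Bv s tau x t (snd (y t))) (at t within {0..1})" if t: "t \<in> {0..1}" for t
  using bounded_linear.has_vector_derivative[OF bounded_linear_snd vy[OF t]]
  by (simp add: c[OF t] c' axis_def if_distrib[of "%c. c *\<^sub>R _"] cong: if_cong)
 thus ?thesis using y(2) by (intro exI[of _ "%t. snd (y t)"]) auto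
qed

definition vk :: "'s => real => R3 => nat => real => R3 \<times> (real^3^3)" where
 "vk s tau x k = (SOME y. y 0 = 0 & (\<forall>t\<in>{0..1}. (y has_vector_derivative Cv s tau x t (wk k) + Bv s tau x t (y t)) (at t within {0..1})))"

lemma vk: "vk s tau x k 0 = 0"
 "t \<in> {0..1} ==> (vk s tau x k has_vector_derivative Cv s tau x t (wk k) + Bv s tau x t (vk s tau x k t)) (at t within {0..1})"
 using someI_ex[OF vk_exists[of s tau x k]] unfolding vk_def by auto

lemma CT_vd:
 assumes t: "t \<in> {0..1}"
 shows "(CT s tau x has_vector_derivative Bv s tau x t (CT s tau x t)) (at t within {0..1})"
proof -
 let ?g = "orb s tau x" and ?N = "orbN s tau x" and ?k = "%_::3. 0::nat"
 have a: "((%t. Ys s (?g t)) has_vector_derivative DY s (?g t) (tau *\<^sub>R Ys s (?g t))) (at t within {0..1})"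
  using vector_derivative_diff_chain_within[OF orb_vd[OF t] has_derivative_at_withinI[OF Ys_hd]]
  by (simp add: comp_def)
 have b: "((%t. DY s (?g t) (?N t $ r)) has_vector_derivative
   tau *\<^sub>R (D2Y s (?g t) (?N t $ r) (Ys s (?g t)) + DY s (?g t) (DY s (?g t) (?N t $ r)))) (at t within {0..1})" for r
 proof -
  have "((%t. ((0::R3, ?g t), ?N t $ r)) has_vector_derivative ((0, tau *\<^sub>R Ys s (?g t)), tau *\<^sub>R DY s (?g t) (?N t $ r))) (at t within {0..1})"
   by (intro has_vector_derivative_Pair has_vector_derivative_const orb_vd orbN_row_vd t)
  from vector_derivative_diff_chain_within[OF this has_derivative_at_withinI[OF TF_hd[of ?k s]]]
  have d: "((%t. DY s (?g t) (?N t $ r)) has_vector_derivative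
   FD (TF ?k s) ((0, ?g t), ?N t $ r) ((0, tau *\<^sub>R Ys s (?g t)), tau *\<^sub>R DY s (?g t) (?N t $ r))) (at t within {0..1})"
   by (simp add: comp_def TF_0)
  have "((0::R3, tau *\<^sub>R Ys s (?g t)), tau *\<^sub>R DY s (?g t) (?N t $ r)) = tau *\<^sub>R ((0, Ys s (?g t)), DY s (?g t) (?N t $ r))"
   by simp
  moreover have "linear (FD (TF ?k s) ((0, ?g t), ?N t $ r))"
   using TF_hd has_derivative_linear by blast
  ultimately have e: "FD (TF ?k s) ((0, ?g t), ?N t $ r) ((0, tau *\<^sub>R Ys s (?g t)), tau *\<^sub>R DY s (?g t) (?N t $ r))
    = tau *\<^sub>R FD (TF ?k s) ((0, ?g t), ?N t $ r) ((0, Ys s (?g t)), DY s (?g t) (?N t $ r))"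
   by (simp only: linear_scale)
  have "(0::jet, 0::jet) = 0" by (simp add: prod_eq_iff)
  hence "DTJ sg p (0::jet, 0::jet) = 0" for p using linear_0[OF linear_DTJ] by metis
  with d[unfolded e, unfolded TF_fd0] show ?thesis by simp
 qed
 show ?thesis
  unfolding CT_def[abs_def] Bv_def fst_conv snd_conv vec_lambda_beta
  using a by (intro has_vector_derivative_Pair)
   (simp_all add: linear_scale[OF linear_DY] has_vector_derivative_vec_lambda b)
qed

end

text \<open>The centre is within \<open>1 / i^2\<close> of \<open>x\<close> while the radius is
  \<open>1 / i\<close>, so the cut-off tends to 1 at \<open>x\<close>; the linear factor contributes
  nothing to the value and \<open>v\<close> to the derivative.\<close>

lemma jv_zero_limit:
 fixes q :: "nat => R3"
 assumes k: "k >= 7" and q: "!!i. i >= 1 ==> norm (q i - x) <= 1 / (real i)\<^sup>2"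
 shows "(%i. jv (tfield k (real i) (q i) 0 v 1 0 e) x) \<longlonglongrightarrow> (0, 0, outer e v)"
proof -
 have near: "real i * norm (x - q i) <= 1" "\<bar>real i * (v \<bullet> (x - q i))\<bar> <= norm v / i"
  "\<bar>(real i)\<^sup>2 * ((x - q i) \<bullet> (x - q i))\<bar> <= 1 / i" if i: "i >= 1" for i
 proof -
  have d: "norm (x - q i) <= 1 / (real i)\<^sup>2" using q[OF i] by (simp add: norm_minus_commute)
  have "real i * norm (x - q i) <= real i * (1 / (real i)\<^sup>2)" using d by (intro mult_left_mono) auto
  hence a: "real i * norm (x - q i) <= 1 / i" using i by (simp add: power2_eq_square)
  thus n1: "real i * norm (x - q i) <= 1" using i order_trans[OF a, of 1] by simp
  have "\<bar>real i * (v \<bullet> (x - q i))\<bar> <= real i * (norm v * norm (x - q i))"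
   using Cauchy_Schwarz_ineq2[of v "x - q i"] by (simp add: abs_mult mult_left_mono)
  also have "... = norm v * (real i * norm (x - q i))" by simp
  also have "... <= norm v * (1 / i)" by (intro mult_left_mono a) auto
  finally show "\<bar>real i * (v \<bullet> (x - q i))\<bar> <= norm v / i" by simp
  have "\<bar>(real i)\<^sup>2 * ((x - q i) \<bullet> (x - q i))\<bar> = (real i * norm (x - q i)) * (real i * norm (x - q i))"
   by (simp add: power2_eq_square flip: power2_norm_eq_inner)
  also have "... <= 1 * (1 / i)" by (intro mult_mono n1 a) auto
  finally show "\<bar>(real i)\<^sup>2 * ((x - q i) \<bullet> (x - q i))\<bar> <= 1 / i" by simp
 qed
 have inv: "(%i. c / real i) \<longlonglongrightarrow> 0" for c :: real
  by (rule lim_const_over_n)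
 have ts: "(%i. ts k (real i) (q i) 0 v 1 0 x) \<longlonglongrightarrow> 0"
  by (rule Lim_null_comparison[OF _ inv[of "norm v"]])
   (use near ts_bounds1(1)[OF k _ near(1), of _ 0] in \<open>auto simp: eventually_sequentially intro!: exI[of _ 1]\<close>)
 have P: "(%i. pq k (1 - (real i)\<^sup>2 * ((x - q i) \<bullet> (x - q i)))) \<longlonglongrightarrow> 1"
 proof -
  have "(%i. (real i)\<^sup>2 * ((x - q i) \<bullet> (x - q i))) \<longlonglongrightarrow> 0"
   by (rule Lim_null_comparison[OF _ inv[of 1]]) (use near(3) in \<open>auto simp: eventually_sequentially intro!: exI[of _ 1]\<close>)
  hence "(%i. 1 - (real i)\<^sup>2 * ((x - q i) \<bullet> (x - q i))) \<longlonglongrightarrow> 1 - 0" by (intro tendsto_diff tendsto_const)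
  from continuous_on_tendsto_compose[OF continuous_on_pq[of UNIV k] this] show ?thesis by (simp add: pq_def)
 qed
 have tsD: "(%i. tsD k (real i) (q i) 0 v 1 0 (axis r 1) x) \<longlonglongrightarrow> v $ r" for r
 proof -
  have "(%i. tsD k (real i) (q i) 0 v 1 0 (axis r 1) x - (v \<bullet> axis r 1) * pq k (1 - (real i)\<^sup>2 * ((x - q i) \<bullet> (x - q i)))) \<longlonglongrightarrow> 0"
   by (rule Lim_null_comparison[OF _ inv[of "real k * norm v"]])
    (use ts_bounds1(2)[OF k _ near(1) _ near(2), of _ "axis r 1"] in \<open>auto simp: eventually_sequentially intro!: exI[of _ 1]\<close>)
  from tendsto_add[OF this tendsto_mult[OF tendsto_const[of "v \<bullet> axis r 1"] P]] show ?thesis by (simp add: inner_axis)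
 qed
 have "(%i. jv (tfield k (real i) (q i) 0 v 1 0 e) x) \<longlonglongrightarrow> 0 *\<^sub>R (0, e, 0) + (\<Sum>i\<in>UNIV. v $ i *\<^sub>R (0, 0, axis i e))"
  unfolding jv_tfield[OF k] by (intro tendsto_intros ts tsD)
 moreover have "0 *\<^sub>R (0, e, 0) + (\<Sum>i\<in>UNIV. v $ i *\<^sub>R (0, 0, axis i e)) = (0::R3, 0::R3, outer e v)"
  by (simp add: outer_sum prod_eq_iff fst_sum snd_sum)
 ultimately show ?thesis by metis
qed

lemma jv_bounds:
 fixes q x :: "R3"
 assumes k: "k >= 7" and i: "i >= 1"
 shows "real i * norm (x - q) > 1 ==> jv (tfield k (real i) q 0 v 1 0 e) x = 0"
  and "\<bar>ts k (real i) q 0 v 1 0 x\<bar> <= norm v"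
  and "\<bar>tsD k (real i) q 0 v 1 0 (axis r 1) x\<bar> <= (real k + 1) * norm v"
proof -
 have z: "ts k (real i) q 0 v 1 0 x = 0 & tsD k (real i) q 0 v 1 0 h x = 0" if "real i * norm (x - q) > 1" for h
 proof -
  have "(real i)\<^sup>2 * ((x - q) \<bullet> (x - q)) = (real i * norm (x - q))\<^sup>2"
   by (simp add: power_mult_distrib power2_norm_eq_inner)
  also have "... >= 1" using that by simp
  finally show ?thesis using k by (simp add: ts_def tsD_def pq_eq_0_iff[THEN iffD2])
 qed
 show "real i * norm (x - q) > 1 ==> jv (tfield k (real i) q 0 v 1 0 e) x = 0"
  unfolding jv_tfield[OF k] using z by (simp add: prod_eq_iff fst_sum snd_sum)
 have "\<bar>ts k (real i) q 0 v 1 0 x\<bar> <= norm v & \<bar>tsD k (real i) q 0 v 1 0 (axis r 1) x\<bar> <= (real k + 1) * norm v"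
 proof (cases "real i * norm (x - q) > 1")
  case True thus ?thesis using z by simp
 next
  case False
  have "\<bar>real i * (v \<bullet> (x - q))\<bar> <= real i * (norm v * norm (x - q))"
   using Cauchy_Schwarz_ineq2[of v "x - q"] by (simp add: abs_mult mult_left_mono)
  also have "... = norm v * (real i * norm (x - q))" by simp
  also have "... <= norm v * 1" using False by (intro mult_left_mono) auto
  finally have v: "\<bar>real i * (v \<bullet> (x - q))\<bar> <= norm v" by simp
  have P: "\<bar>pq k (1 - (real i)\<^sup>2 * ((x - q) \<bullet> (x - q)))\<bar> <= 1" by (auto intro!: pq_le1)
  have "\<bar>v $ r * pq k (1 - (real i)\<^sup>2 * ((x - q) \<bullet> (x - q)))\<bar> <= norm v * 1"
   unfolding abs_mult by (intro mult_mono P component_le_norm_cart) auto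
  thus ?thesis
   using ts_bounds1[OF k _ _ _ v, of "axis r 1"] False i by (auto simp: inner_axis algebra_simps)
 qed
 thus "\<bar>ts k (real i) q 0 v 1 0 x\<bar> <= norm v" "\<bar>tsD k (real i) q 0 v 1 0 (axis r 1) x\<bar> <= (real k + 1) * norm v" by auto
qed

text \<open>The first-order jets of these bumps stay bounded, and at every interior time they are
  eventually 0 because the curve avoids \<open>x\<close> there. Dominated convergence thus separates
  a term evaluated at the base point from a term integrated along the orbit.\<close>

lemma jv_integral_limit:
 fixes gam m :: "real => R3" and L :: "real => jet => R3"
 assumes k: "k >= 7" and q: "q \<longlonglongrightarrow> x"
  and gam: "!!t. t \<in> {0<..<1} ==> gam t ~= x"
  and L: "!!t. linear (L t)" and c: "!!j. continuous_on {0..1} (%t. m t \<bullet> L t j)"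
  and int: "!!i. i >= 1 ==> ((%t. m t \<bullet> L t (jv (tfield k (real i) (q i) 0 v 1 0 e) (gam t))) has_integral I i) {0..1}"
 shows "I \<longlonglongrightarrow> 0"
proof -
 let ?f = "%i t. m t \<bullet> L t (jv (tfield k (real i) (q i) 0 v 1 0 e) (gam t))"
 define h where "h t = norm v * \<bar>m t \<bullet> L t (0, e, 0)\<bar> + (\<Sum>r\<in>UNIV. (real k + 1) * norm v * \<bar>m t \<bullet> L t (0, 0, axis r e)\<bar>)" for t
 have hi: "h integrable_on {0<..<1}"
 proof -
  have "continuous_on {0..1} h" unfolding h_def by (intro continuous_intros c)
  hence "h integrable_on {0..1}" by (rule integrable_continuous_real)
  thus ?thesis by (simp add: integrable_on_open_interval_real)
 qed
 have i1: "(?f (Suc i) has_integral I (Suc i)) {0<..<1}" for i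
  using int[of "Suc i"] by (simp add: has_integral_Icc_iff_Ioo)
 have bd: "norm (?f (Suc i) t) <= h t" for i t
 proof -
  let ?s = "ts k (real (Suc i)) (q (Suc i)) 0 v 1 0 (gam t)" and ?d = "%r. tsD k (real (Suc i)) (q (Suc i)) 0 v 1 0 (axis r 1) (gam t)"
  have "?f (Suc i) t = ?s * (m t \<bullet> L t (0, e, 0)) + (\<Sum>r\<in>UNIV. ?d r * (m t \<bullet> L t (0, 0, axis r e)))" (is "_ = ?A + ?B")
   unfolding jv_tfield[OF k] by (simp only: linear_add[OF L] linear_sum[OF L] linear_scale[OF L] inner_add_right inner_sum_right inner_scaleR_right)
  moreover have "\<bar>?A\<bar> <= norm v * \<bar>m t \<bullet> L t (0, e, 0)\<bar>"
   unfolding abs_mult by (intro mult_right_mono jv_bounds(2)[OF k]) auto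
  moreover have "\<bar>?B\<bar> <= (\<Sum>r\<in>UNIV. (real k + 1) * norm v * \<bar>m t \<bullet> L t (0, 0, axis r e)\<bar>)"
  proof (rule order_trans[OF sum_abs sum_mono])
   fix r
   show "\<bar>?d r * (m t \<bullet> L t (0, 0, axis r e))\<bar> <= (real k + 1) * norm v * \<bar>m t \<bullet> L t (0, 0, axis r e)\<bar>"
    unfolding abs_mult by (intro mult_right_mono jv_bounds(3)[OF k]) auto
  qed
  ultimately show ?thesis unfolding h_def real_norm_def by (simp only:)
 qed
 have pw: "(%i. ?f (Suc i) t) \<longlonglongrightarrow> 0" if t: "t \<in> {0<..<1}" for t
 proof -
  define d where "d = norm (gam t - x)"
  have d: "d > 0" using gam[OF t] by (simp add: d_def)
  have "\<forall>\<^sub>F i in sequentially. dist (q i) x < d / 2" using q d by (intro tendstoD) auto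
  moreover have "\<forall>\<^sub>F i in sequentially. real i > 2 / d"
   using filterlim_real_sequentially unfolding filterlim_at_top_dense by blast
  moreover have "\<forall>\<^sub>F i in sequentially. i >= (1::nat)" by (rule eventually_ge_at_top)
  ultimately have "\<forall>\<^sub>F i in sequentially. ?f i t = 0"
  proof eventually_elim
   case (elim i)
   have ip: "i >= 1" using elim(2) d by (cases i) (auto simp: divide_less_0_iff)
   have "d <= norm (gam t - q i) + norm (q i - x)" unfolding d_def using norm_triangle_ineq[of "gam t - q i" "q i - x"] by simp
   hence "norm (gam t - q i) > d / 2" using elim(1) by (simp add: dist_norm)
   hence "real i * norm (gam t - q i) > (2 / d) * (d / 2)" using elim(2) d ip by (intro mult_strict_mono) auto
   hence "jv (tfield k (real i) (q i) 0 v 1 0 e) (gam t) = 0"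
    using d ip by (intro jv_bounds(1)[OF k]) auto
   thus ?case by (simp only: linear_0[OF L] inner_zero_right)
  qed
  hence "(%i. ?f i t) \<longlonglongrightarrow> 0" by (rule tendsto_eventually)
  thus ?thesis by (rule LIMSEQ_Suc)
 qed
 have "(%i. integral {0<..<1} (?f (Suc i))) \<longlonglongrightarrow> integral {0<..<1::real} (%t. 0)"
 proof (rule dominated_convergence(2)[where f = "%i. ?f (Suc i)" and h = h])
  show "?f (Suc i) integrable_on {0<..<1}" for i using i1 by (rule has_integral_integrable)
 qed (use hi bd pw in auto)
 hence "(%i. I (Suc i)) \<longlonglongrightarrow> 0" using integral_unique[OF i1] by (simp del: of_nat_Suc)
 thus ?thesis by (rule LIMSEQ_imp_Suc)
qed


context principal_family
begin

lemma jv_sum: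
 assumes F: "finite F" and v: "v = (%y. \<Sum>k\<in>F. bet k *\<^sub>R wk k y)"
 shows "jv v y = (\<Sum>k\<in>F. bet k *\<^sub>R jv (wk k) y)" and "jvD v y h = (\<Sum>k\<in>F. bet k *\<^sub>R jvD (wk k) y h)"
proof -
 have wd: "(wk k has_derivative FD (wk k) y) (at y)" for k y
  using Ck_has_derivative[of 2 "%_::real. wk k"] wk by (simp add: num23 del: Ck.simps)
 have vd: "(v has_derivative (%h. \<Sum>k\<in>F. bet k *\<^sub>R FD (wk k) y h)) (at y)" for y
  unfolding v by (intro has_derivative_sum has_derivative_scaleR_right wd)
 have j: "jv v y = (\<Sum>k\<in>F. bet k *\<^sub>R jv (wk k) y)" for y
  unfolding jv_def jac_eqI[OF vd] by (simp add: v prod_eq_iff fst_sum snd_sum jac_def vec_eq_iff)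
 show "jv v y = (\<Sum>k\<in>F. bet k *\<^sub>R jv (wk k) y)" by (rule j)
 have v3: "Ck 3 (%_::real. v)" unfolding v by (intro Ck_sum Ck_scaleR Ck_const wk)
 have "((%y. \<Sum>k\<in>F. bet k *\<^sub>R jv (wk k) y) has_derivative (%h. \<Sum>k\<in>F. bet k *\<^sub>R jvD (wk k) y h)) (at y)"
  by (intro has_derivative_sum has_derivative_scaleR_right jv_hd wk)
 from has_derivative_unique[OF jv_hd[OF v3, unfolded j[abs_def]] this]
 show "jvD v y h = (\<Sum>k\<in>F. bet k *\<^sub>R jvD (wk k) y h)" by (simp add: fun_eq_iff)
qed

lemma Cv_sum:
 assumes "finite F" "v = (%y. \<Sum>k\<in>F. bet k *\<^sub>R wk k y)"
 shows "Cv s tau x t v = (\<Sum>k\<in>F. bet k *\<^sub>R Cv s tau x t (wk k))"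
proof -
 have D: "DYJ sg j (\<Sum>k\<in>F. bet k *\<^sub>R J k) = (\<Sum>k\<in>F. bet k *\<^sub>R DYJ sg j (J k))" for j J
  by (simp only: linear_sum[OF linear_DYJ] linear_scale[OF linear_DYJ])
 have T: "DTJ sg p (\<Sum>k\<in>F. bet k *\<^sub>R J k, \<Sum>k\<in>F. bet k *\<^sub>R J' k) = (\<Sum>k\<in>F. bet k *\<^sub>R DTJ sg p (J k, J' k))" for p J J'
 proof -
  have "(\<Sum>k\<in>F. bet k *\<^sub>R J k, \<Sum>k\<in>F. bet k *\<^sub>R J' k) = (\<Sum>k\<in>F. bet k *\<^sub>R (J k, J' k))"
   by (simp add: prod_eq_iff fst_sum snd_sum)
  thus ?thesis by (simp only: linear_sum[OF linear_DTJ] linear_scale[OF linear_DTJ])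
 qed
 show ?thesis
  unfolding Cv_def jv_sum[OF assms] D T
  by (simp add: prod_eq_iff fst_sum snd_sum vec_eq_iff scaleR_sum_right mult.commute mult.left_commute)
qed

text \<open>This and \<open>DvT\<close> are the partial derivatives of \<open>HH\<close> in the
  coefficients and in \<open>tau\<close>, see \<open>HH_SD\<close>. For \<open>None\<close> the last
  entry involves only the base point, where \<open>ha\<close> is evaluated.\<close>

definition Dv :: "(real \<times> real \<times> real) option => 's => real => R3 => nat => R3 \<times> real" where
 "Dv kd s tau x k = (fst (vk s tau x k 1), case kd of
  None => FD (ha sg) (jt w (Vs s) x) (jv (wk k) x)
 | Some (a, b, d) => b * tr3 (snd (vk s tau x k 1)) + d * (cof3 (orbN s tau x 1) \<bullet> snd (vk s tau x k 1)))"

definition DvT :: "(real \<times> real \<times> real) option => 's => real => R3 => R3 \<times> real" where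
 "DvT kd s tau x = (fst (CT s tau x 1), case kd of
  None => 0
 | Some (a, b, d) => b * tr3 (snd (CT s tau x 1)) + d * (cof3 (orbN s tau x 1) \<bullet> snd (CT s tau x 1)))"

lemma HH_SD:
 obtains L where "SD (HH kd kk) s ((tau, 0), x) L"
  "!!d a. L ((d, a), 0) = d *\<^sub>R DvT kd s tau x + (\<Sum>i\<in>UNIV. a $ i *\<^sub>R Dv kd s tau x (kk i))"
proof -
 let ?p = "((tau, 0), x) :: (real \<times> R3) \<times> R3"
 let ?u = "UU kk s ?p 1"
 define F where "F s z = (fst (snd (snd z)) - snd (fst z), hs kd kk s z)" for s and z :: "((real \<times> R3) \<times> R3) \<times> state"
 have cF: "Ck 1 F" unfolding F_def by (intro Ck_Pair Ck_diff Ck_fst Ck_snd Ck_id Ck_hs)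
 obtain Psi where Psi: "bounded_linear Psi" "!!d. \<exists>y. varsol (GG kk s) (UU kk s ?p) y & y 0 = d"
  "!!y. varsol (GG kk s) (UU kk s ?p) y ==> y 1 = Psi (y 0)"
  using varsol_flow[OF Ck_fixed_param[OF Ck_GG] UU(1), of kk s ?p] by metis
 let ?lam = "%p::(real \<times> R3) \<times> R3. (fst p, snd p, 0::real^3^3)"
 have "SD (%s p. UU kk s p 1) s ?p (%d. Psi (?lam d))"
  by (rule SD_flow[where G = "GG kk" and U = "UU kk" and \<iota> = "%p. (fst p, snd p, mat 1)" and lam = ?lam, OF Ck_GG UU(1) UU(2) _ _ Psi]) (auto intro!: bounded_linear_Pair bounded_linear_fst bounded_linear_snd)
 moreover have "SD (%s p::(real \<times> R3) \<times> R3. p) s ?p (%d. d)"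
  using SD_Ck[of "%s p::(real \<times> R3) \<times> R3. p" s ?p] Ck_id by (simp add: frechet_derivative_ident del: Ck.simps)
 ultimately have "SD (%s p. (p, UU kk s p 1)) s ?p (%d. (d, Psi (?lam d)))" by (intro SD_Pair)
 from SD_compose[OF this SD_Ck[OF cF]]
 have SD: "SD (HH kd kk) s ?p (%d. FD (F s) (?p, ?u) (d, Psi (?lam d)))"
  by (simp add: HH_def[abs_def] F_def[abs_def])
 have dF: "FD (F s) (?p, ?u) (((d, a), 0), ((d, a), l, M)) = (l, case kd of
   None => FD (ha sg) (jt w (Vs s) x) (\<Sum>i\<in>UNIV. a $ i *\<^sub>R jv (wk (kk i)) x)
  | Some (a, b, d) => b * tr3 M + d * (cof3 (orbN s tau x 1) \<bullet> M))" for d a l M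
 proof -
  have J0: "JF kk s (0, x) = jt w (Vs s) x" by (simp add: JF_def jt_def)
  have h: "(hs kd kk s has_derivative (%z. case kd of
   None => FD (ha sg) (jt w (Vs s) x) ((%(a, h). (\<Sum>i\<in>UNIV. a $ i *\<^sub>R jv (wk (kk i)) x) + FD (jt w (Vs s)) x h) (snd (fst (fst z)), snd (fst z)))
  | Some (a, b, d) => b * tr3 (snd (snd (snd z))) + d * (cof3 (orbN s tau x 1) \<bullet> snd (snd (snd z))))) (at (?p, ?u))"
  proof (cases kd)
   case None
   have z: "((%z::((real \<times> R3) \<times> R3) \<times> state. (snd (fst (fst z)), snd (fst z))) has_derivative (%z. (snd (fst (fst z)), snd (fst z)))) (at (?p, ?u))"
    by (auto intro!: derivative_eq_intros)
   have "(ha sg has_derivative FD (ha sg) (jt w (Vs s) x)) (at (JF kk s (0, x)))"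
    unfolding J0 by (rule ha_has_derivative)
   note h = has_derivative_compose[OF JF_hd0 this]
   have "((%z. ha sg (JF kk s (snd (fst (fst z)), snd (fst z)))) has_derivative (%z. FD (ha sg) (jt w (Vs s) x) ((%(a, h). (\<Sum>i\<in>UNIV. a $ i *\<^sub>R jv (wk (kk i)) x) + FD (jt w (Vs s)) x h) (snd (fst (fst z)), snd (fst z))))) (at (?p, ?u))"
    by (rule has_derivative_compose[OF z, of "%y. ha sg (JF kk s y)"]) (use h in simp)
   thus ?thesis by (simp add: hs_def[abs_def] None)
  next
   case (Some y)
   obtain a b d where y: "y = (a, b, d)" by (cases y)
   have N: "snd (snd ?u) = orbN s tau x 1" by (simp add: UU_orb)
   have z: "((%z::((real \<times> R3) \<times> R3) \<times> state. snd (snd (snd z))) has_derivative (%z. snd (snd (snd z)))) (at (?p, ?u))"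
    by (auto intro!: derivative_eq_intros)
   have "((%z::((real \<times> R3) \<times> R3) \<times> state. tr3 (snd (snd (snd z)))) has_derivative (%z. tr3 (snd (snd (snd z))))) (at (?p, ?u))"
    by (rule has_derivative_compose[OF z tr3_hd])
   moreover have "((%z::((real \<times> R3) \<times> R3) \<times> state. dt3 (snd (snd (snd z)))) has_derivative (%z. cof3 (orbN s tau x 1) \<bullet> (snd (snd (snd z))))) (at (?p, ?u))"
    using has_derivative_compose[OF z dt3_hd] by (simp add: N)
   ultimately have "((%z::((real \<times> R3) \<times> R3) \<times> state. a + b * tr3 (snd (snd (snd z))) + d * dt3 (snd (snd (snd z)))) has_derivative
    (%z. 0 + b * tr3 (snd (snd (snd z))) + d * (cof3 (orbN s tau x 1) \<bullet> (snd (snd (snd z)))))) (at (?p, ?u))"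
    by (intro has_derivative_add has_derivative_const has_derivative_mult_right)
   thus ?thesis by (simp add: hs_def[abs_def] Some y)
  qed
  have "((%z::((real \<times> R3) \<times> R3) \<times> state. fst (snd (snd z)) - snd (fst z)) has_derivative (%z. fst (snd (snd z)) - snd (fst z))) (at (?p, ?u))"
   by (auto intro!: derivative_eq_intros)
  from has_derivative_Pair[OF this h]
  have "(F s has_derivative (%z. (fst (snd (snd z)) - snd (fst z), case kd of
   None => FD (ha sg) (jt w (Vs s) x) ((%(a, h). (\<Sum>i\<in>UNIV. a $ i *\<^sub>R jv (wk (kk i)) x) + FD (jt w (Vs s)) x h) (snd (fst (fst z)), snd (fst z)))
  | Some (a, b, d) => b * tr3 (snd (snd (snd z))) + d * (cof3 (orbN s tau x 1) \<bullet> snd (snd (snd z)))))) (at (?p, ?u))"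
   unfolding F_def .
  moreover have "linear (FD (jt w (Vs s)) x)" using jt_hd has_derivative_linear by blast
  ultimately show ?thesis
   using fun_cong[OF frechet_derivative_at, of "F s" _ "(?p, ?u)" "(((d, a), 0), ((d, a), l, M))"]
   by (auto simp: linear_0 split: option.splits)
 qed
 show ?thesis
 proof (rule that[OF SD])
  fix d a
  define y where "y t = ((d, a), (d * t) *\<^sub>R CT s tau x t + (\<Sum>i\<in>UNIV. a $ i *\<^sub>R vk s tau x (kk i) t))" for t
  have "varsol (GG kk s) (UU kk s ?p) y"
   unfolding varsol_def
  proof
   fix t :: real assume t: "t \<in> {0..1}"
   note lB = lin_coeff[OF t, of s tau x]
   have "(y has_vector_derivative (0, ((d * t) *\<^sub>R Bv s tau x t (CT s tau x t) + d *\<^sub>R CT s tau x t)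
     + (\<Sum>i\<in>UNIV. a $ i *\<^sub>R (Cv s tau x t (wk (kk i)) + Bv s tau x t (vk s tau x (kk i) t))))) (at t within {0..1})"
    unfolding y_def[abs_def]
    by (intro has_vector_derivative_Pair has_vector_derivative_const has_vector_derivative_add has_vector_derivative_sum
     has_vector_derivative_scaleR[OF _ CT_vd[OF t]] bounded_linear.has_vector_derivative[OF bounded_linear_scaleR_right vk(2)[OF t]])
     (auto intro!: derivative_eq_intros)
   moreover have "FD (GG kk s) (UU kk s ?p t) (y t) = (0, ((d * t) *\<^sub>R Bv s tau x t (CT s tau x t) + d *\<^sub>R CT s tau x t)
     + (\<Sum>i\<in>UNIV. a $ i *\<^sub>R (Cv s tau x t (wk (kk i)) + Bv s tau x t (vk s tau x (kk i) t))))"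
    unfolding y_def GG_var[OF t]
    by (simp add: linear_add[OF lB] linear_scale[OF lB] linear_sum[OF lB] scaleR_add_right sum.distrib)
   ultimately show "(y has_vector_derivative FD (GG kk s) (UU kk s ?p t) (y t)) (at t within {0..1})"
    by simp
  qed
  moreover have "y 0 = ((d, a), 0, 0)" by (simp add: y_def vk(1)) (simp add: zero_prod_def)
  ultimately have e: "Psi ((d, a), 0, 0) = ((d, a), d *\<^sub>R CT s tau x 1 + (\<Sum>i\<in>UNIV. a $ i *\<^sub>R vk s tau x (kk i) 1))"
   using Psi(3)[of y] by (simp add: y_def)
  have lin: "linear (FD (ha sg) j)" for j using ha_has_derivative has_derivative_linear by blast
  have t3: "tr3 (d *\<^sub>R M + (\<Sum>i\<in>UNIV. a $ i *\<^sub>R M' i)) = d * tr3 M + (\<Sum>i\<in>UNIV. a $ i * tr3 (M' i))" for M M'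
   by (simp add: tr3_inner inner_add_right inner_sum_right)
  have "d *\<^sub>R CT s tau x 1 + (\<Sum>i\<in>UNIV. a $ i *\<^sub>R vk s tau x (kk i) 1) = (d *\<^sub>R fst (CT s tau x 1) + (\<Sum>i\<in>UNIV. a $ i *\<^sub>R fst (vk s tau x (kk i) 1)),
   d *\<^sub>R snd (CT s tau x 1) + (\<Sum>i\<in>UNIV. a $ i *\<^sub>R snd (vk s tau x (kk i) 1)))"
   by (simp add: prod_eq_iff fst_sum snd_sum)
  thus "FD (F s) (?p, ?u) (((d, a), 0), Psi (?lam ((d, a), 0)))
   = d *\<^sub>R DvT kd s tau x + (\<Sum>i\<in>UNIV. a $ i *\<^sub>R Dv kd s tau x (kk i))"
   unfolding fst_conv snd_conv e
   by (simp only: dF) (simp add: prod_eq_iff DvT_def Dv_def fst_sum snd_sum linear_sum[OF lin] linear_scale[OF lin] t3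
    inner_add_right inner_sum_right sum.distrib sum_distrib_left algebra_simps split: option.splits)
 qed
qed


text \<open>In the linearised system the variation of the orbit is independent of the variation of
  the matrix. Hence the adjoint system has solutions with zero matrix part, and for
  \<open>G = 0\<close> one of these is taken.\<close>

lemma adjoint_orb:
 obtains p p' where "p 1 = (\<mu>, G)" "!!t. t \<in> {0..1} ==> (p has_vector_derivative p' t) (at t within {0..1})"
  "!!t h. t \<in> {0..1} ==> p' t \<bullet> h = - (p t \<bullet> Bv s tau x t h)" "!!t. G = 0 ==> t \<in> {0..1} ==> snd (p t) = 0"
proof (cases "G = 0")
 case True
 have l: "linear (%h. tau *\<^sub>R DY s (orb s tau x t) h)" for t
  by (intro linear_compose_scale_right linear_DY)
 have c: "continuous_on {0..1} (%t. tau *\<^sub>R DY s (orb s tau x t) h)" for h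
  using continuous_on_fst[OF continuous_coeff(1), of s tau x "(h, 0)"] by (simp add: Bv_def)
 obtain m m' where m: "m 1 = \<mu>" "!!t. t \<in> {0..1} ==> (m has_vector_derivative m' t) (at t within {0..1})"
  "!!t h. t \<in> {0..1} ==> m' t \<bullet> h = - (m t \<bullet> (tau *\<^sub>R DY s (orb s tau x t) h))"
  using adjoint_ode[OF l c] by metis
 show ?thesis
  by (rule that[of "%t. (m t, 0)" "%t. (m' t, 0)"])
   (use m True in \<open>auto intro!: has_vector_derivative_Pair has_vector_derivative_const simp: Bv_def\<close>)
next
 case False
 obtain p p' where "p 1 = (\<mu>, G)" "!!t. t \<in> {0..1} ==> (p has_vector_derivative p' t) (at t within {0..1})"
  "!!t h. t \<in> {0..1} ==> p' t \<bullet> h = - (p t \<bullet> Bv s tau x t h)"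
  using adjoint_ode[OF lin_coeff continuous_coeff(1)] by metis
 with False that show ?thesis by blast
qed

lemma row_solution:
 assumes "!!t. t \<in> {0..1} ==> (u has_vector_derivative tau *\<^sub>R DY s (orb s tau x t) (u t)) (at t within {0..1})" "t \<in> {0..1}"
 shows "((%t. (0, axis r (u t))) has_vector_derivative Bv s tau x t (0, axis r (u t))) (at t within {0..1})"
proof -
 have D0: "DY s y 0 = 0" for y by (rule linear_0[OF linear_DY])
 have e: "Bv s tau x t (0, axis r (u t)) = (0, axis r (tau *\<^sub>R DY s (orb s tau x t) (u t)))"
  by (auto simp: Bv_def D0 D2Y_0 vec_eq_iff axis_def)
 have bl: "bounded_linear (axis r :: R3 => real^3^3)"
  by (intro linear_conv_bounded_linear[THEN iffD1] linearI) (auto simp: axis_def vec_eq_iff)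
 show ?thesis unfolding e
  by (intro has_vector_derivative_Pair has_vector_derivative_const bounded_linear.has_vector_derivative[OF bl] assms)
qed

lemma Ys_orb_vd: "t \<in> {0..1} ==> ((%t. Ys s (orb s tau x t)) has_vector_derivative tau *\<^sub>R DY s (orb s tau x t) (Ys s (orb s tau x t))) (at t within {0..1})"
 using bounded_linear.has_vector_derivative[OF bounded_linear_fst CT_vd] by (simp add: CT_def Bv_def)

lemma row_unique:
 assumes u: "!!t. t \<in> {0..1} ==> (u has_vector_derivative tau *\<^sub>R DY s (orb s tau x t) (u t)) (at t within {0..1})"
  and v: "!!t. t \<in> {0..1} ==> (v has_vector_derivative tau *\<^sub>R DY s (orb s tau x t) (v t)) (at t within {0..1})"
  and a: "a \<in> {0..1}" "u a = v a" and t: "t \<in> {0..1}"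
 shows "u t = v t"
proof -
 have l: "linear (%h. tau *\<^sub>R DY s (orb s tau x t) h)" for t
  by (intro linear_compose_scale_right linear_DY)
 have c: "continuous_on {0..1} (%t. tau *\<^sub>R DY s (orb s tau x t) h)" for h
  using continuous_on_fst[OF continuous_coeff(1), of s tau x "(h, 0)"] by (simp add: Bv_def)
 show ?thesis by (rule linear_ode_unique[OF l c u v a t])
qed

lemma rows_comb_vd:
 "t \<in> {0..1} ==> ((%t. \<Sum>r\<in>UNIV. c r *\<^sub>R orbN s tau x t $ r) has_vector_derivative
  tau *\<^sub>R DY s (orb s tau x t) (\<Sum>r\<in>UNIV. c r *\<^sub>R orbN s tau x t $ r)) (at t within {0..1})"
 unfolding linear_sum[OF linear_DY] linear_scale[OF linear_DY] scaleR_sum_right scaleR_left_commute[of tau]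
 by (intro has_vector_derivative_sum bounded_linear.has_vector_derivative[OF bounded_linear_scaleR_right] orbN_row_vd)

text \<open>The linearised flow transports the field along its own orbits: both sides solve the same
  linear equation with the same initial value.\<close>

lemma Ys_orb_expand: "t \<in> {0..1} ==> Ys s (orb s tau x t) = (\<Sum>r\<in>UNIV. Ys s x $ r *\<^sub>R orbN s tau x t $ r)"
 by (rule row_unique[OF Ys_orb_vd rows_comb_vd, where a = 0])
  (auto simp: orb_0 vec_eq_iff forall_3 sum_3 mat_def)

lemma Ys_orb_nonzero: "Ys s x ~= 0 ==> t \<in> {0..1} ==> Ys s (orb s tau x t) ~= 0"
proof
 assume Y: "Ys s x ~= 0" and t: "t \<in> {0..1}" and 0: "Ys s (orb s tau x t) = 0"
 have z: "((%_. 0) has_vector_derivative tau *\<^sub>R DY s (orb s tau x t) 0) (at t within {0..1})" for t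
  by (simp add: linear_0[OF linear_DY])
 have "Ys s (orb s tau x 0) = 0"
  by (rule row_unique[OF Ys_orb_vd z t]) (use 0 in auto)
 thus False using Y by (simp add: orb_0)
qed

end

text \<open>The test fields must be finite combinations of the countably many \<open>wk\<close>,
  exactly and not just approximately, so that a covector annihilating every \<open>wk\<close>
  annihilates the test fields by linearity.\<close>

locale principal_span = principal_family sg w Vs wk
 for sg and w and Vs :: "'s::topological_space => R3 => R3" and wk +
 fixes kT :: nat and QS :: "R3 set"
 assumes kT: "kT >= 7" and dense: "!!p e. e > 0 ==> \<exists>q\<in>QS. norm (q - p) <= e"
  and span: "!!i q c1 v1 c2 v2 e. i >= 1 ==> q \<in> QS ==> \<exists>F bet. finite F &
   tfield kT (real i) q c1 v1 c2 v2 e = (%y. \<Sum>k\<in>F. bet k *\<^sub>R wk k y)"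
begin

text \<open>Injectivity lets a bump meet the orbit at a single time. The last inequality is the
  difference between two evaluations of a conserved trace in \<open>rank_lemma\<close>; together
  with a time of nonzero \<open>ha\<close> it makes the spectral equation transversal.\<close>

definition good_pt :: "(real \<times> real \<times> real) option => 's => real => R3 => bool" where
 "good_pt kd s tau x \<longleftrightarrow> tau > 0 & Ys s x ~= 0 & orb s tau x 1 = x &
  (\<forall>t\<in>{0<..<1}. \<forall>t'\<in>{0..1}. orb s tau x t' = orb s tau x t --> t' = t) &
  (case kd of None => ha sg (jt w (Vs s) x) = 0
   | Some (a, b, d) => a + b * tr3 (orbN s tau x 1) + d * dt3 (orbN s tau x 1) = 0 &
     (\<exists>t\<in>{0<..<1}. ha sg (jt w (Vs s) (orb s tau x t)) ~= 0) &
     b * (tr3 (orbN s tau x 1) - 1) + 2 * d * dt3 (orbN s tau x 1) ~= 0)"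

text \<open>The spectral component \<open>kpa\<close> is eliminated first; then the matrix part of
  the adjoint solution is zero and \<open>m_zero\<close> removes the rest. For \<open>None\<close>,
  bumps at the base point isolate \<open>ha\<close>, as the integral along the orbit tends to 0. In
  the other cases the trace of \<open>Wop\<close> is conserved and can be evaluated both by
  \<open>W_rank_one\<close> and at time 1.\<close>

lemma rank_lemma:
 assumes good: "good_pt kd s tau x" and cT: "c \<bullet> DvT kd s tau x = 0" and ck: "!!k. c \<bullet> Dv kd s tau x k = 0"
 shows "c = 0"
proof -
 let ?g = "orb s tau x" and ?N = "orbN s tau x" and ?j = "jt w (Vs s)"
 obtain \<mu> kpa where c: "c = (\<mu>, kpa)" by (cases c)
 have tau: "tau > 0" and Y0: "Ys s x ~= 0" and cl: "?g 1 = x"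
  and inj: "!!t t'. t \<in> {0<..<1} ==> t' \<in> {0..1} ==> ?g t' = ?g t ==> t' = t"
  using good by (auto simp: good_pt_def)
 have V3: "Ck 3 (%_::real. Vs s)" by (rule Ck_fixed_param[OF Vs])
 have c01: "(1::real) \<in> {0..1}" by simp
 \<comment> \<open>The gradient of the fourth equation with respect to the final matrix, scaled by
   \<open>kpa\<close>. Its direct dependence on the field at the base point is collected in
   \<open>hx\<close>.\<close>
 define G where "G = (case kd of None => 0 | Some (a, b, d) => kpa *\<^sub>R (b *\<^sub>R mat 1 + d *\<^sub>R cof3 (?N 1)))"
 define hx where "hx v = (case kd of None => kpa * FD (ha sg) (?j x) (jv v x) | Some _ => 0)" for v
 obtain p p' where p1: "p 1 = (\<mu>, G)"
  and p: "!!t. t \<in> {0..1} ==> (p has_vector_derivative p' t) (at t within {0..1})"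
  and p': "!!t h. t \<in> {0..1} ==> p' t \<bullet> h = - (p t \<bullet> Bv s tau x t h)"
  and pG: "!!t. G = 0 ==> t \<in> {0..1} ==> snd (p t) = 0"
  using adjoint_orb[of \<mu> G s tau x] by blast
 define m where "m t = fst (p t)" for t
 define n where "n t = snd (p t)" for t
 have cp: "continuous_on {0..1} p" using p by (rule continuous_on_vector_derivative)
 have cm: "continuous_on {0..1} m" and cn: "continuous_on {0..1} n"
  unfolding m_def n_def by (intro continuous_intros cp)+
 have intk: "((%t. p t \<bullet> Cv s tau x t (wk k)) has_integral - hx (wk k)) {0..1}" for k
 proof -
  have "p 1 \<bullet> vk s tau x k 1 = - hx (wk k)"
   using ck[of k] by (cases "vk s tau x k 1")
    (auto simp: p1 G_def hx_def c Dv_def tr3_inner inner_add_left algebra_simps split: option.splits)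
  thus ?thesis
   using adjoint_pairing[OF p p' vk(2), of k] by (simp add: vk(1))
 qed
 have int: "((%t. p t \<bullet> Cv s tau x t v) has_integral - hx v) {0..1}"
  if v: "v = tfield kT (real i) q c1 v1 c2 v2 e" and i: "i >= 1" and q: "q \<in> QS" for v i q c1 v1 c2 v2 e
 proof -
  obtain F bet where F: "finite F" "v = (%y. \<Sum>k\<in>F. bet k *\<^sub>R wk k y)"
   using span[OF i q, of c1 v1 c2 v2 e] unfolding v by (elim exE conjE)
  have lin: "linear (FD (ha sg) (?j x))" using ha_has_derivative has_derivative_linear by blast
  have "hx v = (\<Sum>k\<in>F. bet k * hx (wk k))"
   by (simp add: hx_def jv_sum(1)[OF F] linear_sum[OF lin] linear_scale[OF lin] sum_distrib_left mult.left_commute split: option.splits)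
  moreover have "((%t. \<Sum>k\<in>F. bet k * (p t \<bullet> Cv s tau x t (wk k))) has_integral (\<Sum>k\<in>F. bet k * (- hx (wk k)))) {0..1}"
   by (intro has_integral_sum F(1) has_integral_mult_right intk)
  ultimately show ?thesis
   by (simp add: Cv_sum[OF F] inner_sum_right sum_negf)
 qed
 have pair: "p t \<bullet> Cv s tau x t v = tau * (m t \<bullet> DYJ sg (?j (?g t)) (jv v (?g t))
  + (\<Sum>r\<in>UNIV. n t $ r \<bullet> DTJ sg (?j (?g t), frechet_derivative ?j (at (?g t)) (?N t $ r)) (jv v (?g t), jvD v (?g t) (?N t $ r))))" for t v
  by (cases "p t") (simp add: Cv_def m_def n_def inner_vec_def[of "_ :: real^3^3"] sum_distrib_left distrib_left)
 have pT: "m t \<bullet> Ys s (?g t) = 0" if n0: "G = 0" and t: "t \<in> {0..1}" for t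
 proof -
  have "p t \<bullet> CT s tau x t = p 1 \<bullet> CT s tau x 1"
   by (rule adjoint_pairing_const[OF p p' CT_vd t])
  also have "... = \<mu> \<bullet> fst (CT s tau x 1)" using n0 by (cases "CT s tau x 1") (simp add: p1)
  also have "... = c \<bullet> DvT kd s tau x - G \<bullet> snd (CT s tau x 1)"
   by (auto simp: G_def c DvT_def tr3_inner inner_add_left algebra_simps split: option.splits)
  also have "... = 0" using cT n0 by simp
  finally show ?thesis using pG[OF n0 t] by (cases "p t") (simp add: m_def CT_def)
 qed
 have kpa: "kpa = 0"
 proof (cases kd)
  case None
  have h0: "ha sg (?j x) = 0" using good by (simp add: good_pt_def None)
  have G0: "G = 0" by (simp add: G_def None)
  have key: "kpa * FD (ha sg) (?j x) (0, 0, outer e v) = 0" for e v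
  proof -
   have "\<exists>q\<in>QS. norm (q - x) <= 1 / (real (max 1 i))\<^sup>2" for i by (rule dense) auto
   then obtain q where q: "!!i. q i \<in> QS" "!!i. norm (q i - x) <= 1 / (real (max 1 i))\<^sup>2" by metis
   have q1: "norm (q i - x) <= 1 / (real i)\<^sup>2" if "i >= 1" for i using q(2)[of i] that by (simp add: max_def)
   have ql: "q \<longlonglongrightarrow> x"
   proof (rule LIM_zero_cancel, rule Lim_null_comparison)
    show "(%i. 1 / (real i)) \<longlonglongrightarrow> 0" by (rule lim_const_over_n)
    have "norm (q i - x) <= 1 / real i" if i: "i >= 1" for i
    proof -
     have "1 / (real i)\<^sup>2 <= 1 / real i" using i by (intro divide_left_mono) (auto simp: power2_eq_square)
     thus ?thesis using q1[OF i] by linarith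
    qed
    thus "\<forall>\<^sub>F i in sequentially. norm (q i - x) <= 1 / real i" by (auto simp: eventually_sequentially)
   qed
   have gx: "?g t ~= x" if "t \<in> {0<..<1}" for t
    using inj[OF that, of 0] that by (auto simp: orb_0)
   have cD: "continuous_on {0..1} (%t. m t \<bullet> DYJ sg (?j (?g t)) h)" for h
   proof -
    have "Ck 0 (%(_::real) i. DYJ sg i h)"
     using Ck_directional[of 0 "%_. YJ sg" "%(_::real) i. i" "%_ _. h"] Ck_YJ[of 1 sg] by (simp del: Ck.simps)
    note cDY = Ck_continuous_arg[OF this, of UNIV]
    have "continuous_on {0..1} (%t. ?j (?g t))"
     by (rule continuous_on_compose2[OF Ck_continuous_arg[OF Ck_jt_s, of UNIV] continuous_orb(1)]) auto
    thus ?thesis by (intro continuous_intros cm continuous_on_compose2[OF cDY]) auto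
   qed
   have "((%t. m t \<bullet> DYJ sg (?j (?g t)) (jv (tfield kT (real i) (q i) 0 v 1 0 e) (?g t))) has_integral
     (- hx (tfield kT (real i) (q i) 0 v 1 0 e) / tau)) {0..1}" if i: "i >= 1" for i
   proof -
    have "((%t. p t \<bullet> Cv s tau x t (tfield kT (real i) (q i) 0 v 1 0 e) / tau) has_integral (- hx (tfield kT (real i) (q i) 0 v 1 0 e) / tau)) {0..1}"
     by (rule has_integral_divide[OF int[OF refl i q(1)]])
    thus ?thesis
     by (rule has_integral_eq[rotated]) (use tau pG[OF G0] in \<open>simp add: pair n_def\<close>)
   qed
   from jv_integral_limit[OF kT ql gx linear_DYJ cD this]
   have "(%i. - hx (tfield kT (real i) (q i) 0 v 1 0 e) / tau) \<longlonglongrightarrow> 0" .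
   from tendsto_mult[OF this tendsto_const[of "- tau"]]
   have l1: "(%i. hx (tfield kT (real i) (q i) 0 v 1 0 e)) \<longlonglongrightarrow> 0" using tau by simp
   have "bounded_linear (FD (ha sg) (?j x))" using ha_has_derivative has_derivative_bounded_linear by blast
   from bounded_linear.tendsto[OF this jv_zero_limit[OF kT q1]]
   have "(%i. kpa * FD (ha sg) (?j x) (jv (tfield kT (real i) (q i) 0 v 1 0 e) x)) \<longlonglongrightarrow>
    kpa * FD (ha sg) (?j x) (0, 0, outer e v)"
    by (intro tendsto_mult tendsto_const)
   from LIMSEQ_unique[OF l1[unfolded hx_def None option.case] this] show ?thesis by simp
  qed
  let ?Z = "cross3 (Vs s x) (Ys s x)"
  have "FD (ha sg) (?j x) (0, 0, outer (Ys s x) ?Z - outer ?Z (Ys s x)) ~= 0"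
   by (rule Dha_outer[OF sg Vs0[of s x] _ refl Y0 refl h0]) (simp add: jt_def)
  moreover have "linear (FD (ha sg) (?j x))" using ha_has_derivative has_derivative_linear by blast
  from linear_diff[OF this, of "(0, 0, outer (Ys s x) ?Z)" "(0, 0, outer ?Z (Ys s x))"]
  have "kpa * FD (ha sg) (?j x) (0, 0, outer (Ys s x) ?Z - outer ?Z (Ys s x)) = 0"
   by (simp add: right_diff_distrib key)
  ultimately show ?thesis by simp
 next
  case (Some abd)
  obtain a b d where kd: "kd = Some (a, b, d)" using Some by (cases abd) auto
  obtain t0 where t0: "t0 \<in> {0<..<1}" "ha sg (?j (?g t0)) ~= 0"
   and nz: "b * (tr3 (?N 1) - 1) + 2 * d * dt3 (?N 1) ~= 0"
   using good by (auto simp: good_pt_def kd)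
  define \<omega> where "\<omega> = kpa * (b + d * dt3 (?N 1))"
  have G: "G = kpa *\<^sub>R (b *\<^sub>R mat 1 + d *\<^sub>R cof3 (?N 1))" by (simp add: G_def kd)
  have fn: "((%t. m t \<bullet> DYJ sg (?j (?g t)) (jv (tfield kT (real i) q c1 v1 c2 v2 e) (?g t))
    + (\<Sum>r\<in>UNIV. n t $ r \<bullet> DTJ sg (?j (?g t), frechet_derivative ?j (at (?g t)) (?N t $ r))
      (jv (tfield kT (real i) q c1 v1 c2 v2 e) (?g t), jvD (tfield kT (real i) q c1 v1 c2 v2 e) (?g t) (?N t $ r))))
   has_integral 0) {0..1}" if "i >= 1" "q \<in> QS" for i q c1 v1 c2 v2 e
  proof -
   have "((%t. p t \<bullet> Cv s tau x t (tfield kT (real i) q c1 v1 c2 v2 e) / tau) has_integral (- hx (tfield kT (real i) q c1 v1 c2 v2 e) / tau)) {0..1}"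
    by (rule has_integral_divide[OF int[OF refl that]])
   hence "((%t. p t \<bullet> Cv s tau x t (tfield kT (real i) q c1 v1 c2 v2 e) / tau) has_integral 0) {0..1}"
    by (simp add: hx_def kd)
   thus ?thesis by (rule has_integral_eq[rotated]) (use tau in \<open>simp add: pair\<close>)
  qed
  have n': "((%t. n t $ r) has_vector_derivative snd (p' t) $ r) (at t within {0..1})" if "t \<in> {0..1}" for t r
   unfolding n_def
   by (intro bounded_linear.has_vector_derivative[OF bounded_linear_vec_nth] bounded_linear.has_vector_derivative[OF bounded_linear_snd] p that)
  have ax: "snd z $ r \<bullet> h = z \<bullet> (0, axis r h)" for z :: "R3 \<times> (real^3^3)" and r h
   by (cases z) (simp add: inner_axis)
  have n'h: "snd (p' t) $ r \<bullet> h = - (tau * (n t $ r \<bullet> DY s (?g t) h))" if t: "t \<in> {0..1}" for t r h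
  proof -
   have "Bv s tau x t (0, axis r h) = (0, axis r (tau *\<^sub>R DY s (?g t) h))"
    by (auto simp: Bv_def D2Y_0 linear_0[OF linear_DY] vec_eq_iff axis_def)
   hence "p' t \<bullet> (0, axis r h) = - (p t \<bullet> (0, axis r (tau *\<^sub>R DY s (?g t) h)))" by (simp only: p'[OF t])
   thus ?thesis unfolding ax[symmetric] n_def by simp
  qed
  have con: "n t $ r \<bullet> Ys s (?g t) = n 1 $ r \<bullet> Ys s x" if t: "t \<in> {0..1}" for t r
   using adjoint_pairing_const[OF p p' row_solution[OF Ys_orb_vd] t] by (simp add: ax n_def cl)
  have trc: "(\<Sum>r\<in>UNIV. n t $ r \<bullet> ?N t $ r) = (\<Sum>r\<in>UNIV. n 1 $ r \<bullet> ?N 1 $ r)" if t: "t \<in> {0..1}" for t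
  proof (rule sum.cong[OF refl])
   fix r show "n t $ r \<bullet> ?N t $ r = n 1 $ r \<bullet> ?N 1 $ r"
    using adjoint_pairing_const[OF p p' row_solution[OF orbN_row_vd] t, of r r] by (simp add: ax n_def)
  qed
  have n1: "n 1 = G" by (simp add: n_def p1)
  have Y1: "(\<Sum>r\<in>UNIV. Ys s x $ r *\<^sub>R ?N 1 $ r) = Ys s x"
   using Ys_orb_expand[OF c01, of s tau x] cl by simp
  \<comment> \<open>The identity part of \<open>G\<close> contributes \<open>b\<close>, because the
    field at the base point of a closed orbit is fixed by the linearised return; the cofactor part
    contributes \<open>d * dt3\<close> by \<open>cof3_sum\<close>.\<close>
  have e1: "(\<Sum>r\<in>UNIV. (n 1 $ r \<bullet> Ys s x) *\<^sub>R ?N 1 $ r) = \<omega> *\<^sub>R Ys s x"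
  proof -
   have "n 1 $ r \<bullet> Ys s x = kpa * (b * Ys s x $ r + d * (cof3 (?N 1) $ r \<bullet> Ys s x))" for r
   proof -
    have "(mat 1 :: real^3^3) $ r \<bullet> Ys s x = Ys s x $ r" using exhaust_3[of r] by (auto simp: mat_def inner_vec_def sum_3)
    thus ?thesis by (simp add: n1 G inner_add_left)
   qed
   hence "(\<Sum>r\<in>UNIV. (n 1 $ r \<bullet> Ys s x) *\<^sub>R ?N 1 $ r) = kpa *\<^sub>R (b *\<^sub>R (\<Sum>r\<in>UNIV. Ys s x $ r *\<^sub>R ?N 1 $ r)
     + d *\<^sub>R (\<Sum>r\<in>UNIV. (cof3 (?N 1) $ r \<bullet> Ys s x) *\<^sub>R ?N 1 $ r))"
    by (simp add: scaleR_sum_right sum.distrib scaleR_add_right scaleR_add_left algebra_simps)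
   thus ?thesis unfolding Y1 cof3_sum by (simp add: \<omega>_def algebra_simps)
  qed
  have W: "(\<Sum>r\<in>UNIV. (n t $ r \<bullet> Ys s (?g t)) *\<^sub>R ?N t $ r) = \<omega> *\<^sub>R Ys s (?g t)" if t: "t \<in> {0..1}" for t
  proof -
   have sc: "((%t. \<omega> *\<^sub>R Ys s (?g t)) has_vector_derivative tau *\<^sub>R DY s (?g t) (\<omega> *\<^sub>R Ys s (?g t))) (at t within {0..1})" if "t \<in> {0..1}" for t
    unfolding linear_scale[OF linear_DY] scaleR_left_commute[of tau]
    by (intro bounded_linear.has_vector_derivative[OF bounded_linear_scaleR_right] Ys_orb_vd that)
   show ?thesis unfolding con[OF t]
    by (rule row_unique[OF rows_comb_vd sc c01 _ t]) (use e1 cl in auto)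
  qed
  have Wg: "Wop ?N n t (Ys s (?g t)) = \<omega> *\<^sub>R Ys s (?g t)" if "t \<in> {0..1}" for t
   unfolding Wop_def by (rule W[OF that])
  have "(\<Sum>r\<in>UNIV. n t0 $ r \<bullet> ?N t0 $ r) = \<omega>"
   by (rule W_rank_one[where k = kT and gam = "?g" and N = "?N" and m = m and n = n and QS = QS and sg = sg and w = w
     and V = "Vs s" and tau = tau and n' = "%t r. snd (p' t) $ r" and \<omega> = \<omega>,
     OF kT sg w V3 tau orb_vd continuous_orb(2) cm cn Ys_orb_nonzero[OF Y0] Vs0 inj dense fn orbN_row_vd n' n'h Wg t0])
  moreover have "(\<Sum>r\<in>UNIV. n 1 $ r \<bullet> ?N 1 $ r) = kpa * (b * tr3 (?N 1) + d * (3 * dt3 (?N 1)))"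
   unfolding n1 inner_vec_def[of G, symmetric] unfolding G
   by (simp add: inner_add_left tr3_inner cof3_inner algebra_simps)
  moreover have tr0: "(\<Sum>r\<in>UNIV. n t0 $ r \<bullet> ?N t0 $ r) = (\<Sum>r\<in>UNIV. n 1 $ r \<bullet> ?N 1 $ r)"
   using t0(1) by (intro trc) auto
  \<comment> \<open>The right side is the trace at \<open>t0\<close>, the left side the same trace
    at time 1. The factor 3 is the degree of the determinant, by \<open>cof3_inner\<close>.\<close>
  ultimately have tw: "kpa * (b * tr3 (?N 1) + d * (3 * dt3 (?N 1))) = kpa * (b + d * dt3 (?N 1))"
   using tr0 unfolding \<omega>_def by metis
  have "kpa * (b * (tr3 (?N 1) - 1) + 2 * d * dt3 (?N 1)) = kpa * (b * tr3 (?N 1) + d * (3 * dt3 (?N 1))) - kpa * (b + d * dt3 (?N 1))"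
   by (simp only: algebra_simps)
  hence "kpa * (b * (tr3 (?N 1) - 1) + 2 * d * dt3 (?N 1)) = 0" using tw by simp
  thus ?thesis using nz by simp
 qed
 hence G0: "G = 0" by (auto simp: G_def split: option.splits)
 have hx0: "hx v = 0" for v by (auto simp: hx_def kpa split: option.splits)
 have fn: "((%t. m t \<bullet> DYJ sg (?j (?g t)) (jv (tfield kT (real i) q c1 v1 c2 v2 e) (?g t))
    + (\<Sum>r\<in>UNIV. n t $ r \<bullet> DTJ sg (?j (?g t), frechet_derivative ?j (at (?g t)) (?N t $ r))
      (jv (tfield kT (real i) q c1 v1 c2 v2 e) (?g t), jvD (tfield kT (real i) q c1 v1 c2 v2 e) (?g t) (?N t $ r))))
   has_integral 0) {0..1}" if "i >= 1" "q \<in> QS" for i q c1 v1 c2 v2 e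
 proof -
  have "((%t. p t \<bullet> Cv s tau x t (tfield kT (real i) q c1 v1 c2 v2 e) / tau) has_integral (- hx (tfield kT (real i) q c1 v1 c2 v2 e) / tau)) {0..1}"
   by (rule has_integral_divide[OF int[OF refl that]])
  hence "((%t. p t \<bullet> Cv s tau x t (tfield kT (real i) q c1 v1 c2 v2 e) / tau) has_integral 0) {0..1}"
   by (simp add: hx0)
  thus ?thesis by (rule has_integral_eq[rotated]) (use tau in \<open>simp add: pair\<close>)
 qed
 have n0: "n t = 0" if "t \<in> {0..1}" for t using pG[OF G0 that] by (simp add: n_def)
 have "m t = 0" if "t \<in> {0<..<1}" for t
  by (rule m_zero[where k = kT and gam = "?g" and N = "?N" and m = m and n = n and QS = QS and sg = sg and w = w
     and V = "Vs s" and tau = tau,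
     OF kT sg w V3 tau orb_vd continuous_orb(2) cm cn Ys_orb_nonzero[OF Y0] Vs0 inj dense fn n0 pT[OF G0] that])
 hence "m 1 = 0"
  using continuous_constant_on_closure[of "{0<..<1}" m 0 1] cm by (simp add: closure_greaterThanLessThan)
 thus ?thesis using kpa by (simp add: c m_def p1 zero_prod_def)
qed

end

section \<open>Exceptional parameters\<close>

text \<open>As no nonzero covector annihilates everything, \<open>v\<close> and the family span a
  space of dimension 4. Since \<open>v\<close> is nonzero, three members complete it to a basis;
  this is where the number of coefficients comes from.\<close>

lemma complete_basis:
 fixes v :: "R3 \<times> real" and f :: "nat => R3 \<times> real"
 assumes v: "v ~= 0" and perp: "!!c. c \<bullet> v = 0 ==> (!!k. c \<bullet> f k = 0) ==> c = 0"
 shows "\<exists>(kk :: 3 => nat) B. inj kk & B > 0 &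
  (\<forall>d a. B * norm (d, a) <= norm (d *\<^sub>R v + (\<Sum>i\<in>UNIV. a $ i *\<^sub>R f (kk i))))"
proof -
 let ?V = "insert v (range f)"
 have sp: "span ?V = UNIV"
 proof (rule ccontr)
  assume "span ?V ~= UNIV"
  from span_not_UNIV_orthogonal[OF this] obtain c where "c ~= 0" "\<forall>x\<in>span ?V. c \<bullet> x = 0" by blast
  moreover have "v \<in> span ?V" "f k \<in> span ?V" for k by (auto intro: span_base)
  ultimately show False using perp by blast
 qed
 obtain B where B: "{v} \<subseteq> B" "B \<subseteq> ?V" "independent B" "?V \<subseteq> span B"
  using maximal_independent_subset_extend[of "{v}" ?V] v by auto
 have fin: "finite B" using B(3) independent_imp_finite by blast
 have "card B = dim ?V" using basis_card_eq_dim[OF B(2,4,3)] .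
 also have "... = DIM(R3 \<times> real)" using sp by (metis dim_span dim_UNIV)
 finally have "card B = 4" by simp
 hence "card (B - {v}) = card (UNIV :: 3 set)" using B(1) fin by (simp add: card_Diff_singleton)
 then obtain b where b: "bij_betw b (UNIV :: 3 set) (B - {v})"
  using finite_same_card_bij[of "UNIV :: 3 set" "B - {v}"] fin by auto
 have "\<exists>k. f k = b i" for i
 proof -
  have "b i \<in> B - {v}" using b by (auto simp: bij_betw_def)
  hence "b i \<in> range f" using B(2) by blast
  thus ?thesis by (metis rangeE)
 qed
 then obtain kk where kk: "!!i. f (kk i) = b i" by metis
 have inj: "inj b" and rb: "range b = B - {v}" using b by (auto simp: bij_betw_def)
 let ?T = "%z::real \<times> R3. fst z *\<^sub>R v + (\<Sum>i\<in>UNIV. snd z $ i *\<^sub>R f (kk i))"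
 have lin: "linear ?T"
  by (rule linearI) (simp_all add: algebra_simps sum.distrib scaleR_sum_right)
 have injT: "inj ?T"
 proof (subst linear_injective_0[OF lin], intro allI impI)
  fix z assume z: "?T z = 0"
  define c where "c x = (if x = v then fst z else snd z $ (inv b x))" for x
  have vb: "b i ~= v" for i using rb by blast
  have "(\<Sum>x\<in>B. c x *\<^sub>R x) = c v *\<^sub>R v + (\<Sum>x\<in>B - {v}. c x *\<^sub>R x)"
   using B(1) fin by (simp add: sum.remove)
  also have "(\<Sum>x\<in>B - {v}. c x *\<^sub>R x) = (\<Sum>i\<in>UNIV. c (b i) *\<^sub>R b i)"
   unfolding rb[symmetric] by (simp add: sum.reindex[OF inj])
  finally have "(\<Sum>x\<in>B. c x *\<^sub>R x) = 0" using z vb by (simp add: c_def kk inv_f_f[OF inj])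
  hence c0: "!!x. x \<in> B ==> c x = 0" using B(3) unfolding independent_explicit by blast
  have "snd z $ i = 0" for i
  proof -
   have "b i \<in> B" using rb by blast
   from c0[OF this] show ?thesis using vb by (simp add: c_def inv_f_f[OF inj])
  qed
  moreover have "fst z = 0" using c0[of v] B(1) by (simp add: c_def)
  ultimately show "z = 0" by (simp add: prod_eq_iff vec_eq_iff)
 qed
 obtain C where C0: "C > 0" "!!z. C * norm z <= norm (?T z)"
  by (rule linear_inj_bounded_below_pos[OF lin injT]) (rule that)
 have C: "C * norm (d, a) <= norm (d *\<^sub>R v + (\<Sum>i\<in>UNIV. a $ i *\<^sub>R f (kk i)))"
  for d a using C0(2)[of "(d, a)"] by simp
 have "inj kk" using inj kk by (metis injI injD)
 thus ?thesis using C0(1) C by blast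
qed

text \<open>By the Lipschitz bound \<open>snd p\<close> determines \<open>fst p\<close>. The set in
  question is thus the image of part of a plane, which is null, under a Lipschitz map between spaces
  of equal dimension 3.\<close>

lemma negligible_projection:
 fixes Z :: "((real \<times> R3) \<times> R3) set"
 assumes pl: "!!p. p \<in> Z ==> snd p $ i = c"
  and lip: "!!p p'. p \<in> Z ==> p' \<in> Z ==> norm (fst p - fst p') <= C * norm (snd p - snd p')"
 shows "negligible ((%p. snd (fst p)) ` Z)"
proof -
 define g where "g x = snd (fst (SOME p. p \<in> Z & snd p = x))" for x
 have g: "g (snd p) = snd (fst p)" if "p \<in> Z" for p
 proof -
  let ?p = "SOME p'. p' \<in> Z & snd p' = snd p"
  have "?p \<in> Z & snd ?p = snd p" by (rule someI[of _ p]) (use that in simp)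
  with lip[of ?p p] that show ?thesis by (simp add: g_def)
 qed
 have "negligible (g ` (snd ` Z))"
 proof (rule negligible_locally_Lipschitz_image)
  have "negligible {x::R3. axis i 1 \<bullet> x = c}" by (rule negligible_hyperplane) (simp add: axis_eq_0_iff)
  thus "negligible (snd ` Z)"
   by (rule negligible_subset) (use pl in \<open>auto simp: inner_axis'\<close>)
  fix x assume "x \<in> snd ` Z"
  then obtain p where p: "p \<in> Z" "x = snd p" by blast
  have "norm (g y - g x) <= C * norm (y - x)" if y: "y \<in> snd ` Z" for y
  proof -
   obtain p' where p': "p' \<in> Z" "y = snd p'" using y by blast
   have "norm (g y - g x) = norm (snd (fst p' - fst p))" by (simp add: p p' g)
   also have "... <= norm (fst p' - fst p)" by (metis norm_snd_le prod.collapse)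
   also have "... <= C * norm (y - x)" using lip[OF p'(1) p(1)] by (simp add: p p')
   finally show ?thesis .
  qed
  thus "\<exists>T B. open T & x \<in> T & (\<forall>y\<in>snd ` Z \<inter> T. norm (g y - g x) <= B * norm (y - x))"
   by (intro exI[of _ UNIV] exI[of _ C]) auto
 qed simp
 moreover have "g ` (snd ` Z) = (%p. snd (fst p)) ` Z"
  by (auto simp: g image_image cong: image_cong)
 ultimately show ?thesis by simp
qed

context principal_span
begin

text \<open>The derivative in (\<open>tau\<close>, \<open>alp\<close>) is bounded below by
  \<open>B\<close>, and strict differentiability keeps the error below \<open>B / 2\<close>. The
  difference of two points with the same value is therefore controlled by its component in
  \<open>x\<close>, uniformly for parameters near \<open>s0\<close>.\<close>

lemma local_lipschitz_zeros:
 assumes good: "good_pt kd s0 tau0 x0"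
 obtains kk S d C where "inj kk" "open S" "s0 \<in> S" "d > 0"
  "!!s p p'. s \<in> S ==> norm (p - ((tau0, 0), x0)) < d ==> norm (p' - ((tau0, 0), x0)) < d ==>
   HH kd kk s p = HH kd kk s p' ==> norm (fst p - fst p') <= C * norm (snd p - snd p')"
proof -
 have Y0: "Ys s0 x0 ~= 0" using good by (simp add: good_pt_def)
 have "fst (DvT kd s0 tau0 x0) = Ys s0 (orb s0 tau0 x0 1)" by (simp add: DvT_def CT_def)
 hence "DvT kd s0 tau0 x0 ~= 0" using Ys_orb_nonzero[OF Y0, of 1] by auto
 note nz = this
 have "\<exists>(kk :: 3 => nat) B. inj kk & B > 0 &
  (\<forall>d a. B * norm (d, a) <= norm (d *\<^sub>R DvT kd s0 tau0 x0 + (\<Sum>i\<in>UNIV. a $ i *\<^sub>R Dv kd s0 tau0 x0 (kk i))))"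
  by (rule complete_basis[OF nz]) (blast intro: rank_lemma[OF good])
 then obtain kk :: "3 => nat" and B where kk: "inj kk" and B: "B > 0"
  "!!d (a::R3). B * norm (d, a) <= norm (d *\<^sub>R DvT kd s0 tau0 x0 + (\<Sum>i\<in>UNIV. a $ i *\<^sub>R Dv kd s0 tau0 x0 (kk i)))"
  by (elim exE conjE) auto
 obtain L where L: "SD (HH kd kk) s0 ((tau0, 0), x0) L"
  "!!d a. L ((d, a), 0) = d *\<^sub>R DvT kd s0 tau0 x0 + (\<Sum>i\<in>UNIV. a $ i *\<^sub>R Dv kd s0 tau0 x0 (kk i))"
  by (rule HH_SD[of kd kk s0 tau0 x0]) (rule that)
 have bl: "bounded_linear L" using SD_D(1)[OF L(1)] .
 obtain K where K: "K > 0" "!!z. norm (L z) <= norm z * K" using bounded_linear.pos_bounded[OF bl] by blast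
 obtain S d where S: "open S" "s0 \<in> S" "d > 0"
  and sd: "!!s p p'. s \<in> S ==> norm (p - ((tau0, 0), x0)) < d ==> norm (p' - ((tau0, 0), x0)) < d ==>
    norm (HH kd kk s p - HH kd kk s p' - L (p - p')) <= B / 2 * norm (p - p')"
  using SD_D(2)[OF L(1), of "B / 2"] B(1) by (metis half_gt_zero)
 have "norm (fst p - fst p') <= ((K + B / 2) / (B / 2)) * norm (snd p - snd p')"
  if s: "s \<in> S" and p: "norm (p - ((tau0, 0), x0)) < d" "norm (p' - ((tau0, 0), x0)) < d" and e: "HH kd kk s p = HH kd kk s p'" for s p p'
 proof -
  let ?a = "norm (fst p - fst p')" and ?b = "norm (snd p - snd p')"
  have "p - p' = (fst p - fst p', snd p - snd p')" by (simp add: prod_eq_iff)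
  hence np: "norm (p - p') <= ?a + ?b"
   using norm_triangle_ineq[of "(fst (p - p'), 0)" "(0, snd (p - p'))"] by (simp add: norm_Pair)
  have "norm (L (p - p')) <= B / 2 * norm (p - p')" using sd[OF s p] by (simp add: e)
  also have "... <= B / 2 * (?a + ?b)" using np B(1) by (intro mult_left_mono) auto
  finally have 1: "norm (L (p - p')) <= B / 2 * (?a + ?b)" .
  have "p - p' = (fst (p - p'), 0) + (0, snd (p - p'))" by (simp add: prod_eq_iff)
  hence "L (p - p') = L (fst (p - p'), 0) + L (0, snd (p - p'))"
   using linear_add[OF bounded_linear.linear[OF bl]] by metis
  hence "norm (L (fst (p - p'), 0)) <= norm (L (p - p')) + norm (L (0, snd (p - p')))"
   using norm_triangle_ineq4[of "L (p - p')" "L (0, snd (p - p'))"] by simp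
  moreover have "norm (L (0, snd (p - p'))) <= ?b * K" using K(2)[of "(0, snd (p - p'))"] by (simp add: norm_Pair)
  moreover have "B * ?a <= norm (L (fst (p - p'), 0))"
  proof -
   obtain d a where "fst p - fst p' = (d, a)" by (cases "fst p - fst p'")
   thus ?thesis using B(2)[of d a] L(2)[of d a] by simp
  qed
  ultimately have "B * ?a <= B / 2 * (?a + ?b) + ?b * K" using 1 by linarith
  hence "B / 2 * ?a <= (K + B / 2) * ?b" by (simp add: algebra_simps)
  thus ?thesis using B(1) by (simp add: field_simps)
 qed
 thus ?thesis using that kk S by blast
qed

lemma continuous_HH: "continuous_on UNIV (%(s, q). HH kd kk s ((fst q, 0), snd q))"
proof -
 define F where "F = (%(s, q). HH kd kk s ((fst q, 0), snd q))"
 have "\<exists>A. open A & z \<in> A & (\<forall>y\<in>A. F y \<in> B)"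
  if B: "open B" "F z \<in> B" for z B
 proof -
  obtain s tau x where z: "z = (s, tau, x)" by (cases z)
  obtain e where e: "e > 0" "!!y. dist y (HH kd kk s ((tau, 0), x)) < e ==> y \<in> B"
   using B unfolding z by (auto simp: open_dist F_def)
  obtain L where L: "SD (HH kd kk) s ((tau, 0), x) L" using HH_SD by metis
  from SD_D(3)[OF L e(1)] obtain S d where S: "open S" "s \<in> S" "d > 0"
   "\<forall>s'\<in>S. \<forall>p. norm (p - ((tau, 0), x)) < d --> norm (HH kd kk s' p - HH kd kk s ((tau, 0), x)) < e"
   by blast
  have *: "norm (((tau', 0::R3), x') - ((tau, 0), x)) = norm ((tau', x') - (tau, x))" for tau' x'
   by (simp add: norm_Pair)
  have "HH kd kk s' ((tau', 0), x') \<in> B" if "s' \<in> S" "(tau', x') \<in> ball (tau, x) d" for s' tau' x'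
  proof -
   have "norm ((tau', x') - (tau, x)) < d" using that(2) by (metis mem_ball dist_norm dist_commute)
   thus ?thesis using S(4) that(1) * by (intro e(2)) (simp add: dist_norm)
  qed
  with S show ?thesis
   by (intro exI[of _ "S \<times> ball (tau, x) d"]) (auto simp: z F_def open_Times simp del: mem_ball)
 qed
 note nb = this
 have "continuous_on UNIV F"
  unfolding continuous_on_topological
 proof (intro ballI allI impI)
  fix z B assume "open B" "F z \<in> B"
  from nb[OF this] obtain A where "open A" "z \<in> A" "\<forall>y\<in>A. F y \<in> B" by (elim exE conjE)
  thus "\<exists>A. open A & z \<in> A & (\<forall>y\<in>UNIV. y \<in> A --> F y \<in> B)" by (intro exI[of _ A]) simp
 qed
 thus ?thesis by (simp add: F_def)
qed

end

text \<open>Adding small multiples of three of the fields can be realised by moving the parameter.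
  This is the link between null sets of coefficients and open sets of parameters.\<close>

locale principal_shift = principal_span sg w Vs wk kT QS
 for sg and w and Vs :: "'s::second_countable_topology => R3 => R3" and wk and kT and QS +
 assumes shift: "inj kk ==> \<exists>sig::R3 => 's. (sig \<longlongrightarrow> s) (at 0) &
  (\<forall>\<^sub>F alp in at 0. Vs (sig alp) = (%x. Vs s x + (\<Sum>i\<in>UNIV. alp $ i *\<^sub>R wk (kk i) x)))"
begin

lemma HH_shift:
 assumes V: "Vs s' = (%x. Vs s x + (\<Sum>i\<in>UNIV. alp $ i *\<^sub>R wk (kk i) x))"
 shows "HH kd kk' s' ((tau, 0), x) = HH kd kk s ((tau, alp), x)"
proof -
 have dV: "(Vs s has_derivative FD (Vs s) x) (at x)" for x
  using Ck_has_derivative[of 2 Vs] Vs by (simp add: num23 del: Ck.simps)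
 have dk: "(wk k has_derivative FD (wk k) x) (at x)" for k x
  using Ck_has_derivative[of 2 "%_::real. wk k"] wk by (simp add: num23 del: Ck.simps)
 have "(Vs s' has_derivative (%h. FD (Vs s) x h + (\<Sum>i\<in>UNIV. alp $ i *\<^sub>R FD (wk (kk i)) x h))) (at x)" for x
  unfolding V by (intro has_derivative_add dV has_derivative_sum has_derivative_scaleR_right dk)
 from jac_eqI[OF this] have "jac (Vs s') x = jac (Vs s) x + (\<Sum>i\<in>UNIV. alp $ i *\<^sub>R jac (wk (kk i)) x)" for x
  by (simp add: jac_def vec_eq_iff)
 hence J: "JF kk' s' (0, x) = JF kk s (alp, x)" for x by (simp add: JF_def V)
 have Y: "YF kk' s' (0, x) = YF kk s (alp, x)" for x by (simp add: YF_def J)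
 have T: "TF kk' s' ((0, x), h) = TF kk s ((alp, x), h)" for x h
  using fun_cong[OF has_derivative_unique[OF YF_x_hd[of kk' s' 0 x, unfolded Y] YF_x_hd], of h] .
 let ?U = "UU kk s ((tau, alp), x)"
 have U: "((tau, 0), snd (?U t)) = UU kk' s' ((tau, 0), x) t" if t: "t \<in> {0..1}" for t
 proof (rule UU_unique[OF _ _ t, where U = "%t. ((tau, 0), snd (?U t))"])
  show "((tau, 0), snd (?U 0)) = ((tau, 0), x, mat 1)" by (simp add: UU(2))
  show "sol1 (GG kk' s') (%t. ((tau, 0), snd (?U t)))"
   unfolding sol1_def
  proof
   fix t :: real assume t: "t \<in> {0..1}"
   obtain y N where "snd (?U t) = (y, N)" by (cases "snd (?U t)")
   hence "?U t = ((tau, alp), y, N)" using UU(3)[OF t, of kk s "((tau, alp), x)"] by (simp add: prod_eq_iff)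
   hence e: "snd (GG kk s (?U t)) = snd (GG kk' s' ((tau, 0), snd (?U t)))"
    by (simp add: GG_def Y T)
   have eq: "GG kk' s' ((tau, 0), snd (?U t)) = (0, snd (GG kk s (?U t)))"
    unfolding e by (simp add: GG_def)
   show "((%t. ((tau, 0), snd (?U t))) has_vector_derivative GG kk' s' ((tau, 0), snd (?U t))) (at t within {0..1})"
    unfolding eq
    by (intro has_vector_derivative_Pair has_vector_derivative_const bounded_linear.has_vector_derivative[OF bounded_linear_snd UU_vd[OF t]])
  qed
 qed
 from arg_cong[OF U[of 1], of snd] have "snd (UU kk' s' ((tau, 0), x) 1) = snd (?U 1)" by simp
 thus ?thesis by (simp add: HH_def hs_def J split: option.splits)
qed

text \<open>Compactness in (\<open>tau\<close>, \<open>x\<close>) makes the bad set closed relative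
  to \<open>S\<close>. If it contained an open set, moving the parameter there would realise a whole
  punctured ball of coefficients, contrary to \<open>negligible_projection\<close>.\<close>

lemma bad_nowhere_dense:
 assumes good: "good_pt kd s0 tau0 x0"
 obtains C W where "closed C" "interior C = {}" "open W" "(s0, tau0, x0) \<in> W"
  "!!s tau x. (s, tau, x) \<in> W ==> x $ i = x0 $ i ==> HH kd (%_. 0) s ((tau, 0), x) = 0 ==> s \<in> C"
proof -
 obtain kk S d C where kk: "inj kk" and S: "open S" "s0 \<in> S" and d: "d > 0"
  and lip: "!!s p p'. s \<in> S ==> norm (p - ((tau0, 0), x0)) < d ==> norm (p' - ((tau0, 0), x0)) < d ==>
   HH kd kk s p = HH kd kk s p' ==> norm (fst p - fst p') <= C * norm (snd p - snd p')"
  by (rule local_lipschitz_zeros[OF good]) (rule that)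
 define K where "K = cball (tau0, x0) (d / 2) \<inter> {z. snd z $ i = x0 $ i}"
 have K: "compact K"
  unfolding K_def by (intro compact_Int_closed compact_cball closed_Collect_eq continuous_intros)
 define A where "A = {s \<in> S. \<exists>q\<in>K. HH kd (%_. 0) s ((fst q, 0), snd q) = 0}"
 have op: "open (S - A)"
 proof (subst open_subopen, rule ballI)
  fix s assume s: "s \<in> S - A"
  define N where "N = {z. (case z of (s, q) => HH kd (%_. 0) s ((fst q, 0), snd q)) ~= 0}"
  have oN: "open N" unfolding N_def by (intro open_Collect_neq continuous_HH continuous_on_const)
  have "{s} \<times> K \<subseteq> N" using s by (auto simp: A_def N_def)
  from Elementary_Topology.tube_lemma[OF K oN this] obtain X where X: "s \<in> X" "open X" "X \<times> K \<subseteq> N" by (elim exE conjE)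
  have "X \<inter> S \<subseteq> S - A" using X(3) by (auto simp: A_def N_def)
  thus "\<exists>T. open T & s \<in> T & T \<subseteq> S - A" using X S s by (intro exI[of _ "X \<inter> S"]) auto
 qed
 have emp: "U = {}" if U: "open U" "U \<subseteq> A" for U
 proof (rule ccontr)
  assume "U ~= {}"
  then obtain s where s: "s \<in> U" by blast
  hence sS: "s \<in> S" using U by (auto simp: A_def)
  obtain sig where sig: "(sig \<longlongrightarrow> s) (at 0)"
   "\<forall>\<^sub>F alp in at 0. Vs (sig alp) = (%x. Vs s x + (\<Sum>i\<in>UNIV. alp $ i *\<^sub>R wk (kk i) x))"
   using shift[OF kk] by blast
  have "\<forall>\<^sub>F alp in at 0. sig alp \<in> U" using topological_tendstoD[OF sig(1) U(1) s] .
  with sig(2) have "\<forall>\<^sub>F alp in at 0. Vs (sig alp) = (%x. Vs s x + (\<Sum>i\<in>UNIV. alp $ i *\<^sub>R wk (kk i) x)) & sig alp \<in> U"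
   by (rule eventually_conj)
  then obtain e where e: "e > 0" "!!alp. alp ~= 0 ==> dist alp 0 < e ==> Vs (sig alp) = (%x. Vs s x + (\<Sum>i\<in>UNIV. alp $ i *\<^sub>R wk (kk i) x)) & sig alp \<in> U"
   unfolding eventually_at by blast
  define Z where "Z = {p. norm (p - ((tau0, 0), x0)) < d & snd p $ i = x0 $ i & HH kd kk s p = 0}"
  have "negligible ((%p. snd (fst p)) ` Z)"
   by (rule negligible_projection[where i = i and c = "x0 $ i" and C = C]) (auto simp: Z_def intro!: lip[OF sS])
  moreover have "ball 0 (min e (d / 2)) - {0} \<subseteq> (%p. snd (fst p)) ` Z"
  proof
   fix alp :: "R3" assume alp: "alp \<in> ball 0 (min e (d / 2)) - {0}"
   hence V: "Vs (sig alp) = (%x. Vs s x + (\<Sum>i\<in>UNIV. alp $ i *\<^sub>R wk (kk i) x))" and "sig alp \<in> U"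
    using e(2)[of alp] by (auto simp: dist_norm)
   then obtain tau x where tx: "(tau, x) \<in> K" "HH kd (%_. 0) (sig alp) ((tau, 0), x) = 0"
    using U(2) unfolding A_def by force
   hence "HH kd kk s ((tau, alp), x) = 0" using HH_shift[OF V] by metis
   moreover have "norm (((tau, alp), x) - ((tau0, 0), x0)) < d"
   proof -
    have "((tau, alp), x) - ((tau0, 0), x0) = ((tau - tau0, 0), x - x0) + ((0, alp), 0)" by simp
    hence "norm (((tau, alp), x) - ((tau0, 0), x0)) <= norm ((tau - tau0, 0::R3), x - x0) + norm ((0::real, alp), 0::R3)"
     by (metis norm_triangle_ineq)
    also have "norm ((tau - tau0, 0::R3), x - x0) = norm ((tau, x) - (tau0, x0))" by (simp add: norm_Pair)
    also have "... <= d / 2"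
    proof -
     have "dist (tau0, x0) (tau, x) <= d / 2" using tx(1) by (simp add: K_def)
     thus ?thesis by (metis dist_norm dist_commute)
    qed
    also have "norm ((0::real, alp), 0::R3) < d / 2" using alp by (simp add: norm_Pair dist_norm)
    finally show ?thesis by simp
   qed
   ultimately have "((tau, alp), x) \<in> Z" using tx(1) by (simp add: Z_def K_def)
   thus "alp \<in> (%p. snd (fst p)) ` Z" by force
  qed
  ultimately have "negligible (ball 0 (min e (d / 2)) - {0::R3})" by (rule negligible_subset)
  hence "negligible (insert 0 (ball 0 (min e (d / 2)) - {0::R3}))" by (simp only: negligible_insert)
  hence "negligible (ball 0 (min e (d / 2)) :: R3 set)" by (rule negligible_subset) blast
  thus False using e(1) d open_not_negligible[of "ball 0 (min e (d / 2)) :: R3 set"] by auto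
 qed
 show ?thesis
 proof (rule that[of "closure A" "S \<times> ball (tau0, x0) (d / 2)"])
  show "interior (closure A) = {}"
  proof (rule ccontr)
   assume ne: "interior (closure A) ~= {}"
   let ?U = "interior (closure A) \<inter> S"
   \<comment> \<open>\<open>A\<close> is closed only relative to \<open>S\<close>, so its closure is
     compared with it inside \<open>S\<close>.\<close>
   have "?U \<subseteq> A"
   proof
    fix s assume s: "s \<in> ?U"
    show "s \<in> A"
    proof (rule ccontr)
     assume "s \<notin> A"
     hence "s \<in> S - A" using s by blast
     hence "(S - A) \<inter> A ~= {}"
      using s interior_subset[of "closure A"] open_Int_closure_eq_empty[OF op, of A] by blast
     thus False by blast
    qed
   qed
   hence "?U = {}" using emp[of ?U] S(1) by blast
   hence "interior (closure A) \<inter> A = {}" by (auto simp: A_def)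
   hence "interior (closure A) \<inter> closure A = {}"
    using open_Int_closure_eq_empty[OF open_interior, of "closure A" A] by blast
   thus False using ne interior_subset[of "closure A"] by blast
  qed
  show "open (S \<times> ball (tau0, x0) (d / 2))" using S by (intro open_Times) auto
  show "(s0, tau0, x0) \<in> S \<times> ball (tau0, x0) (d / 2)" using S d by simp
  fix s tau x assume "(s, tau, x) \<in> S \<times> ball (tau0, x0) (d / 2)" "x $ i = x0 $ i" "HH kd (%_. 0) s ((tau, 0), x) = 0"
  hence "s \<in> A" unfolding A_def K_def by (auto intro!: bexI[of _ "(tau, x)"])
  thus "s \<in> closure A" using closure_subset by blast
 qed simp
qed

lemma good_pt_HH: "good_pt kd s tau x ==> HH kd (%_. 0) s ((tau, 0), x) = 0"
 by (auto simp: good_pt_def HH_def hs_def UU_orb JF_def jt_def prod_eq_iff split: option.splits)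

text \<open>The open sets of \<open>bad_nowhere_dense\<close> cover all good points of the slice;
  second countability of the space of triples (\<open>s\<close>, \<open>tau\<close>,
  \<open>x\<close>) leaves countably many of them.\<close>

lemma countable_bad:
 obtains \<C> where "countable \<C>" "!!C. C \<in> \<C> ==> closed C & interior C = {}"
  "!!s tau x. good_pt kd s tau x ==> x $ i = c ==> s \<in> \<Union>\<C>"
proof -
 define P where "P W C \<longleftrightarrow> closed C & interior C = {} & open W &
  (\<forall>s tau x. (s, tau, x) \<in> W --> x $ i = c --> HH kd (%_. 0) s ((tau, 0), x) = 0 --> s \<in> C)" for W C
 have ex: "\<exists>W C. P W C & (s, tau, x) \<in> W" if g: "good_pt kd s tau x" "x $ i = c" for s tau x
 proof -
  obtain C W where "closed C" "interior C = {}" "open W" "(s, tau, x) \<in> W"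
   "!!s' tau' x'. (s', tau', x') \<in> W ==> x' $ i = x $ i ==> HH kd (%_. 0) s' ((tau', 0), x') = 0 ==> s' \<in> C"
   using bad_nowhere_dense[OF g(1), of i] by metis
  thus ?thesis using g(2) unfolding P_def by blast
 qed
 define \<F> where "\<F> = {W. \<exists>C. P W C}"
 obtain \<F>' where F: "\<F>' \<subseteq> \<F>" "countable \<F>'" "\<Union>\<F>' = \<Union>\<F>"
  using Lindelof[of \<F>] by (auto simp: \<F>_def P_def)
 define cc where "cc W = (SOME C. P W C)" for W
 have cc: "P W (cc W)" if "W \<in> \<F>'" for W
  using F(1) that unfolding cc_def \<F>_def by (metis (mono_tags, lifting) mem_Collect_eq someI subsetD)
 show ?thesis
 proof (rule that[of "cc ` \<F>'"])
  fix s tau x assume g: "good_pt kd s tau x" "x $ i = c"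
  from ex[OF this] have "(s, tau, x) \<in> \<Union>\<F>" unfolding \<F>_def by blast
  then obtain W where W: "W \<in> \<F>'" "(s, tau, x) \<in> W" using F(3) by blast
  hence "s \<in> cc W" using cc[OF W(1)] g(2) good_pt_HH[OF g(1)] unfolding P_def by blast
  thus "s \<in> \<Union>(cc ` \<F>')" using W by blast
 qed (use F cc in \<open>auto simp: P_def\<close>)
qed

end

section \<open>Perturbations in the Whitney topology\<close>

lemma Ck_powr:
 fixes F :: "'s::topological_space => 'a::euclidean_space => real"
 assumes F: "Ck n F" and pos: "!!s x. F s x > 0"
 shows "Ck n (%s x. F s x powr a)"
 using F
proof (induction n arbitrary: a)
 case 0
 thus ?case using pos
  by (auto intro!: continuous_on_powr continuous_on_const simp: less_imp_neq[THEN not_sym])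
next
 case (Suc n)
 show ?case
 proof (rule Ck_SucI)
  show "continuous_on UNIV (%p. F (fst p) (snd p) powr a)"
   using Ck_continuous[OF Suc.prems] pos
   by (auto intro!: continuous_on_powr continuous_on_const simp: less_imp_neq[THEN not_sym])
  show "((%x. F s x powr a) has_derivative (%h. (a * F s x powr (a - 1)) * FD (F s) x h)) (at x)" for s x
  proof -
   have "((%u. u powr a) has_derivative (%h. (a * F s x powr (a - 1)) * h)) (at (F s x))"
    using has_real_derivative_powr[OF pos[of s x], of a] by (simp add: has_field_derivative_def)
   from has_derivative_compose[OF Ck_has_derivative[OF Suc.prems] this] show ?thesis .
  qed
  fix i :: 'a assume i: "i \<in> Basis"
  show "Ck n (%s x. a * F s x powr (a - 1) * FD (F s) x i)"
   using Suc.prems i by (intro Ck_mult Ck_const Suc.IH Ck_Suc_D[OF Suc.prems]) auto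
 qed
qed

lemma Ck_partial_deriv:
 assumes "Ck n F" "set vs \<subseteq> Basis" "length vs <= n"
 shows "Ck (n - length vs) (%s. partial_deriv vs (F s))"
 using assms(2,3)
proof (induction vs)
 case (Cons v vs)
 hence "Ck (n - length vs) (%s. partial_deriv vs (F s))" by simp
 moreover have "n - length vs = Suc (n - length (v # vs))" using Cons.prems by simp
 ultimately show ?case using Cons.prems by simp
qed (use assms in simp)

lemma Ck_partial_deriv_continuous:
 assumes "Ck n F" "vs \<in> multi_indices n"
 shows "continuous_on UNIV (%p. partial_deriv vs (F (fst p)) (snd p))"
 using Ck_continuous[OF Ck_partial_deriv[OF assms(1), of vs]] assms(2) by (simp add: multi_indices_def)

lemma Cr_on_iff_Ck:
 fixes f :: "'a::euclidean_space => 'b::real_normed_vector"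
 shows "Cr_on r f UNIV \<longleftrightarrow> Ck r (%_::real. f)"
proof
 assume f: "Cr_on r f UNIV"
 have "Ck m (%_::real. partial_deriv vs f)" if "set vs \<subseteq> Basis" "length vs + m <= r" for m vs
  using that
 proof (induction m arbitrary: vs)
  case 0
  hence c: "continuous_on UNIV (partial_deriv vs f)" using f by (simp add: Cr_on_def multi_indices_def)
  show ?case using continuous_on_compose2[OF c, of UNIV snd] by (simp add: continuous_on_snd)
 next
  case (Suc m)
  have c: "continuous_on UNIV (partial_deriv vs f)" and d: "\<forall>x. partial_deriv vs f differentiable at x"
   using f Suc.prems by (auto simp: Cr_on_def multi_indices_def)
  have "Ck m (%_::real. partial_deriv (i # vs) f)" if "i \<in> Basis" for i
   by (rule Suc.IH) (use Suc.prems that in auto)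
  thus ?case using continuous_on_compose2[OF c, of UNIV snd] d by (simp add: continuous_on_snd)
 qed
 from this[of "[]" r] show "Ck r (%_::real. f)" by simp
next
 assume f: "Ck r (%_::real. f)"
 have c: "Ck (r - length vs) (%_::real. partial_deriv vs f)" if "vs \<in> multi_indices r" for vs
  using Ck_partial_deriv[OF f, of vs] that by (simp add: multi_indices_def)
 have d: "partial_deriv vs f differentiable at x" if vs: "vs \<in> multi_indices r" "length vs < r" for vs x
 proof -
  obtain m where "r - length vs = Suc m" using vs(2) by (metis Suc_diff_Suc)
  thus ?thesis using Ck_partial_deriv[OF f, of vs] vs by (simp add: multi_indices_def)
 qed
 show "Cr_on r f UNIV" unfolding Cr_on_def
  by (intro ballI conjI impI d; (rule Ck_continuous_arg[OF c])?)
qed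

lemma Ck_reparam_const: "Ck n (%_::real. f) ==> Ck n (%_::'s::topological_space. f)"
 using Ck_reparam[of "%_::'s. 0::real" n "%_. f"] by simp

lemma partial_deriv_snoc: "partial_deriv vs (%x. FD f x i) = partial_deriv (vs @ [i]) f"
 by (induction vs) auto

lemma partial_deriv_cong_open:
 assumes "open S" "!!x. x \<in> S ==> f x = g x"
 shows "x \<in> S ==> partial_deriv vs f x = partial_deriv vs g x"
proof (induction vs arbitrary: x)
 case (Cons v vs)
 have "FD (partial_deriv vs f) x = FD (partial_deriv vs g) x"
 proof -
  have "(partial_deriv vs f has_derivative D) (at x) \<longleftrightarrow> (partial_deriv vs g has_derivative D) (at x)" for D
   using has_derivative_transform_within_open[OF _ assms(1) Cons.prems] Cons.IH by (metis (no_types, lifting))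
  thus ?thesis by (simp add: frechet_derivative_def)
 qed
 thus ?case by simp
qed (use assms in simp)

lemma partial_deriv_zero: "partial_deriv vs (%_::'a::euclidean_space. 0::'b::real_normed_vector) x = 0"
proof -
 have "partial_deriv vs (%_::'a. 0::'b) = (%_. 0)"
  by (induction vs) (auto simp: frechet_derivative_const)
 thus ?thesis by simp
qed

lemma Ck_scaleR_const: "Ck n F ==> Ck n (%s x. c *\<^sub>R F s x)"
 by (intro Ck_scaleR Ck_const)

lemma partial_deriv_scaleR:
 assumes "Ck n (%_::real. f)" "set vs \<subseteq> Basis" "length vs <= n"
 shows "partial_deriv vs (%x. c *\<^sub>R f x) x = c *\<^sub>R partial_deriv vs f x"
 using assms(2,3)
proof (induction vs arbitrary: x)
 case (Cons v vs)
 obtain m where m: "n - length vs = Suc m" using Cons.prems by (cases "n - length vs") auto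
 have e: "partial_deriv vs (%x. c *\<^sub>R f x) = (%x. c *\<^sub>R partial_deriv vs f x)" using Cons by auto
 have "(partial_deriv vs f has_derivative FD (partial_deriv vs f) x) (at x)"
  using Ck_has_derivative[of m "%_::real. partial_deriv vs f"] Ck_partial_deriv[OF assms(1), of vs] Cons.prems m by simp
 from has_derivative_scaleR_right[OF this, of c]
 have "FD (%x. c *\<^sub>R partial_deriv vs f x) x = (%h. c *\<^sub>R FD (partial_deriv vs f) x h)"
  by (simp add: frechet_derivative_at[symmetric])
 thus ?case by (simp add: e)
qed simp

lemma Ck_compact_support_bounded:
 fixes f :: "R3 => R3"
 assumes f: "Ck n (%_::real. f)" and supp: "!!x. norm x > R ==> f x = 0"
 obtains M where "M > 0" "!!vs x. vs \<in> multi_indices n ==> norm (partial_deriv vs f x) <= M"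
proof -
 have "\<exists>M. \<forall>x. norm (partial_deriv vs f x) <= M" if vs: "vs \<in> multi_indices n" for vs
 proof -
  have "continuous_on (cball 0 R) (partial_deriv vs f)"
   using Ck_continuous_arg[OF Ck_partial_deriv[OF f, of vs]] vs by (simp add: multi_indices_def)
  from continuous_on_compact_bound[OF compact_cball this]
  obtain B where B: "B >= 0" "!!x. x \<in> cball 0 R ==> norm (partial_deriv vs f x) <= B" by metis
  have "partial_deriv vs f x = 0" if "norm x > R" for x
   using partial_deriv_cong_open[OF open_Compl[OF closed_cball], of 0 R f "%_. 0" x vs] supp that by (simp add: partial_deriv_zero)
  hence "norm (partial_deriv vs f x) <= B" for x using B by (cases "norm x > R") auto
  thus ?thesis by blast
 qed
 then obtain m where m: "!!vs x. vs \<in> multi_indices n ==> norm (partial_deriv vs f x) <= m vs" by metis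
 let ?M = "Max (insert 1 (m ` multi_indices n))"
 have fin: "finite (insert 1 (m ` (multi_indices n :: R3 list set)))" using finite_multi_indices by blast
 show ?thesis
 proof (rule that[of ?M])
  show "?M > 0" using Max_ge[OF fin, of 1] by simp
  fix vs x assume vs: "vs \<in> (multi_indices n :: R3 list set)"
  have "m vs <= ?M" using vs by (intro Max_ge[OF fin]) auto
  thus "norm (partial_deriv vs f x) <= ?M" using m[OF vs, of x] by linarith
 qed
qed

lemma series_continuous:
 fixes f :: "nat => 'a::euclidean_space => 'b::euclidean_space" and tht :: "nat => 's::topological_space => real"
 assumes f: "!!k. continuous_on UNIV (f k)" and b: "!!k s x. norm (tht k s *\<^sub>R f k x) <= M k"
  and M: "summable M" and tht: "!!k. continuous_on UNIV (tht k)"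
 shows "continuous_on UNIV (%p. \<Sum>k. tht k (fst p) *\<^sub>R f k (snd p))"
proof -
 have ul: "uniform_limit UNIV (%n p. \<Sum>k<n. tht k (fst p) *\<^sub>R f k (snd p)) (%p. \<Sum>k. tht k (fst p) *\<^sub>R f k (snd p)) sequentially"
  by (rule Weierstrass_m_test[OF b M])
 have cn: "continuous_on UNIV (%p. \<Sum>k<n. tht k (fst p) *\<^sub>R f k (snd p))" for n
 proof (intro continuous_on_sum continuous_on_scaleR)
  show "continuous_on UNIV (%p::'s \<times> 'a. tht k (fst p))" for k
   by (rule continuous_on_compose2[OF tht continuous_on_fst[OF continuous_on_id]]) simp
  show "continuous_on UNIV (%p::'s \<times> 'a. f k (snd p))" for k
   by (rule continuous_on_compose2[OF f continuous_on_snd[OF continuous_on_id]]) simp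
 qed
 show ?thesis by (rule uniform_limit_theorem[OF always_eventually[OF allI[OF cn]] ul]) simp
qed

lemma Ck_series:
 fixes f :: "nat => 'a::euclidean_space => 'b::euclidean_space" and tht :: "nat => 's::topological_space => real"
 assumes f: "!!k. Ck n (%_::real. f k)"
  and bd: "!!k vs x. vs \<in> multi_indices n ==> norm (partial_deriv vs (f k) x) <= M k"
  and M: "summable M" and tht: "!!k. continuous_on UNIV (tht k)" "!!k s. \<bar>tht k s\<bar> <= 1"
 shows "Ck n (%s x. \<Sum>k. tht k s *\<^sub>R f k x)"
 using f bd
proof (induction n arbitrary: f)
 case 0
 have b: "norm (tht k s *\<^sub>R f k x) <= M k" for k s x
  using 0(2)[of "[]" k x] tht(2)[of k s] mult_mono[of "\<bar>tht k s\<bar>" 1 "norm (f k x)" "M k"] by (auto simp: multi_indices_def)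
 have "continuous_on UNIV (%p. \<Sum>k. tht k (fst p) *\<^sub>R f k (snd p))"
  by (rule series_continuous[OF Ck_continuous_arg[OF 0(1)] b M tht(1)])
 thus ?case by simp
next
 case (Suc n)
 have ml: "[] \<in> (multi_indices (Suc n) :: 'a list set)" "!!i. i \<in> Basis ==> [i] \<in> (multi_indices (Suc n) :: 'a list set)"
  by (auto simp: multi_indices_def)
 have tb: "norm (tht k s *\<^sub>R y) <= M k" if "norm y <= M k" for k s and y :: 'b
  using that tht(2)[of k s] mult_mono[of "\<bar>tht k s\<bar>" 1 "norm y" "M k"] by auto
 have b0: "norm (tht k s *\<^sub>R f k x) <= M k" for k s x
  using tb Suc.prems(2)[OF ml(1)] by simp
 have b1: "norm (tht k s *\<^sub>R FD (f k) x i) <= M k" if "i \<in> Basis" for k s x i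
  using tb Suc.prems(2)[OF ml(2)[OF that]] by simp
 show ?case
 proof (rule Ck_SucI)
  show "continuous_on UNIV (%p. \<Sum>k. tht k (fst p) *\<^sub>R f k (snd p))"
   by (rule series_continuous[OF Ck_continuous_arg[OF Suc.prems(1)] b0 M tht(1)])
  define g' where "g' s x h = (\<Sum>i\<in>Basis. (h \<bullet> i) *\<^sub>R (\<Sum>k. tht k s *\<^sub>R FD (f k) x i))" for s x h
  show "((%x. \<Sum>k. tht k s *\<^sub>R f k x) has_derivative g' s x) (at x)" for s x
  proof -
   have "\<exists>g. \<forall>x\<in>UNIV. (%k. tht k s *\<^sub>R f k x) sums g x & (g has_derivative g' s x) (at x within UNIV)"
   proof (rule has_derivative_series[where x = 0])
    show "((%x. tht k s *\<^sub>R f k x) has_derivative (%h. tht k s *\<^sub>R FD (f k) x h)) (at x within UNIV)" for k x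
     using Ck_has_derivative[OF Suc.prems(1)] by (intro has_derivative_scaleR_right) simp
    show "(%k. tht k s *\<^sub>R f k 0) sums (\<Sum>k. tht k s *\<^sub>R f k 0)"
     by (intro summable_sums summable_comparison_test'[OF M, of 0] b0)
    fix e :: real assume e: "e > 0"
    have "\<forall>\<^sub>F n in sequentially. \<forall>x\<in>UNIV. dist (\<Sum>k<n. tht k s *\<^sub>R FD (f k) x i) (\<Sum>k. tht k s *\<^sub>R FD (f k) x i) < e / DIM('a)"
     if "i \<in> Basis" for i
     by (rule uniform_limitD[OF Weierstrass_m_test[OF b1[OF that] M]]) (use e in simp)
    hence "\<forall>\<^sub>F n in sequentially. \<forall>i\<in>Basis. \<forall>x\<in>UNIV. dist (\<Sum>k<n. tht k s *\<^sub>R FD (f k) x i) (\<Sum>k. tht k s *\<^sub>R FD (f k) x i) < e / DIM('a)"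
     by (simp add: eventually_ball_finite)
    thus "\<forall>\<^sub>F n in sequentially. \<forall>x\<in>UNIV. \<forall>h. norm ((\<Sum>k<n. tht k s *\<^sub>R FD (f k) x h) - g' s x h) <= e * norm h"
    proof eventually_elim
     case (elim N)
     show ?case
     proof (intro ballI allI)
      fix x h :: 'a
      let ?p = "%i. \<Sum>k<N. tht k s *\<^sub>R FD (f k) x i" and ?l = "%i. \<Sum>k. tht k s *\<^sub>R FD (f k) x i"
      have "?p h = (\<Sum>k<N. \<Sum>i\<in>Basis. (h \<bullet> i) *\<^sub>R tht k s *\<^sub>R FD (f k) x i)"
       by (subst frechet_derivative_expand[OF Ck_differentiable[OF Suc.prems(1)]]) (simp add: scaleR_sum_right mult.commute)
      also have "... = (\<Sum>i\<in>Basis. (h \<bullet> i) *\<^sub>R ?p i)"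
       by (subst sum.swap) (simp add: scaleR_sum_right)
      finally have "?p h - g' s x h = (\<Sum>i\<in>Basis. (h \<bullet> i) *\<^sub>R (?p i - ?l i))"
       by (simp add: g'_def sum_subtractf scaleR_diff_right)
      also have "norm ... <= (\<Sum>i\<in>(Basis::'a set). norm h * (e / DIM('a)))"
      proof (rule order_trans[OF norm_sum sum_mono])
       fix i :: 'a assume i: "i \<in> Basis"
       have "norm (?p i - ?l i) <= e / DIM('a)" using elim i by (force simp: dist_norm intro: less_imp_le)
       thus "norm ((h \<bullet> i) *\<^sub>R (?p i - ?l i)) <= norm h * (e / DIM('a))"
        using Basis_le_norm[OF i, of h] by (simp only: norm_scaleR) (intro mult_mono, auto)
      qed
      also have "... = e * norm h" by simp
      finally show "norm (?p h - g' s x h) <= e * norm h" .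
     qed
    qed
   qed auto
   then obtain g where g: "!!x. (%k. tht k s *\<^sub>R f k x) sums g x" "!!x. (g has_derivative g' s x) (at x)" by auto
   have "g = (%x. \<Sum>k. tht k s *\<^sub>R f k x)" using g(1) by (auto simp: sums_unique)
   thus ?thesis using g(2) by simp
  qed
  fix i :: 'a assume i: "i \<in> Basis"
  have "Ck n (%s x. \<Sum>k. tht k s *\<^sub>R FD (f k) x i)"
  proof (rule Suc.IH)
   show "Ck n (%_::real. (%x. FD (f k) x i))" for k using Suc.prems(1) i by simp
   show "norm (partial_deriv vs (%x. FD (f k) x i) x) <= M k" if "vs \<in> multi_indices n" for k vs x
    unfolding partial_deriv_snoc by (rule Suc.prems(2)) (use that i in \<open>auto simp: multi_indices_def\<close>)
  qed
  moreover have "g' s x i = (\<Sum>k. tht k s *\<^sub>R FD (f k) x i)" for s x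
  proof -
   have "g' s x i = (\<Sum>j\<in>Basis. if j = i then (\<Sum>k. tht k s *\<^sub>R FD (f k) x j) else 0)"
    unfolding g'_def by (rule sum.cong) (auto simp: inner_Basis i)
   thus ?thesis by (simp add: i)
  qed
  ultimately show "Ck n (%s x. g' s x i)" by simp
 qed
qed

lemma Ck_tfield:
 assumes "k >= 2 * n + 1" shows "Ck n (%_::real. tfield k a q c1 v1 c2 v2 e)"
 unfolding tfield_def[abs_def] ts_def
 by (intro Ck_scaleR Ck_mult Ck_pq_compose assms Ck_diff Ck_inner Ck_add Ck_const Ck_id)

lemma tfield_supp:
 assumes "a >= 1" "k >= 1" "norm x > norm q + 1" shows "tfield k a q c1 v1 c2 v2 e x = 0"
proof -
 have "norm (x - q) > 1" using assms(3) norm_triangle_ineq2[of x q] by linarith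
 hence "a * norm (x - q) > 1" using assms(1) mult_right_mono[of 1 a "norm (x - q)"] by simp
 hence "(a * norm (x - q))\<^sup>2 >= 1" by simp
 hence "a\<^sup>2 * ((x - q) \<bullet> (x - q)) >= 1" by (simp add: power_mult_distrib power2_norm_eq_inner)
 thus ?thesis using assms(2) by (simp add: tfield_def ts_def pq_eq_0_iff[THEN iffD2])
qed

section \<open>Countably many perturbing fields with bounded coefficients\<close>

lemma open_fun_nbhd:
 fixes U :: "(nat => real) set"
 assumes "open U" "(%_. 0) \<in> U"
 obtains e n where "e > 0" "!!t. (!!k. k < n ==> \<bar>t k\<bar> < e) ==> t \<in> U"
proof -
 have "openin (product_topology (%i. euclidean) UNIV) U" using assms(1) by (simp add: open_fun_def)
 from product_topology_open_contains_basis[OF this assms(2)]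
 obtain X where X: "(%_. 0) \<in> (\<Pi>\<^sub>E i\<in>UNIV. X i)" "!!i. open (X i)" "finite {i. X i ~= UNIV}" "(\<Pi>\<^sub>E i\<in>UNIV. X i) \<subseteq> U"
  by auto
 have "\<exists>e>0. ball 0 e \<subseteq> X i" for i
 proof -
  have "0 \<in> X i" using X(1) by (auto simp: PiE_def Pi_def)
  thus ?thesis using X(2)[of i] by (meson openE)
 qed
 then obtain e where e: "!!i. e i > 0" "!!i. ball 0 (e i) \<subseteq> X i" by metis
 let ?S = "{i. X i ~= UNIV}"
 define E where "E = Min (insert 1 (e ` ?S))"
 have fin: "finite (insert 1 (e ` ?S))" using X(3) by simp
 have E: "E > 0" unfolding E_def using Min_in[OF fin] e(1) by (auto simp: Min_gr_iff[OF fin])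
 obtain n where n: "!!i. i \<in> ?S ==> i < n" using X(3) by (metis finite_nat_set_iff_bounded)
 show ?thesis
 proof (rule that[OF E, of n])
  fix t :: "nat => real" assume t: "!!k. k < n ==> \<bar>t k\<bar> < E"
  have "t i \<in> X i" for i
  proof (cases "i \<in> ?S")
   case True
   have "E <= e i" unfolding E_def by (intro Min_le fin) (use True in auto)
   hence "t i \<in> ball 0 (e i)" using t[OF n[OF True]] by (simp add: dist_real_def)
   thus ?thesis using e(2) by blast
  qed auto
  thus "t \<in> U" using X(4) by (auto simp: PiE_def Pi_def)
 qed
qed

text \<open>A homeomorphism of the line onto the open interval from -1 to 1, with inverse
  \<open>psi\<close>. It bounds the coefficients, keeps the complete space
  \<open>nat => real\<close> as parameter space for Baire's theorem, and leaves room to move every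
  coefficient in both directions.\<close>

definition theta :: "real => real" where "theta u = u / (1 + \<bar>u\<bar>)"
definition psi :: "real => real" where "psi u = u / (1 - \<bar>u\<bar>)"

lemma abs_theta: "\<bar>theta u\<bar> < 1"
 by (simp add: theta_def abs_div divide_simps)

lemma continuous_theta: "continuous_on S theta"
 unfolding theta_def by (intro continuous_intros) (auto simp: add_nonneg_eq_0_iff)

lemma psi_theta: "psi (theta u) = u"
 by (simp add: psi_def theta_def abs_div divide_simps)

lemma theta_psi: "\<bar>u\<bar> < 1 ==> theta (psi u) = u"
 by (simp add: psi_def theta_def abs_div divide_simps)

definition mc :: "3 option => real" where "mc a = (case a of None => 1 | Some _ => 0)"
definition mw :: "3 option => R3" where "mw a = (case a of None => 0 | Some i => axis i 1)"

lemma mono_expand: "c + v \<bullet> y = (\<Sum>a\<in>UNIV. (case a of None => c | Some i => v $ i) * (mc a + mw a \<bullet> y))"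
 by (simp add: UNIV_option_conv sum.reindex mc_def mw_def inner_axis' inner_vec_def[of v])

text \<open>A test field is linear in each affine factor and in \<open>e\<close>, so finitely many
  generators for each radius and centre suffice, and a countable set of centres keeps the whole
  family countable.\<close>

lemma tfield_expand:
 "tfield k n q c1 v1 c2 v2 e = (%x. \<Sum>z\<in>UNIV. ((case fst z of None => c1 | Some i => v1 $ i) *
  (case fst (snd z) of None => c2 | Some i => v2 $ i) * e $ (snd (snd z))) *\<^sub>R
  tfield k n q (mc (fst z)) (mw (fst z)) (mc (fst (snd z))) (mw (fst (snd z))) (axis (snd (snd z)) 1) x)"
proof
 fix x
 let ?P = "pq k (1 - n\<^sup>2 * ((x - q) \<bullet> (x - q)))"
 let ?A = "%a. (case a of None => c1 | Some i => v1 $ i) * (mc a + mw a \<bullet> (x - q))"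
 let ?B = "%a. (case a of None => c2 | Some i => v2 $ i) * (mc a + mw a \<bullet> (x - q))"
 have e: "e = (\<Sum>j\<in>UNIV. e $ j *\<^sub>R axis j 1)"
  by (simp add: vec_eq_iff axis_def if_distrib cong: if_cong)
 have "tfield k n q c1 v1 c2 v2 e x = (?P * ((\<Sum>a\<in>UNIV. ?A a) * (\<Sum>b\<in>UNIV. ?B b))) *\<^sub>R (\<Sum>j\<in>UNIV. e $ j *\<^sub>R axis j 1)"
  unfolding tfield_def ts_def mono_expand[symmetric] e[symmetric] ..
 also have "... = (\<Sum>a\<in>UNIV. \<Sum>b\<in>UNIV. \<Sum>j\<in>UNIV. (?P * (?A a * ?B b)) *\<^sub>R (e $ j *\<^sub>R axis j 1))"
 proof -
  have "?P * ((\<Sum>a\<in>UNIV. ?A a) * (\<Sum>b\<in>UNIV. ?B b)) = (\<Sum>a\<in>UNIV. \<Sum>b\<in>UNIV. ?P * (?A a * ?B b))"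
   by (simp only: sum_product) (simp only: sum_distrib_left)
  thus ?thesis by (simp only: scaleR_sum_left) (simp only: scaleR_sum_right)
 qed
 also have "... = (\<Sum>z\<in>UNIV. (?P * (?A (fst z) * ?B (fst (snd z)))) *\<^sub>R (e $ (snd (snd z)) *\<^sub>R axis (snd (snd z)) 1))"
  by (simp add: sum.cartesian_product case_prod_beta flip: UNIV_Times_UNIV)
 finally show "tfield k n q c1 v1 c2 v2 e x = (\<Sum>z\<in>UNIV. ((case fst z of None => c1 | Some i => v1 $ i) *
  (case fst (snd z) of None => c2 | Some i => v2 $ i) * e $ (snd (snd z))) *\<^sub>R
  tfield k n q (mc (fst z)) (mw (fst z)) (mc (fst (snd z))) (mw (fst (snd z))) (axis (snd (snd z)) 1) x)"
  unfolding tfield_def ts_def by (simp add: ac_simps)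
qed

locale field_family =
 fixes r :: nat and K :: "nat => R3 set" and eta :: "R3 => R3" and \<delta> :: "R3 => real" and QS :: "R3 set"
 assumes r: "r >= 3" and K: "compact_exhaustion K" and eta: "eta \<in> unit_vector_fields r"
  and \<delta>: "continuous_on UNIV \<delta>" "!!x. \<delta> x > 0"
  and QS: "countable QS" "!!X. open X ==> X ~= {} ==> \<exists>q\<in>QS. q \<in> X"
begin

text \<open>\<open>2 * r + 1\<close> already makes the test fields of class C^r by
  \<open>Ck_pq\<close>; the margin guarantees the exponent 7 of the test estimates.\<close>

definition kT :: nat where "kT = 2 * r + 7"

definition raw :: "(nat \<times> R3) \<times> (3 option \<times> 3 option \<times> 3) => R3 => R3" where
 "raw z = tfield kT (real (Suc (fst (fst z)))) (snd (fst z)) (mc (fst (snd z))) (mw (fst (snd z)))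
  (mc (fst (snd (snd z)))) (mw (fst (snd (snd z)))) (axis (snd (snd (snd z))) 1)"

definition TS where "TS = ((UNIV :: nat set) \<times> QS) \<times> (UNIV :: (3 option \<times> 3 option \<times> 3) set)"

definition idx :: "nat => (nat \<times> R3) \<times> (3 option \<times> 3 option \<times> 3)" where "idx = from_nat_into TS"

lemma range_idx: "range idx = TS"
proof -
 obtain q where "q \<in> QS" using QS(2)[of UNIV] by auto
 hence "TS ~= {}" by (auto simp: TS_def)
 moreover have "countable TS" unfolding TS_def using QS(1) by (intro countable_SIGMA) (auto intro: countable_finite)
 ultimately show ?thesis unfolding idx_def by (rule range_from_nat_into)
qed

lemma Ck_raw: "Ck r (%_::real. raw z)"
 unfolding raw_def by (rule Ck_tfield) (simp add: kT_def)

lemma raw_supp: "norm x > norm (snd (fst z)) + 1 ==> raw z x = 0"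
 unfolding raw_def by (rule tfield_supp) (auto simp: kT_def)

lemma ex_bound: "\<exists>M>0. \<forall>vs\<in>multi_indices r. \<forall>x. norm (partial_deriv vs (raw z) x) <= M"
proof -
 obtain M where "M > 0" "!!vs x. vs \<in> multi_indices r ==> norm (partial_deriv vs (raw z) x) <= M"
  using Ck_compact_support_bounded[OF Ck_raw raw_supp] by blast
 thus ?thesis by blast
qed

definition bnd :: "(nat \<times> R3) \<times> (3 option \<times> 3 option \<times> 3) => real" where
 "bnd z = (SOME M. M > 0 & (\<forall>vs\<in>multi_indices r. \<forall>x. norm (partial_deriv vs (raw z) x) <= M))"

lemma bnd: "bnd z > 0" "vs \<in> multi_indices r ==> norm (partial_deriv vs (raw z) x) <= bnd z"
 using someI_ex[OF ex_bound[of z]] unfolding bnd_def by auto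

text \<open>The powers of 2 sum to 1/2, which is less than the norm 1 of \<open>eta\<close>. So the
  perturbed field has no zeros and can be normalised, and the series converges with all derivatives
  up to order \<open>r\<close>.\<close>

definition g :: "nat => R3 => R3" where
 "g k x = (1 / (bnd (idx k) * 2 ^ (k + 2))) *\<^sub>R raw (idx k) x"

lemma Ck_g: "Ck r (%_::real. g k)"
 unfolding g_def by (intro Ck_scaleR Ck_const Ck_raw)

lemma g_supp: "norm x > norm (snd (fst (idx k))) + 1 ==> g k x = 0"
 by (simp add: g_def raw_supp)

lemma g_bound: "vs \<in> multi_indices r ==> norm (partial_deriv vs (g k) x) <= (1 / 2) ^ (k + 2)"
proof -
 assume vs: "vs \<in> multi_indices r"
 have "partial_deriv vs (g k) x = (1 / (bnd (idx k) * 2 ^ (k + 2))) *\<^sub>R partial_deriv vs (raw (idx k)) x"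
  unfolding g_def[abs_def] using partial_deriv_scaleR[OF Ck_raw, of vs] vs by (simp add: multi_indices_def)
 also have "norm ... <= (1 / (bnd (idx k) * 2 ^ (k + 2))) * bnd (idx k)"
 proof -
  have "0 <= 1 / (bnd (idx k) * 2 ^ (k + 2))" using bnd(1)[of "idx k"] by simp
  from mult_left_mono[OF bnd(2)[OF vs, where z = "idx k" and x = x] this] this
  show ?thesis by (simp only: norm_scaleR abs_of_nonneg)
 qed
 also have "... = (1 / 2) ^ (k + 2)" using bnd(1)[of "idx k"] by (simp add: power_divide)
 finally show ?thesis .
qed

lemma sums_bound: "(%k. (1 / 2 :: real) ^ (k + 2)) sums (1 / 2)"
proof -
 have "(%k. (1 / 4) * (1 / 2 :: real) ^ k) sums ((1 / 4) * (1 / (1 - 1 / 2)))"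
  by (intro sums_mult geometric_sums) simp
 thus ?thesis by (simp add: power_add power2_eq_square mult.commute)
qed

text \<open>Makes the series converge for every real sequence, so that \<open>W\<close> is C^r over
  all of \<open>nat => real\<close> and neighbourhoods of the zero sequence can be taken there;
  entries of absolute value at most 1 are kept.\<close>

definition clamp1 :: "real => real" where "clamp1 u = max (-1) (min 1 u)"

lemma clamp1: "\<bar>clamp1 u\<bar> <= 1" "\<bar>u\<bar> <= 1 ==> clamp1 u = u" "clamp1 0 = 0" "continuous_on S clamp1"
 by (auto simp: clamp1_def[abs_def] intro!: continuous_intros)

definition W :: "(nat => real) => R3 => R3" where
 "W t x = eta x + (\<Sum>k. clamp1 (t k) *\<^sub>R g k x)"

lemma Ck_eta: "Ck r (%_::real. eta)" and norm_eta: "norm (eta x) = 1"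
 using eta by (auto simp: unit_vector_fields_def vector_fields_def Cr_on_iff_Ck)

lemma continuous_coord: "continuous_on UNIV (%t::nat => real. t k)"
 by (rule continuous_on_product_coordinates)

lemma Ck_W: "Ck r W"
 unfolding W_def[abs_def]
proof (intro Ck_add Ck_reparam_const[OF Ck_eta] Ck_series[where M = "%k. (1 / 2) ^ (k + 2)"])
 show "continuous_on UNIV (%t::nat => real. clamp1 (t k))" for k
  by (rule continuous_on_compose2[OF clamp1(4)[of UNIV] continuous_coord]) simp
qed (use Ck_g g_bound clamp1 sums_summable[OF sums_bound] in auto)

lemma g_le: "norm (g k x) <= (1 / 2) ^ (k + 2)"
 using g_bound[of "[]" k x] by (simp add: multi_indices_def)

lemma term_le: "norm (clamp1 u *\<^sub>R g k x) <= (1 / 2) ^ (k + 2)"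
 using mult_mono[OF clamp1(1)[of u] g_le[of k x]] by simp

lemma summable_terms: "summable (%k. clamp1 (t k) *\<^sub>R g k x)"
 by (rule summable_comparison_test'[OF sums_summable[OF sums_bound] term_le])

lemma W_near: "norm (W t x - eta x) <= 1 / 2"
proof -
 have s: "summable (%k. norm (clamp1 (t k) *\<^sub>R g k x))"
  by (rule summable_comparison_test'[OF sums_summable[OF sums_bound]]) (use term_le in simp)
 have "norm (\<Sum>k. clamp1 (t k) *\<^sub>R g k x) <= (\<Sum>k. norm (clamp1 (t k) *\<^sub>R g k x))" by (rule summable_norm[OF s])
 also have "... <= (\<Sum>k. (1 / 2) ^ (k + 2))" by (rule suminf_le[OF term_le s sums_summable[OF sums_bound]])
 also have "... = 1 / 2" by (rule sums_unique[OF sums_bound, symmetric])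
 finally show ?thesis by (simp add: W_def)
qed

lemma W_nonzero: "W t x ~= 0"
 using W_near[of t x] norm_eta[of x] by auto

definition NW :: "(nat => real) => R3 => R3" where
 "NW t x = ((W t x \<bullet> W t x) powr (-1/2)) *\<^sub>R W t x"

lemma Ck_NW: "Ck r NW"
 unfolding NW_def[abs_def] by (intro Ck_scaleR Ck_powr Ck_inner Ck_W) (simp add: W_nonzero)

lemma NW_eq: "NW t x = (1 / norm (W t x)) *\<^sub>R W t x"
proof -
 have "(W t x \<bullet> W t x) powr (-1/2) = 1 / norm (W t x)"
 proof -
  have "(W t x \<bullet> W t x) powr (1/2) = norm (W t x)" by (simp only: powr_half_sqrt inner_ge_zero norm_eq_sqrt_inner)
  moreover have "(-1/2::real) = - (1/2)" by simp
  ultimately show ?thesis by (simp only: powr_minus inverse_eq_divide)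
 qed
 thus ?thesis by (simp add: NW_def)
qed

lemma norm_NW: "norm (NW t x) = 1"
 using W_nonzero[of t x] by (simp add: NW_eq)

lemma W_0: "W (%_. 0) = eta"
 by (simp add: fun_eq_iff W_def clamp1)

lemma NW_0: "NW (%_. 0) = eta"
 by (simp add: fun_eq_iff NW_eq W_0 norm_eta)

definition dl :: "nat => real" where "dl i = (INF x\<in>shell K i. \<delta> x)"

lemma dl_pos: "dl i > 0"
proof -
 have ne: "shell K i ~= {}" and co: "compact (shell K i)" using shell_nonempty[OF K] compact_shell[OF K] by auto
 obtain x where "x \<in> shell K i" "!!y. y \<in> shell K i ==> \<delta> x <= \<delta> y"
  using continuous_attains_inf[OF co ne continuous_on_subset[OF \<delta>(1)]] by auto
 hence "\<delta> x <= dl i" unfolding dl_def using ne by (intro cINF_greatest) auto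
 thus ?thesis using \<delta>(2)[of x] by linarith
qed

text \<open>Compactness of the shell gives a neighbourhood of the zero sequence in the product
  topology, which restricts finitely many entries. In \<open>ep\<close> the number of these entries
  is dropped, at the price of asking that all entries be small.\<close>

lemma ex_eps: "\<exists>e>0. \<exists>n. \<forall>t. (\<forall>k<n. \<bar>t k\<bar> < e) -->
 (\<forall>vs\<in>multi_indices r. \<forall>x\<in>shell K i. norm (partial_deriv vs eta x - partial_deriv vs (NW t) x) < dl i / 2)"
proof -
 have co: "compact (shell K i)" using compact_shell[OF K] .
 have "\<exists>U. open U & (%_. 0) \<in> U & (\<forall>t\<in>U. \<forall>x\<in>shell K i. norm (partial_deriv vs eta x - partial_deriv vs (NW t) x) < dl i / 2)"
  if vs: "vs \<in> multi_indices r" for vs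
 proof -
  define Q where "Q = {p :: (nat => real) \<times> R3. norm (partial_deriv vs eta (snd p) - partial_deriv vs (NW (fst p)) (snd p)) < dl i / 2}"
  have c1: "continuous_on UNIV (%p :: (nat => real) \<times> R3. partial_deriv vs (NW (fst p)) (snd p))"
   by (rule Ck_partial_deriv_continuous[OF Ck_NW vs])
  have c2: "continuous_on UNIV (%p :: (nat => real) \<times> R3. partial_deriv vs eta (snd p))"
   by (rule Ck_partial_deriv_continuous[OF Ck_reparam_const[OF Ck_eta] vs])
  have "open Q" unfolding Q_def
   by (intro open_Collect_less continuous_on_norm continuous_on_diff c1 c2 continuous_on_const)
  moreover have "{%_. 0} \<times> shell K i \<subseteq> Q" using dl_pos[of i] by (auto simp: Q_def NW_0)
  ultimately show ?thesis using Elementary_Topology.tube_lemma[OF co, of Q "%_. 0"] by (force simp: Q_def)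
 qed
 then obtain U where U: "!!vs. vs \<in> multi_indices r ==> open (U vs) & (%_. 0) \<in> U vs &
   (\<forall>t\<in>U vs. \<forall>x\<in>shell K i. norm (partial_deriv vs eta x - partial_deriv vs (NW t) x) < dl i / 2)" by metis
 have "open (\<Inter>vs\<in>multi_indices r. U vs)" "(%_. 0) \<in> (\<Inter>vs\<in>multi_indices r. U vs)"
  using U finite_multi_indices by (auto intro!: open_INT)
 from open_fun_nbhd[OF this] obtain e n where "e > 0"
  "!!t. (!!k. k < n ==> \<bar>t k\<bar> < e) ==> t \<in> (\<Inter>vs\<in>multi_indices r. U vs)" by metis
 thus ?thesis using U by (intro exI[of _ e] conjI exI[of _ n]) auto
qed

definition ep :: "nat => real" where "ep i = (SOME e. e > 0 & (\<exists>n. \<forall>t. (\<forall>k<n. \<bar>t k\<bar> < e) -->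
 (\<forall>vs\<in>multi_indices r. \<forall>x\<in>shell K i. norm (partial_deriv vs eta x - partial_deriv vs (NW t) x) < dl i / 2)))"

lemma ep: "ep i > 0" "(!!k. \<bar>t k\<bar> < ep i) ==> vs \<in> multi_indices r ==> x \<in> shell K i ==>
  norm (partial_deriv vs eta x - partial_deriv vs (NW t) x) < dl i / 2"
 using someI_ex[OF ex_eps[of i]] unfolding ep_def by blast+

text \<open>An open set around the shell, since equality of derivatives needs equality of germs. For
  \<open>i = 0\<close> subtraction of naturals gives \<open>K 0\<close>, which is empty.\<close>

definition OC :: "nat => R3 set" where "OC i = - K (i - 1)"

lemma compact_K: "compact (K i)"
 using K by (cases "i = 0") (auto simp: compact_exhaustion_def)

lemma open_OC: "open (OC i)"
 unfolding OC_def using compact_K by (intro open_Compl compact_imp_closed)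

lemma shell_OC: "shell K i \<subseteq> OC i"
proof (cases i)
 case 0 thus ?thesis using K by (auto simp: OC_def compact_exhaustion_def)
next
 case (Suc j)
 have "K j \<subseteq> interior (K (Suc j))" using K by (auto simp: compact_exhaustion_def)
 thus ?thesis by (auto simp: Suc OC_def shell_def)
qed

definition touch :: "nat => nat => bool" where "touch k i \<longleftrightarrow> (\<exists>x\<in>OC i. g k x ~= 0)"

lemma K_mono: "i <= j ==> K i \<subseteq> K j"
proof (induction j)
 case (Suc j)
 have "K j \<subseteq> interior (K (Suc j))" using K by (auto simp: compact_exhaustion_def)
 hence "K j \<subseteq> K (Suc j)" using interior_subset by blast
 thus ?case using Suc by (cases "i = Suc j") auto
qed simp

lemma finite_touch: "finite {i. touch k i}"
proof -
 let ?B = "cball 0 (norm (snd (fst (idx k))) + 1) :: R3 set"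
 have "?B \<subseteq> (\<Union>i. interior (K (Suc i)))"
 proof
  fix x :: "R3" have "x \<in> (\<Union>i. K i)" using K by (auto simp: compact_exhaustion_def)
  then obtain i where "x \<in> K i" by blast
  moreover have "K i \<subseteq> interior (K (Suc i))" using K by (auto simp: compact_exhaustion_def)
  ultimately show "x \<in> (\<Union>i. interior (K (Suc i)))" by blast
 qed
 then obtain C where C: "finite C" "?B \<subseteq> (\<Union>i\<in>C. interior (K (Suc i)))"
  using compactE_image[OF compact_cball, of UNIV "%i. interior (K (Suc i))"] by (metis open_interior subset_UNIV)
 obtain N where N: "!!i. i \<in> C ==> i < N" using C(1) by (metis finite_nat_set_iff_bounded)
 have B: "?B \<subseteq> K N"
 proof
  fix x assume "x \<in> ?B"
  then obtain i where "i \<in> C" "x \<in> K (Suc i)" using C(2) interior_subset by blast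
  thus "x \<in> K N" using K_mono[of "Suc i" N] N[of i] by auto
 qed
 have "i <= N + 1" if tk: "touch k i" for i
 proof (rule ccontr)
  assume "\<not> i <= N + 1"
  hence "K N \<subseteq> K (i - 1)" by (intro K_mono) auto
  moreover obtain x where "x \<in> OC i" "g k x ~= 0" using tk by (auto simp: touch_def)
  moreover have "x \<in> ?B" using g_supp[of k x] \<open>g k x ~= 0\<close> by (auto simp: not_less[symmetric])
  ultimately show False using B by (auto simp: OC_def)
 qed
 thus ?thesis using finite_nat_set_iff_bounded_le by auto
qed

text \<open>The support of \<open>g k\<close> is bounded and meets only finitely many of the sets
  \<open>OC i\<close>, so one positive number serves all shells it can influence. Halving gives
  strict inequalities.\<close>

definition cc :: "nat => real" where "cc k = Min (insert 1 (ep ` {i. touch k i})) / 2"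

lemma cc: "cc k > 0" "cc k <= 1" "touch k i ==> cc k < ep i"
proof -
 have fin: "finite (insert 1 (ep ` {i. touch k i}))" using finite_touch by simp
 have p: "Min (insert 1 (ep ` {i. touch k i})) > 0" using ep(1) by (auto simp: Min_gr_iff[OF fin])
 thus "cc k > 0" by (simp add: cc_def)
 show "cc k <= 1" using Min_le[OF fin, of 1] by (simp add: cc_def)
 show "cc k < ep i" if "touch k i" using Min_le[OF fin, of "ep i"] that p by (simp add: cc_def)
qed

text \<open>On \<open>OC i\<close> the fields that vanish there may be given coefficient 0; the
  other coefficients are below \<open>ep i\<close> by the choice of \<open>cc\<close>. This is how a
  condition on every shell at once is met by one sequence.\<close>

lemma NW_close:
 assumes t: "!!k. \<bar>t k\<bar> <= cc k" and vs: "vs \<in> multi_indices r" and x: "x \<in> shell K i"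
 shows "norm (partial_deriv vs eta x - partial_deriv vs (NW t) x) < dl i / 2"
proof -
 define t' where "t' k = (if touch k i then t k else 0)" for k
 have "W t y = W t' y" if "y \<in> OC i" for y
 proof -
  have "clamp1 (t k) *\<^sub>R g k y = clamp1 (t' k) *\<^sub>R g k y" for k
   using that by (auto simp: t'_def touch_def)
  hence "(%k. clamp1 (t k) *\<^sub>R g k y) = (%k. clamp1 (t' k) *\<^sub>R g k y)" by (rule ext)
  thus ?thesis by (simp only: W_def)
 qed
 hence "NW t y = NW t' y" if "y \<in> OC i" for y using that by (simp add: NW_def)
 hence e: "partial_deriv vs (NW t) x = partial_deriv vs (NW t') x"
  using shell_OC x by (intro partial_deriv_cong_open[OF open_OC[of i]]) auto
 show ?thesis unfolding e
  by (rule ep(2)[OF _ vs x]) (use t cc(3) ep(1)[of i] in \<open>auto simp: t'_def intro: le_less_trans\<close>)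
qed

definition Vs :: "(nat => real) => R3 => R3" where "Vs s = W (%k. cc k * theta (s k))"
definition wk :: "nat => R3 => R3" where "wk k x = cc k *\<^sub>R g k x"
definition es :: "(nat => real) => R3 => R3" where "es s = NW (%k. cc k * theta (s k))"

lemma t_le: "\<bar>cc k * theta u\<bar> <= cc k"
 using abs_theta[of u] cc(1)[of k] by (simp add: abs_mult)

lemma t_le1: "\<bar>cc k * theta u\<bar> <= 1"
 using t_le cc(2) order_trans by blast

lemma Vs_eq: "Vs s x = eta x + (\<Sum>k. theta (s k) *\<^sub>R wk k x)"
 by (simp add: Vs_def W_def wk_def clamp1(2)[OF t_le1] mult.commute[of "theta _"])

lemma summable_Vs: "summable (%k. theta (s k) *\<^sub>R wk k x)"
 using summable_terms[of "%k. cc k * theta (s k)" x] by (simp add: wk_def clamp1(2)[OF t_le1] mult.commute[of "theta _"])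

lemma continuous_t: "continuous_on UNIV (%s k. cc k * theta (s k))"
 by (intro continuous_on_coordinatewise_then_product continuous_intros
  continuous_on_compose2[OF continuous_theta[of UNIV] continuous_coord]) auto

lemma Ck_Vs: "Ck r Vs"
 unfolding Vs_def using Ck_reparam[OF continuous_t Ck_W] .

lemma Ck_wk: "Ck r (%_::real. wk k)"
 unfolding wk_def by (intro Ck_scaleR Ck_const Ck_g)

lemma es_eq: "es s x = (1 / norm (Vs s x)) *\<^sub>R Vs s x"
 by (simp add: es_def Vs_def NW_eq)

lemma es_unit: "es s \<in> unit_vector_fields r"
proof -
 have "Ck r (%_::real. es s)" unfolding es_def by (rule Ck_fixed_param[OF Ck_NW])
 thus ?thesis by (simp add: unit_vector_fields_def vector_fields_def Cr_on_iff_Ck es_def norm_NW)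
qed

lemma es_nbhd: "es s \<in> whitney_nbhd r K eta \<delta>"
proof -
 have "Cr_dist r eta (es s) (shell K i) < (INF x\<in>shell K i. \<delta> x)" for i
 proof -
  \<comment> \<open>A supremum weakens strict bounds, hence the half of \<open>dl i\<close> in the
    preceding estimates.\<close>
  have "Cr_dist r eta (es s) (shell K i) <= dl i / 2"
   unfolding Cr_dist_def
  proof (rule cSUP_least)
   have "[] \<in> multi_indices r" by (simp add: multi_indices_def)
   thus "multi_indices r \<times> shell K i ~= {}" using shell_nonempty[OF K] by blast
   fix p :: "R3 list \<times> R3" assume "p \<in> multi_indices r \<times> shell K i"
   then obtain vs x where p: "p = (vs, x)" "vs \<in> multi_indices r" "x \<in> shell K i" by auto
   show "(case p of (vs, x) => norm (partial_deriv vs eta x - partial_deriv vs (es s) x)) <= dl i / 2"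
    using NW_close[OF t_le p(2,3), of s] by (simp add: p(1) es_def)
  qed
  also have "... < dl i" using dl_pos[of i] by simp
  finally show ?thesis by (simp add: dl_def)
 qed
 thus ?thesis using es_unit by (simp add: whitney_nbhd_def unit_vector_fields_def)
qed

lemma span_wk:
 assumes i: "i >= 1" and q: "q \<in> QS"
 shows "\<exists>F bet. finite F & tfield kT (real i) q c1 v1 c2 v2 e = (%y. \<Sum>k\<in>F. bet k *\<^sub>R wk k y)"
proof -
 \<comment> \<open>The bump with factor \<open>i\<close> is stored under \<open>i - 1\<close>,
   because \<open>raw\<close> applies \<open>Suc\<close> to exclude 0.\<close>
 have "\<exists>k. idx k = ((i - 1, q), z)" for z
  using range_idx q by (metis (no_types, lifting) SigmaI TS_def UNIV_I image_iff)
 then obtain kz where kz: "!!z. idx (kz z) = ((i - 1, q), z)" by metis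
 have inj: "inj kz" by (metis injI kz prod.inject)
 let ?co = "%z::3 option \<times> 3 option \<times> 3. (case fst z of None => c1 | Some i => v1 $ i) *
  (case fst (snd z) of None => c2 | Some i => v2 $ i) * e $ (snd (snd z))"
 define bet where "bet k = ?co (snd (idx k)) * (bnd (idx k) * 2 ^ (k + 2)) / cc k" for k
 have raw: "raw ((i - 1, q), z) x = ((bnd (idx (kz z)) * 2 ^ (kz z + 2)) / cc (kz z)) *\<^sub>R wk (kz z) x" for z x
  using bnd(1)[of "idx (kz z)"] cc(1)[of "kz z"] by (simp add: wk_def g_def kz)
 have "tfield kT (real i) q c1 v1 c2 v2 e y = (\<Sum>k\<in>range kz. bet k *\<^sub>R wk k y)" for y
 proof -
  have "tfield kT (real i) q c1 v1 c2 v2 e y = (\<Sum>z\<in>UNIV. ?co z *\<^sub>R raw ((i - 1, q), z) y)"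
   unfolding tfield_expand[of kT "real i" q c1 v1 c2 v2 e] raw_def using i by simp
  also have "... = (\<Sum>z\<in>UNIV. bet (kz z) *\<^sub>R wk (kz z) y)"
   by (rule sum.cong[OF refl]) (simp only: raw bet_def kz snd_conv scaleR_scaleR times_divide_eq_right)
  also have "... = (\<Sum>k\<in>range kz. bet k *\<^sub>R wk k y)" by (simp add: sum.reindex[OF inj])
  finally show ?thesis .
 qed
 thus ?thesis by (intro exI[of _ "range kz"] exI[of _ bet]) (auto simp: fun_eq_iff)
qed

text \<open>Changing three distinct coefficients by \<open>alp\<close> means replacing three entries
  through \<open>psi\<close>, which is possible for small \<open>alp\<close> because
  \<open>theta\<close> stays strictly between -1 and 1.\<close>

lemma shift_Vs:
 assumes kk: "inj (kk :: 3 => nat)"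
 shows "\<exists>sig::R3 => (nat => real). (sig \<longlongrightarrow> s) (at 0) &
  (\<forall>\<^sub>F alp in at 0. Vs (sig alp) = (%x. Vs s x + (\<Sum>i\<in>UNIV. alp $ i *\<^sub>R wk (kk i) x)))"
proof -
 define sig where "sig alp k = (if k \<in> range kk then psi (theta (s k) + alp $ (inv kk k)) else s k)" for alp :: "R3" and k
 define A where "A = (\<Inter>i\<in>UNIV. {alp::R3. \<bar>theta (s (kk i)) + alp $ i\<bar> < 1})"
 have A: "open A" "0 \<in> A"
  unfolding A_def using abs_theta by (auto intro!: open_INT open_Collect_less continuous_intros)
 have "continuous_on A (%alp. sig alp k)" for k
 proof (cases "k \<in> range kk")
  case True
  then obtain i where i: "k = kk i" by blast
  have "continuous_on A (%alp. psi (theta (s (kk i)) + alp $ i))"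
   unfolding psi_def by (intro continuous_intros) (auto simp: A_def, metis less_irrefl)
  thus ?thesis by (simp add: sig_def i inv_f_f[OF kk])
 qed (simp add: sig_def)
 hence "continuous_on A sig" by (intro continuous_on_coordinatewise_then_product)
 hence "continuous (at 0) sig" using A by (simp add: continuous_on_eq_continuous_at)
 moreover have "sig 0 = s" by (auto simp: sig_def fun_eq_iff psi_theta)
 ultimately have "(sig \<longlongrightarrow> s) (at 0)" by (simp add: continuous_at)
 moreover have "\<forall>\<^sub>F alp in at 0. alp \<in> A" using A by (rule eventually_at_in_open')
 hence "\<forall>\<^sub>F alp in at 0. Vs (sig alp) = (%x. Vs s x + (\<Sum>i\<in>UNIV. alp $ i *\<^sub>R wk (kk i) x))"
 proof (rule eventually_mono)
  fix alp assume alp: "alp \<in> A"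
  show "Vs (sig alp) = (%x. Vs s x + (\<Sum>i\<in>UNIV. alp $ i *\<^sub>R wk (kk i) x))"
  proof
   fix x
   define b where "b k = (if k \<in> range kk then alp $ (inv kk k) *\<^sub>R wk k x else 0)" for k
   have th: "theta (sig alp k) *\<^sub>R wk k x = theta (s k) *\<^sub>R wk k x + b k" for k
   proof (cases "k \<in> range kk")
    case True
    then obtain i where i: "k = kk i" by blast
    have "\<bar>theta (s (kk i)) + alp $ i\<bar> < 1" using alp by (auto simp: A_def)
    from theta_psi[OF this] show ?thesis by (simp add: sig_def b_def i inv_f_f[OF kk] scaleR_add_left)
   qed (simp add: sig_def b_def)
   have bs: "b sums (\<Sum>k\<in>range kk. b k)" by (rule sums_finite) (auto simp: b_def)
   have "(\<Sum>k. theta (sig alp k) *\<^sub>R wk k x) = (\<Sum>k. theta (s k) *\<^sub>R wk k x) + (\<Sum>k\<in>range kk. b k)"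
    unfolding th using suminf_add[OF summable_Vs[of s x] sums_summable[OF bs]] sums_unique[OF bs] by simp
   also have "(\<Sum>k\<in>range kk. b k) = (\<Sum>i\<in>UNIV. alp $ i *\<^sub>R wk (kk i) x)"
    by (simp add: sum.reindex[OF kk] b_def inv_f_f[OF kk])
   finally show "Vs (sig alp) x = Vs s x + (\<Sum>i\<in>UNIV. alp $ i *\<^sub>R wk (kk i) x)" by (simp add: Vs_eq)
  qed
 qed
 ultimately show ?thesis by blast
qed

lemma principal_shift:
 assumes "sg = 1 \<or> sg = -1" "Ck 3 (%_::real. w)" "\<exists>R. \<forall>x. norm x > R --> w x = 0"
 shows "principal_shift sg w Vs wk kT QS"
proof unfold_locales
 show "Ck 3 Vs" "Ck 3 (%_::real. wk k)" for k
  using Ck_mono[OF Ck_Vs r] Ck_mono[OF Ck_wk r] by auto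
 show "Vs s x ~= 0" for s x by (simp add: Vs_def W_nonzero)
 show "7 <= kT" by (simp add: kT_def)
 show "\<exists>q\<in>QS. norm (q - p) <= e" if "e > 0" for p e
  using QS(2)[of "ball p e"] that by (force simp: dist_norm norm_minus_commute)
qed (use assms span_wk shift_Vs in auto)

end

section \<open>Cycles and return maps\<close>

lemma dt3_det: "dt3 N = det N"
 by (simp add: dt3_def det_3 inner_vec_def sum_3 cross3_simps)

lemma tr3_trace: "tr3 N = trace N"
 by (simp add: tr3_def trace_def)

lemma affine_vd:
 assumes u: "!!t. t \<in> {0..1} ==> (u has_vector_derivative u' t) (at t within {0..1})"
  and ab: "a >= 0" "b >= 0" "a + b <= 1" and t: "t \<in> {0..1::real}"
 shows "((%t. u (a + b * t)) has_vector_derivative b *\<^sub>R u' (a + b * t)) (at t within {0..1})"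
proof -
 have in01: "a + b * t \<in> {0..1}" if "t \<in> {0..1}" for t
  using that ab mult_left_le[of t b] by auto
 have "((%t. a + b * t) has_vector_derivative b) (at t within {0..1})"
  by (auto intro!: derivative_eq_intros)
 moreover have "(u has_vector_derivative u' (a + b * t)) (at (a + b * t) within (%t. a + b * t) ` {0..1})"
  using u[OF in01[OF t]] by (rule has_vector_derivative_within_subset) (use in01 in auto)
 ultimately show ?thesis using vector_diff_chain_within by (force simp: comp_def)
qed

context principal_family
begin

text \<open>The flow law, rescaled so that every piece of orbit is run through in unit time.\<close>

lemma orb_affine:
 assumes ab: "a >= 0" "b >= 0" "a + b <= 1" and t: "t \<in> {0..1}"
 shows "orb s T x (a + b * t) = orb s (b * T) (orb s T x a) t"
proof (rule sol1_unique[where G = "%y. (b * T) *\<^sub>R Ys s y", OF _ _ _ _ t])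
 show "Ck 1 (%_::real. %y. (b * T) *\<^sub>R Ys s y)"
  by (intro Ck_scaleR_const Ck_fixed_param Ck_mono[OF Ck_Ys]) simp
 show "sol1 (%y. (b * T) *\<^sub>R Ys s y) (orb s (b * T) (orb s T x a))"
  using orb_vd by (simp add: sol1_def)
 show "sol1 (%y. (b * T) *\<^sub>R Ys s y) (%t. orb s T x (a + b * t))"
  unfolding sol1_def using affine_vd[OF orb_vd ab] by simp
qed (simp add: orb_0)

lemma orb_scale: "t \<in> {0..1} ==> b \<in> {0..1} ==> orb s T x (b * t) = orb s (b * T) x t"
 using orb_affine[of 0 b t s T x] by (simp add: orb_0)

lemma rows_affine:
 assumes ab: "a >= 0" "b >= 0" "a + b <= 1" and t: "t \<in> {0..1}"
 shows "(\<Sum>r\<in>UNIV. h $ r *\<^sub>R orbN s T x (a + b * t) $ r) =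
  (\<Sum>r\<in>UNIV. (\<Sum>r\<in>UNIV. h $ r *\<^sub>R orbN s T x a $ r) $ r *\<^sub>R orbN s (b * T) (orb s T x a) t $ r)"
proof (rule row_unique[OF _ rows_comb_vd, where a = 0])
 fix t :: real assume t: "t \<in> {0..1}"
 show "((%t. \<Sum>r\<in>UNIV. h $ r *\<^sub>R orbN s T x (a + b * t) $ r) has_vector_derivative
   (b * T) *\<^sub>R DY s (orb s (b * T) (orb s T x a) t) (\<Sum>r\<in>UNIV. h $ r *\<^sub>R orbN s T x (a + b * t) $ r)) (at t within {0..1})"
  using affine_vd[OF rows_comb_vd[where c = "($) h"] ab t] by (simp add: orb_affine[OF ab t, symmetric])
qed (use t in \<open>auto simp: orb_0 vec_eq_iff forall_3 sum_3 mat_def\<close>)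

text \<open>The linearised flow over the times from 0 to \<open>1 + a\<close> factors either through
  time \<open>a\<close> or through time 1, so the monodromies at two points of the orbit are
  conjugate. The period \<open>2 * tau\<close> is used to fit two rounds into the unit
  interval.\<close>

lemma orbN_conjugate:
 assumes cl: "orb s tau x 1 = x" and a: "a \<in> {0..1}"
 shows "tr3 (orbN s tau (orb s tau x a) 1) = tr3 (orbN s tau x 1)" "dt3 (orbN s tau (orb s tau x a) 1) = dt3 (orbN s tau x 1)"
proof -
 let ?Q = "orbN s tau x a" and ?N0 = "orbN s tau x 1" and ?N1 = "orbN s tau (orb s tau x a) 1"
 have sc: "orb s (2 * tau) x (t / 2) = orb s tau x t" if "t \<in> {0..1}" for t
  using orb_scale[of t "1/2" s "2 * tau" x] that by simp
 have scN: "(\<Sum>r\<in>UNIV. h $ r *\<^sub>R orbN s (2 * tau) x (t / 2) $ r) = (\<Sum>r\<in>UNIV. h $ r *\<^sub>R orbN s tau x t $ r)" if "t \<in> {0..1}" for h t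
 proof -
  have "(\<Sum>r\<in>UNIV. h $ r *\<^sub>R (mat 1 :: real^3^3) $ r) = h" by (simp add: vec_eq_iff forall_3 sum_3 mat_def)
  thus ?thesis using rows_affine[of 0 "1/2" t h s "2 * tau" x] that by (simp add: orb_0)
 qed
 have ax: "(\<Sum>r\<in>UNIV. axis i 1 $ r *\<^sub>R M $ r) = M $ i" for i and M :: "real^3^3"
  by (simp add: axis_def if_distrib[of "%c. c *\<^sub>R _"] cong: if_cong)
 have "(\<Sum>r\<in>UNIV. ?Q $ i $ r *\<^sub>R ?N1 $ r) = (\<Sum>r\<in>UNIV. ?N0 $ i $ r *\<^sub>R ?Q $ r)" for i
 proof -
  let ?h = "axis i 1 :: R3"
  have "(\<Sum>r\<in>UNIV. ?h $ r *\<^sub>R orbN s (2 * tau) x (a / 2 + 1 / 2 * 1) $ r)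
    = (\<Sum>r\<in>UNIV. (\<Sum>r\<in>UNIV. ?h $ r *\<^sub>R orbN s (2 * tau) x (a / 2) $ r) $ r *\<^sub>R orbN s (1 / 2 * (2 * tau)) (orb s (2 * tau) x (a / 2)) 1 $ r)"
   by (rule rows_affine) (use a in auto)
  moreover have "(\<Sum>r\<in>UNIV. ?h $ r *\<^sub>R orbN s (2 * tau) x (1 / 2 + 1 / 2 * a) $ r)
    = (\<Sum>r\<in>UNIV. (\<Sum>r\<in>UNIV. ?h $ r *\<^sub>R orbN s (2 * tau) x (1 / 2) $ r) $ r *\<^sub>R orbN s (1 / 2 * (2 * tau)) (orb s (2 * tau) x (1 / 2)) a $ r)"
   by (rule rows_affine) (use a in auto)
  moreover have "a / 2 + 1 / 2 * 1 = 1 / 2 + 1 / 2 * a" by simp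
  ultimately show ?thesis
   using sc[OF a] sc[of 1] scN[OF a, of ?h] scN[of 1 ?h] cl by (simp add: ax add.commute[of "a / 2" "1 / 2"])
 qed
 hence QN: "?Q ** ?N1 = ?N0 ** ?Q"
  by (simp add: vec_eq_iff matrix_matrix_mult_def)
 have "invertible (transpose ?Q)"
  unfolding invertible_left_inverse matrix_left_invertible_ker
 proof (intro allI impI)
  fix h :: "R3" assume "transpose ?Q *v h = 0"
  hence 0: "(\<Sum>r\<in>UNIV. h $ r *\<^sub>R ?Q $ r) = 0"
   by (simp add: vec_eq_iff matrix_vector_mult_def transpose_def mult.commute)
  have z: "((%_. 0) has_vector_derivative tau *\<^sub>R DY s (orb s tau x t) 0) (at t within {0..1})" for t
   by (simp add: linear_0[OF linear_DY])
  have "(\<Sum>r\<in>UNIV. h $ r *\<^sub>R orbN s tau x 0 $ r) = 0"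
   by (rule row_unique[OF rows_comb_vd z a]) (use 0 in auto)
  thus "h = 0" by (simp add: orb_0 vec_eq_iff forall_3 sum_3 mat_def)
 qed
 hence Q0: "det ?Q ~= 0" "invertible ?Q" by (simp_all add: invertible_det_nz)
 then obtain R where R: "R ** ?Q = mat 1" "?Q ** R = mat 1" unfolding invertible_def by blast
 have "R ** (?N0 ** ?Q) = (R ** ?Q) ** ?N1" by (simp only: QN[symmetric] matrix_mul_assoc)
 hence "?N1 = R ** (?N0 ** ?Q)" by (simp only: R(1) matrix_mul_lid)
 hence "trace ?N1 = trace (R ** (?N0 ** ?Q))" by (rule arg_cong)
 also have "... = trace ((?N0 ** ?Q) ** R)" by (rule trace_mul_sym)
 also have "(?N0 ** ?Q) ** R = ?N0" by (simp only: matrix_mul_assoc[symmetric] R(2) matrix_mul_rid)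
 finally show "tr3 ?N1 = tr3 ?N0" by (simp add: tr3_trace)
 have "det (?Q ** ?N1) = det (?N0 ** ?Q)" by (simp only: QN)
 thus "dt3 ?N1 = dt3 ?N0" using Q0 by (simp add: dt3_det det_mul)
qed

text \<open>Dividing \<open>Vs s\<close> by its norm multiplies the second fundamental form by a positive factor.\<close>

definition ns :: "'s => R3 => R3" where "ns s x = (1 / norm (Vs s x)) *\<^sub>R Vs s x"

lemma Vs_hd: "(Vs s has_derivative FD (Vs s) x) (at x)"
 using Ck_has_derivative[of 2 Vs] Vs by (simp add: num23 del: Ck.simps)

lemma ns_form:
 shows "normal_plane (ns s) x = {X. Vs s x \<bullet> X = 0}" "1 / norm (Vs s x) > 0"
  and "Vs s x \<bullet> X = 0 ==> FD (ns s) x X \<bullet> X = 1 / norm (Vs s x) * qf (jac (Vs s) x) X"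
proof -
 show "normal_plane (ns s) x = {X. Vs s x \<bullet> X = 0}" "1 / norm (Vs s x) > 0"
  using Vs0 by (auto simp: normal_plane_def ns_def)
 assume X: "Vs s x \<bullet> X = 0"
 have "(%x. 1 / norm (Vs s x)) differentiable (at x)"
  using differentiable_chain_at[of "Vs s" x norm] Vs_hd[of s x] Vs0[of s x] differentiable_norm_at
  by (intro differentiable_divide differentiable_const) (auto simp: differentiable_def comp_def)
 hence "((%x. 1 / norm (Vs s x)) has_derivative FD (%x. 1 / norm (Vs s x)) x) (at x)"
  using frechet_derivative_works by blast
 from has_derivative_scaleR[OF this Vs_hd[of s x]]
 have "(ns s has_derivative (%h. (1 / norm (Vs s x)) *\<^sub>R FD (Vs s) x h + FD (%x. 1 / norm (Vs s x)) x h *\<^sub>R Vs s x)) (at x)"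
  by (simp add: ns_def[abs_def])
 from fun_cong[OF frechet_derivative_at[OF this], of X]
 have "FD (ns s) x X = (1 / norm (Vs s x)) *\<^sub>R FD (Vs s) x X + FD (%x. 1 / norm (Vs s x)) x X *\<^sub>R Vs s x" by simp
 moreover have "FD (Vs s) x X = mv (jac (Vs s) x) X"
  by (rule jac_mv) (use Vs_hd in \<open>auto simp: differentiable_def\<close>)
 ultimately show "FD (ns s) x X \<bullet> X = 1 / norm (Vs s x) * qf (jac (Vs s) x) X"
  using X by (simp add: qf_def inner_add_left)
qed

lemma Ys_YY: "Ys s x = YY sg (w x) (Vs s x) (jac (Vs s) x)"
 by (simp add: YJ_def jt_def)

lemma Ys_principal:
 assumes "Ys s x ~= 0"
 shows "Ys s x \<in> principal_directions (ns s) (kap sg (ns s)) x" "x \<notin> partially_umbilic_set (ns s)"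
 using YY_principal[OF Vs0 ns_form sg, of s x "w x"] assms by (simp_all add: Ys_YY)

lemma Ys_of_principal:
 assumes "e \<in> principal_directions (ns s) (kap sg (ns s)) x" "x \<notin> partially_umbilic_set (ns s)" "w x \<bullet> e > 0"
 obtains a where "a > 0" "e = a *\<^sub>R Ys s x" "Ys s x ~= 0"
 using YY_of_principal[OF Vs0 ns_form sg assms] by (metis Ys_YY)

lemma Ys_lip: obtains L where "L >= 0" "!!x y. norm (Ys s x - Ys s y) <= L * norm (x - y)"
proof -
 obtain L where L: "L >= 0" "!!x y. norm (YF (%_. 0) s (0, x) - YF (%_. 0) s (0, y)) <= L * norm (x - y)"
  using YF_lipschitz by metis
 show ?thesis by (rule that[OF L(1)]) (use L(2) in \<open>simp add: YF_0\<close>)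
qed

text \<open>As \<open>w\<close> lies on the side of the tangent, the tangent is a positive multiple
  \<open>a t\<close> of the field. The primitive of \<open>a\<close> is the time change, its value
  at \<open>T\<close> is \<open>tau\<close>, and Gronwall identifies the curve with the
  orbit.\<close>

lemma cycle_orbit:
 assumes cyc: "principal_cycle (ns s) (kap sg (ns s)) gam T"
  and w0: "!!t. w (gam t) \<bullet> vector_derivative gam (at t) > 0"
 obtains tau where "tau > 0" "Ys s (gam 0) ~= 0" "orb s tau (gam 0) 1 = gam 0"
  "!!t t'. t \<in> {0<..<1} ==> t' \<in> {0..1} ==> orb s tau (gam 0) t' = orb s tau (gam 0) t ==> t' = t"
  "range gam = orb s tau (gam 0) ` {0..1}"
  "\<exists>a>0. vector_derivative gam (at 0) = a *\<^sub>R Ys s (gam 0)"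
proof -
 have T: "T > 0" and per: "gam (t + T) = gam t" and inj: "inj_on gam {0..<T}"
  and C1: "gam C1_differentiable_on UNIV"
  and pd: "gam t \<notin> partially_umbilic_set (ns s)" "vector_derivative gam (at t) \<in> principal_directions (ns s) (kap sg (ns s)) (gam t)" for t
  using cyc by (auto simp: principal_cycle_def principal_line_def)
 have "\<exists>a>0. vector_derivative gam (at t) = a *\<^sub>R Ys s (gam t) & Ys s (gam t) ~= 0" for t
  using Ys_of_principal[OF pd(2) pd(1) w0] by metis
 then obtain a where a: "!!t. a t > 0" "!!t. vector_derivative gam (at t) = a t *\<^sub>R Ys s (gam t)" and Y0: "!!t. Ys s (gam t) ~= 0" by metis
 obtain D where D: "!!t. (gam has_vector_derivative D t) (at t)" "continuous_on UNIV D"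
  using C1 unfolding C1_differentiable_on_def by blast
 have Da: "D t = a t *\<^sub>R Ys s (gam t)" for t using vector_derivative_at[OF D(1)] a(2) by metis
 have cgam: "continuous_on UNIV gam" using D(1) by (auto intro: continuous_at_imp_continuous_on has_vector_derivative_continuous)
 have cY: "continuous_on UNIV (%t. Ys s (gam t))"
  by (rule continuous_on_compose2[OF Ck_continuous_arg[OF Ck_Ys, of UNIV] cgam]) auto
 \<comment> \<open>The factors \<open>a t\<close> were chosen pointwise; this quotient recovers them
   and shows that they are continuous.\<close>
 have "continuous_on UNIV (%t. (D t \<bullet> Ys s (gam t)) / (Ys s (gam t) \<bullet> Ys s (gam t)))"
  by (intro continuous_intros D(2) cY) (simp add: Y0)
 hence ca: "continuous_on UNIV a" by (simp add: Da Y0)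
 define tht where "tht t = integral {0..t} a" for t
 have tht': "(tht has_vector_derivative a t) (at t within {0..T})" if "t \<in> {0..T}" for t
  unfolding tht_def by (rule integral_has_vector_derivative[OF continuous_on_subset[OF ca]]) (use that in auto)
 have ctht: "continuous_on {0..T} tht" using tht' by (rule continuous_on_vector_derivative)
 have mono: "tht t < tht t'" if t: "0 <= t" "t < t'" "t' <= T" for t t'
 proof -
  show ?thesis
  proof (rule DERIV_pos_imp_increasing_open[OF t(2)])
   fix z assume "t < z" "z < t'"
   hence "(tht has_vector_derivative a z) (at z)"
    using tht'[of z] t by (simp add: at_within_Icc_at)
   thus "\<exists>y. DERIV tht z :> y & 0 < y" using a(1) by (auto simp: has_real_derivative_iff_has_vector_derivative)
  qed (use continuous_on_subset[OF ctht] t in auto)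
 qed
 have tht0: "tht 0 = 0" by (simp add: tht_def)
 define tau where "tau = tht T"
 have tau: "tau > 0" using mono[of 0 T] T by (simp add: tau_def tht0)
 let ?o = "orb s tau (gam 0)"
 have tht01: "tht t / tau \<in> {0..1}" if "t \<in> {0..T}" for t
  using mono[of 0 t] mono[of t T] that tau by (cases "t = 0"; cases "t = T") (auto simp: tht0 tau_def)
 have eq: "gam t = ?o (tht t / tau)" if t: "t \<in> {0..T}" for t
 proof -
  obtain L where L: "L >= 0" "!!x y. norm (Ys s x - Ys s y) <= L * norm (x - y)" using Ys_lip by blast
  obtain M where M: "!!t. t \<in> {0..T} ==> norm (a t) <= M" "M >= 0"
   using continuous_on_compact_bound[OF compact_Icc continuous_on_subset[OF ca], of 0 T] by auto
  have "((%t. gam t - ?o (tht t / tau)) has_vector_derivative (a t *\<^sub>R Ys s (gam t) - a t *\<^sub>R Ys s (?o (tht t / tau)))) (at t within {0..T})" if t: "t \<in> {0..T}" for t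
  proof -
   have "((%t. tht t / tau) has_vector_derivative a t / tau) (at t within {0..T})"
    using bounded_linear.has_vector_derivative[OF bounded_linear_divide tht'[OF t]] .
   moreover have "(?o has_vector_derivative tau *\<^sub>R Ys s (?o (tht t / tau))) (at (tht t / tau) within (%t. tht t / tau) ` {0..T})"
    using orb_vd[OF tht01[OF t]] by (rule has_vector_derivative_within_subset) (use tht01 in auto)
   ultimately have "((%t. ?o (tht t / tau)) has_vector_derivative (a t / tau) *\<^sub>R tau *\<^sub>R Ys s (?o (tht t / tau))) (at t within {0..T})"
    using vector_diff_chain_within by (force simp: comp_def)
   thus ?thesis using tau D(1)[of t] by (intro has_vector_derivative_diff) (auto simp: Da intro: has_vector_derivative_at_within)
  qed
  moreover have "norm (a t *\<^sub>R Ys s (gam t) - a t *\<^sub>R Ys s (?o (tht t / tau))) <= (M * L) * norm (gam t - ?o (tht t / tau)) + 0" if "t \<in> {0..T}" for t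
  proof -
   have "norm (a t *\<^sub>R (Ys s (gam t) - Ys s (?o (tht t / tau)))) <= M * (L * norm (gam t - ?o (tht t / tau)))"
    unfolding norm_scaleR using M(1)[OF that] L by (intro mult_mono) auto
   thus ?thesis by (simp add: scaleR_diff_right)
  qed
  ultimately have "norm (gam t - ?o (tht t / tau)) <= (norm (gam 0 - ?o (tht 0 / tau)) + 0 * t) * exp ((M * L) * t)"
   by (rule gronwall) (use M L t in auto)
  thus ?thesis by (simp add: tht0 orb_0)
 qed
 have inv: "\<exists>u\<in>{0..T}. t = tht u / tau" if "t \<in> {0..1}" for t
 proof -
  have "\<exists>u\<ge>0. u <= T & tht u = t * tau"
   by (rule IVT'[OF _ _ _ ctht]) (use that tau T in \<open>auto simp: tht0 tau_def[symmetric] mult_left_le_one_le\<close>)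
  thus ?thesis using tau by force
 qed
 have gamT: "gam T = gam 0" using per[of 0] by simp
 show ?thesis
 proof (rule that[OF tau Y0])
  show cl: "?o 1 = gam 0" using eq[of T] T tau gamT by (simp add: tau_def)
  fix t t' assume t: "t \<in> {0<..<1}" "t' \<in> {0..1}" and e: "?o t' = ?o t"
  obtain u where u: "u \<in> {0..T}" "t = tht u / tau" using inv[of t] t by auto
  obtain u' where u': "u' \<in> {0..T}" "t' = tht u' / tau" using inv[of t'] t by auto
  have "u ~= 0" "u ~= T" using t u tht0 tau by (auto simp: tau_def)
  hence uu: "u \<in> {0..<T}" using u by auto
  have g: "gam u' = gam u" using eq[OF u(1)] eq[OF u'(1)] e u u' by simp
  show "t' = t"
  proof (cases "u' = T")
   case True
   hence "gam 0 = gam u" using g gamT by simp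
   hence "0 = u" using inj uu T by (auto dest: inj_onD)
   thus ?thesis using \<open>u ~= 0\<close> by simp
  next
   case False
   hence "u' = u" using inj_onD[OF inj g] u' uu by auto
   thus ?thesis using u u' by simp
  qed
 next
  have "gam t \<in> ?o ` {0..1}" for t
  proof -
   obtain u where u: "u \<in> {0..<T}" "gam t = gam u" by (rule periodic_reduce[of T gam t, OF T per]) (rule that)
   thus ?thesis using eq[of u] tht01[of u] u by auto
  qed
  moreover have "?o t \<in> range gam" if "t \<in> {0..1}" for t using inv[OF that] eq by (metis rangeI)
  ultimately show "range gam = ?o ` {0..1}" by auto
  show "\<exists>a>0. vector_derivative gam (at 0) = a *\<^sub>R Ys s (gam 0)" using a by blast
 qed
qed

end

text \<open>A real eigenvalue on the unit circle is 1 or -1, which the first two conditions exclude.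
  A non-real one comes with its conjugate, and then the determinant is the square of its
  modulus.\<close>

lemma eigenvalue_2:
 fixes M :: "real^2^2"
 assumes z: "complex_eigenvalue M z" and tr: "tr = M $ 1 $ 1 + M $ 2 $ 2" and dt: "dt = M $ 1 $ 1 * M $ 2 $ 2 - M $ 1 $ 2 * M $ 2 $ 1"
  and nz: "1 - tr + dt ~= 0" "1 + tr + dt ~= 0" "dt ~= 1"
 shows "cmod z ~= 1"
proof
 assume c1: "cmod z = 1"
 obtain v :: "complex^2" where v: "v ~= 0" "(\<chi> i j. complex_of_real (M $ i $ j)) *v v = z *s v"
  using z by (auto simp: complex_eigenvalue_def)
 let ?m = "%i j. complex_of_real (M $ i $ j)"
 have e: "?m 1 1 * v $ 1 + ?m 1 2 * v $ 2 = z * v $ 1" "?m 2 1 * v $ 1 + ?m 2 2 * v $ 2 = z * v $ 2"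
  using v(2) by (simp_all add: vec_eq_iff forall_2 matrix_vector_mult_def sum_2)
 define P where "P = z * z - of_real tr * z + of_real dt"
 have P: "P = (z - ?m 1 1) * (z - ?m 2 2) - ?m 1 2 * ?m 2 1" by (simp add: P_def tr dt algebra_simps)
 have "P * v $ 1 = 0" "P * v $ 2 = 0" unfolding P using e by algebra+
 moreover have "v $ 1 ~= 0 \<or> v $ 2 ~= 0" using v(1) by (auto simp: vec_eq_iff forall_2)
 ultimately have P0: "P = 0" by auto
 have n: "(Re z)\<^sup>2 + (Im z)\<^sup>2 = 1" using c1 by (simp add: cmod_def)
 have re: "(Re z)\<^sup>2 - (Im z)\<^sup>2 - tr * Re z + dt = 0" and im: "2 * Re z * Im z - tr * Im z = 0"
  using arg_cong[OF P0, of Re] arg_cong[OF P0, of Im] by (simp_all add: P_def power2_eq_square)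
 show False
 proof (cases "Im z = 0")
  case True
  hence "(Re z)\<^sup>2 = 1" using n by simp
  hence "Re z = 1 \<or> Re z = -1" by (simp add: power2_eq_1_iff)
  thus False using re True nz by auto
 next
  case False
  hence "tr = 2 * Re z" using im by (simp flip: left_diff_distrib)
  hence "dt = (Re z)\<^sup>2 + (Im z)\<^sup>2" using re by (simp add: power2_eq_square)
  thus False using n nz by simp
 qed
qed

section \<open>The return map of a closed orbit\<close>

lemma has_vector_derivative_glue:
 assumes "(f has_vector_derivative D) (at x within S)" "(f has_vector_derivative D) (at x within T)"
 shows "(f has_vector_derivative D) (at x within S \<union> T)"
 using assms unfolding has_vector_derivative_def has_derivative_within by (auto intro: Lim_Un)

text \<open>The derivative at the start of a leaf is two-sided in \<open>principal_line\<close>,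
  whereas a solution is given for nonnegative times only; it is continued by its tangent.\<close>

lemma extend_linearly:
 fixes f :: "real => 'a::real_normed_vector"
 assumes f: "!!t. t \<in> {0..b} ==> (f has_vector_derivative D t) (at t within {0..b})" and t: "t \<in> {0..<b}"
 shows "((%t. if t < 0 then f 0 + t *\<^sub>R D 0 else f t) has_vector_derivative D t) (at t)" (is "(?g has_vector_derivative _) _")
proof -
 have r: "(?g has_vector_derivative D t) (at t within {0..b})"
  by (rule has_vector_derivative_transform[OF _ _ f]) (use t in auto)
 show ?thesis
 proof (cases "t = 0")
  case True
  have "((%t. f 0 + t *\<^sub>R D 0) has_vector_derivative D 0) (at 0 within {..0})"
   by (auto intro!: derivative_eq_intros)
  hence "(?g has_vector_derivative D 0) (at 0 within {..0})"
   by (rule has_vector_derivative_transform[rotated 2]) auto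
  from has_vector_derivative_glue[OF this] r True have "(?g has_vector_derivative D 0) (at 0 within {..0} \<union> {0..b})" by simp
  moreover have "at 0 within ({..0} \<union> {0..b}) = at (0::real)"
  proof (rule at_within_interior)
   have "{..<b} \<subseteq> interior ({..0} \<union> {0..b})" by (rule interior_maximal) auto
   thus "0 \<in> interior ({..0} \<union> {0..b})" using t True by auto
  qed
  ultimately show ?thesis using True by simp
 next
  case False thus ?thesis using r t by (simp add: at_within_Icc_at)
 qed
qed

lemma orthonormal_frame:
 fixes n :: "R3"
 assumes "norm n = 1"
 obtains A :: "real^3^3" where "orthogonal_matrix A" "column 3 A = n"
  "!!i j. column i A \<bullet> column j A = (if i = j then 1 else 0)"
  "!!y. y = (\<Sum>i\<in>UNIV. (column i A \<bullet> y) *\<^sub>R column i A)"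
proof -
 obtain A :: "real^3^3" where A: "orthogonal_matrix A" "A *v axis 3 1 = n"
  using orthogonal_matrix_exists_basis[OF assms] by blast
 have c: "column i A = A *v axis i 1" for i
  by (simp add: column_def matrix_vector_mult_def vec_eq_iff axis_def if_distrib cong: if_cong)
 have AA: "transpose A ** A = mat 1" "A ** transpose A = mat 1" using A(1) by (auto simp: orthogonal_matrix_def)
 have o: "column i A \<bullet> column j A = (if i = j then 1 else 0)" for i j
 proof -
  have "(transpose A ** A) $ i $ j = column i A \<bullet> column j A"
   by (simp add: matrix_matrix_mult_def transpose_def column_def inner_vec_def)
  thus ?thesis by (simp add: AA mat_def)
 qed
 have "y = (\<Sum>i\<in>UNIV. (column i A \<bullet> y) *\<^sub>R column i A)" for y
 proof -
  have "y = A *v (transpose A *v y)" by (simp only: matrix_vector_mul_assoc AA matrix_vector_mul_lid)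
  hence "y = (\<Sum>i\<in>UNIV. (transpose A *v y) $ i *s column i A)" by (simp only: matrix_mult_sum)
  moreover have "(transpose A *v y) $ i = column i A \<bullet> y" for i
   by (simp only: matrix_vector_mult_def transpose_def column_def inner_vec_def vec_lambda_beta inner_real_def)
  ultimately show ?thesis by (simp only: scalar_mult_eq_scaleR)
 qed
 thus ?thesis using that[of A] A o c[of 3] by simp
qed

context principal_family
begin

lemma flow_hd:
 "((%p. orb s (fst p) (snd p) 1) has_derivative
  (%q. fst q *\<^sub>R Ys s (orb s tau x 1) + (\<Sum>r\<in>UNIV. snd q $ r *\<^sub>R orbN s tau x 1 $ r))) (at (tau, x))"
proof -
 let ?kk = "%_::3. 0::nat" and ?p = "((tau, 0::R3), x)"
 obtain Psi where Psi: "bounded_linear Psi" "!!d. \<exists>y. varsol (GG ?kk s) (UU ?kk s ?p) y & y 0 = d"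
  "!!y. varsol (GG ?kk s) (UU ?kk s ?p) y ==> y 1 = Psi (y 0)"
  using varsol_flow[OF Ck_fixed_param[OF Ck_GG] UU(1), of ?kk s ?p] by metis
 let ?lam = "%p::(real \<times> R3) \<times> R3. (fst p, snd p, 0::real^3^3)"
 have bl: "bounded_linear ?lam" by (intro bounded_linear_Pair bounded_linear_fst bounded_linear_snd) simp
 have SD: "SD (%s p. UU ?kk s p 1) s ?p (%d. Psi (?lam d))"
  by (rule SD_flow[where G = "GG ?kk" and U = "UU ?kk" and \<iota> = "%p. (fst p, snd p, mat 1)" and lam = ?lam, OF Ck_GG UU(1) UU(2) _ bl Psi]) auto
 have "((%p. UU ?kk s p 1) has_derivative (%d. Psi (?lam d))) (at ?p)"
  unfolding has_derivative_at_alt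
 proof (intro conjI allI impI)
  fix e :: real assume "e > 0"
  from SD_D(2)[OF SD this] obtain S d where S: "s \<in> S" "d > 0"
   and h: "\<forall>s\<in>S. \<forall>p p'. norm (p - ?p) < d --> norm (p' - ?p) < d --> norm (UU ?kk s p 1 - UU ?kk s p' 1 - Psi (?lam (p - p'))) <= e * norm (p - p')"
   by blast
  have "norm (UU ?kk s y 1 - UU ?kk s ?p 1 - Psi (?lam (y - ?p))) <= e * norm (y - ?p)" if "norm (y - ?p) < d" for y
   by (rule h[rule_format, OF S(1) that]) (simp only: diff_self norm_zero S(2))
  thus "\<exists>d>0. \<forall>y. norm (y - ?p) < d --> norm (UU ?kk s y 1 - UU ?kk s ?p 1 - Psi (?lam (y - ?p))) <= e * norm (y - ?p)"
   using S(2) by blast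
 qed (use SD_D(1)[OF SD] in simp)
 hence h1: "((%p. fst (snd (UU ?kk s p 1))) has_derivative (%d. fst (snd (Psi (?lam d))))) (at ?p)"
  by (intro has_derivative_fst has_derivative_snd)
 have h2: "((%q. ((fst q, 0::R3), snd q)) has_derivative (%q. ((fst q, 0), snd q))) (at (tau, x))"
  by (auto intro!: derivative_eq_intros simp: zero_prod_def)
 have "((%q. fst (snd (UU ?kk s ((fst q, 0), snd q) 1))) has_derivative (%q. fst (snd (Psi ((fst q, 0), snd q, 0))))) (at (tau, x))"
  using has_derivative_compose[OF h2, of "%p. fst (snd (UU ?kk s p 1))" "%d. fst (snd (Psi (?lam d)))"] h1 by simp
 moreover have "fst (snd (Psi ((d, 0), h, 0))) = d *\<^sub>R Ys s (orb s tau x 1) + (\<Sum>r\<in>UNIV. h $ r *\<^sub>R orbN s tau x 1 $ r)" for d h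
 proof -
  obtain y where y: "varsol (GG ?kk s) (UU ?kk s ?p) y" "y 0 = ((d, 0), h, 0)" using Psi(2) by blast
  have vy: "(y has_vector_derivative (0, fst (fst (y t)) *\<^sub>R CT s tau x t + (\<Sum>i\<in>UNIV. snd (fst (y t)) $ i *\<^sub>R Cv s tau x t (wk 0)) + Bv s tau x t (snd (y t)))) (at t within {0..1})"
   if t: "t \<in> {0..1}" for t
   using y(1) t GG_var[OF t, of ?kk s tau x "fst (fst (y t))" "snd (fst (y t))" "snd (y t)"]
   unfolding varsol_def by (metis prod.collapse)
  have "((%t. fst (y t)) has_vector_derivative 0) (at t within {0..1})" if "t \<in> {0..1}" for t
   using bounded_linear.has_vector_derivative[OF bounded_linear_fst vy[OF that]] by simp
  then obtain c where c: "!!t. t \<in> {0..1} ==> fst (y t) = c"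
   using has_vector_derivative_zero_constant[of "{0..1::real}" "%t. fst (y t)"] by auto
  from c[of 0] y(2) have c': "c = (d, 0)" by simp
  have "((%t. fst (snd (y t)) - (d * t) *\<^sub>R Ys s (orb s tau x t)) has_vector_derivative
   tau *\<^sub>R DY s (orb s tau x t) (fst (snd (y t)) - (d * t) *\<^sub>R Ys s (orb s tau x t))) (at t within {0..1})" if t: "t \<in> {0..1}" for t
  proof -
   have "((%t. fst (snd (y t))) has_vector_derivative (d *\<^sub>R Ys s (orb s tau x t) + tau *\<^sub>R DY s (orb s tau x t) (fst (snd (y t))))) (at t within {0..1})"
    using bounded_linear.has_vector_derivative[OF bounded_linear_fst bounded_linear.has_vector_derivative[OF bounded_linear_snd vy[OF t]]]
    by (simp add: c[OF t] c' CT_def Bv_def)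
   moreover have "((%t. (d * t) *\<^sub>R Ys s (orb s tau x t)) has_vector_derivative ((d * t) *\<^sub>R (tau *\<^sub>R DY s (orb s tau x t) (Ys s (orb s tau x t))) + d *\<^sub>R Ys s (orb s tau x t))) (at t within {0..1})"
    by (rule has_vector_derivative_scaleR[OF _ Ys_orb_vd[OF t]]) (auto intro!: derivative_eq_intros)
   ultimately show ?thesis
    using has_vector_derivative_diff by (force simp: linear_diff[OF linear_DY] linear_scale[OF linear_DY] algebra_simps)
  qed
  hence "fst (snd (y 1)) - (d * 1) *\<^sub>R Ys s (orb s tau x 1) = (\<Sum>r\<in>UNIV. h $ r *\<^sub>R orbN s tau x 1 $ r)"
   by (rule row_unique[OF _ rows_comb_vd, where a = 0]) (auto simp: y orb_0 vec_eq_iff forall_3 sum_3 mat_def)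
  thus ?thesis using Psi(3)[OF y(1)] y(2) by (simp add: algebra_simps)
 qed
 ultimately show ?thesis by (simp add: UU_orb)
qed

lemma flow_close:
 obtains C where "C > 0" "!!x y t. t \<in> {0..1} ==> norm (orb s T x t - orb s T y t) <= C * norm (x - y)"
proof -
 obtain L where L: "L >= 0" "!!x y. norm (Ys s x - Ys s y) <= L * norm (x - y)" using Ys_lip by blast
 have "norm (orb s T x t - orb s T y t) <= exp (\<bar>T\<bar> * L) * norm (x - y)" if t: "t \<in> {0..1}" for x y t
 proof -
  have "norm (orb s T x t - orb s T y t) <= (norm (orb s T x 0 - orb s T y 0) + 0 * t) * exp ((\<bar>T\<bar> * L) * t)"
  proof (rule gronwall[where T = 1 and f' = "%t. T *\<^sub>R Ys s (orb s T x t) - T *\<^sub>R Ys s (orb s T y t)"])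
   show "norm (T *\<^sub>R Ys s (orb s T x t) - T *\<^sub>R Ys s (orb s T y t)) <= (\<bar>T\<bar> * L) * norm (orb s T x t - orb s T y t) + 0" for t
    using mult_left_mono[OF L(2)[of "orb s T x t" "orb s T y t"], of "\<bar>T\<bar>"] by (simp flip: scaleR_diff_right)
  qed (use t L orb_vd in \<open>auto intro: has_vector_derivative_diff\<close>)
  also have "... <= norm (x - y) * exp (\<bar>T\<bar> * L)"
   using t L(1) by (auto simp: orb_0 intro!: mult_left_mono mult_left_le)
  finally show ?thesis by (simp add: mult.commute)
 qed
 thus ?thesis by (intro that[of "exp (\<bar>T\<bar> * L)"]) auto
qed

end

context principal_family
begin

text \<open>The section is a flat disc orthogonal to the field at \<open>x0\<close>. The linearised
  flow fixes the direction of the field, so the derivative of the return map is its compression to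
  the disc: the trace drops by 1 and the determinant is the same.\<close>

lemma hyperbolic_of_orbit:
 assumes tau: "tau > 0" and Y0: "Ys s x0 ~= 0" and cl: "orb s tau x0 1 = x0"
  and inj: "!!t t'. t \<in> {0<..<1} ==> t' \<in> {0..1} ==> orb s tau x0 t' = orb s tau x0 t ==> t' = t"
  and rng: "range gam = orb s tau x0 ` {0..1}" and gam0: "gam 0 = x0"
  and va: "vector_derivative gam (at 0) = a *\<^sub>R Ys s x0" "a > 0"
  and f: "2 - tr3 (orbN s tau x0 1) + dt3 (orbN s tau x0 1) ~= 0" "tr3 (orbN s tau x0 1) + dt3 (orbN s tau x0 1) ~= 0"
   "dt3 (orbN s tau x0 1) ~= 1"
 shows "hyperbolic_cycle (ns s) (kap sg (ns s)) gam"
proof -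
 let ?N = "orbN s tau x0 1"
 define y where "y = norm (Ys s x0)"
 define n where "n = (1 / y) *\<^sub>R Ys s x0"
 have y: "y > 0" using Y0 by (simp add: y_def)
 have n1: "norm n = 1" and Yn: "Ys s x0 = y *\<^sub>R n" using y by (auto simp: n_def y_def)
 obtain A :: "real^3^3" where A: "orthogonal_matrix A" "column 3 A = n"
  and o: "!!i j. column i A \<bullet> column j A = (if i = j then 1 else 0)"
  and ex: "!!z. z = (\<Sum>i\<in>UNIV. (column i A \<bullet> z) *\<^sub>R column i A)"
  using orthonormal_frame[OF n1] by blast
 define e where "e i = column i A" for i
 have e3: "e 3 = n" by (simp add: e_def A)
 define E where "E u = u $ 1 *\<^sub>R e 1 + u $ 2 *\<^sub>R e 2" for u :: "real^2"
 define pr where "pr z = (vector [e 1 \<bullet> z, e 2 \<bullet> z] :: real^2)" for z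
 have nE: "n \<bullet> E u = 0" for u by (simp add: E_def e3[symmetric] inner_add_right e_def o)
 have prE: "pr (E u) = u" for u
  by (simp add: pr_def E_def vec_eq_iff forall_2 inner_add_right e_def o)
 have Epr: "E (pr z) = z" if "n \<bullet> z = 0" for z
  using ex[of z] that by (simp add: E_def pr_def e_def sum_3 A)
 have nrmE: "norm (E u) = norm u" for u
 proof -
  have "E u \<bullet> E u = u \<bullet> u"
   by (simp add: E_def inner_add_left inner_add_right e_def o inner_vec_def[of u u] sum_2)
  thus ?thesis by (simp add: norm_eq_sqrt_inner)
 qed
 have blE: "bounded_linear E"
  by (rule linear_conv_bounded_linear[THEN iffD1], rule linearI) (simp_all add: E_def algebra_simps)
 have blp: "bounded_linear pr"
  by (rule linear_conv_bounded_linear[THEN iffD1], rule linearI) (simp_all add: pr_def vec_eq_iff forall_2 inner_add_right)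
 have prn: "norm (pr z) <= 2 * norm z" for z
 proof -
  have p: "norm (pr z) <= \<bar>e 1 \<bullet> z\<bar> + \<bar>e 2 \<bullet> z\<bar>"
   using norm_le_l1_cart[of "pr z"] by (simp add: pr_def sum_2)
  have "norm (e i) = 1" for i by (simp add: norm_eq_sqrt_inner e_def o)
  hence ez: "\<bar>e i \<bullet> z\<bar> <= norm z" for i using Cauchy_Schwarz_ineq2[of "e i" z] by simp
  show ?thesis using p ez[of 1] ez[of 2] by linarith
 qed
 define L0 where "L0 h = (\<Sum>r\<in>UNIV. h $ r *\<^sub>R ?N $ r)" for h
 have blL: "bounded_linear L0"
  by (rule linear_conv_bounded_linear[THEN iffD1], rule linearI) (simp_all add: L0_def algebra_simps sum.distrib scaleR_sum_right)
 have "L0 (Ys s x0) = Ys s x0" using Ys_orb_expand[of 1 s tau x0] cl by (simp add: L0_def)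
 hence Ln: "L0 n = n" by (simp add: n_def linear_scale[OF bounded_linear.linear[OF blL]])
 define sig where "sig u = x0 + E u" for u
 \<comment> \<open>Orbits are followed up to time \<open>2 * tau\<close>, since the return time of a
   neighbouring leaf may exceed \<open>tau\<close>.\<close>
 define c where "c u t = orb s (2 * tau) (sig u) (t / (2 * tau))" for u t
 have E0: "E 0 = 0" by (simp add: E_def)
 have c\<phi>: "c u t = orb s t (sig u) 1" if "t \<in> {0..2 * tau}" for u t
  using orb_scale[of 1 "t / (2 * tau)" s "2 * tau" "sig u"] that tau by (simp add: c_def)
 have c0: "c u 0 = sig u" for u by (simp add: c_def orb_0)
 have cvd: "(c u has_vector_derivative Ys s (c u t)) (at t within {0..2 * tau})" if t: "t \<in> {0..2 * tau}" for u t
 proof -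
  have "((%t. t / (2 * tau)) has_vector_derivative 1 / (2 * tau)) (at t within {0..2 * tau})"
   by (auto intro!: derivative_eq_intros)
  moreover have "(orb s (2 * tau) (sig u) has_vector_derivative (2 * tau) *\<^sub>R Ys s (c u t)) (at (t / (2 * tau)) within (%t. t / (2 * tau)) ` {0..2 * tau})"
   unfolding c_def by (rule has_vector_derivative_within_subset[OF orb_vd]) (use t tau in auto)
  ultimately show ?thesis using vector_diff_chain_within tau by (force simp: comp_def c_def[abs_def])
 qed
 have cc: "continuous_on {0..2 * tau} (c u)" for u using cvd by (rule continuous_on_vector_derivative)
 have est: "\<exists>d>0. \<forall>T u. T \<in> {0..2 * tau} --> \<bar>T - tau\<bar> + norm u < d -->
   norm (c u T - x0 - ((T - tau) *\<^sub>R Ys s x0 + L0 (E u))) <= epsn * (\<bar>T - tau\<bar> + norm u)" if eps: "epsn > 0" for epsn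
 proof -
  have tri: "norm (T - tau, E u) <= \<bar>T - tau\<bar> + norm u" for T u
   using norm_triangle_ineq[of "(T - tau, 0)" "(0, E u)"] by (simp add: norm_Pair nrmE)
  from flow_hd[of s tau x0, unfolded has_derivative_at_alt fst_conv snd_conv, THEN conjunct2, rule_format, OF eps]
  obtain d where d: "d > 0" "\<forall>q. norm (q - (tau, x0)) < d --> norm (orb s (fst q) (snd q) 1 - orb s tau x0 1
    - (fst (q - (tau, x0)) *\<^sub>R Ys s (orb s tau x0 1) + (\<Sum>r\<in>UNIV. snd (q - (tau, x0)) $ r *\<^sub>R ?N $ r))) <= epsn * norm (q - (tau, x0))"
   by blast
  have "norm (c u T - x0 - ((T - tau) *\<^sub>R Ys s x0 + L0 (E u))) <= epsn * (\<bar>T - tau\<bar> + norm u)"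
   if T: "T \<in> {0..2 * tau}" and "\<bar>T - tau\<bar> + norm u < d" for T u
  proof -
   have "norm ((T, sig u) - (tau, x0)) < d" using tri[of T u] that(2) by (simp add: sig_def)
   from d(2)[rule_format, OF this]
   have "norm (c u T - x0 - ((T - tau) *\<^sub>R Ys s x0 + L0 (E u))) <= epsn * norm (T - tau, E u)"
    by (simp add: c\<phi>[OF T] cl L0_def sig_def)
   also have "... <= epsn * (\<bar>T - tau\<bar> + norm u)" using tri \<open>epsn > 0\<close> by (intro mult_left_mono) auto
   finally show ?thesis .
  qed
  thus ?thesis using d(1) by blast
 qed
 obtain B where B: "B > 0" "!!u. norm (L0 (E u)) <= norm u * B"
  using bounded_linear.pos_bounded[OF bounded_linear_compose[OF blL blE]] by blast
 \<comment> \<open>In a small ball around \<open>x0\<close> the height in direction \<open>n\<close>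
   increases strictly along the field.\<close>
 have "continuous_on UNIV (%z. n \<bullet> Ys s z)"
  by (intro continuous_intros continuous_on_compose2[OF Ck_continuous_arg[OF Ck_Ys, of UNIV]]) auto
 hence "open {z. n \<bullet> Ys s z > 0}" by (intro open_Collect_less continuous_on_const)
 moreover have "n \<bullet> Ys s x0 > 0" using y n1 by (simp add: Yn flip: power2_norm_eq_inner)
 ultimately obtain rho where rho: "rho > 0" "!!z. norm (z - x0) < rho ==> n \<bullet> Ys s z > 0"
  by (auto simp: open_dist dist_norm)
 have mono: "n \<bullet> c u p < n \<bullet> c u q" if pq: "0 <= p" "p < q" "q <= 2 * tau" and near: "!!t. t \<in> {p..q} ==> norm (c u t - x0) < rho" for u p q
 proof (rule DERIV_pos_imp_increasing_open[OF pq(2)])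
  fix t assume t: "p < t" "t < q"
  hence "(c u has_vector_derivative Ys s (c u t)) (at t)"
   using cvd[of t u] pq by (simp add: at_within_Icc_at)
  from bounded_linear.has_vector_derivative[OF bounded_linear_inner_right this, of n]
  show "\<exists>y. DERIV (%t. n \<bullet> c u t) t :> y & 0 < y"
   using rho(2)[OF near[of t]] t by (auto simp: has_real_derivative_iff_has_vector_derivative)
 next
  show "continuous_on {p..q} (%t. n \<bullet> c u t)"
   using pq by (intro continuous_intros continuous_on_subset[OF cc]) auto
 qed
 have co: "c 0 t = orb s tau x0 (t / tau)" if "t \<in> {0..tau}" for t
  using orb_scale[of "t / tau" "1/2" s "2 * tau" x0] that tau by (simp add: c_def sig_def E0)
 have ctau: "c 0 tau = x0" using co[of tau] cl tau by simp
 have near0: "\<exists>epsn>0. \<forall>t\<in>{0..2 * tau}. \<bar>t - t0\<bar> <= epsn --> norm (c 0 t - x0) < rho / 2" if t0: "t0 \<in> {0..2 * tau}" "c 0 t0 = x0" for t0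
 proof -
  obtain d where d: "d > 0" "\<forall>t\<in>{0..2 * tau}. dist t t0 < d --> dist (c 0 t) (c 0 t0) < rho / 2"
   using cc[of 0] t0 rho(1) unfolding continuous_on_iff by (meson half_gt_zero)
  thus ?thesis using t0 by (intro exI[of _ "d / 2"]) (auto simp: dist_norm)
 qed
 obtain epsn1 where epsn1: "epsn1 > 0" "\<forall>t\<in>{0..2 * tau}. \<bar>t - 0\<bar> <= epsn1 --> norm (c 0 t - x0) < rho / 2"
  using near0[of 0] tau by (auto simp: c0 sig_def E0)
 obtain epsn2 where epsn2: "epsn2 > 0" "\<forall>t\<in>{0..2 * tau}. \<bar>t - tau\<bar> <= epsn2 --> norm (c 0 t - x0) < rho / 2"
  using near0[of tau] tau ctau by auto
 define epsn0 where "epsn0 = min (tau / 4) (min epsn1 epsn2)"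
 have epsn0: "epsn0 > 0" "epsn0 <= tau / 4" "epsn0 <= epsn1" "epsn0 <= epsn2" using epsn1 epsn2 tau by (auto simp: epsn0_def)
 obtain d where d: "d > 0" "!!t. t \<in> {epsn0..tau - epsn0} ==> norm (c 0 t - x0) >= d"
 proof -
  have cn: "continuous_on {epsn0..tau - epsn0} (%t. norm (c 0 t - x0))"
   using epsn0 tau by (intro continuous_intros continuous_on_subset[OF cc]) auto
  obtain t0 where t0: "t0 \<in> {epsn0..tau - epsn0}" "!!t. t \<in> {epsn0..tau - epsn0} ==> norm (c 0 t0 - x0) <= norm (c 0 t - x0)"
   using continuous_attains_inf[OF compact_Icc _ cn] epsn0 tau by auto
  have "c 0 t0 ~= x0"
  proof
   assume "c 0 t0 = x0"
   moreover have "t0 / tau \<in> {0<..<1}" using t0 epsn0 tau by auto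
   ultimately have "0 = t0 / tau" using t0 epsn0 by (intro inj) (auto simp: co orb_0)
   thus False using t0 epsn0 tau by auto
  qed
  thus ?thesis using that[of "norm (c 0 t0 - x0)"] t0 by auto
 qed
 obtain C where C: "C > 0" "!!u t. t \<in> {0..2 * tau} ==> norm (c u t - c 0 t) <= C * norm u"
 proof -
  obtain C where C: "C > 0" "!!x y t. t \<in> {0..1} ==> norm (orb s (2 * tau) x t - orb s (2 * tau) y t) <= C * norm (x - y)"
   using flow_close by blast
  show ?thesis
  proof (rule that[OF C(1)])
   fix u t assume "t \<in> {0..2 * tau}"
   thus "norm (c u t - c 0 t) <= C * norm u"
    using C(2)[of "t / (2 * tau)" "sig u" "sig 0"] tau by (simp add: c_def) (simp add: sig_def E0 nrmE)
  qed
 qed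
 \<comment> \<open>With this value \<open>kpa * y / 2 = B + y\<close>, which outweighs the error
   terms. Hence the height has opposite signs, up to zero, at the times
   \<open>tau - kpa * norm u\<close> and \<open>tau + kpa * norm u\<close>, and the intermediate
   value theorem gives a return time.\<close>
 define kpa where "kpa = 2 * (B + y) / y"
 have kpa: "kpa > 0" using B y by (simp add: kpa_def)
 obtain d1 where d1: "d1 > 0" "!!T u. T \<in> {0..2 * tau} ==> \<bar>T - tau\<bar> + norm u < d1 ==>
   norm (c u T - x0 - ((T - tau) *\<^sub>R Ys s x0 + L0 (E u))) <= y / 2 * (\<bar>T - tau\<bar> + norm u)"
  using est[of "y / 2"] y by auto
 define \<delta> where "\<delta> = Min {rho / 2 / C, d / 2 / C, d1 / (kpa + 1), epsn0 / kpa, d / 2, rho}"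
 have \<delta>: "\<delta> > 0" using C rho d d1 kpa epsn0 by (simp add: \<delta>_def)
 have small: "C * norm u < rho / 2" "C * norm u < d / 2" "(kpa + 1) * norm u < d1" "kpa * norm u < epsn0" "norm u < d / 2" "norm u < rho"
  if "norm u < \<delta>" for u :: "real^2"
  using that C(1) kpa by (auto simp: \<delta>_def field_simps)
 have ret: "\<exists>T. \<bar>T - tau\<bar> <= kpa * norm u & n \<bullet> (c u T - x0) = 0" if u: "norm u < \<delta>" for u
 proof -
  note sm = small[OF u]
  have k0: "kpa * norm u >= 0" using kpa by simp
  have in2: "T \<in> {0..2 * tau}" if "\<bar>T - tau\<bar> <= kpa * norm u" for T using that sm epsn0 tau by auto
  have key: "\<bar>n \<bullet> (c u T - x0) - (T - tau) * y\<bar> <= kpa * norm u * y" if T: "\<bar>T - tau\<bar> = kpa * norm u" for T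
  proof -
   let ?r = "c u T - x0 - ((T - tau) *\<^sub>R Ys s x0 + L0 (E u))"
   have "norm ?r <= y / 2 * (\<bar>T - tau\<bar> + norm u)"
    using T sm(3) by (intro d1 in2) (auto simp: algebra_simps)
   moreover have "\<bar>n \<bullet> ?r\<bar> <= norm ?r" using Cauchy_Schwarz_ineq2[of n ?r] n1 by simp
   moreover have "\<bar>n \<bullet> L0 (E u)\<bar> <= norm u * B" using Cauchy_Schwarz_ineq2[of n "L0 (E u)"] n1 B(2)[of u] by simp
   moreover have "n \<bullet> (c u T - x0) - (T - tau) * y = n \<bullet> ?r + n \<bullet> L0 (E u)"
    using n1 by (simp add: inner_diff_right inner_add_right Yn flip: power2_norm_eq_inner)
   ultimately have "\<bar>n \<bullet> (c u T - x0) - (T - tau) * y\<bar> <= y / 2 * (kpa * norm u + norm u) + norm u * B" unfolding T by linarith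
   also have "... <= kpa * norm u * y"
   proof -
    have "kpa * y = 2 * B + 2 * y" using y by (simp add: kpa_def field_simps)
    hence "(kpa * y) * norm u = (2 * B + 2 * y) * norm u" by (rule arg_cong)
    hence k: "kpa * norm u * y = 2 * (B * norm u) + 2 * (y * norm u)" by (simp add: algebra_simps)
    have "y / 2 * (kpa * norm u + norm u) + norm u * B = kpa * norm u * y / 2 + (y * norm u) / 2 + B * norm u" by (simp add: algebra_simps)
    moreover have "0 <= y * norm u" using y by simp
    ultimately show ?thesis using k by linarith
   qed
   finally show ?thesis .
  qed
  have "\<exists>T\<ge>tau - kpa * norm u. T <= tau + kpa * norm u & n \<bullet> (c u T - x0) = 0"
  proof (rule IVT')
   show "n \<bullet> (c u (tau - kpa * norm u) - x0) <= 0" using key[of "tau - kpa * norm u"] k0 by (auto simp: abs_le_iff)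
   show "0 <= n \<bullet> (c u (tau + kpa * norm u) - x0)" using key[of "tau + kpa * norm u"] k0 by (auto simp: abs_le_iff)
   show "continuous_on {tau - kpa * norm u..tau + kpa * norm u} (%T. n \<bullet> (c u T - x0))"
    by (intro continuous_intros continuous_on_subset[OF cc] subsetI in2) (simp add: abs_le_iff)
  qed (use k0 in simp)
  then obtain T where "tau - kpa * norm u <= T" "T <= tau + kpa * norm u" "n \<bullet> (c u T - x0) = 0" by blast
  thus ?thesis by (intro exI[of _ T]) (simp add: abs_le_iff)
 qed
 define Tr where "Tr u = (SOME T. \<bar>T - tau\<bar> <= kpa * norm u & n \<bullet> (c u T - x0) = 0)" for u
 have Tr: "\<bar>Tr u - tau\<bar> <= kpa * norm u" "n \<bullet> (c u (Tr u) - x0) = 0" if "norm u < \<delta>" for u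
  using someI_ex[OF ret[OF that]] by (auto simp: Tr_def)
 have Trb: "\<bar>Tr u - tau\<bar> < epsn0" "Tr u \<in> {0<..<2 * tau}" if "norm u < \<delta>" for u
  using Tr(1)[OF that] small[OF that] epsn0 tau by auto
 have Tr0: "Tr 0 = tau" using Tr(1)[of 0] \<delta> by simp
 define \<pi> where "\<pi> u = pr (c u (Tr u) - x0)" for u
 have \<pi>0: "\<pi> 0 = 0" by (simp add: \<pi>_def Tr0 ctau linear_0[OF bounded_linear.linear[OF blp]])
 have sig\<pi>: "sig (\<pi> u) = c u (Tr u)" if "norm u < \<delta>" for u
  using Epr[OF Tr(2)[OF that]] by (simp add: sig_def \<pi>_def)
 define U where "U = ball (0::real^2) (d / 2)"
 \<comment> \<open>At the beginning and at the end of the round the height is strictly monotone and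
   vanishes only at the departure and the return. In between the leaf stays too far from
   \<open>x0\<close> to meet a disc of radius \<open>d / 2\<close>.\<close>
 have nohit: "c u t \<notin> sig ` U" if u: "norm u < \<delta>" and t: "t \<in> {0<..<Tr u}" for u t
 proof
  assume "c u t \<in> sig ` U"
  then obtain v where v: "norm v < d / 2" "c u t - x0 = E v" by (auto simp: U_def sig_def)
  hence disc: "n \<bullet> c u t = n \<bullet> x0" "norm (c u t - x0) < d / 2"
   using nE[of v] inner_diff_right[of n "c u t" x0] by (simp_all add: nrmE)
  note sm = small[OF u] and tb = Trb[OF u]
  have near: "norm (c u t' - x0) < rho" if "t' \<in> {0..2 * tau}" "\<bar>t'\<bar> <= epsn0 \<or> \<bar>t' - tau\<bar> <= epsn0" for t'
  proof -
   have "norm (c 0 t' - x0) < rho / 2" using that epsn1(2) epsn2(2) epsn0 by auto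
   thus ?thesis
    using C(2)[OF that(1), of u] sm(1) norm_triangle_ineq[of "c u t' - c 0 t'" "c 0 t' - x0"] by auto
  qed
  consider "t <= epsn0" | "t \<in> {epsn0..tau - epsn0}" | "tau - epsn0 <= t" by fastforce
  thus False
  proof cases
   case 1
   have "n \<bullet> c u 0 < n \<bullet> c u t" by (rule mono) (use t 1 epsn0 tau in \<open>auto intro!: near\<close>)
   thus False using disc(1) nE[of u] by (simp add: c0 sig_def inner_add_right)
  next
   case 2
   have t2: "t \<in> {0..2 * tau}" using 2 epsn0 tau by auto
   have "d <= norm (c 0 t - x0)" using d(2)[OF 2] .
   also have "... <= norm (c u t - c 0 t) + norm (c u t - x0)"
    using norm_triangle_ineq4[of "c u t - x0" "c u t - c 0 t"] by (simp add: add.commute)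
   finally show False using C(2)[OF t2, of u] sm(2) disc(2) by linarith
  next
   case 3
   have "n \<bullet> c u t < n \<bullet> c u (Tr u)" by (rule mono) (use t 3 tb epsn0 tau in \<open>auto intro!: near\<close>)
   thus False using disc(1) Tr(2)[OF u] by (simp add: inner_diff_right)
  qed
 qed
 define M where "M u = pr (L0 (E u))" for u
 have blM: "bounded_linear M" unfolding M_def by (intro bounded_linear_compose[OF blp] bounded_linear_compose[OF blL] blE)
 have \<pi>d: "(\<pi> has_derivative M) (at 0)"
  unfolding has_derivative_at_alt
 proof (intro conjI allI impI blM)
  fix epsn :: real assume epsn: "epsn > 0"
  define epsn' where "epsn' = epsn / (2 * (kpa + 1))"
  have epsn': "epsn' > 0" using epsn kpa by (simp add: epsn'_def)
  obtain d2 where d2: "d2 > 0" "!!T u. T \<in> {0..2 * tau} ==> \<bar>T - tau\<bar> + norm u < d2 ==>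
    norm (c u T - x0 - ((T - tau) *\<^sub>R Ys s x0 + L0 (E u))) <= epsn' * (\<bar>T - tau\<bar> + norm u)"
   using est[OF epsn'] by auto
  have "norm (\<pi> u - \<pi> 0 - M (u - 0)) <= epsn * norm (u - 0)" if u: "norm (u - 0) < min \<delta> (d2 / (kpa + 1))" for u
  proof -
   have u1: "norm u < \<delta>" and u2: "(kpa + 1) * norm u < d2" using u kpa by (auto simp: field_simps)
   let ?r = "c u (Tr u) - x0 - ((Tr u - tau) *\<^sub>R Ys s x0 + L0 (E u))"
   have tk: "\<bar>Tr u - tau\<bar> + norm u <= (kpa + 1) * norm u" using Tr(1)[OF u1] by (simp add: algebra_simps)
   have prn0: "pr n = 0" by (simp add: pr_def vec_eq_iff forall_2 e3[symmetric] e_def o)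
   \<comment> \<open>The variation of the return time drops out: it displaces the end point along
     \<open>n\<close>, and \<open>pr\<close> kills this direction.\<close>
   have "\<pi> u - M u = pr ?r"
    by (simp add: \<pi>_def M_def linear_diff[OF bounded_linear.linear[OF blp]] linear_add[OF bounded_linear.linear[OF blp]]
     linear_scale[OF bounded_linear.linear[OF blp]] Yn prn0)
   hence "norm (\<pi> u - M u) <= 2 * norm ?r" using prn by simp
   also have "norm ?r <= epsn' * (\<bar>Tr u - tau\<bar> + norm u)"
    using Trb(2)[OF u1] tk u2 by (intro d2(2)) auto
   also have "... <= epsn' * ((kpa + 1) * norm u)" using tk epsn' by (intro mult_left_mono) auto
   also have "2 * (epsn' * ((kpa + 1) * norm u)) = epsn * norm u" using kpa by (simp add: epsn'_def field_simps)
   finally show ?thesis by (simp add: \<pi>0)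
  qed
  thus "\<exists>d>0. \<forall>u. norm (u - 0) < d --> norm (\<pi> u - \<pi> 0 - M (u - 0)) <= epsn * norm (u - 0)"
   using \<delta> d2(1) kpa by (intro exI[of _ "min \<delta> (d2 / (kpa + 1))"]) auto
 qed
 have sigd: "FD sig u = E" for u
 proof -
  have "(sig has_derivative (%h. 0 + E h)) (at u)"
   unfolding sig_def by (intro has_derivative_add has_derivative_const bounded_linear_imp_has_derivative[OF blE])
  from frechet_derivative_at[OF this] show ?thesis by simp
 qed
 have sec: "transversal_section gam U sig"
  unfolding transversal_section_def
 proof (intro conjI ballI)
  show "open U" "0 \<in> U" using d(1) by (auto simp: U_def)
  show "sig 0 = gam 0" by (simp add: sig_def E0 gam0)
  have "Ck 1 (%_::real. sig)" unfolding sig_def by (intro Ck_add Ck_const Ck_bounded_linear_arg blE)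
  thus "Cr_on 1 sig U" unfolding Cr_on_iff_Ck[symmetric] by (auto simp: Cr_on_def intro: continuous_on_subset)
  show "inj (FD sig u)" for u
   unfolding sigd by (metis injI prE)
  have "homeomorphism U (sig ` U) sig (%z. pr (z - x0))"
   unfolding sig_def by (intro homeomorphismI continuous_intros linear_continuous_on[OF blE] linear_continuous_on_compose[OF _ bounded_linear.linear[OF blp]])
    (auto simp: prE)
  thus "\<exists>tau. homeomorphism U (sig ` U) sig tau" by blast
  show "sig ` U \<inter> range gam = {gam 0}"
  proof -
   have x1: "x0 \<in> sig ` U" using d(1) by (auto simp: U_def sig_def E0 intro!: image_eqI[of _ _ 0])
   have x2: "x0 \<in> range gam" using gam0 by (metis rangeI)
   have x3: "z = x0" if zz: "z \<in> sig ` U" "z \<in> range gam" for z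
   proof -
    obtain t where t: "t \<in> {0..1}" "z = orb s tau x0 t" using zz(2) rng by auto
    have "z = c 0 (tau * t)" using co[of "tau * t"] t tau by (simp add: mult_left_le)
    hence "\<not> (0 < t & t < 1)" using nohit[of 0 "tau * t"] \<delta> tau zz(1) by (auto simp: Tr0)
    hence "t = 0 \<or> t = 1" using t(1) by auto
    thus ?thesis using t(2) cl by (auto simp: orb_0)
   qed
   show ?thesis unfolding gam0 by (rule equalityI, rule subsetI, erule IntE) (simp only: x3 singleton_iff, simp add: x1 x2)
  qed
  show "vector_derivative gam (at 0) \<notin> range (FD sig 0)"
  proof
   assume "vector_derivative gam (at 0) \<in> range (FD sig 0)"
   then obtain u where "a *\<^sub>R Ys s x0 = E u" by (auto simp: sigd va)
   hence "n \<bullet> (a *\<^sub>R y *\<^sub>R n) = 0" using nE[of u] by (simp add: Yn)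
   thus False using va(2) y n1 by (simp flip: power2_norm_eq_inner)
  qed
 qed
 have frm: "first_return_map (ns s) (kap sg (ns s)) gam U sig \<pi>"
  unfolding first_return_map_def
 proof -
  obtain \<delta>2 where \<delta>2: "\<delta>2 > 0" "!!u. norm u < \<delta>2 ==> norm (\<pi> u) < d / 2"
   using has_derivative_continuous[OF \<pi>d, unfolded continuous_at_eps_delta, rule_format, of "d / 2"] d(1) \<pi>0 by auto
  have "u \<in> U & \<pi> u \<in> U & (\<exists>c tau. tau > 0 & principal_line (ns s) (kap sg (ns s)) c {0..tau} &
    c 0 = sig u & c tau = sig (\<pi> u) & (\<forall>t\<in>{0<..<tau}. c t \<notin> sig ` U) & vector_derivative c (at 0) \<bullet> vector_derivative gam (at 0) > 0)"
   if u: "norm u < min \<delta> \<delta>2" for u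
  proof (intro conjI)
   have u1: "norm u < \<delta>" using u by simp
   note sm = small[OF u1] and tb = Trb[OF u1]
   show "u \<in> U" "\<pi> u \<in> U" using sm u \<delta>2(2)[of u] by (auto simp: U_def)
   define cx where "cx t = (if t < 0 then c u 0 + t *\<^sub>R Ys s (c u 0) else c u t)" for t
   have cxd: "(cx has_vector_derivative Ys s (c u t)) (at t)" if "t \<in> {0..Tr u}" for t
    unfolding cx_def by (rule extend_linearly[OF cvd]) (use that tb in auto)
   have nsig: "n \<bullet> Ys s (sig u) > 0" using rho(2)[of "sig u"] sm(6) by (simp add: sig_def nrmE)
   have Ynz: "Ys s (c u t) ~= 0" if "t \<in> {0..Tr u}" for t
    unfolding c_def by (rule Ys_orb_nonzero) (use nsig that tb tau in auto)
   have "principal_line (ns s) (kap sg (ns s)) cx {0..Tr u}"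
    unfolding principal_line_def C1_differentiable_on_def
   proof (intro conjI exI[of _ "%t. Ys s (c u t)"] ballI cxd)
    show "continuous_on {0..Tr u} (%t. Ys s (c u t))"
     by (rule continuous_on_compose2[OF Ck_continuous_arg[OF Ck_Ys, of UNIV] continuous_on_subset[OF cc]]) (use tb in auto)
    fix t assume t: "t \<in> {0..Tr u}"
    have "cx t = c u t" using t by (simp add: cx_def)
    thus "cx t \<notin> partially_umbilic_set (ns s)" "vector_derivative cx (at t) \<in> principal_directions (ns s) (kap sg (ns s)) (cx t)"
     using Ys_principal[OF Ynz[OF t]] vector_derivative_at[OF cxd[OF t]] by simp_all
   qed
   moreover have "vector_derivative cx (at 0) \<bullet> vector_derivative gam (at 0) > 0"
    using vector_derivative_at[OF cxd[of 0]] tb(2) nsig va(2) y by (simp add: va(1) Yn c0 inner_commute)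
   moreover have "cx t \<notin> sig ` U" if "t \<in> {0<..<Tr u}" for t using nohit[OF u1 that] that by (simp add: cx_def)
   ultimately show "\<exists>c tau. tau > 0 & principal_line (ns s) (kap sg (ns s)) c {0..tau} &
    c 0 = sig u & c tau = sig (\<pi> u) & (\<forall>t\<in>{0<..<tau}. c t \<notin> sig ` U) & vector_derivative c (at 0) \<bullet> vector_derivative gam (at 0) > 0"
    using tb(2) sig\<pi>[OF u1] by (intro exI[of _ cx] exI[of _ "Tr u"]) (auto simp: cx_def c0)
  qed
  thus "\<forall>\<^sub>F u in nhds 0. u \<in> U & \<pi> u \<in> U & (\<exists>c tau. tau > 0 & principal_line (ns s) (kap sg (ns s)) c {0..tau} &
    c 0 = sig u & c tau = sig (\<pi> u) & (\<forall>t\<in>{0<..<tau}. c t \<notin> sig ` U) & vector_derivative c (at 0) \<bullet> vector_derivative gam (at 0) > 0)"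
   unfolding eventually_nhds_metric using \<delta> \<delta>2(1) by (intro exI[of _ "min \<delta> \<delta>2"]) (simp add: dist_norm)
 qed
 have "cmod z ~= 1" if z: "complex_eigenvalue (matrix (FD \<pi> 0)) z" for z
 proof -
  \<comment> \<open>The linearised flow in the orthonormal frame. Its third column is the fixed
    vector \<open>n\<close>, so its upper left block is the derivative of the return map.\<close>
  define Q where "Q = transpose A ** (transpose ?N ** A)"
  have Q: "Q $ i $ j = e i \<bullet> L0 (e j)" for i j
   by (simp add: Q_def matrix_matrix_mult_def transpose_def e_def column_def inner_vec_def L0_def mult.commute)
  have AA: "A ** transpose A = mat 1" using A(1) by (simp add: orthogonal_matrix_def)
  have "trace Q = trace ((transpose ?N ** A) ** transpose A)" unfolding Q_def by (rule trace_mul_sym)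
  also have "(transpose ?N ** A) ** transpose A = transpose ?N" by (simp only: matrix_mul_assoc[symmetric] AA matrix_mul_rid)
  finally have tQ: "trace Q = tr3 ?N" by (simp add: tr3_def trace_def transpose_def)
  have "det A * det A = 1" using arg_cong[OF AA, of det] by (simp add: det_mul)
  hence dQ: "det Q = dt3 ?N" by (simp add: Q_def det_mul dt3_det algebra_simps)
  have Q3: "Q $ i $ 3 = (if i = 3 then 1 else 0)" for i
   unfolding Q e3 Ln by (simp add: e3[symmetric] e_def o)
  have ME: "E (axis 1 1) = e 1" "E (axis 2 1) = e 2" by (simp_all add: E_def axis_def)
  let ?P = "matrix (FD \<pi> 0)"
  have fd: "FD \<pi> 0 = M" using frechet_derivative_at[OF \<pi>d] by simp
  have P: "?P $ 1 $ 1 = Q $ 1 $ 1" "?P $ 1 $ 2 = Q $ 1 $ 2" "?P $ 2 $ 1 = Q $ 2 $ 1" "?P $ 2 $ 2 = Q $ 2 $ 2"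
   unfolding fd by (simp_all add: matrix_def M_def ME pr_def Q)
  have "tr3 ?N - 1 = ?P $ 1 $ 1 + ?P $ 2 $ 2" using Q3[of 3] by (simp add: tQ[symmetric] trace_def sum_3 P)
  moreover have "dt3 ?N = ?P $ 1 $ 1 * ?P $ 2 $ 2 - ?P $ 1 $ 2 * ?P $ 2 $ 1"
   using Q3[of 1] Q3[of 2] Q3[of 3] by (simp add: dQ[symmetric] det_3 P)
  ultimately show ?thesis using f by (intro eigenvalue_2[OF z]) auto
 qed
 thus ?thesis
  unfolding hyperbolic_cycle_def using sec frm differentiableI[OF \<pi>d]
  by (intro exI[of _ U] exI[of _ sig] exI[of _ \<pi>] conjI allI impI)
qed

end

section \<open>Choice of a base point on the orbit, and generic hyperbolicity\<close>

context principal_family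
begin

text \<open>Some coordinate is not constant along the orbit, so it takes a rational value. Hence
  countably many slices, one for each coordinate and each rational number, meet all closed
  orbits.\<close>

lemma orbit_rational_point:
 assumes tau: "tau > 0" and Y0: "Ys s x ~= 0"
 obtains a i q where "a \<in> {0..1}" "q \<in> \<rat>" "orb s tau x a $ i = q"
proof -
 obtain i where i: "Ys s x $ i ~= 0" using Y0 by (auto simp: vec_eq_iff)
 define h where "h t = orb s tau x t $ i" for t
 have hd: "(h has_vector_derivative tau * Ys s x $ i) (at 0 within {0..1})"
  using bounded_linear.has_vector_derivative[OF bounded_linear_vec_nth orb_vd[of 0 s tau x], of i] by (simp add: h_def[abs_def] orb_0)
 have ch: "continuous_on {0..1} h" unfolding h_def by (intro continuous_intros continuous_orb)
 have "\<exists>t\<in>{0..1}. h t ~= h 0"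
 proof (rule ccontr)
  assume c: "\<not> (\<exists>t\<in>{0..1}. h t ~= h 0)"
  have "(h has_vector_derivative 0) (at 0 within {0..1})"
   by (rule has_vector_derivative_transform[OF _ _ has_vector_derivative_const[of "h 0"]]) (simp, use c in blast)
  hence "tau * Ys s x $ i = 0"
   using hd by (intro vector_derivative_unique_within_closed_interval[of 0 1 0 h]) simp_all
  thus False using i tau by simp
 qed
 then obtain t1 where t1: "t1 \<in> {0..1}" "h t1 ~= h 0" by blast
 obtain q where q: "q \<in> \<rat>" "min (h 0) (h t1) < q" "q < max (h 0) (h t1)"
  using Rats_dense_in_real[of "min (h 0) (h t1)" "max (h 0) (h t1)"] t1(2) by (meson min_less_iff_disj less_max_iff_disj linorder_neqE)
 have c1: "continuous_on {0..t1} h" using t1 by (intro continuous_on_subset[OF ch]) auto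
 have "\<exists>a\<ge>0. a <= t1 & h a = q"
 proof (cases "h 0 <= q")
  case True thus ?thesis by (intro IVT'[OF True _ _ c1]) (use q t1 in auto)
 next
  case False thus ?thesis by (intro IVT2'[OF _ _ _ c1]) (use q t1 in auto)
 qed
 thus ?thesis using that[of _ q i] q(1) t1 by (force simp: h_def)
qed

lemma orbit_shift:
 assumes cl: "orb s tau x 1 = x" and a: "a \<in> {0..1}"
  and inj: "!!t t'. t \<in> {0<..<1} ==> t' \<in> {0..1} ==> orb s tau x t' = orb s tau x t ==> t' = t"
 shows "orb s tau (orb s tau x a) 1 = orb s tau x a"
  and "t \<in> {0<..<1} ==> t' \<in> {0..1} ==> orb s tau (orb s tau x a) t' = orb s tau (orb s tau x a) t ==> t' = t"
proof -
 have sc: "orb s (2 * tau) x (t / 2) = orb s tau x t" if "t \<in> {0..1}" for t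
  using orb_scale[of t "1/2" s "2 * tau" x] that by simp
 \<comment> \<open>Folds the times of two rounds back to one. Both 0 and 1 stand for the base point,
   so these two values are treated apart from the interior ones below.\<close>
 define g where "g v = (if v <= 1 then v else v - 1)" for v :: real
 have o2: "orb s (2 * tau) x (v / 2) = orb s tau x (g v)" if v: "v \<in> {0..2}" for v
 proof (cases "v <= 1")
  case True thus ?thesis using sc[of v] v by (simp add: g_def)
 next
  case False
  have "orb s (2 * tau) x (1/2 + 1/2 * (v - 1)) = orb s (1/2 * (2 * tau)) (orb s (2 * tau) x (1/2)) (v - 1)"
   by (rule orb_affine) (use v False in auto)
  moreover have "1/2 + 1/2 * (v - 1) = v / 2" "1/2 * (2 * tau) = tau" "orb s (2 * tau) x (1/2) = x"
   using sc[of 1] cl by (simp_all add: field_simps)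
  ultimately have "orb s (2 * tau) x (v / 2) = orb s tau x (v - 1)" by metis
  thus ?thesis using False by (simp add: g_def)
 qed
 have sh: "orb s tau (orb s tau x a) t = orb s tau x (g (a + t))" if t: "t \<in> {0..1}" for t
 proof -
  have "orb s (2 * tau) x (a / 2 + 1/2 * t) = orb s (1/2 * (2 * tau)) (orb s (2 * tau) x (a / 2)) t"
   by (rule orb_affine) (use a t in auto)
  moreover have "a / 2 + 1/2 * t = (a + t) / 2" "1/2 * (2 * tau) = tau" by (simp_all add: field_simps)
  ultimately have "orb s (2 * tau) x ((a + t) / 2) = orb s tau (orb s (2 * tau) x (a / 2)) t" by metis
  thus ?thesis using o2[of "a + t"] sc[OF a] a t by simp
 qed
 have "orb s tau x (g (a + 1)) = orb s tau x a" using a cl by (cases "a = 0") (auto simp: g_def orb_0)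
 thus "orb s tau (orb s tau x a) 1 = orb s tau x a" using sh[of 1] by simp
 assume t: "t \<in> {0<..<1}" "t' \<in> {0..1}" and e: "orb s tau (orb s tau x a) t' = orb s tau (orb s tau x a) t"
 have g01: "g (a + t) \<in> {0..1}" "g (a + t') \<in> {0..1}" using a t by (auto simp: g_def)
 have e': "orb s tau x (g (a + t')) = orb s tau x (g (a + t))" using e sh[of t] sh[of t'] t by simp
 have bd: "u \<in> {0, 1} \<or> u \<in> {0<..<1}" if "u \<in> {0..1}" for u :: real using that by auto
 have "g (a + t) \<in> {0<..<1} ==> g (a + t') = g (a + t)" by (rule inj[OF _ g01(2) e'])
 moreover have "g (a + t') \<in> {0<..<1} ==> g (a + t) = g (a + t')" by (rule inj[OF _ g01(1) e'[symmetric]])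
 ultimately have "g (a + t') = g (a + t) \<or> g (a + t) \<in> {0, 1} & g (a + t') \<in> {0, 1}"
  using bd[OF g01(1)] bd[OF g01(2)] by metis
 thus "t' = t" using a t by (auto simp: g_def split: if_splits)
qed

end

context principal_shift
begin

lemma generic_cycles:
 obtains \<C> where "countable \<C>" "!!C. C \<in> \<C> ==> closed C & interior C = {}"
  "!!s gam T. s \<notin> \<Union>\<C> ==> principal_cycle (ns s) (kap sg (ns s)) gam T ==>
   (!!t. w (gam t) \<bullet> vector_derivative gam (at t) > 0) ==> hyperbolic_cycle (ns s) (kap sg (ns s)) gam"
proof -
 \<comment> \<open>The linearised flow has the extra eigenvalue 1 besides those of the return map.
   In terms of its trace and determinant, \<open>(-1, 0, 1)\<close> says determinant 1,
   \<open>(2, -1, 1)\<close> eigenvalue 1 and \<open>(0, 1, 1)\<close> eigenvalue -1.\<close>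
 define I where "I = {None, Some (-1 :: real, 0 :: real, 1), Some (2, -1, 1), Some (0, 1, 1 :: real)} \<times> (UNIV :: 3 set) \<times> (\<rat> :: real set)"
 have "\<exists>\<C>. countable \<C> & (\<forall>C\<in>\<C>. closed C & interior C = {}) &
   (\<forall>s tau x. good_pt (fst z) s tau x --> x $ fst (snd z) = snd (snd z) --> s \<in> \<Union>\<C>)" for z
  by (rule countable_bad[of "fst z" "fst (snd z)" "snd (snd z)"]) blast
 then obtain CC where CC: "!!z. countable (CC z) & (\<forall>C\<in>CC z. closed C & interior C = {}) &
   (\<forall>s tau x. good_pt (fst z) s tau x --> x $ fst (snd z) = snd (snd z) --> s \<in> \<Union>(CC z))" by metis
 have cI: "countable I" unfolding I_def by (intro countable_SIGMA countable_rat) auto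
 show ?thesis
 proof (rule that[of "\<Union>z\<in>I. CC z"])
  show "countable (\<Union>z\<in>I. CC z)" using cI CC by blast
  show "closed C & interior C = {}" if "C \<in> (\<Union>z\<in>I. CC z)" for C using that CC by blast
  fix s gam T assume s: "s \<notin> \<Union>(\<Union>z\<in>I. CC z)" and cyc: "principal_cycle (ns s) (kap sg (ns s)) gam T"
   and w0: "!!t. w (gam t) \<bullet> vector_derivative gam (at t) > 0"
  obtain tau where tau: "tau > 0" and Y0: "Ys s (gam 0) ~= 0" and cl: "orb s tau (gam 0) 1 = gam 0"
   and inj: "!!t t'. t \<in> {0<..<1} ==> t' \<in> {0..1} ==> orb s tau (gam 0) t' = orb s tau (gam 0) t ==> t' = t"
   and rng: "range gam = orb s tau (gam 0) ` {0..1}" and va: "\<exists>a>0. vector_derivative gam (at 0) = a *\<^sub>R Ys s (gam 0)"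
   using cycle_orbit[OF cyc w0] by metis
  obtain a i q where a: "a \<in> {0..1}" and q: "q \<in> \<rat>" "orb s tau (gam 0) a $ i = q"
   using orbit_rational_point[OF tau Y0] by metis
  define x where "x = orb s tau (gam 0) a"
  have ng: "\<not> good_pt kd s tau x" if "kd \<in> {None, Some (-1, 0, 1), Some (2, -1, 1), Some (0, 1, 1)}" for kd
  proof
   assume "good_pt kd s tau x"
   hence "s \<in> \<Union>(CC (kd, i, q))" using CC[of "(kd, i, q)"] q(2) by (simp add: x_def)
   moreover have "(kd, i, q) \<in> I" using that q(1) by (simp add: I_def)
   ultimately show False using s by blast
  qed
  have Yx: "Ys s x ~= 0" unfolding x_def by (rule Ys_orb_nonzero[OF Y0 a])
  have base: "tau > 0 & Ys s x ~= 0 & orb s tau x 1 = x &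
   (\<forall>t\<in>{0<..<1}. \<forall>t'\<in>{0..1}. orb s tau x t' = orb s tau x t --> t' = t)"
   using tau Yx orbit_shift[OF cl a inj] unfolding x_def by blast
  have "ha sg (jt w (Vs s) x) ~= 0" using ng[of None] base by (simp add: good_pt_def)
  moreover have "continuous_on {0..1} (%t. ha sg (jt w (Vs s) (orb s tau x t)))"
  proof -
   have "continuous_on UNIV (ha sg)" using Ck_continuous_arg[of 0 "%_::real. ha sg"] Ck_ha[of 0 sg] by simp
   moreover have "continuous_on {0..1} (%t. jt w (Vs s) (orb s tau x t))"
    by (rule continuous_on_compose2[OF Ck_continuous_arg[OF Ck_jt_s, of UNIV] continuous_orb(1)]) auto
   ultimately show ?thesis by (rule continuous_on_compose2) auto
  qed
  ultimately obtain d where d: "d > 0" "\<forall>t\<in>{0..1}. dist t 0 < d -->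
    dist (ha sg (jt w (Vs s) (orb s tau x t))) (ha sg (jt w (Vs s) (orb s tau x 0))) < \<bar>ha sg (jt w (Vs s) x)\<bar>"
   unfolding continuous_on_iff by (metis atLeastAtMost_iff order_refl zero_le_one zero_less_abs_iff)
  \<comment> \<open>\<open>ha\<close> is nonzero at the base point, but \<open>good_pt\<close> asks
    for a time strictly inside the round; continuity supplies one.\<close>
  define m where "m = min (d / 2) (1 / 2)"
  have m: "m \<in> {0..1}" "m \<in> {0<..<1}" "dist m 0 < d" using d(1) by (auto simp: m_def)
  have "ha sg (jt w (Vs s) (orb s tau x m)) ~= 0"
   using d(2)[rule_format, OF m(1,3)] by (auto simp: dist_norm orb_0)
  with m(2)
  have ha: "\<exists>t\<in>{0<..<1}. ha sg (jt w (Vs s) (orb s tau x t)) ~= 0" by blast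
  let ?t = "tr3 (orbN s tau x 1)" and ?d = "dt3 (orbN s tau x 1)"
  have S: "good_pt (Some (a, b, c)) s tau x \<longleftrightarrow> a + b * ?t + c * ?d = 0 & b * (?t - 1) + 2 * c * ?d ~= 0" for a b c
   unfolding good_pt_def using base ha by simp
  \<comment> \<open>Determinant 1 is excluded first: for this equation the last condition of
    \<open>good_pt\<close> reads \<open>2 * ?d ~= 0\<close>, and for the other two it reduces to
    \<open>?d ~= 1\<close>.\<close>
  have f3: "?d ~= 1" using ng[of "Some (-1, 0, 1)"] by (auto simp: S)
  have f1: "2 - ?t + ?d ~= 0" using ng[of "Some (2, -1, 1)"] f3 by (auto simp: S)
  have f2: "?t + ?d ~= 0" using ng[of "Some (0, 1, 1)"] f3 by (auto simp: S)
  note N = orbN_conjugate[OF cl a, folded x_def]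
  show "hyperbolic_cycle (ns s) (kap sg (ns s)) gam"
   using va hyperbolic_of_orbit[OF tau Y0 cl inj rng refl _ _ f1[unfolded N] f2[unfolded N] f3[unfolded N]] by blast
 qed
qed

end

section \<open>Countably many orienting fields, and the Baire argument\<close>

definition bump :: "nat \<times> R3 \<times> R3 => R3 => R3" where
 "bump z = tfield 7 (real (Suc (fst z))) (fst (snd z)) 1 0 1 0 (snd (snd z))"

definition wl :: "(nat \<times> R3 \<times> R3) set => R3 => R3" where
 "wl Z x = (\<Sum>z\<in>Z. bump z x)"

lemma Ck_wl: "Ck 3 (%_::real. wl Z)"
 unfolding wl_def bump_def by (intro Ck_sum Ck_tfield) simp

lemma wl_supp: "finite Z ==> \<exists>R. \<forall>x. norm x > R --> wl Z x = 0"
proof -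
 assume Z: "finite Z"
 let ?R = "Max (insert 0 ((%z. norm (fst (snd z)) + 1) ` Z))"
 have fin: "finite (insert 0 ((%z. norm (fst (snd z)) + 1) ` Z))" using Z by simp
 have "bump z x = 0" if "z \<in> Z" "norm x > ?R" for z x
 proof -
  have "norm (fst (snd z)) + 1 <= ?R" by (rule Max_ge[OF fin]) (use that in auto)
  thus ?thesis unfolding bump_def using that by (intro tfield_supp) auto
 qed
 thus ?thesis by (intro exI[of _ ?R]) (simp add: wl_def)
qed

lemma bump_eq: obtains c where "bump z x = c *\<^sub>R snd (snd z)" "c >= 0"
  "c > 0 \<longleftrightarrow> real (Suc (fst z)) * norm (x - fst (snd z)) < 1"
proof -
 let ?N = "real (Suc (fst z))" and ?v = "x - fst (snd z)"
 have "?N\<^sup>2 * (?v \<bullet> ?v) = (?N * norm ?v)\<^sup>2" by (simp only: power_mult_distrib power2_norm_eq_inner)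
 hence "pq 7 (1 - ?N\<^sup>2 * (?v \<bullet> ?v)) > 0 \<longleftrightarrow> (?N * norm ?v)\<^sup>2 < 1" by (simp only: pq_pos_iff) simp
 also have "... \<longleftrightarrow> ?N * norm ?v < 1" by (simp only: abs_square_less_1 abs_mult abs_norm_cancel abs_of_nat)
 finally show ?thesis using that[of "pq 7 (1 - ?N\<^sup>2 * (?v \<bullet> ?v))"] by (simp add: bump_def tfield_def ts_def)
qed

text \<open>The curve is injective on a period, so \<open>gam'\<close> is a continuous function of the point of the curve,
 which a partition argument approximates within a half space.\<close>

lemma choose_wl:
 fixes QS :: "R3 set"
 assumes QS: "!!X. open X ==> X ~= {} ==> \<exists>q\<in>QS. q \<in> X"
  and T: "T > 0" and per: "!!t. gam (t + T) = gam t" and inj: "inj_on gam {0..<T}"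
  and D: "!!t. (gam has_vector_derivative D t) (at t)" "continuous_on UNIV D" "!!t. D t ~= 0"
 obtains Z where "finite Z" "Z \<subseteq> UNIV \<times> QS \<times> QS" "!!t. wl Z (gam t) \<bullet> D t > 0"
proof -
 have Dper: "D (t + T) = D t" for t
 proof -
  have "((%s. s + T) has_vector_derivative 1) (at t)" by (auto intro!: derivative_eq_intros)
  from vector_diff_chain_at[OF this D(1)] have "(gam has_vector_derivative D (t + T)) (at t)"
   by (simp add: comp_def per)
  thus ?thesis using D(1) vector_derivative_unique_at by blast
 qed
 have cgam: "continuous_on S gam" for S
  using D(1) by (auto intro: continuous_at_imp_continuous_on has_vector_derivative_continuous)
 have same: "D t = D t'" if t: "t \<in> {0..T}" "t' \<in> {0..T}" "gam t = gam t'" for t t'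
 proof -
  define f where "f t = (if t = T then 0 else t)" for t :: real
  have f: "f t \<in> {0..<T}" "gam (f t) = gam t" "D (f t) = D t" if "t \<in> {0..T}" for t
   using that T per[of 0] Dper[of 0] by (auto simp: f_def)
  have "f t = f t'" using inj_onD[OF inj, of "f t" "f t'"] f t by auto
  thus ?thesis using f(3)[OF t(1)] f(3)[OF t(2)] by simp
 qed
 have loc: "\<exists>z\<in>UNIV \<times> QS \<times> QS. real (Suc (fst z)) * norm (gam t0 - fst (snd z)) < 1 &
   (\<forall>t\<in>{0..T}. real (Suc (fst z)) * norm (gam t - fst (snd z)) < 1 --> snd (snd z) \<bullet> D t > 0)" if t0: "t0 \<in> {0..T}" for t0
 proof -
  have "open {u. u \<bullet> D t0 > 0}" by (intro open_Collect_less continuous_intros)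
  moreover have "D t0 \<in> {u. u \<bullet> D t0 > 0}" using D(3) by simp
  ultimately obtain u where u: "u \<in> QS" "u \<bullet> D t0 > 0" using QS[of "{u. u \<bullet> D t0 > 0}"] by blast
  define B where "B = {t \<in> {0..T}. u \<bullet> D t <= 0}"
  have "closed {t. u \<bullet> D t <= 0}" by (intro closed_Collect_le continuous_intros D(2))
  moreover have "B = {0..T} \<inter> {t. u \<bullet> D t <= 0}" by (auto simp: B_def)
  ultimately have "compact B" by (simp add: compact_Int_closed)
  hence "compact (gam ` B)" by (intro compact_continuous_image cgam)
  hence "open (- (gam ` B))" by (intro open_Compl compact_imp_closed)
  moreover have "gam t0 \<in> - (gam ` B)" using same[OF t0] u(2) by (force simp: B_def)
  ultimately obtain epsn where epsn: "epsn > 0" "ball (gam t0) epsn \<subseteq> - (gam ` B)" using openE by blast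
  \<comment> \<open>A bump of radius \<open>1 / ?N\<close> that contains \<open>gam t0\<close> lies
    within distance \<open>2 / ?N\<close> of it, hence inside the ball of radius
    \<open>epsn\<close>.\<close>
  obtain n where n: "2 / epsn < real (Suc n)" by (meson less_trans lessI of_nat_less_iff reals_Archimedean2)
  let ?N = "real (Suc n)"
  obtain q where q: "q \<in> QS" "q \<in> ball (gam t0) (1 / ?N)" using QS[of "ball (gam t0) (1 / ?N)"] by auto
  have q': "?N * norm (gam t0 - q) < 1" using q(2) by (simp add: dist_norm field_simps)
  moreover have "u \<bullet> D t > 0" if t: "t \<in> {0..T}" "?N * norm (gam t - q) < 1" for t
  proof -
   have "norm (gam t0 - gam t) <= norm (gam t0 - q) + norm (gam t - q)"
    using norm_triangle_ineq4[of "gam t0 - q" "gam t - q"] by simp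
   hence "?N * norm (gam t0 - gam t) <= ?N * norm (gam t0 - q) + ?N * norm (gam t - q)"
    unfolding distrib_left[symmetric] by (rule mult_left_mono) simp
   hence "?N * norm (gam t0 - gam t) < 2" using q' t(2) by linarith
   moreover have "2 < ?N * epsn" using n epsn(1) by (simp add: field_simps)
   ultimately have "?N * norm (gam t0 - gam t) < ?N * epsn" by linarith
   hence "norm (gam t0 - gam t) < epsn" by simp
   hence "gam t \<notin> gam ` B" using epsn(2) by (auto simp: dist_norm)
   thus ?thesis using t(1) by (auto simp: B_def)
  qed
  ultimately show ?thesis using u(1) q(1) by (intro bexI[of _ "(n, q, u)"]) auto
 qed
 then obtain zz where zz: "!!t0. t0 \<in> {0..T} ==> zz t0 \<in> UNIV \<times> QS \<times> QS & real (Suc (fst (zz t0))) * norm (gam t0 - fst (snd (zz t0))) < 1 &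
   (\<forall>t\<in>{0..T}. real (Suc (fst (zz t0))) * norm (gam t - fst (snd (zz t0))) < 1 --> snd (snd (zz t0)) \<bullet> D t > 0)" by metis
 have op: "open {t. real (Suc (fst z)) * norm (gam t - fst (snd z)) < 1}" for z
  by (intro open_Collect_less continuous_intros cgam)
 define V where "V t0 = {t. real (Suc (fst (zz t0))) * norm (gam t - fst (snd (zz t0))) < 1}" for t0
 have opV: "open (V t0)" for t0 using op[of "zz t0"] by (simp add: V_def)
 have cov: "{0..T} \<subseteq> (\<Union>t0\<in>{0..T}. V t0)" using zz by (intro subsetI UN_I) (auto simp: V_def)
 obtain F where F: "F \<subseteq> {0..T}" "finite F" "{0..T} \<subseteq> (\<Union>t0\<in>F. V t0)"
  by (rule compactE_image[OF compact_Icc _ cov], rule opV, rule that)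
 have pos: "wl (zz ` F) (gam t) \<bullet> D t > 0" if t: "t \<in> {0..T}" for t
 proof -
  have trm: "bump z (gam t) \<bullet> D t >= 0 & (real (Suc (fst z)) * norm (gam t - fst (snd z)) < 1 --> bump z (gam t) \<bullet> D t > 0)"
   if z: "z \<in> zz ` F" for z
  proof -
   obtain c where c: "bump z (gam t) = c *\<^sub>R snd (snd z)" "c >= 0" "c > 0 \<longleftrightarrow> real (Suc (fst z)) * norm (gam t - fst (snd z)) < 1"
    using bump_eq by metis
   have "c > 0 ==> snd (snd z) \<bullet> D t > 0" using z zz t F(1) c(3) by fast
   thus ?thesis using c by (cases "c = 0") (auto simp: less_le)
  qed
  obtain t0 where t0: "t0 \<in> F" "real (Suc (fst (zz t0))) * norm (gam t - fst (snd (zz t0))) < 1" using F(3) t by (auto simp: V_def)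
  have "(\<Sum>z\<in>zz ` F. bump z (gam t) \<bullet> D t) > 0"
   by (rule sum_pos2[of _ "zz t0"]) (use F(2) t0 trm in auto)
  thus ?thesis by (simp add: wl_def inner_sum_left)
 qed
 show ?thesis
 proof (rule that[of "zz ` F"])
  show "wl (zz ` F) (gam t) \<bullet> D t > 0" for t
  proof -
   define h where "h t = wl (zz ` F) (gam t) \<bullet> D t" for t
   have hp: "h (t + T) = h t" for t by (simp add: h_def per Dper)
   obtain u where "u \<in> {0..<T}" "h t = h u" by (rule periodic_reduce[of T h t, OF T hp]) (rule that)
   thus ?thesis using pos[of u] by (simp add: h_def)
  qed
  have "zz t0 \<in> UNIV \<times> QS \<times> QS" if "t0 \<in> F" for t0 using zz[of t0] F(1) that by blast
  thus "zz ` F \<subseteq> UNIV \<times> QS \<times> QS" by blast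
 qed (use F in simp)
qed

lemma countable_nowhere_dense:
 fixes \<C> :: "('a::complete_space) set set"
 assumes "countable \<C>" "!!C. C \<in> \<C> ==> closed C & interior C = {}"
 shows "\<exists>s. s \<notin> \<Union>\<C>"
proof -
 have "Met_TC.mcomplete TYPE('a)" by (simp add: complete_UNIV)
 from Met_TC.metric_Baire_category_alt[OF this assms(1)] assms(2) have "interior (\<Union>\<C>) = {}" by simp
 thus ?thesis by (metis UNIV_eq_I UNIV_not_empty interior_UNIV)
qed

context field_family
begin

lemma ex_hyperbolic: "\<exists>s. es s \<in> hyperbolic_cycle_fields r"
proof -
 define I where "I = {1, -1 :: real} \<times> {Z. finite Z & Z \<subseteq> (UNIV :: nat set) \<times> QS \<times> QS}"
 have "countable {Z. finite Z & Z \<subseteq> (UNIV :: nat set) \<times> QS \<times> QS}"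
  by (rule countable_Collect_finite_subset) (use QS(1) in auto)
 hence cI: "countable I" unfolding I_def by (intro countable_SIGMA) auto
 define P where "P z \<C> \<longleftrightarrow> countable \<C> & (\<forall>C\<in>\<C>. closed C & interior C = {}) &
  (\<forall>s gam T. s \<notin> \<Union>\<C> --> principal_cycle (es s) (kap (fst z) (es s)) gam T -->
   (\<forall>t. wl (snd z) (gam t) \<bullet> vector_derivative gam (at t) > 0) --> hyperbolic_cycle (es s) (kap (fst z) (es s)) gam)" for z :: "real \<times> (nat \<times> R3 \<times> R3) set" and \<C>
 have "\<exists>\<C>. P z \<C>" if z: "z \<in> I" for z
 proof -
  interpret principal_shift "fst z" "wl (snd z)" Vs wk kT QS
   by (rule principal_shift) (use z in \<open>auto simp: I_def Ck_wl wl_supp\<close>)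
  have ens: "ns s = es s" for s by (simp add: fun_eq_iff es_eq ns_def)
  obtain \<C> where C: "countable \<C>" "!!C. C \<in> \<C> ==> closed C & interior C = {}"
   "!!s gam T. s \<notin> \<Union>\<C> ==> principal_cycle (ns s) (kap (fst z) (ns s)) gam T ==>
   (!!t. wl (snd z) (gam t) \<bullet> vector_derivative gam (at t) > 0) ==> hyperbolic_cycle (ns s) (kap (fst z) (ns s)) gam"
  proof (rule generic_cycles, goal_cases)
   case (1 \<C>)
   show ?case by (rule that) (fact 1)+
  qed
  show ?thesis unfolding P_def
  proof (intro exI[of _ \<C>] conjI allI impI ballI)
   fix s gam T assume a: "s \<notin> \<Union>\<C>" "principal_cycle (es s) (kap (fst z) (es s)) gam T"
    "\<forall>t. wl (snd z) (gam t) \<bullet> vector_derivative gam (at t) > 0"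
   show "hyperbolic_cycle (es s) (kap (fst z) (es s)) gam"
    using C(3)[OF a(1), unfolded ens, OF a(2)] a(3) by simp
  qed (simp_all add: C(1,2))
 qed
 then obtain CC where CC: "!!z. z \<in> I ==> P z (CC z)" by metis
 obtain s where s: "s \<notin> \<Union>(\<Union>z\<in>I. CC z)"
  using countable_nowhere_dense[of "\<Union>z\<in>I. CC z"] cI CC unfolding P_def by blast
 have "hyperbolic_cycle (es s) kpa gam" if kpa: "kpa \<in> {k1 (es s), k2 (es s)}" and cyc: "principal_cycle (es s) kpa gam T" for kpa gam T
 proof -
  obtain sg where sg: "sg \<in> {1, -1 :: real}" "kpa = kap sg (es s)" using kpa by (cases "kpa = k1 (es s)") (auto intro: that[of 1] that[of "-1"])
  have T: "T > 0" and per: "gam (t + T) = gam t" and inj: "inj_on gam {0..<T}" and C1: "gam C1_differentiable_on UNIV"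
   and pd: "vector_derivative gam (at t) \<in> principal_directions (es s) kpa (gam t)" for t
   using cyc by (auto simp: principal_cycle_def principal_line_def)
  obtain D where D: "!!t. (gam has_vector_derivative D t) (at t)" "continuous_on UNIV D"
   using C1 unfolding C1_differentiable_on_def by blast
  have vD: "vector_derivative gam (at t) = D t" for t using D(1) by (rule vector_derivative_at)
  have D0: "D t ~= 0" for t using pd[of t] by (simp add: vD principal_directions_def)
  obtain Z where Z: "finite Z" "Z \<subseteq> UNIV \<times> QS \<times> QS" "!!t. wl Z (gam t) \<bullet> D t > 0"
   using choose_wl[OF QS(2) T per inj D D0] by blast
  have zI: "(sg, Z) \<in> I" using sg Z by (simp add: I_def)
  hence s': "s \<notin> \<Union>(CC (sg, Z))" using s by blast
  have "\<forall>t. wl Z (gam t) \<bullet> vector_derivative gam (at t) > 0" using Z(3) by (simp add: vD)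
  thus ?thesis
   using CC[OF zI] s' cyc unfolding P_def fst_conv snd_conv sg(2) by blast
 qed
 thus ?thesis using es_unit by (auto simp: hyperbolic_cycle_fields_def)
qed

end

theorem theorem2:
  fixes r :: nat and K :: "nat \<Rightarrow> (real^3) set"
  assumes "r \<ge> 3" and "compact_exhaustion K"
  shows "unit_field_topology r K closure_of hyperbolic_cycle_fields r
           = topspace (unit_field_topology r K)"
proof (rule equalityI[OF closure_of_subset_topspace], rule subsetI)
 fix eta assume "eta \<in> topspace (unit_field_topology r K)"
 hence eta: "eta \<in> unit_vector_fields r" by (simp add: topspace_unit_field_topology)
 have "\<exists>y\<in>hyperbolic_cycle_fields r. y \<in> A" if A: "eta \<in> A" "openin (unit_field_topology r K) A" for A
 proof -
  obtain U where U: "openin (whitney_topology r K) U" "A = U \<inter> unit_vector_fields r"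
   using A(2) by (auto simp: unit_field_topology_def openin_subtopology)
  obtain \<delta> where \<delta>: "continuous_on UNIV \<delta>" "!!x. \<delta> x > 0" "whitney_nbhd r K eta \<delta> \<subseteq> U"
   using U A(1) unfolding openin_whitney_topology whitney_open_def by blast
  note W = \<delta>(3)
  obtain QS :: "R3 set" where QS: "countable QS" "!!X. open X ==> X ~= {} ==> \<exists>q\<in>QS. q \<in> X"
   using countable_dense_setE by blast
  interpret field_family r K eta \<delta> QS
   by unfold_locales (use assms eta \<delta> QS in auto)
  obtain s where "es s \<in> hyperbolic_cycle_fields r" using ex_hyperbolic by blast
  thus ?thesis using es_nbhd[of s] es_unit[of s] W U(2) by blast
 qed
 thus "eta \<in> unit_field_topology r K closure_of hyperbolic_cycle_fields r"
  using eta by (auto simp: in_closure_of topspace_unit_field_topology)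
qed

end
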